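(* Let $(M,\mathcal F)$ be a compact Riemannian manifold with an isoparametric foliation. Assume that $\mathrm{Spec}(M,\mathcal F)\subsetneq\mathrm{Spec}_1(M)$. Then every isoparametric tube of $\mathcal F$ fails the Pompeiu property. More precisely, let $f$ be an eigenfunction of the Laplacian of $M$ associated to $\lambda\in\mathrm{Spec}_1(M)\setminus\mathrm{Spec}(M,\mathcal F)$. Then, for all $t\in(0,D(\mathcal F))$ and for any isometry $h$ of $M$, one has $$\int_{h(\Omega_t)}f=0.$$
   Context: $M$ is a compact connected Riemannian manifold without boundary, and $\Delta=-\mathrm{div}\,\nabla$ is its positive Laplacian. An isoparametric function on $M$ is a smooth function $F:M\to[a,b]$ with $F(M)=[a,b]$, $a<b$, such that $|\nabla F|^2=A\circ F$ and $\Delta F=B\circ F$ for some smooth functions $A,B:[a,b]\to\mathbb R$. The sets $M^+:=F^{-1}(a)$ and $M^-:=F^{-1}(b)$ are smooth closed submanifolds, called the focal sets; $F$ is called proper if both focal sets have codimension at least $2$ in $M$. All isoparametric functions are assumed proper. The isoparametric foliation $\mathcal F$ is the decomposition $M=\bigcup_{t\in[a,b]}F^{-1}(t)$ into level sets of $F$. Let $\rho(x)=\mathrm{dist}(x,M^+)$ and $D(\mathcal F)=\mathrm{dist}(M^+,M^-)$, so that $\rho:M\to[0,D(\mathcal F)]$; the leaves of $\mathcal F$ are also the level sets of $\rho$. For $t\in(0,D(\mathcal F))$ the isoparametric tube is $\Omega_t=\{x\in M:\rho(x)<t\}$. A function $f$ on $M$ is radial if $f=\psi\circ\rho$ for some $\psi:[0,D(\mathcal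 F)]\to\mathbb R$. $\mathrm{Spec}_1(M)$ is the set of distinct eigenvalues of $\Delta$ on $M$. An eigenvalue $\lambda\in\mathrm{Spec}_1(M)$ is radial if there is a (nonzero) radial eigenfunction associated to $\lambda$; $\mathrm{Spec}(M,\mathcal F)\subseteq\mathrm{Spec}_1(M)$ is the set of radial eigenvalues. A bounded domain $\Omega\subseteq M$ has the Pompeiu property if the only continuous function $f:M\to\mathbb R$ with $\int_{h(\Omega)}f=0$ for all isometries $h$ of $M$ (integration with respect to the Riemannian measure) is $f=0$; otherwise $\Omega$ fails the Pompeiu property. *)

theory Defs
  imports "HOL-Analysis.Analysis"
begin

section \<open>Smoothness in Euclidean space\<close>

text \<open>\<open>Ck_on k f S\<close> is meant for open sets \<open>S\<close> only: derivatives are the two-sided ones of \<open>f\<close>.\<close>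

primrec Ck_on :: "nat \<Rightarrow> ('a::euclidean_space \<Rightarrow> 'b::real_normed_vector) \<Rightarrow> 'a set \<Rightarrow> bool" where
  "Ck_on 0 f S \<longleftrightarrow> continuous_on S f"
| "Ck_on (Suc k) f S \<longleftrightarrow>
     (\<forall>x\<in>S. f differentiable (at x)) \<and>
     (\<forall>e\<in>Basis. Ck_on k (\<lambda>x. frechet_derivative f (at x) e) S)"

definition smooth_on :: "('a::euclidean_space \<Rightarrow> 'b::real_normed_vector) \<Rightarrow> 'a set \<Rightarrow> bool" where
  "smooth_on f S \<longleftrightarrow> (\<forall>k. Ck_on k f S)"

text \<open>Smoothness on a compact interval, with one-sided derivatives of all orders at the end points.\<close>

definition smooth_on_interval :: "(real \<Rightarrow> real) \<Rightarrow> real \<Rightarrow> real \<Rightarrow> bool" where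
  "smooth_on_interval f a b \<longleftrightarrow>
     (\<exists>d::nat \<Rightarrow> real \<Rightarrow> real. d 0 = f \<and>
        (\<forall>k. \<forall>x\<in>{a..b}. (d k has_real_derivative d (Suc k) x) (at x within {a..b})))"

definition partial_deriv :: "'n \<Rightarrow> (real^'n \<Rightarrow> real) \<Rightarrow> real^'n::finite \<Rightarrow> real" where
  "partial_deriv i f x = frechet_derivative f (at x) (axis i 1)"


section \<open>Smooth manifolds\<close>

text \<open>
  A chart is a pair of its domain and its coordinate map (whose values outside the domain are
  irrelevant). The underlying set of a manifold is a whole type. Boundaries are excluded because
  the image of a chart is open in \<open>real^'n\<close>.
\<close>

type_synonym ('a, 'n) chart = "'a set \<times> ('a \<Rightarrow> real^'n)"

definition is_chart :: "('a::topological_space, 'n::finite) chart \<Rightarrow> bool" where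
  "is_chart c \<longleftrightarrow> open (fst c) \<and> open (snd c ` fst c) \<and>
     (\<exists>\<psi>. homeomorphism (fst c) (snd c ` fst c) (snd c) \<psi>)"

definition chart_inv :: "('a, 'n::finite) chart \<Rightarrow> real^'n \<Rightarrow> 'a" where
  "chart_inv c = inv_into (fst c) (snd c)"

text \<open>A map \<open>h\<close> in coordinates; for \<open>h = id\<close> this is the transition map from \<open>c\<close> to \<open>c'\<close>.\<close>

definition local_dom :: "('a \<Rightarrow> 'a) \<Rightarrow> ('a, 'n::finite) chart \<Rightarrow> ('a, 'n) chart \<Rightarrow> (real^'n) set" where
  "local_dom h c c' = snd c ` (fst c \<inter> h -` fst c')"

definition local_rep :: "('a \<Rightarrow> 'a) \<Rightarrow> ('a, 'n::finite) chart \<Rightarrow> ('a, 'n) chart \<Rightarrow> real^'n \<Rightarrow> real^'n" where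
  "local_rep h c c' = snd c' \<circ> h \<circ> chart_inv c"

definition compatible_charts :: "('a, 'n::finite) chart \<Rightarrow> ('a, 'n) chart \<Rightarrow> bool" where
  "compatible_charts c c' \<longleftrightarrow>
     smooth_on (local_rep id c c') (local_dom id c c') \<and>
     smooth_on (local_rep id c' c) (local_dom id c' c)"

definition smooth_atlas :: "('a::topological_space, 'n::finite) chart set \<Rightarrow> bool" where
  "smooth_atlas \<A> \<longleftrightarrow> (\<forall>c\<in>\<A>. is_chart c) \<and> (\<Union>c\<in>\<A>. fst c) = UNIV \<and>
     (\<forall>c\<in>\<A>. \<forall>c'\<in>\<A>. compatible_charts c c')"


section \<open>Riemannian manifolds\<close>

text \<open>
  The metric is given by its matrix of components \<open>metric M c x\<close> at the coordinate point \<open>x\<close> of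
  each chart \<open>c\<close> of the atlas, subject to the transformation law of a covariant 2-tensor.
\<close>

record ('a, 'n) riem =
  atlas :: "('a, 'n::finite) chart set"
  metric :: "('a, 'n) chart \<Rightarrow> real^'n \<Rightarrow> real^'n^'n"

text \<open>\<open>preserves_metric M h\<close>: the pullback of the metric of \<open>M\<close> under \<open>h\<close> is the metric of \<open>M\<close>.\<close>

definition preserves_metric :: "('a, 'n::finite) riem \<Rightarrow> ('a \<Rightarrow> 'a) \<Rightarrow> bool" where
  "preserves_metric M h \<longleftrightarrow>
     (\<forall>c\<in>atlas M. \<forall>c'\<in>atlas M. \<forall>x\<in>local_dom h c c'.
        metric M c x =
          (let \<tau> = local_rep h c c'; J = jacobian \<tau> (at x)
           in transpose J ** metric M c' (\<tau> x) ** J))"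

definition riemannian_manifold ::
    "('a::{t2_space, second_countable_topology}, 'n::finite) riem \<Rightarrow> bool" where
  "riemannian_manifold M \<longleftrightarrow>
     smooth_atlas (atlas M) \<and>
     (\<forall>c\<in>atlas M.
        smooth_on (metric M c) (snd c ` fst c) \<and>
        (\<forall>x\<in>snd c ` fst c.
           transpose (metric M c x) = metric M c x \<and>
           (\<forall>v. v \<noteq> 0 \<longrightarrow> v \<bullet> (metric M c x *v v) > 0))) \<and>
     preserves_metric M id"

definition compact_connected_riemannian_manifold ::
    "('a::{t2_space, second_countable_topology}, 'n::finite) riem \<Rightarrow> bool" where
  "compact_connected_riemannian_manifold M \<longleftrightarrow>
     riemannian_manifold M \<and> compact (UNIV :: 'a set) \<and> connected (UNIV :: 'a set)"

definition smooth_function :: "('a, 'n::finite) riem \<Rightarrow> ('a \<Rightarrow> real) \<Rightarrow> bool" where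
  "smooth_function M f \<longleftrightarrow> (\<forall>c\<in>atlas M. smooth_on (f \<circ> chart_inv c) (snd c ` fst c))"

definition smooth_map :: "('a::topological_space, 'n::finite) riem \<Rightarrow> ('a \<Rightarrow> 'a) \<Rightarrow> bool" where
  "smooth_map M h \<longleftrightarrow> continuous_on UNIV h \<and>
     (\<forall>c\<in>atlas M. \<forall>c'\<in>atlas M. smooth_on (local_rep h c c') (local_dom h c c'))"

definition riemannian_isometry :: "('a::topological_space, 'n::finite) riem \<Rightarrow> ('a \<Rightarrow> 'a) \<Rightarrow> bool" where
  "riemannian_isometry M h \<longleftrightarrow>
     bij h \<and> smooth_map M h \<and> smooth_map M (inv h) \<and> preserves_metric M h"

text \<open>
  Pointwise scalar quantities are computed in an arbitrarily selected chart around the point;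
  they do not depend on the selection.
\<close>

definition chart_at :: "('a, 'n::finite) riem \<Rightarrow> 'a \<Rightarrow> ('a, 'n) chart" where
  "chart_at M p = (SOME c. c \<in> atlas M \<and> p \<in> fst c)"

text \<open>Vector fields are given by their components in each chart, as functions of the coordinates.\<close>

type_synonym ('a, 'n) vfield = "('a, 'n) chart \<Rightarrow> real^'n \<Rightarrow> real^'n"

definition gradient :: "('a, 'n::finite) riem \<Rightarrow> ('a \<Rightarrow> real) \<Rightarrow> ('a, 'n) vfield" where
  "gradient M f = (\<lambda>c x. matrix_inv (metric M c x) *v (\<chi> i. partial_deriv i (f \<circ> chart_inv c) x))"

definition sq_norm_at :: "('a, 'n::finite) riem \<Rightarrow> ('a, 'n) vfield \<Rightarrow> 'a \<Rightarrow> real" where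
  "sq_norm_at M X p =
     (let c = chart_at M p; x = snd c p in X c x \<bullet> (metric M c x *v X c x))"

definition divergence :: "('a, 'n::finite) riem \<Rightarrow> ('a, 'n) vfield \<Rightarrow> 'a \<Rightarrow> real" where
  "divergence M X p =
     (let c = chart_at M p; x = snd c p
      in (\<Sum>i\<in>UNIV. partial_deriv i (\<lambda>y. sqrt (det (metric M c y)) * X c y $ i) x)
         / sqrt (det (metric M c x)))"

definition laplacian :: "('a, 'n::finite) riem \<Rightarrow> ('a \<Rightarrow> real) \<Rightarrow> 'a \<Rightarrow> real" where
  "laplacian M f p = - divergence M (gradient M f) p"

text \<open>
  The Riemannian measure is the unique Borel measure with density \<open>sqrt (det g)\<close> with respect to
  Lebesgue measure in each chart.
\<close>

definition riemannian_measure :: "('a::topological_space, 'n::finite) riem \<Rightarrow> 'a measure" where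
  "riemannian_measure M =
     (THE \<mu>. sets \<mu> = sets borel \<and>
        (\<forall>c\<in>atlas M. \<forall>E\<in>sets borel. E \<subseteq> fst c \<longrightarrow>
           emeasure \<mu> E = (\<integral>\<^sup>+x\<in>snd c ` E. ennreal (sqrt (det (metric M c x))) \<partial>lborel)))"

text \<open>As for \<open>piecewise_C1_differentiable_on\<close>: a continuous curve, C1 off a finite set of times.\<close>

definition piecewise_C1_curve ::
    "('a::topological_space, 'n::finite) riem \<Rightarrow> (real \<Rightarrow> 'a) \<Rightarrow> bool" where
  "piecewise_C1_curve M \<gamma> \<longleftrightarrow> path \<gamma> \<and>
     (\<exists>K. finite K \<and>
        (\<forall>c\<in>atlas M. (snd c \<circ> \<gamma>) C1_differentiable_on (({0..1} - K) \<inter> \<gamma> -` fst c)))"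

definition speed :: "('a, 'n::finite) riem \<Rightarrow> (real \<Rightarrow> 'a) \<Rightarrow> real \<Rightarrow> real" where
  "speed M \<gamma> t =
     (let c = chart_at M (\<gamma> t); v = vector_derivative (snd c \<circ> \<gamma>) (at t)
      in sqrt (v \<bullet> (metric M c (snd c (\<gamma> t)) *v v)))"

definition curve_length :: "('a, 'n::finite) riem \<Rightarrow> (real \<Rightarrow> 'a) \<Rightarrow> ennreal" where
  "curve_length M \<gamma> = (\<integral>\<^sup>+t\<in>{0..1}. ennreal (speed M \<gamma> t) \<partial>lborel)"

definition riem_dist :: "('a::topological_space, 'n::finite) riem \<Rightarrow> 'a \<Rightarrow> 'a \<Rightarrow> real" where
  "riem_dist M p q =
     enn2real (INF \<gamma>\<in>{\<gamma>. piecewise_C1_curve M \<gamma> \<and> pathstart \<gamma> = p \<and> pathfinish \<gamma> = q}.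
                 curve_length M \<gamma>)"

definition riem_setdist :: "('a::topological_space, 'n::finite) riem \<Rightarrow> 'a set \<Rightarrow> 'a set \<Rightarrow> real" where
  "riem_setdist M S T = (INF (p, q)\<in>S \<times> T. riem_dist M p q)"

text \<open>
  A smooth embedded submanifold all of whose components have codimension at least \<open>m\<close>: around each
  of its points there is a slice chart, not necessarily in the atlas but compatible with it.
\<close>

definition submanifold_codim_ge ::
    "('a::topological_space, 'n::finite) riem \<Rightarrow> nat \<Rightarrow> 'a set \<Rightarrow> bool" where
  "submanifold_codim_ge M m S \<longleftrightarrow>
     (\<forall>p\<in>S. \<exists>c. \<exists>I::'n set.
        is_chart c \<and> (\<forall>c'\<in>atlas M. compatible_charts c c') \<and> p \<in> fst c \<and> card I \<ge> m \<and>
        snd c ` (fst c \<inter> S) = {x \<in> snd c ` fst c. \<forall>i\<in>I. x $ i = 0})"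


section \<open>Isoparametric functions\<close>

definition isoparametric_function ::
    "('a, 'n::finite) riem \<Rightarrow> ('a \<Rightarrow> real) \<Rightarrow> real \<Rightarrow> real \<Rightarrow> bool" where
  "isoparametric_function M F a b \<longleftrightarrow>
     a < b \<and> smooth_function M F \<and> range F = {a..b} \<and>
     (\<exists>A B. smooth_on_interval A a b \<and> smooth_on_interval B a b \<and>
        (\<forall>p. sq_norm_at M (gradient M F) p = A (F p)) \<and>
        (\<forall>p. laplacian M F p = B (F p)))"

definition proper_isoparametric_function ::
    "('a::topological_space, 'n::finite) riem \<Rightarrow> ('a \<Rightarrow> real) \<Rightarrow> real \<Rightarrow> real \<Rightarrow> bool" where
  "proper_isoparametric_function M F a b \<longleftrightarrow>
     isoparametric_function M F a b \<and>
     submanifold_codim_ge M 2 (F -` {a}) \<and> submanifold_codim_ge M 2 (F -` {b})"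

definition focal_dist ::
    "('a::topological_space, 'n::finite) riem \<Rightarrow> ('a \<Rightarrow> real) \<Rightarrow> real \<Rightarrow> 'a \<Rightarrow> real" where
  "focal_dist M F a x = riem_setdist M {x} (F -` {a})"

definition foliation_width ::
    "('a::topological_space, 'n::finite) riem \<Rightarrow> ('a \<Rightarrow> real) \<Rightarrow> real \<Rightarrow> real \<Rightarrow> real" where
  "foliation_width M F a b = riem_setdist M (F -` {a}) (F -` {b})"

definition isoparametric_tube ::
    "('a::topological_space, 'n::finite) riem \<Rightarrow> ('a \<Rightarrow> real) \<Rightarrow> real \<Rightarrow> real \<Rightarrow> 'a set" where
  "isoparametric_tube M F a t = {x. focal_dist M F a x < t}"

definition radial ::
    "('a::topological_space, 'n::finite) riem \<Rightarrow> ('a \<Rightarrow> real) \<Rightarrow> real \<Rightarrow> ('a \<Rightarrow> real) \<Rightarrow> bool" where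
  "radial M F a f \<longleftrightarrow> (\<exists>\<psi>::real \<Rightarrow> real. f = \<psi> \<circ> focal_dist M F a)"


section \<open>Spectrum and Pompeiu property\<close>

definition eigenfunction :: "('a, 'n::finite) riem \<Rightarrow> real \<Rightarrow> ('a \<Rightarrow> real) \<Rightarrow> bool" where
  "eigenfunction M l f \<longleftrightarrow>
     smooth_function M f \<and> f \<noteq> (\<lambda>_. 0) \<and> (\<forall>p. laplacian M f p = l * f p)"

definition Spec1 :: "('a, 'n::finite) riem \<Rightarrow> real set" where
  "Spec1 M = {l. \<exists>f. eigenfunction M l f}"

definition radial_Spec ::
    "('a::topological_space, 'n::finite) riem \<Rightarrow> ('a \<Rightarrow> real) \<Rightarrow> real \<Rightarrow> real set" where
  "radial_Spec M F a = {l \<in> Spec1 M. \<exists>f. eigenfunction M l f \<and> radial M F a f}"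

definition pompeiu_property :: "('a::topological_space, 'n::finite) riem \<Rightarrow> 'a set \<Rightarrow> bool" where
  "pompeiu_property M \<Omega> \<longleftrightarrow>
     (\<forall>f::'a \<Rightarrow> real.
        continuous_on UNIV f \<and>
        (\<forall>h. riemannian_isometry M h \<longrightarrow> (LINT x:h ` \<Omega>|riemannian_measure M. f x) = 0)
        \<longrightarrow> f = (\<lambda>_. 0))"

end

theory Submission
  imports Defs "HOL-Analysis.Analysis"
begin

text \<open>
  Let \<open>f\<close> be an eigenfunction for a nonradial eigenvalue \<open>l\<close>, let \<open>h\<close> be an isometry and put
  \<open>w = f \<circ> h\<close>. Write \<open>\<langle>du, dv\<rangle>\<close> for the pairing of two differentials in the metric. The weak form
  of the eigenvalue equation, \<open>\<integral> \<langle>dw, d\<eta>\<rangle> = l \<integral> w \<eta>\<close> for all test functions \<open>\<eta>\<close>, holds for \<open>f\<close> by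
  Green's identity (\<open>green\<close>) and passes to \<open>w\<close>, because \<open>h\<close> preserves the pairing and the
  Riemannian measure. In the same way \<open>\<integral> \<langle>dF, d\<eta>\<rangle> = \<integral> B(F) \<eta>\<close>. Take \<open>\<eta> = g(F)\<close> in the first
  equation and \<open>\<eta> = g'(F) w\<close> in the second. As \<open>\<langle>dF, dF\<rangle> = A(F)\<close>, the difference is
    \<open>\<integral> (B g' - A g'' - l g)(F) w = 0\<close> for every \<open>g\<close> of class \<open>C\<^sup>2\<close> on \<open>[a, b]\<close>.
  So \<open>w\<close> integrates to zero over \<open>{F \<le> s0}\<close> as soon as the indicator function of \<open>[a, s0]\<close> is a bounded
  pointwise limit of functions \<open>B g' - A g'' - l g\<close>.

  This is where nonradiality enters (\<open>indicator_approximation\<close>). The equation \<open>B g' - A g'' = l g\<close>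
  has regular singular points at \<open>a\<close> and \<open>b\<close>: there \<open>A\<close> vanishes exactly to first order, and
  \<open>B a < 0 < B b\<close> (\<open>focal\<close>). Hence it has a solution \<open>u\<close> that is smooth up to \<open>a\<close> and a solution \<open>v\<close>
  that is smooth up to \<open>b\<close>. If their Wronskian vanished somewhere, they would be proportional, and
  \<open>u(F)\<close> would be a radial eigenfunction for \<open>l\<close>. So the Wronskian has no zero, and constants \<open>c\<close>, \<open>d\<close>
  can be chosen such that \<open>c u - 1 / l\<close> on \<open>[a, s0]\<close> and \<open>d v\<close> on \<open>[s0, b]\<close> fit together to a \<open>C\<^sup>1\<close>
  function, for which \<open>B g' - A g'' - l g\<close> is \<open>1\<close> on the left of \<open>s0\<close> and \<open>0\<close> on the right. Only the
  second derivative jumps at \<open>s0\<close>. The jump is removed by a correction whose second derivative is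
  concentrated on an interval of length tending to zero.

  It remains to see that a tube is a sublevel set of \<open>F\<close>. Along a curve, \<open>F\<close> changes at a rate of at
  most \<open>sqrt (A F)\<close> times the speed, and moving against the gradient almost attains this rate, so the
  distance from the focal set is \<open>\<phi>(F)\<close> with the strictly increasing function
  \<open>\<phi> s = \<integral>\<^sub>a\<^sup>s 1 / sqrt A\<close> (\<open>rho_eq_\<phi>\<close>). Finally \<open>\<integral> f\<close> over \<open>h(\<Omega>)\<close> equals \<open>\<integral> f \<circ> h\<close> over \<open>\<Omega>\<close>.
\<close>

section \<open>Calculus of functions of class $C^k$\<close>

lemma Ck_on_continuous: "Ck_on k f S \<Longrightarrow> continuous_on S f"
  by (cases k) (auto intro!: continuous_at_imp_continuous_on differentiable_imp_continuous_within)

lemma Ck_on_SucD: "Ck_on (Suc k) f S \<Longrightarrow> Ck_on k f S"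
proof (induction k arbitrary: f)
  case 0
  then show ?case using Ck_on_continuous by fastforce
next
  case (Suc k)
  then show ?case by (metis Ck_on.simps(2))
qed

lemma Ck_on_le: "Ck_on k f S \<Longrightarrow> j \<le> k \<Longrightarrow> Ck_on j f S"
  by (induction k) (auto simp: le_Suc_eq dest: Ck_on_SucD simp del: Ck_on.simps)

text \<open>
  Derivatives are two-sided, so the values of a function on an open set determine its derivatives there.
\<close>

lemma Ck_on_cong:
  assumes "open S" "\<And>x. x \<in> S \<Longrightarrow> f x = g x" "Ck_on k f S"
  shows "Ck_on k g S"
  using assms(2,3)
proof (induction k arbitrary: f g)
  case 0
  then show ?case using continuous_on_cong by force
next
  case (Suc k)
  have d: "(g has_derivative frechet_derivative f (at x)) (at x)" if "x \<in> S" for x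
  proof -
    have "(f has_derivative frechet_derivative f (at x)) (at x)"
      using Suc.prems that frechet_derivative_works by auto
    then show ?thesis
      using has_derivative_transform_within_open[OF _ assms(1) that] Suc.prems by metis
  qed
  have fd: "frechet_derivative g (at x) = frechet_derivative f (at x)" if "x \<in> S" for x
    using d[OF that] frechet_derivative_at by metis
  show ?case
    unfolding Ck_on.simps
  proof (intro conjI ballI)
    fix x assume "x \<in> S" then show "g differentiable at x" using d differentiableI by blast
  next
    fix e :: 'a assume "e \<in> Basis"
    then show "Ck_on k (\<lambda>x. frechet_derivative g (at x) e) S"
      using Suc.IH[of "\<lambda>x. frechet_derivative f (at x) e" "\<lambda>x. frechet_derivative g (at x) e"] fd Suc.prems by auto
  qed
qed

lemma Ck_on_local:
  assumes "\<And>x. x \<in> S \<Longrightarrow> \<exists>T. open T \<and> x \<in> T \<and> Ck_on k f T"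
  shows "Ck_on k f S"
  using assms
proof (induction k arbitrary: f)
  case 0
  show ?case unfolding Ck_on.simps
  proof (intro continuous_at_imp_continuous_on ballI)
    fix x assume "x \<in> S"
    with 0 show "isCont f x" by (metis Ck_on.simps(1) continuous_on_eq_continuous_at)
  qed
next
  case (Suc k)
  show ?case unfolding Ck_on.simps
  proof (intro conjI ballI)
    fix x assume "x \<in> S" with Suc.prems show "f differentiable at x" by fastforce
  next
    fix e :: 'a assume "e \<in> Basis"
    then show "Ck_on k (\<lambda>x. frechet_derivative f (at x) e) S"
      using Suc.prems Suc.IH by (metis Ck_on.simps(2))
  qed
qed

text \<open>
  It suffices to exhibit some derivative: on an open set it has to agree with the one that
  \<open>frechet_derivative\<close> selects, and only its values on a basis have to be of class $C^k$.
\<close>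

lemma Ck_on_SucI:
  assumes "open S" "\<And>x. x \<in> S \<Longrightarrow> (f has_derivative f' x) (at x)"
    "\<And>e. e \<in> Basis \<Longrightarrow> Ck_on k (\<lambda>x. f' x e) S"
  shows "Ck_on (Suc k) f S"
  unfolding Ck_on.simps
proof (intro conjI ballI)
  fix x assume "x \<in> S" then show "f differentiable at x" using assms(2) differentiableI by blast
next
  fix e :: 'a assume e: "e \<in> Basis"
  have "f' x e = frechet_derivative f (at x) e" if "x \<in> S" for x
    using assms(2)[OF that] frechet_derivative_at by metis
  then show "Ck_on k (\<lambda>x. frechet_derivative f (at x) e) S"
    by (rule Ck_on_cong[OF assms(1) _ assms(3)[OF e]])
qed

lemma Ck_on_SucE:
  assumes "Ck_on (Suc k) f S"
  shows "x \<in> S \<Longrightarrow> (f has_derivative frechet_derivative f (at x)) (at x)"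
    and "e \<in> Basis \<Longrightarrow> Ck_on k (\<lambda>x. frechet_derivative f (at x) e) S"
  using assms frechet_derivative_works by auto

lemma Ck_on_const: "open S \<Longrightarrow> Ck_on k (\<lambda>x. c) S"
proof (induction k arbitrary: c)
  case (Suc k)
  show ?case by (rule Ck_on_SucI[where f'="\<lambda>x h. 0"]) (use Suc in auto)
qed auto

lemma Ck_on_linear:
  assumes "open S" "bounded_linear L" "Ck_on k f S"
  shows "Ck_on k (\<lambda>x. L (f x)) S"
  using assms(3)
proof (induction k arbitrary: f)
  case 0
  then show ?case using assms(2) by (auto intro: bounded_linear.continuous_on)
next
  case (Suc k)
  show ?case
  proof (rule Ck_on_SucI[where f'="\<lambda>x h. L (frechet_derivative f (at x) h)", OF assms(1)])
    fix x assume "x \<in> S"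
    then show "((\<lambda>x. L (f x)) has_derivative (\<lambda>h. L (frechet_derivative f (at x) h))) (at x)"
      by (rule bounded_linear.has_derivative[OF assms(2) Ck_on_SucE(1)[OF Suc.prems]])
  qed (rule Suc.IH[OF Ck_on_SucE(2)[OF Suc.prems]])
qed

lemma Ck_on_add:
  assumes "open S" "Ck_on k f S" "Ck_on k g S"
  shows "Ck_on k (\<lambda>x. f x + g x) S"
  using assms(2,3)
proof (induction k arbitrary: f g)
  case 0
  then show ?case by (auto intro: continuous_intros)
next
  case (Suc k)
  show ?case
  proof (rule Ck_on_SucI[where f'="\<lambda>x h. frechet_derivative f (at x) h + frechet_derivative g (at x) h", OF assms(1)])
    fix x assume "x \<in> S"
    then show "((\<lambda>x. f x + g x) has_derivative (\<lambda>h. frechet_derivative f (at x) h + frechet_derivative g (at x) h)) (at x)"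
      using Suc.prems by (intro has_derivative_add Ck_on_SucE(1))
  qed (intro Suc.IH Ck_on_SucE(2)[OF Suc.prems(1)] Ck_on_SucE(2)[OF Suc.prems(2)])
qed

lemma Ck_on_sum:
  assumes "open S" "\<And>i. i \<in> I \<Longrightarrow> Ck_on k (f i) S"
  shows "Ck_on k (\<lambda>x. \<Sum>i\<in>I. f i x) S"
  using assms(2)
  by (induction I rule: infinite_finite_induct) (auto intro: Ck_on_add Ck_on_const assms(1))

lemma Ck_on_scaleR:
  fixes f :: "'a::euclidean_space \<Rightarrow> real"
  assumes "open S" "Ck_on k f S" "Ck_on k g S"
  shows "Ck_on k (\<lambda>x. f x *\<^sub>R g x) S"
  using assms(2,3)
proof (induction k arbitrary: f g)
  case 0
  then show ?case by (auto intro: continuous_intros)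
next
  case (Suc k)
  show ?case
  proof (rule Ck_on_SucI[where f'="\<lambda>x h. f x *\<^sub>R frechet_derivative g (at x) h + frechet_derivative f (at x) h *\<^sub>R g x", OF assms(1)])
    fix x assume "x \<in> S"
    then show "((\<lambda>x. f x *\<^sub>R g x) has_derivative (\<lambda>h. f x *\<^sub>R frechet_derivative g (at x) h + frechet_derivative f (at x) h *\<^sub>R g x)) (at x)"
      using Suc.prems by (intro has_derivative_scaleR Ck_on_SucE(1))
  next
    fix e :: 'a assume "e \<in> Basis"
    then show "Ck_on k (\<lambda>x. f x *\<^sub>R frechet_derivative g (at x) e + frechet_derivative f (at x) e *\<^sub>R g x) S"
      by (intro Ck_on_add[OF assms(1)] Suc.IH Ck_on_SucD[OF Suc.prems(1)] Ck_on_SucD[OF Suc.prems(2)]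
          Ck_on_SucE(2)[OF Suc.prems(1)] Ck_on_SucE(2)[OF Suc.prems(2)])
  qed
qed

lemma Ck_on_mult:
  fixes f :: "'a::euclidean_space \<Rightarrow> real"
  shows "open S \<Longrightarrow> Ck_on k f S \<Longrightarrow> Ck_on k g S \<Longrightarrow> Ck_on k (\<lambda>x. f x * g x) S"
  using Ck_on_scaleR[of S k f g] by simp

lemma Ck_on_diff:
  fixes f :: "'a::euclidean_space \<Rightarrow> real"
  shows "open S \<Longrightarrow> Ck_on k f S \<Longrightarrow> Ck_on k g S \<Longrightarrow> Ck_on k (\<lambda>x. f x - g x) S"
  using Ck_on_add[of S k f "\<lambda>x. (-1) * g x"] Ck_on_mult[of S k "\<lambda>x. -1" g] Ck_on_const by force

lemma Ck_on_prod:
  fixes f :: "'i \<Rightarrow> 'a::euclidean_space \<Rightarrow> real"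
  assumes "open S" "\<And>i. i \<in> I \<Longrightarrow> Ck_on k (f i) S"
  shows "Ck_on k (\<lambda>x. \<Prod>i\<in>I. f i x) S"
  using assms(2)
  by (induction I rule: infinite_finite_induct) (auto intro: Ck_on_mult Ck_on_const assms(1))

lemma Ck_on_vec:
  fixes f :: "'a::euclidean_space \<Rightarrow> 'b::real_normed_vector^'n::finite"
  shows "open S \<Longrightarrow> Ck_on k f S \<Longrightarrow> Ck_on k (\<lambda>x. f x $ i) S"
  using Ck_on_linear[OF _ bounded_linear_vec_nth] by blast

lemma Ck_on_mat:
  fixes f :: "'a::euclidean_space \<Rightarrow> real^'n::finite^'m::finite"
  shows "open S \<Longrightarrow> Ck_on k f S \<Longrightarrow> Ck_on k (\<lambda>x. f x $ i $ j) S"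
  using Ck_on_vec[of S k "\<lambda>x. f x $ i" j] Ck_on_vec[of S k f i] by blast

text \<open>
  The determinant is a polynomial in the entries.
\<close>

lemma Ck_on_det:
  fixes f :: "'a::euclidean_space \<Rightarrow> real^'n::finite^'n"
  assumes S: "open S" and f: "\<And>i j. Ck_on k (\<lambda>x. f x $ i $ j) S"
  shows "Ck_on k (\<lambda>x. det (f x)) S"
  unfolding det_def by (intro Ck_on_sum Ck_on_mult Ck_on_const Ck_on_prod S f)

lemma Ck_on_id: "open S \<Longrightarrow> Ck_on k (\<lambda>x. x) S"
  by (cases k) (auto simp: Ck_on_const)

section \<open>Functions of one variable with one-sided derivatives\<close>

text \<open>
  The derivatives are taken within the set. On \<open>{a..b}\<close> this is smoothness up to the end points, which
  is what the coefficients of an isoparametric function have. Sets such as \<open>{a..<b}\<close> are used for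
  functions that are smooth up to one end point only.
\<close>

primrec Ck_real :: "nat \<Rightarrow> (real \<Rightarrow> real) \<Rightarrow> real set \<Rightarrow> bool" where
  "Ck_real 0 f S \<longleftrightarrow> continuous_on S f"
| "Ck_real (Suc k) f S \<longleftrightarrow>
     (\<exists>f'. (\<forall>x\<in>S. (f has_real_derivative f' x) (at x within S)) \<and> Ck_real k f' S)"

lemma Ck_real_continuous: "Ck_real k f S \<Longrightarrow> continuous_on S f"
  by (cases k) (auto intro: DERIV_continuous_on)

lemma Ck_real_SucD: "Ck_real (Suc k) f S \<Longrightarrow> Ck_real k f S"
proof (induction k arbitrary: f)
  case 0
  then show ?case by (auto intro: DERIV_continuous_on)
next
  case (Suc k)
  then show ?case by (metis Ck_real.simps(2))
qed

lemma Ck_real_cong: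
  assumes "Ck_real k f S" "\<And>x. x \<in> S \<Longrightarrow> f x = g x"
  shows "Ck_real k g S"
proof (cases k)
  case 0
  then show ?thesis using assms continuous_on_cong by force
next
  case (Suc j)
  then obtain f' where f': "\<forall>x\<in>S. (f has_real_derivative f' x) (at x within S)" "Ck_real j f' S"
    using assms(1) by auto
  have "\<forall>x\<in>S. (g has_real_derivative f' x) (at x within S)"
    using f'(1) assms(2) DERIV_cong_ev has_field_derivative_transform_within[OF _ zero_less_one]
    by (metis (no_types, lifting))
  then show ?thesis using Suc f'(2) by auto
qed

lemma Ck_real_const: "Ck_real k (\<lambda>x. c) S"
  by (induction k arbitrary: c) (auto intro!: exI[of _ "\<lambda>x. 0"] derivative_eq_intros)

lemma Ck_real_add: "Ck_real k f S \<Longrightarrow> Ck_real k g S \<Longrightarrow> Ck_real k (\<lambda>x. f x + g x) S"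
proof (induction k arbitrary: f g)
  case (Suc k)
  then obtain f' g' where "\<forall>x\<in>S. (f has_real_derivative f' x) (at x within S)" "Ck_real k f' S"
    "\<forall>x\<in>S. (g has_real_derivative g' x) (at x within S)" "Ck_real k g' S" by auto
  with Suc.IH show ?case by (auto intro!: exI[of _ "\<lambda>x. f' x + g' x"] derivative_eq_intros)
qed (auto intro: continuous_intros)

lemma Ck_real_mult: "Ck_real k f S \<Longrightarrow> Ck_real k g S \<Longrightarrow> Ck_real k (\<lambda>x. f x * g x) S"
proof (induction k arbitrary: f g)
  case (Suc k)
  then obtain f' g' where *: "\<forall>x\<in>S. (f has_real_derivative f' x) (at x within S)" "Ck_real k f' S"
    "\<forall>x\<in>S. (g has_real_derivative g' x) (at x within S)" "Ck_real k g' S" by auto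
  have "Ck_real k (\<lambda>x. f' x * g x + g' x * f x) S"
    by (intro Ck_real_add Suc.IH Ck_real_SucD[OF Suc.prems(1)] Ck_real_SucD[OF Suc.prems(2)] *)
  with * show ?case by (auto intro!: exI[of _ "\<lambda>x. f' x * g x + g' x * f x"] derivative_eq_intros)
qed (auto intro: continuous_intros)

lemma Ck_real_cmult: "Ck_real k f S \<Longrightarrow> Ck_real k (\<lambda>x. c * f x) S"
  using Ck_real_mult[OF Ck_real_const] by blast

lemma Ck_real_diff: "Ck_real k f S \<Longrightarrow> Ck_real k g S \<Longrightarrow> Ck_real k (\<lambda>x. f x - g x) S"
  using Ck_real_add[of k f S "\<lambda>x. (-1) * g x"] Ck_real_cmult[of k g S "-1"] by simp

lemma Ck_real_powr: "Ck_real k (\<lambda>x. x powr r) {0<..}"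
proof (induction k arbitrary: r)
  case 0
  then show ?case by (auto intro!: continuous_intros)
next
  case (Suc k)
  show ?case unfolding Ck_real.simps
    using Ck_real_cmult[OF Suc]
    by (intro exI[of _ "\<lambda>x. r * x powr (r - 1)"] conjI ballI)
      (auto intro: has_field_derivative_at_within has_real_derivative_powr)
qed

text \<open>
  A one-sided derivative of the outer function is enough if the inner function takes its values on
  that side: at a point where \<open>F\<close> attains its minimum \<open>a\<close>, a function on \<open>{a..b}\<close> is composed with \<open>F\<close>.
\<close>

lemma has_derivative_compose_real:
  assumes f: "(f has_derivative f') (at x)" and "open S" "x \<in> S" "f ` S \<subseteq> T"
    and g: "(g has_real_derivative g') (at (f x) within T)"
  shows "((\<lambda>x. g (f x)) has_derivative (\<lambda>h. g' * f' h)) (at x)"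
proof -
  have "(g has_derivative (*) g') (at (f x) within f ` S)"
    using g assms(4) unfolding has_field_derivative_def by (rule has_derivative_subset)
  then have "((\<lambda>x. g (f x)) has_derivative (\<lambda>h. g' * f' h)) (at x within S)"
    by (rule has_derivative_in_compose[OF has_derivative_at_withinI[OF f]])
  then show ?thesis unfolding at_within_open[OF assms(3,2)] .
qed

lemma Ck_on_compose_real:
  assumes "open S" "Ck_on k f S" "Ck_real k g T" "f ` S \<subseteq> T"
  shows "Ck_on k (\<lambda>x. g (f x)) S"
  using assms(2,3)
proof (induction k arbitrary: g)
  case 0
  then show ?case using assms(4) by (auto intro: continuous_on_compose2)
next
  case (Suc k)
  then obtain g' where g': "\<forall>x\<in>T. (g has_real_derivative g' x) (at x within T)" "Ck_real k g' T" by auto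
  show ?case
  proof (rule Ck_on_SucI[where f'="\<lambda>x h. g' (f x) * frechet_derivative f (at x) h", OF assms(1)])
    fix x assume "x \<in> S"
    then show "((\<lambda>x. g (f x)) has_derivative (\<lambda>h. g' (f x) * frechet_derivative f (at x) h)) (at x)"
      using Suc.prems g' assms(4)
      by (intro has_derivative_compose_real[OF Ck_on_SucE(1)[OF Suc.prems(1)] assms(1)]) auto
  next
    fix e :: 'a assume "e \<in> Basis"
    then show "Ck_on k (\<lambda>x. g' (f x) * frechet_derivative f (at x) e) S"
      using Suc.IH[OF Ck_on_SucD[OF Suc.prems(1)] g'(2)] Suc.prems by (intro Ck_on_mult assms(1)) auto
  qed
qed

text \<open>
  Square roots and reciprocals of positive functions are both powers with a real exponent, and
  \<open>powr\<close> is smooth on the positive half-line.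
\<close>

lemma Ck_on_sqrt:
  assumes "open S" "Ck_on k f S" "\<And>x. x \<in> S \<Longrightarrow> f x > 0"
  shows "Ck_on k (\<lambda>x. sqrt (f x)) S"
proof -
  have "Ck_on k (\<lambda>x. f x powr (1/2)) S"
    using Ck_on_compose_real[OF assms(1,2) Ck_real_powr] assms(3) by force
  then show ?thesis
    by (rule Ck_on_cong[OF assms(1), rotated]) (use assms(3) powr_half_sqrt order_less_imp_le in blast)
qed

lemma Ck_on_inverse:
  fixes f :: "'a::euclidean_space \<Rightarrow> real"
  assumes "open S" "Ck_on k f S" "\<And>x. x \<in> S \<Longrightarrow> f x > 0"
  shows "Ck_on k (\<lambda>x. inverse (f x)) S"
proof -
  have "Ck_on k (\<lambda>x. f x powr (-1)) S"
    using Ck_on_compose_real[OF assms(1,2) Ck_real_powr[of k "-1"]] assms(3) by force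
  then show ?thesis
    by (rule Ck_on_cong[OF assms(1), rotated]) (use assms(3) in \<open>simp add: powr_minus order_less_imp_le less_imp_neq\<close>)
qed

lemma Ck_on_divide:
  fixes f :: "'a::euclidean_space \<Rightarrow> real"
  assumes "open S" "Ck_on k f S" "Ck_on k g S" "\<And>x. x \<in> S \<Longrightarrow> g x > 0"
  shows "Ck_on k (\<lambda>x. f x / g x) S"
  using Ck_on_mult[OF assms(1,2) Ck_on_inverse[OF assms(1,3,4)]] by (simp add: divide_inverse)

lemma frechet_derivative_basis_expansion:
  fixes f :: "real^'n::finite \<Rightarrow> 'b::real_normed_vector"
  assumes "f differentiable (at x)"
  shows "frechet_derivative f (at x) v = (\<Sum>j\<in>UNIV. v $ j *\<^sub>R frechet_derivative f (at x) (axis j 1))"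
proof -
  have lin: "linear (frechet_derivative f (at x))" using assms linear_frechet_derivative by blast
  have "frechet_derivative f (at x) v = frechet_derivative f (at x) (\<Sum>j\<in>UNIV. v $ j *\<^sub>R axis j 1)"
    by (metis basis_expansion scalar_mult_eq_scaleR)
  also have "\<dots> = (\<Sum>j\<in>UNIV. v $ j *\<^sub>R frechet_derivative f (at x) (axis j 1))"
    by (simp add: linear_sum[OF lin] linear_scale[OF lin])
  finally show ?thesis .
qed

text \<open>The chain rule for C1 functions is all that is needed for changes of coordinates.\<close>
text \<open>
  Test functions are of class $C^1$, and this order of the chain rule expresses them in other
  coordinates and composes them with isometries.
\<close>

lemma C1_compose:
  fixes f :: "real^'n::finite \<Rightarrow> real" and \<tau> :: "'a::euclidean_space \<Rightarrow> real^'n"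
  assumes "open S" "Ck_on 1 \<tau> S" "open T" "Ck_on 1 f T" "\<tau> ` S \<subseteq> T"
  shows "Ck_on 1 (\<lambda>x. f (\<tau> x)) S"
  unfolding One_nat_def
proof (rule Ck_on_SucI[where f'="\<lambda>x h. frechet_derivative f (at (\<tau> x)) (frechet_derivative \<tau> (at x) h)", OF assms(1)])
  fix x assume x: "x \<in> S"
  have 1: "(\<tau> has_derivative frechet_derivative \<tau> (at x)) (at x)"
    using Ck_on_SucE(1) assms(2) x by (metis One_nat_def)
  have 2: "(f has_derivative frechet_derivative f (at (\<tau> x))) (at (\<tau> x))"
    using Ck_on_SucE(1) assms(4,5) x by (metis One_nat_def image_subset_iff)
  show "((\<lambda>x. f (\<tau> x)) has_derivative (\<lambda>h. frechet_derivative f (at (\<tau> x)) (frechet_derivative \<tau> (at x) h))) (at x)"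
    using has_derivative_compose[OF 1 2] .
next
  fix e :: 'a assume e: "e \<in> Basis"
  have c: "continuous_on S \<tau>" using assms(2) Ck_on_continuous by blast
  have ce: "continuous_on S (\<lambda>x. frechet_derivative \<tau> (at x) e)"
    using assms(2) e by auto
  have "continuous_on T (\<lambda>y. frechet_derivative f (at y) (axis j 1))" for j
    using assms(4) by auto
  then have cf: "continuous_on S (\<lambda>x. frechet_derivative f (at (\<tau> x)) (axis j 1))" for j
    using continuous_on_compose2[OF _ c assms(5)] by blast
  have "continuous_on S (\<lambda>x. \<Sum>j\<in>UNIV. (frechet_derivative \<tau> (at x) e) $ j *\<^sub>R frechet_derivative f (at (\<tau> x)) (axis j 1))"
    by (intro continuous_intros cf ce)
  moreover have "(\<Sum>j\<in>UNIV. (frechet_derivative \<tau> (at x) e) $ j *\<^sub>R frechet_derivative f (at (\<tau> x)) (axis j 1))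
     = frechet_derivative f (at (\<tau> x)) (frechet_derivative \<tau> (at x) e)" if "x \<in> S" for x
    using frechet_derivative_basis_expansion[symmetric] assms(4,5) that by fastforce
  ultimately show "Ck_on 0 (\<lambda>x. frechet_derivative f (at (\<tau> x)) (frechet_derivative \<tau> (at x) e)) S"
    by (metis (no_types, lifting) Ck_on.simps(1) continuous_on_cong)
qed

section \<open>First-order equations with a singular end point\<close>

lemma at_within_Ico_right: "a < b \<Longrightarrow> at a within {a..<b} = at_right (a::real)"
  by (rule at_within_nhd[of _ "{..<b}"]) auto

lemma at_within_Ico_interior: "a < x \<Longrightarrow> x < b \<Longrightarrow> at x within {a..<b} = at (x::real)"
  by (rule at_within_nhd[of _ "{a<..<b}"]) auto

lemma eventually_at_right_interval: "a < b \<Longrightarrow> eventually (\<lambda>x. x \<in> {a<..<b}) (at_right (a::real))"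
  unfolding eventually_at_right by auto

lemma continuous_on_Ico_tendsto:
  assumes "continuous_on {a..<b} f" "a < (b::real)"
  shows "(f \<longlongrightarrow> f a) (at_right a)"
  using assms at_within_Ico_right[OF assms(2)] unfolding continuous_on_def
  by (metis atLeastLessThan_iff order_refl)

lemma continuous_on_Ico_interior:
  assumes "continuous_on {a..<b} f" "a < x" "x < (b::real)"
  shows "isCont f x"
  using assms at_within_Ico_interior[OF assms(2,3)]
  unfolding continuous_on_eq_continuous_within by (metis atLeastLessThan_iff less_imp_le)

lemma Icc_subset_Ico: "y < b \<Longrightarrow> {a..y} \<subseteq> {a..<b::real}"
  by auto

text \<open>
  If the derivative has a limit at the end point, the function has that derivative there, by the mean
  value theorem. Smoothness at the singular end points is obtained in this way.
\<close>

lemma derivative_limit_at_left_endpoint: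
  fixes f f' :: "real \<Rightarrow> real"
  assumes "a < b" "(f \<longlongrightarrow> f a) (at_right a)" "(f' \<longlongrightarrow> f' a) (at_right a)"
    and d: "\<And>x. x \<in> {a<..<b} \<Longrightarrow> (f has_real_derivative f' x) (at x)"
  shows "(f has_real_derivative f' a) (at a within {a..<b})"
  unfolding has_field_derivative_iff at_within_Ico_right[OF assms(1)]
proof (rule lhopital_right[where f'=f' and g'="\<lambda>_. 1"])
  have ev: "eventually (\<lambda>x. x \<in> {a<..<b}) (at_right a)"
    by (rule eventually_at_right_interval[OF assms(1)])
  show "((\<lambda>y. f y - f a) \<longlongrightarrow> 0) (at_right a)" "((\<lambda>y. y - a) \<longlongrightarrow> 0) (at_right a)"
    using assms(2) by (auto simp: LIM_zero_iff intro!: tendsto_eq_intros)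
  show "\<forall>\<^sub>F x in at_right a. x - a \<noteq> 0"
    by (rule eventually_mono[OF ev]) auto
  show "\<forall>\<^sub>F x in at_right a. ((\<lambda>y. f y - f a) has_real_derivative f' x) (at x)"
    by (rule eventually_mono[OF ev]) (auto intro!: derivative_eq_intros d)
  show "\<forall>\<^sub>F x in at_right a. ((\<lambda>y. y - a) has_real_derivative 1) (at x)"
    by (intro always_eventually allI) (auto intro!: derivative_eq_intros)
qed (use assms in auto)

text \<open>
  A solution of \<open>A w' + \<beta> w = r\<close> with \<open>A a = 0\<close> can be continuous at \<open>a\<close> only with the value
  \<open>r a / \<beta> a\<close>. It is continuous if the general solution \<open>1 / p\<close> of the homogeneous equation, which blows
  up at \<open>a\<close>, is excluded. The exclusion is the condition that \<open>p w\<close> tends to zero, and the limit then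
  follows from l'Hopital's rule for the quotient \<open>(p w) / p\<close>.
\<close>

lemma singular_ode_limit:
  fixes p A \<beta> r w :: "real \<Rightarrow> real"
  assumes ab: "a < b"
    and p: "\<And>x. x \<in> {a<..<b} \<Longrightarrow> (p has_real_derivative p x * \<beta> x / A x) (at x)"
    and p0: "(p \<longlongrightarrow> 0) (at_right a)" and ppos: "\<And>x. x \<in> {a<..<b} \<Longrightarrow> p x > 0"
    and A: "\<And>x. x \<in> {a<..<b} \<Longrightarrow> A x > 0"
    and \<beta>: "(\<beta> \<longlongrightarrow> \<beta> a) (at_right a)" "\<beta> a > 0" and r: "(r \<longlongrightarrow> r a) (at_right a)"
    and w: "\<And>x. x \<in> {a<..<b} \<Longrightarrow> (w has_real_derivative (r x - \<beta> x * w x) / A x) (at x)"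
    and pw: "((\<lambda>x. p x * w x) \<longlongrightarrow> 0) (at_right a)"
  shows "(w \<longlongrightarrow> r a / \<beta> a) (at_right a)"
proof -
  have ev: "eventually (\<lambda>x. x \<in> {a<..<b}) (at_right a)"
    by (rule eventually_at_right_interval[OF ab])
  have ev\<beta>: "eventually (\<lambda>x. \<beta> x > 0) (at_right a)"
    using order_tendstoD(1)[OF \<beta>] .
  have "((\<lambda>x. (p x * w x) / p x) \<longlongrightarrow> r a / \<beta> a) (at_right a)"
  proof (rule lhopital_right[where f'="\<lambda>x. p x * r x / A x" and g'="\<lambda>x. p x * \<beta> x / A x", OF pw p0])
    show "\<forall>\<^sub>F x in at_right a. p x \<noteq> 0"
      by (rule eventually_mono[OF ev]) (use ppos in force)
    show "\<forall>\<^sub>F x in at_right a. p x * \<beta> x / A x \<noteq> 0"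
      using ev ev\<beta> by eventually_elim (use ppos A in force)
    show "\<forall>\<^sub>F x in at_right a. (p has_real_derivative p x * \<beta> x / A x) (at x)"
      by (rule eventually_mono[OF ev]) (use p in auto)
    show "\<forall>\<^sub>F x in at_right a. ((\<lambda>x. p x * w x) has_real_derivative p x * r x / A x) (at x)"
      using ev
    proof eventually_elim
      case (elim x)
      show ?case
        by (rule DERIV_cong[OF DERIV_mult[OF p[OF elim] w[OF elim]]])
          (use A[OF elim] in \<open>simp add: field_simps\<close>)
    qed
    have "((\<lambda>x. r x / \<beta> x) \<longlongrightarrow> r a / \<beta> a) (at_right a)"
      using \<beta> r by (auto intro!: tendsto_intros)
    moreover have "\<forall>\<^sub>F x in at_right a. p x * r x / A x / (p x * \<beta> x / A x) = r x / \<beta> x"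
      using ev ev\<beta>
    proof eventually_elim
      case (elim x)
      then show ?case using ppos[of x] A[of x] by (simp add: field_simps)
    qed
    ultimately show "((\<lambda>x. p x * r x / A x / (p x * \<beta> x / A x)) \<longlongrightarrow> r a / \<beta> a) (at_right a)"
      by (simp add: tendsto_cong)
  qed
  moreover have "\<forall>\<^sub>F x in at_right a. (p x * w x) / p x = w x"
    by (rule eventually_mono[OF ev]) (use ppos in force)
  ultimately show ?thesis by (simp add: tendsto_cong)
qed

text \<open>
  Differentiating \<open>A w' + \<beta> w = r\<close> shows that \<open>w'\<close> solves an equation of the same kind,
  \<open>A (w')' + (A' + \<beta>) w' = r' - \<beta>' w\<close>, with the integrating factor \<open>p A\<close> instead of \<open>p\<close>. By induction the
  continuity of solutions gives their smoothness. Since \<open>A' a > 0\<close>, the new coefficient is positive at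
  \<open>a\<close> as well.
\<close>

lemma singular_ode_regular:
  fixes p A \<beta> r w :: "real \<Rightarrow> real"
  assumes ab: "a < b"
    and A: "\<And>x. x \<in> {a<..<b} \<Longrightarrow> A x > 0" "\<And>k. Ck_real k A {a..<b}" "A a = 0"
    and A': "\<And>x. x \<in> {a..<b} \<Longrightarrow> (A has_real_derivative A' x) (at x within {a..<b})" "\<And>k. Ck_real k A' {a..<b}" "A' a > 0"
    and p: "\<And>x. x \<in> {a<..<b} \<Longrightarrow> (p has_real_derivative p x * \<beta> x / A x) (at x)"
    and p0: "(p \<longlongrightarrow> 0) (at_right a)" and ppos: "\<And>x. x \<in> {a<..<b} \<Longrightarrow> p x > 0"
    and \<beta>: "\<And>k. Ck_real k \<beta> {a..<b}" "\<beta> a > 0" and r: "Ck_real n r {a..<b}"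
    and w: "\<And>x. x \<in> {a<..<b} \<Longrightarrow> (w has_real_derivative (r x - \<beta> x * w x) / A x) (at x)"
    and pw: "((\<lambda>x. p x * w x) \<longlongrightarrow> 0) (at_right a)"
    and wa: "w a = r a / \<beta> a"
  shows "Ck_real n w {a..<b}"
  using p p0 ppos \<beta> r w pw wa
proof (induction n arbitrary: p \<beta> r w)
  case 0
  have "(w \<longlongrightarrow> r a / \<beta> a) (at_right a)"
    by (rule singular_ode_limit[OF ab 0(1-3) A(1) _ _ _ 0(7,8)])
      (use 0 continuous_on_Ico_tendsto[OF Ck_real_continuous ab] in blast)+
  then have wlim: "(w \<longlongrightarrow> w a) (at_right a)" using 0 by simp
  show ?case
    unfolding Ck_real.simps continuous_on_def
  proof
    fix x assume x: "x \<in> {a..<b}"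
    show "(w \<longlongrightarrow> w x) (at x within {a..<b})"
    proof (cases "x = a")
      case True then show ?thesis using wlim at_within_Ico_right[OF ab] by simp
    next
      case False
      then have "isCont w x" using x 0(7)[of x] DERIV_isCont by auto
      then show ?thesis by (metis continuous_at_imp_continuous_at_within continuous_within)
    qed
  qed
next
  case (Suc n)
  note pder = Suc.prems(1) and p0 = Suc.prems(2) and ppos = Suc.prems(3) and \<beta> = Suc.prems(4,5)
    and r = Suc.prems(6) and w = Suc.prems(7) and pw = Suc.prems(8) and wa = Suc.prems(9)
  obtain r1 where r1: "\<forall>x\<in>{a..<b}. (r has_real_derivative r1 x) (at x within {a..<b})" "Ck_real n r1 {a..<b}"
    using r by auto
  obtain \<beta>1 where \<beta>1: "\<forall>x\<in>{a..<b}. (\<beta> has_real_derivative \<beta>1 x) (at x within {a..<b})"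
    using \<beta>(1)[of "Suc 0"] by auto
  have \<beta>1k: "Ck_real k \<beta>1 {a..<b}" for k
  proof -
    obtain g where g: "\<forall>x\<in>{a..<b}. (\<beta> has_real_derivative g x) (at x within {a..<b})" "Ck_real k g {a..<b}"
      using \<beta>(1)[of "Suc k"] by auto
    have "g x = \<beta>1 x" if "x \<in> {a..<b}" for x
    proof (rule has_field_derivative_unique)
      show "at x within {a..<b} \<noteq> bot"
        using that ab at_within_Ico_right[OF ab] at_within_Ico_interior[of a x b] by (cases "x = a") auto
    qed (use g \<beta>1 that in auto)
    then show ?thesis using Ck_real_cong[OF g(2)] by blast
  qed
  have wn: "Ck_real n w {a..<b}"
    by (rule Suc.IH[OF pder p0 ppos \<beta> Ck_real_SucD[OF r] w pw wa])
  \<comment> \<open>the value at \<open>a\<close> is the limit of \<open>w'\<close> that the differentiated equation prescribes\<close>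
  define w1 where "w1 x = (if x = a then (r1 a - \<beta>1 a * w a) / (A' a + \<beta> a) else (r x - \<beta> x * w x) / A x)" for x
  have w1n: "Ck_real n w1 {a..<b}"
  proof (rule Suc.IH[of "\<lambda>x. p x * A x" "\<lambda>x. A' x + \<beta> x" "\<lambda>x. r1 x - \<beta>1 x * w x"])
    fix x assume x: "x \<in> {a<..<b}"
    have Ax: "(A has_real_derivative A' x) (at x)" and rx: "(r has_real_derivative r1 x) (at x)"
      and \<beta>x: "(\<beta> has_real_derivative \<beta>1 x) (at x)"
      using x A'(1)[of x] bspec[OF r1(1), of x] bspec[OF \<beta>1, of x] at_within_Ico_interior[of a x b] by auto
    show "((\<lambda>x. p x * A x) has_real_derivative p x * A x * (A' x + \<beta> x) / A x) (at x)"
      by (rule DERIV_cong[OF DERIV_mult[OF pder[OF x] Ax]]) (use A(1)[OF x] in \<open>simp add: field_simps\<close>)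
    show "0 < p x * A x" using ppos[OF x] A(1)[OF x] by simp
    have d: "((\<lambda>x. (r x - \<beta> x * w x) / A x) has_real_derivative
        (r1 x - \<beta>1 x * w x - (A' x + \<beta> x) * w1 x) / A x) (at x)"
      by (rule DERIV_cong[OF DERIV_divide[OF DERIV_diff[OF rx DERIV_mult[OF \<beta>x w[OF x]]] Ax]])
        (use A(1)[OF x] x in \<open>auto simp: w1_def field_simps power2_eq_square\<close>)
    show "(w1 has_real_derivative (r1 x - \<beta>1 x * w x - (A' x + \<beta> x) * w1 x) / A x) (at x)"
      by (rule has_field_derivative_transform_within_open[OF d, of "{a<..<b}"]) (use x in \<open>auto simp: w1_def\<close>)
  next
    have Al: "(A \<longlongrightarrow> 0) (at_right a)" using continuous_on_Ico_tendsto[OF Ck_real_continuous[OF A(2)] ab] A(3) by simp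
    show "((\<lambda>x. p x * A x) \<longlongrightarrow> 0) (at_right a)" using tendsto_mult[OF p0 Al] by simp
    have ev: "eventually (\<lambda>x. x \<in> {a<..<b}) (at_right a)"
      by (rule eventually_at_right_interval[OF ab])
    have "((\<lambda>x. p x * (r x - \<beta> x * w x)) \<longlongrightarrow> 0 * (r a - \<beta> a * w a)) (at_right a)"
      by (intro tendsto_intros p0 continuous_on_Ico_tendsto[OF Ck_real_continuous ab])
         (rule r \<beta>(1) wn)+
    moreover have "\<forall>\<^sub>F x in at_right a. p x * (r x - \<beta> x * w x) = p x * A x * w1 x"
      using ev by eventually_elim (use A(1) in \<open>force simp: w1_def field_simps\<close>)
    ultimately show "((\<lambda>x. p x * A x * w1 x) \<longlongrightarrow> 0) (at_right a)" by (simp add: tendsto_cong)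
    show "A' a + \<beta> a > 0" using A'(3) \<beta>(2) by simp
    show "Ck_real n (\<lambda>x. r1 x - \<beta>1 x * w x) {a..<b}"
      by (intro Ck_real_diff Ck_real_mult r1(2) \<beta>1k wn)
    show "Ck_real k (\<lambda>x. A' x + \<beta> x) {a..<b}" for k
      by (intro Ck_real_add A'(2) \<beta>(1))
  qed (auto simp: w1_def)
  have "(w has_real_derivative w1 x) (at x within {a..<b})" if x: "x \<in> {a..<b}" for x
  proof (cases "x = a")
    case True
    have "(w has_real_derivative w1 x) (at x)" if "x \<in> {a<..<b}" for x
      using w[OF that] that by (simp add: w1_def)
    then show ?thesis unfolding True
      by (rule derivative_limit_at_left_endpoint[OF ab continuous_on_Ico_tendsto[OF Ck_real_continuous[OF wn] ab]
          continuous_on_Ico_tendsto[OF Ck_real_continuous[OF w1n] ab]])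
  next
    case False
    then show ?thesis using w[of x] x by (auto simp: w1_def intro: has_field_derivative_at_within)
  qed
  with w1n show ?case unfolding Ck_real.simps by (intro exI[of _ w1] conjI ballI)
qed

lemma powers_over_fact_derivative:
  assumes "(f has_real_derivative f') (at x within S)"
  shows "((\<lambda>x. f x ^ Suc n / fact (Suc n)) has_real_derivative f' * (f x ^ n / fact n)) (at x within S)"
proof -
  have "((\<lambda>x. f x ^ Suc n / fact (Suc n)) has_real_derivative (real (Suc n) * (f' * f x ^ n)) / fact (Suc n)) (at x within S)"
    using DERIV_cdivide[OF DERIV_power_Suc[OF assms, of n], of "fact (Suc n)"] by (simp add: mult.assoc add.commute)
  moreover have "(real (Suc n) * (f' * f x ^ n)) / fact (Suc n) = f' * (f x ^ n / fact n)"
    by (simp add: fact_Suc del: of_nat_Suc)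
  ultimately show ?thesis by simp
qed

section \<open>The regular solution at a singular end point\<close>

text \<open>
  The equation \<open>A u'' + \<beta> u' + l u = 0\<close> near a simple zero \<open>a\<close> of \<open>A\<close>. Its indices at \<open>a\<close> are \<open>0\<close> and
  \<open>1 - \<beta> a / A' a\<close>, and \<open>\<beta> a > 0\<close> makes a solution with \<open>u a = 1\<close> that is smooth up to \<open>a\<close>
  available for every \<open>l\<close>.
\<close>

locale singular_endpoint =
  fixes a b :: real and A A' \<beta> :: "real \<Rightarrow> real"
  assumes ab: "a < b"
    and A_pos: "\<And>x. x \<in> {a<..<b} \<Longrightarrow> A x > 0"
    and A_smooth: "\<And>k. Ck_real k A {a..<b}"
    and A_a: "A a = 0"
    and A_deriv: "\<And>x. x \<in> {a..<b} \<Longrightarrow> (A has_real_derivative A' x) (at x within {a..<b})"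
    and A'_smooth: "\<And>k. Ck_real k A' {a..<b}"
    and A'_a: "A' a > 0"
    and \<beta>_smooth: "\<And>k. Ck_real k \<beta> {a..<b}"
    and \<beta>_a: "\<beta> a > 0"
begin

lemma A_isCont: "x \<in> {a<..<b} \<Longrightarrow> isCont A x"
  using continuous_on_Ico_interior[OF Ck_real_continuous[OF A_smooth]] by auto

lemma \<beta>_isCont: "x \<in> {a<..<b} \<Longrightarrow> isCont \<beta> x"
  using continuous_on_Ico_interior[OF Ck_real_continuous[OF \<beta>_smooth]] by auto

text \<open>
  \<open>p = exp (\<integral> \<beta> / A)\<close>. It tends to zero at \<open>a\<close>: there \<open>\<beta> / A\<close> exceeds \<open>\<kappa> / (x - a)\<close> for some
  \<open>\<kappa> > 0\<close>, so that \<open>p\<close> is bounded by a multiple of \<open>(x - a) powr \<kappa>\<close>.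
\<close>

lemma integrating_factor:
  obtains p where "\<And>x. p x > 0" "\<And>x. x \<in> {a<..<b} \<Longrightarrow> (p has_real_derivative p x * \<beta> x / A x) (at x)"
    "(p \<longlongrightarrow> 0) (at_right a)"
proof -
  have "\<exists>q. \<forall>x. ereal a < ereal x \<longrightarrow> ereal x < ereal b \<longrightarrow> (q has_vector_derivative \<beta> x / A x) (at x)"
  proof (rule einterval_antiderivative)
    fix x assume "ereal a < ereal x" "ereal x < ereal b"
    then have x: "x \<in> {a<..<b}" by auto
    show "isCont (\<lambda>x. \<beta> x / A x) x"
      using A_isCont[OF x] \<beta>_isCont[OF x] A_pos[OF x] by (intro continuous_intros) auto
  qed (use ab in auto)
  then obtain q where q: "\<And>x. x \<in> {a<..<b} \<Longrightarrow> (q has_real_derivative \<beta> x / A x) (at x)"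
    by (auto simp: has_real_derivative_iff_has_vector_derivative)
  have ev: "eventually (\<lambda>x. x \<in> {a<..<b}) (at_right a)"
    by (rule eventually_at_right_interval[OF ab])
  \<comment> \<open>half of the limit of \<open>(x - a) \<beta> x / A x\<close> at \<open>a\<close>\<close>
  define \<kappa> where "\<kappa> = \<beta> a / A' a / 2"
  have \<kappa>: "\<kappa> > 0" using \<beta>_a A'_a by (simp add: \<kappa>_def)
  have "((\<lambda>x. (A x - A a) / (x - a)) \<longlongrightarrow> A' a) (at_right a)"
    using A_deriv[of a] ab at_within_Ico_right[OF ab] by (simp add: has_field_derivative_iff)
  then have "((\<lambda>x. \<beta> x / ((A x - A a) / (x - a))) \<longlongrightarrow> \<beta> a / A' a) (at_right a)"
    using A'_a continuous_on_Ico_tendsto[OF Ck_real_continuous[OF \<beta>_smooth] ab] by (intro tendsto_intros) auto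
  moreover have "\<kappa> < \<beta> a / A' a" using \<kappa> by (simp add: \<kappa>_def)
  ultimately have "\<forall>\<^sub>F x in at_right a. \<kappa> < \<beta> x / ((A x - A a) / (x - a))"
    by (rule order_tendstoD(1))
  then obtain d where d: "d > a" "\<And>x. x > a \<Longrightarrow> x < d \<Longrightarrow> \<kappa> < \<beta> x / ((A x - A a) / (x - a))"
    unfolding eventually_at_right_field by auto
  define e where "e = (a + min d b) / 2"
  have e: "a < e" "e < d" "e < b" using d ab by (auto simp: e_def min_def)
  have bound: "q x \<le> q e - \<kappa> * ln (e - a) + \<kappa> * ln (x - a)" if x: "a < x" "x < e" for x
  proof -
    have "q x - \<kappa> * ln (x - a) \<le> q e - \<kappa> * ln (e - a)"
    proof (rule DERIV_nonneg_imp_nondecreasing[where f="\<lambda>x. q x - \<kappa> * ln (x - a)"])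
      fix y assume y: "x \<le> y" "y \<le> e"
      have "((\<lambda>x. q x - \<kappa> * ln (x - a)) has_real_derivative \<beta> y / A y - \<kappa> * (1 / (y - a))) (at y)"
        using q[of y] x y e by (auto intro!: derivative_eq_intros)
      moreover have "0 \<le> \<beta> y / A y - \<kappa> * (1 / (y - a))"
        using d(2)[of y] x y e A_pos[of y] by (auto simp: A_a field_simps)
      ultimately show "\<exists>z. ((\<lambda>x. q x - \<kappa> * ln (x - a)) has_real_derivative z) (at y) \<and> 0 \<le> z" by blast
    qed (use x in auto)
    then show ?thesis by simp
  qed
  define p where "p x = exp (q x)" for x
  have p_pos: "p x > 0" for x by (simp add: p_def)
  have p_deriv: "(p has_real_derivative p x * \<beta> x / A x) (at x)" if "x \<in> {a<..<b}" for x
      unfolding p_def using DERIV_fun_exp[OF q[OF that]] by (simp add: p_def)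
  define C where "C = exp (q e - \<kappa> * ln (e - a))"
    have lim: "((\<lambda>x. C * (x - a) powr \<kappa>) \<longlongrightarrow> C * 0) (at_right a)"
    proof (rule tendsto_mult[OF tendsto_const])
      have "((\<lambda>x. (x - a) powr \<kappa>) \<longlongrightarrow> (a - a) powr \<kappa>) (at_right a)"
        using \<kappa> by (intro tendsto_powr2 tendsto_intros) (auto simp: eventually_at_right_field intro!: exI[of _ "a+1"])
      then show "((\<lambda>x. (x - a) powr \<kappa>) \<longlongrightarrow> 0) (at_right a)" by (simp del: powr_eq_0_iff)
    qed
  have "(p \<longlongrightarrow> 0) (at_right a)"
    proof (rule tendsto_sandwich[OF _ _ tendsto_const[of 0] lim[simplified]])
      show "\<forall>\<^sub>F x in at_right a. 0 \<le> p x" by (simp add: p_def)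
      show "\<forall>\<^sub>F x in at_right a. p x \<le> C * (x - a) powr \<kappa>"
        using eventually_at_right_interval[OF e(1)]
      proof eventually_elim
        case (elim x)
        have "p x \<le> exp (q e - \<kappa> * ln (e - a) + \<kappa> * ln (x - a))"
          using bound[of x] elim by (simp add: p_def)
        also have "\<dots> = C * (x - a) powr \<kappa>" using elim by (simp add: C_def powr_def exp_add)
        finally show ?case .
      qed
    qed
  with p_pos p_deriv show thesis by (rule that)
qed

end

text \<open>
  For \<open>w = u'\<close> the equation is \<open>(p w)' = - l (p / A) u\<close>. Integrating twice from \<open>a\<close> turns it into the
  fixed point equation \<open>u = 1 - l \<cdot> volterra u\<close>, which is solved by its Neumann series. Here
  \<open>first_order_solution r\<close> is the solution of \<open>A w' + \<beta> w = r\<close> that is continuous at \<open>a\<close>, and \<open>volterra r\<close>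
  is its integral.
\<close>

locale singular_endpoint_factor = singular_endpoint +
  fixes p :: "real \<Rightarrow> real"
  assumes p_pos: "\<And>x. p x > 0"
    and p_deriv: "\<And>x. x \<in> {a<..<b} \<Longrightarrow> (p has_real_derivative p x * \<beta> x / A x) (at x)"
    and p_lim: "(p \<longlongrightarrow> 0) (at_right a)"
begin

definition weight_integral :: "(real \<Rightarrow> real) \<Rightarrow> real \<Rightarrow> real" where
  "weight_integral r y = integral {a..y} (\<lambda>x. p x / A x * r x)"

text \<open>
  At \<open>a\<close> the quotient would be \<open>0 / p a\<close>; the value given there instead is the limit from the right.
\<close>

definition first_order_solution :: "(real \<Rightarrow> real) \<Rightarrow> real \<Rightarrow> real" where
  "first_order_solution r x = (if x = a then r a / \<beta> a else weight_integral r x / p x)"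

definition volterra :: "(real \<Rightarrow> real) \<Rightarrow> real \<Rightarrow> real" where
  "volterra r x = integral {a..x} (first_order_solution r)"

text \<open>
  Near \<open>a\<close> the function \<open>p \<beta> / A\<close> is the derivative of \<open>p\<close>, which is continuous up to \<open>a\<close>, and it
  is nonnegative, hence absolutely integrable. Dividing by the continuous positive function \<open>\<beta>\<close>
  preserves this.
\<close>

lemma pA_integrable:
  assumes y: "y \<in> {a<..<b}"
  shows "(\<lambda>x. p x / A x) absolutely_integrable_on {a..y}"
proof -
  have "(\<beta> \<longlongrightarrow> \<beta> a) (at_right a)" using continuous_on_Ico_tendsto[OF Ck_real_continuous[OF \<beta>_smooth] ab] .
  moreover have "\<beta> a / 2 < \<beta> a" using \<beta>_a by simp
  ultimately have "\<forall>\<^sub>F x in at_right a. \<beta> a / 2 < \<beta> x" by (rule order_tendstoD(1))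
  then obtain d where d: "d > a" "\<And>x. x > a \<Longrightarrow> x < d \<Longrightarrow> \<beta> a / 2 < \<beta> x"
    unfolding eventually_at_right_field by auto
  define c where "c = (a + min d y) / 2"
  have c: "a < c" "c < d" "c < y" using d y by (auto simp: c_def min_def)
  \<comment> \<open>\<open>p\<close> itself is arbitrary at \<open>a\<close>\<close>
  define pp where "pp x = (if x = a then 0 else p x)" for x
  define g where "g x = p x * \<beta> x / A x" for x
  have cont_p: "isCont p x" if "x \<in> {a<..<b}" for x using p_deriv[OF that] DERIV_isCont by blast
  have pp_deriv: "(pp has_real_derivative g x) (at x)" if x: "x \<in> {a<..<b}" for x
    unfolding g_def by (rule has_field_derivative_transform_within_open[OF p_deriv[OF x], of "{a<..<b}"])
      (use x in \<open>auto simp: pp_def\<close>)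
  have "(g has_integral pp c - pp a) {a..c}"
  proof (rule fundamental_theorem_of_calculus_interior)
    show "continuous_on {a..c} pp"
      unfolding continuous_on_def
    proof
      fix x assume x: "x \<in> {a..c}"
      show "(pp \<longlongrightarrow> pp x) (at x within {a..c})"
      proof (cases "x = a")
        case True
        have "(pp \<longlongrightarrow> 0) (at_right a)"
          by (rule Lim_transform_eventually[OF p_lim]) (auto simp: pp_def eventually_at_right_field intro!: exI[of _ "a+1"])
        then have "(pp \<longlongrightarrow> 0) (at a within {a..c})"
          unfolding at_within_Icc_at_right[OF c(1)] .
        then show ?thesis unfolding True by (simp add: pp_def)
      next
        case False
        then have xx: "x \<in> {a<..<b}" using x c y by auto
        have "isCont pp x" using DERIV_isCont[OF pp_deriv[OF xx]] .
        then show ?thesis by (metis continuous_at_imp_continuous_at_within continuous_within)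
      qed
    qed
    fix x assume "x \<in> {a<..<c}"
    then have x: "x \<in> {a<..<b}" using c y by auto
    show "(pp has_vector_derivative g x) (at x)"
      using pp_deriv[OF x] by (simp add: has_real_derivative_iff_has_vector_derivative)
  qed (use c in auto)
  then have gi: "g integrable_on {a..c}" by blast
  have \<beta>p: "\<beta> x > 0" if "x \<in> {a..c}" for x
    using d(2)[of x] that c \<beta>_a by (cases "x = a") auto
  have A0: "A x \<ge> 0" if "x \<in> {a..c}" for x
    using A_pos[of x] that c y A_a by (cases "x = a") auto
  have ga: "g absolutely_integrable_on {a..c}"
  proof (rule nonnegative_absolutely_integrable_1[OF gi])
    show "0 \<le> g x" if "x \<in> {a..c}" for x
      unfolding g_def using less_imp_le[OF \<beta>p[OF that]] A0[OF that] less_imp_le[OF p_pos[of x]]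
      by (intro divide_nonneg_nonneg mult_nonneg_nonneg)
  qed
  have cont: "continuous_on {a..c} (\<lambda>x. 1 / \<beta> x)"
    using continuous_on_subset[OF Ck_real_continuous[OF \<beta>_smooth], of "{a..c}"] c y \<beta>p
    by (intro continuous_intros) force+
  have "(\<lambda>x. (1 / \<beta> x) * g x) absolutely_integrable_on {a..c}"
    by (rule absolutely_integrable_bounded_measurable_product_real[OF _ _ _ ga])
      (use cont compact_continuous_image[OF cont] in \<open>auto intro!: continuous_imp_measurable_on_sets_lebesgue compact_imp_bounded\<close>)
  then have 1: "(\<lambda>x. p x / A x) absolutely_integrable_on {a..c}"
    proof (rule absolutely_integrable_spike[OF _ negligible_empty])
    fix x assume "x \<in> {a..c} - {}"
    then show "p x / A x = 1 / \<beta> x * g x" using \<beta>p[of x] by (simp add: g_def)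
  qed
  have "continuous_on {c..y} (\<lambda>x. p x / A x)"
  proof (intro continuous_at_imp_continuous_on ballI)
    fix x assume "x \<in> {c..y}"
    then have x: "x \<in> {a<..<b}" using c y by auto
    show "isCont (\<lambda>x. p x / A x) x"
      using A_pos[OF x] by (intro continuous_intros A_isCont[OF x] cont_p[OF x]) auto
  qed
  then have 2: "(\<lambda>x. p x / A x) absolutely_integrable_on {c..y}"
    by (rule absolutely_integrable_continuous_real)
  have "{a..y} = {a..c} \<union> {c..y}" using c by auto
  then show ?thesis using absolutely_integrable_Un[OF 1 2] by simp
qed

lemma weighted_integrable:
  assumes r: "continuous_on {a..<b} r" and y: "y \<in> {a<..<b}"
  shows "(\<lambda>x. p x / A x * r x) absolutely_integrable_on {a..y}"
proof -
  have cont: "continuous_on {a..y} r" using continuous_on_subset[OF r Icc_subset_Ico] y by auto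
  have "(\<lambda>x. r x * (p x / A x)) absolutely_integrable_on {a..y}"
    by (rule absolutely_integrable_bounded_measurable_product_real[OF _ _ _ pA_integrable[OF y]])
      (use cont compact_continuous_image[OF cont] in \<open>auto intro!: continuous_imp_measurable_on_sets_lebesgue compact_imp_bounded\<close>)
  then show ?thesis by (simp add: mult.commute)
qed

lemma indefinite_integral_derivative:
  fixes g :: "real \<Rightarrow> real"
  assumes "g integrable_on {a..y}" "isCont g x" "a < x" "x < y"
  shows "((\<lambda>u. integral {a..u} g) has_real_derivative g x) (at x)"
proof -
  have "((\<lambda>u. integral {a..u} g) has_vector_derivative g x) (at x within {a..y})"
    using integral_has_vector_derivative_continuous_at[OF assms(1), of x "{}"] assms
    by (auto intro: continuous_at_imp_continuous_at_within)
  moreover have "at x within {a..y} = at x"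
    using assms at_within_Icc_at by blast
  ultimately show ?thesis by (simp add: has_real_derivative_iff_has_vector_derivative)
qed

lemma weight_integral_deriv:
  assumes r: "continuous_on {a..<b} r" and x: "x \<in> {a<..<b}"
  shows "(weight_integral r has_real_derivative p x / A x * r x) (at x)"
proof -
  obtain y where y: "x < y" "y < b" using x dense by auto
  show ?thesis unfolding weight_integral_def[abs_def]
  proof (rule indefinite_integral_derivative[of _ y])
    show "(\<lambda>x. p x / A x * r x) integrable_on {a..y}"
      using weighted_integrable[OF r, of y] x y set_lebesgue_integral_eq_integral(1) by auto
    have "isCont r x" using continuous_on_Ico_interior[OF r] x by auto
    moreover have "isCont p x" using p_deriv[OF x] DERIV_isCont by blast
    ultimately show "isCont (\<lambda>x. p x / A x * r x) x"
      using A_isCont[OF x] A_pos[OF x] by (intro continuous_intros) auto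
  qed (use x y in auto)
qed

lemma weight_integral_lim:
  assumes r: "continuous_on {a..<b} r"
  shows "(weight_integral r \<longlongrightarrow> 0) (at_right a)"
proof -
  obtain y where y: "a < y" "y < b" using ab dense by auto
  have "(\<lambda>x. p x / A x * r x) integrable_on {a..y}"
    using weighted_integrable[OF r, of y] y set_lebesgue_integral_eq_integral(1) by auto
  then have "continuous_on {a..y} (weight_integral r)"
    unfolding weight_integral_def[abs_def] by (rule indefinite_integral_continuous_1)
  then have "(weight_integral r \<longlongrightarrow> weight_integral r a) (at a within {a..y})"
    using y by (auto simp: continuous_on_def)
  then show ?thesis
    unfolding at_within_Icc_at_right[OF y(1)] by (simp add: weight_integral_def)
qed

lemma first_order_solution_deriv:
  assumes r: "continuous_on {a..<b} r" and x: "x \<in> {a<..<b}"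
  shows "(first_order_solution r has_real_derivative (r x - \<beta> x * first_order_solution r x) / A x) (at x)"
proof -
  have "((\<lambda>x. weight_integral r x / p x) has_real_derivative (r x - \<beta> x * first_order_solution r x) / A x) (at x)"
    by (rule DERIV_cong[OF DERIV_divide[OF weight_integral_deriv[OF r x] p_deriv[OF x]]])
      (use p_pos[of x] A_pos[OF x] x in \<open>auto simp: first_order_solution_def field_simps power2_eq_square\<close>)
  then show ?thesis
    by (rule has_field_derivative_transform_within_open[of _ _ _ "{a<..<b}"])
      (use x in \<open>auto simp: first_order_solution_def\<close>)
qed

lemma first_order_solution_flux_lim:
  assumes r: "continuous_on {a..<b} r"
  shows "((\<lambda>x. p x * first_order_solution r x) \<longlongrightarrow> 0) (at_right a)"
  by (rule Lim_transform_eventually[OF weight_integral_lim[OF r]], rule eventually_mono[OF eventually_at_right_interval[OF ab]])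
    (use p_pos in \<open>force simp: first_order_solution_def less_imp_neq[OF p_pos, symmetric]\<close>)

lemma first_order_solution_continuous:
  assumes r: "continuous_on {a..<b} r"
  shows "continuous_on {a..<b} (first_order_solution r)"
proof -
  have "Ck_real 0 (first_order_solution r) {a..<b}"
    by (rule singular_ode_regular[OF ab A_pos A_smooth A_a A_deriv A'_smooth A'_a p_deriv p_lim p_pos \<beta>_smooth \<beta>_a])
      (use r first_order_solution_deriv[OF r] first_order_solution_flux_lim[OF r] in \<open>auto simp: first_order_solution_def\<close>)
  then show ?thesis by simp
qed

lemma first_order_solution_integrable:
  assumes r: "continuous_on {a..<b} r" "y < b"
  shows "first_order_solution r integrable_on {a..y}"
  by (intro integrable_continuous_real continuous_on_subset[OF first_order_solution_continuous[OF r(1)]]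
    Icc_subset_Ico r(2))

lemma volterra_deriv:
  assumes r: "continuous_on {a..<b} r" and x: "x \<in> {a..<b}"
  shows "(volterra r has_real_derivative first_order_solution r x) (at x within {a..<b})"
proof -
  obtain y where y: "x < y" "y < b" using x dense by auto
  have "((\<lambda>u. integral {a..u} (first_order_solution r)) has_vector_derivative first_order_solution r x) (at x within {a..y})"
  proof (rule integral_has_vector_derivative_continuous_at[where S="{}", simplified])
    show "first_order_solution r integrable_on {a..y}" using first_order_solution_integrable[OF r y(2)] .
    show "continuous (at x within {a..y}) (first_order_solution r)"
      using continuous_on_subset[OF first_order_solution_continuous[OF r] Icc_subset_Ico[OF y(2)]] x y
      unfolding continuous_on_eq_continuous_within by auto
  qed (use x y in auto)
  moreover have "at x within {a..y} = at x within {a..<b}"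
    by (rule at_within_nhd[of _ "{..<y}"]) (use y in auto)
  ultimately show ?thesis
    unfolding volterra_def[abs_def] by (simp add: has_real_derivative_iff_has_vector_derivative)
qed

lemma volterra_continuous: "continuous_on {a..<b} r \<Longrightarrow> continuous_on {a..<b} (volterra r)"
  using volterra_deriv DERIV_continuous_on by blast

lemma volterra_a: "volterra r a = 0"
  by (simp add: volterra_def)

abbreviation "unit_solution \<equiv> first_order_solution (\<lambda>_. 1)"
abbreviation "unit_volterra \<equiv> volterra (\<lambda>_. 1)"

lemma first_order_solution_mono:
  assumes r: "continuous_on {a..<b} r" and s: "continuous_on {a..<b} s" and x: "x \<in> {a..<b}"
    and rs: "\<And>y. y \<in> {a..x} \<Longrightarrow> r y \<le> s y"
  shows "first_order_solution r x \<le> first_order_solution s x"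
proof (cases "x = a")
  case True
  then show ?thesis using rs[of a] \<beta>_a by (simp add: first_order_solution_def divide_right_mono)
next
  case False
  then have x': "x \<in> {a<..<b}" using x by auto
  have A0: "A y \<ge> 0" if "y \<in> {a..x}" for y
    using A_pos[of y] that x' A_a by (cases "y = a") auto
  have "weight_integral r x \<le> weight_integral s x"
    unfolding weight_integral_def
  proof (rule integral_le)
    show "(\<lambda>x. p x / A x * r x) integrable_on {a..x}" "(\<lambda>x. p x / A x * s x) integrable_on {a..x}"
      using weighted_integrable[OF r x'] weighted_integrable[OF s x'] set_lebesgue_integral_eq_integral(1) by auto
    show "p y / A y * r y \<le> p y / A y * s y" if "y \<in> {a..x}" for y
      using rs[OF that] A0[OF that] p_pos[of y] by (intro mult_left_mono divide_nonneg_nonneg) auto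
  qed
  then show ?thesis using False p_pos[of x] by (simp add: first_order_solution_def divide_right_mono)
qed

lemma first_order_solution_cmult: "first_order_solution (\<lambda>_. c) x = c * unit_solution x"
proof -
  have "integral {a..x} (\<lambda>x. p x / A x * c) = integral {a..x} (\<lambda>x. p x / A x) * c"
    by (rule integral_mult_left)
  then show ?thesis by (simp add: first_order_solution_def weight_integral_def)
qed

lemma first_order_solution_nonneg:
  assumes r: "continuous_on {a..<b} r" and x: "x \<in> {a..<b}" and "\<And>y. y \<in> {a..x} \<Longrightarrow> 0 \<le> r y"
  shows "0 \<le> first_order_solution r x"
  using first_order_solution_mono[of "\<lambda>_. 0" r x] assms first_order_solution_cmult[of 0] by auto

lemma volterra_nonneg:
  assumes r: "continuous_on {a..<b} r" and x: "x \<in> {a..<b}" and "\<And>y. y \<in> {a..x} \<Longrightarrow> 0 \<le> r y"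
  shows "0 \<le> volterra r x"
  unfolding volterra_def
  by (rule integral_nonneg) (use first_order_solution_integrable[OF r] first_order_solution_nonneg[OF r] assms in auto)

lemma unit_volterra_mono:
  assumes "a \<le> x" "x \<le> y" "y < b"
  shows "unit_volterra x \<le> unit_volterra y"
  unfolding volterra_def
proof (rule integral_subset_le)
  show "unit_solution integrable_on {a..x}" "unit_solution integrable_on {a..y}"
    using assms by (auto intro: first_order_solution_integrable)
  show "\<forall>z\<in>{a..y}. 0 \<le> unit_solution z"
    using assms by (intro ballI first_order_solution_nonneg) auto
qed (use assms in auto)

text \<open>
  With \<open>k = volterra 1\<close> and \<open>k' = first_order_solution 1\<close>, monotonicity gives
  \<open>first_order_solution r \<le> k' k ^ n / n!\<close> whenever \<open>0 \<le> r \<le> k ^ n / n!\<close>, and integration gives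
  \<open>k ^ (n + 1) / (n + 1)!\<close>. This is the usual factorial gain of Volterra operators.
\<close>

lemma iterate_bounds:
  assumes r: "continuous_on {a..<b} r" and rb: "\<And>y. y \<in> {a..<b} \<Longrightarrow> 0 \<le> r y \<and> r y \<le> unit_volterra y ^ n / fact n"
    and x: "x \<in> {a..<b}"
  shows "first_order_solution r x \<le> unit_solution x * (unit_volterra x ^ n / fact n)"
    and "volterra r x \<le> unit_volterra x ^ Suc n / fact (Suc n)"
proof -
  have K0: "0 \<le> unit_volterra y" if "y \<in> {a..<b}" for y
    using volterra_nonneg[of "\<lambda>_. 1" y] that by simp
  have *: "first_order_solution r x \<le> unit_solution x * (unit_volterra x ^ n / fact n)" if "x \<in> {a..<b}" for x
  proof -
    have "first_order_solution r x \<le> first_order_solution (\<lambda>_. unit_volterra x ^ n / fact n) x"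
    proof (rule first_order_solution_mono[OF r _ that])
      fix y assume y: "y \<in> {a..x}"
      have "unit_volterra y ^ n \<le> unit_volterra x ^ n"
        using y that K0 by (intro power_mono unit_volterra_mono) auto
      then show "r y \<le> unit_volterra x ^ n / fact n"
        using rb[of y] y that divide_right_mono[of "unit_volterra y ^ n" "unit_volterra x ^ n" "fact n"]
        by (meson atLeastAtMost_iff atLeastLessThan_iff fact_ge_zero order_trans order_le_less_trans)
    qed (rule continuous_on_const)
    then show ?thesis unfolding first_order_solution_cmult[of "_ / _"] by (simp only: mult.commute)
  qed
  show "first_order_solution r x \<le> unit_solution x * (unit_volterra x ^ n / fact n)" by (rule *[OF x])
  have hi: "((\<lambda>x. unit_solution x * (unit_volterra x ^ n / fact n)) has_integral
      (unit_volterra x ^ Suc n / fact (Suc n) - unit_volterra a ^ Suc n / fact (Suc n))) {a..x}"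
  proof (rule fundamental_theorem_of_calculus)
    fix y assume y: "y \<in> {a..x}"
    have "((\<lambda>x. unit_volterra x ^ Suc n / fact (Suc n)) has_real_derivative unit_solution y * (unit_volterra y ^ n / fact n)) (at y within {a..<b})"
      by (rule powers_over_fact_derivative[OF volterra_deriv]) (use x y in auto)
    then show "((\<lambda>x. unit_volterra x ^ Suc n / fact (Suc n)) has_vector_derivative unit_solution y * (unit_volterra y ^ n / fact n)) (at y within {a..x})"
      unfolding has_real_derivative_iff_has_vector_derivative[symmetric]
      by (rule has_field_derivative_subset) (use x in auto)
  qed (use x in auto)
  show "volterra r x \<le> unit_volterra x ^ Suc n / fact (Suc n)"
    using has_integral_le[OF integrable_integral[OF first_order_solution_integrable[OF r, of x]] hi] * x
    by (auto simp: volterra_def)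
qed

end

context singular_endpoint_factor begin

definition iterate :: "nat \<Rightarrow> real \<Rightarrow> real" where
  "iterate n = (volterra ^^ n) (\<lambda>_. 1)"

lemma iterate_Suc: "iterate (Suc n) = volterra (iterate n)" and iterate_0: "iterate 0 = (\<lambda>_. 1)"
  by (simp_all add: iterate_def)

lemma iterate_continuous: "continuous_on {a..<b} (iterate n)"
  by (induction n) (auto simp: iterate_0 iterate_Suc volterra_continuous)

lemma iterate_le: "y \<in> {a..<b} \<Longrightarrow> 0 \<le> iterate n y \<and> iterate n y \<le> unit_volterra y ^ n / fact n"
proof (induction n arbitrary: y)
  case 0
  then show ?case by (simp add: iterate_0)
next
  case (Suc n)
  have "0 \<le> volterra (iterate n) y"
    by (rule volterra_nonneg[OF iterate_continuous]) (use Suc in auto)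
  then show ?case
    using iterate_bounds(2)[OF iterate_continuous[of n] Suc.IH Suc.prems] by (auto simp: iterate_Suc)
qed

lemma unit_volterra_nonneg: "y \<in> {a..<b} \<Longrightarrow> 0 \<le> unit_volterra y"
  using volterra_nonneg[of "\<lambda>_. 1" y] by simp

lemma unit_solution_nonneg: "y \<in> {a..<b} \<Longrightarrow> 0 \<le> unit_solution y"
  using first_order_solution_nonneg[of "\<lambda>_. 1" y] by simp

text \<open>
  The terms of the exponential series of \<open>\<bar>l\<bar> k(c)\<close>, which dominate the Neumann series on \<open>{a..c}\<close>.
\<close>

definition majorant :: "real \<Rightarrow> real \<Rightarrow> nat \<Rightarrow> real" where
  "majorant l c n = (\<bar>l\<bar> * unit_volterra c) ^ n / fact n"

lemma majorant_summable: "summable (majorant l c)"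
  using summable_exp[of "\<bar>l\<bar> * unit_volterra c"] by (simp add: majorant_def[abs_def] field_simps)

lemma power_unit_volterra_mono:
  assumes "x \<in> {a..c}" "c < b"
  shows "unit_volterra x ^ n / fact n \<le> unit_volterra c ^ n / fact n"
  using assms by (intro divide_right_mono power_mono unit_volterra_mono unit_volterra_nonneg) auto

lemma iterate_majorant:
  assumes "x \<in> {a..c}" "c < b"
  shows "\<bar>(- l) ^ n * iterate n x\<bar> \<le> majorant l c n"
proof -
  have "\<bar>iterate n x\<bar> \<le> unit_volterra c ^ n / fact n"
    using iterate_le[of x n] power_unit_volterra_mono[OF assms, of n] assms by auto
  then show ?thesis
    by (simp add: abs_mult power_abs majorant_def power_mult_distrib mult_left_mono flip: times_divide_eq_right)
qed

lemma derivative_majorant: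
  assumes "x \<in> {a..c}" "c < b" and C: "unit_solution x \<le> C"
  shows "\<bar>(- l) ^ n * first_order_solution (iterate n) x\<bar> \<le> C * majorant l c n"
proof -
  have x: "x \<in> {a..<b}" using assms by auto
  have "first_order_solution (iterate n) x \<le> unit_solution x * (unit_volterra x ^ n / fact n)"
    by (rule iterate_bounds(1)[OF iterate_continuous iterate_le x])
  also have "\<dots> \<le> C * (unit_volterra c ^ n / fact n)"
    using power_unit_volterra_mono[OF assms(1,2), of n] C unit_solution_nonneg[OF x] unit_volterra_nonneg[OF x]
    by (intro mult_mono) (auto intro!: divide_nonneg_nonneg)
  finally have "\<bar>first_order_solution (iterate n) x\<bar> \<le> C * (unit_volterra c ^ n / fact n)"
    using first_order_solution_nonneg[OF iterate_continuous x, of n] iterate_le assms by auto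
  then have "\<bar>l\<bar> ^ n * \<bar>first_order_solution (iterate n) x\<bar> \<le> \<bar>l\<bar> ^ n * (C * (unit_volterra c ^ n / fact n))"
    by (intro mult_left_mono) auto
  then show ?thesis
    by (simp add: abs_mult power_abs majorant_def power_mult_distrib mult_ac)
qed

lemma unit_solution_bound:
  assumes "c < b"
  obtains C where "C \<ge> 0" "\<And>x. x \<in> {a..c} \<Longrightarrow> unit_solution x \<le> C"
proof -
  have "compact (unit_solution ` {a..c})"
    by (intro compact_continuous_image continuous_on_subset[OF first_order_solution_continuous Icc_subset_Ico] assms)
      auto
  then obtain C where "\<And>y. y \<in> unit_solution ` {a..c} \<Longrightarrow> \<bar>y\<bar> \<le> C"
    by (metis bounded_iff compact_imp_bounded real_norm_def)
  then show thesis using that[of "max C 0"] by fastforce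
qed

definition series_solution :: "real \<Rightarrow> real \<Rightarrow> real" where
  "series_solution l x = (\<Sum>n. (- l) ^ n * iterate n x)"

text \<open>
  The derivative of \<open>series_solution l\<close> is \<open>- l\<close> times this series.
\<close>

definition series_derivative :: "real \<Rightarrow> real \<Rightarrow> real" where
  "series_derivative l x = (\<Sum>n. (- l) ^ n * first_order_solution (iterate n) x)"

lemma series_solution_uniform:
  assumes "c < b"
  shows "uniform_limit {a..c} (\<lambda>n x. \<Sum>i<n. (- l) ^ i * iterate i x) (series_solution l) sequentially"
  unfolding series_solution_def[abs_def]
  by (rule Weierstrass_m_test[OF _ majorant_summable]) (use iterate_majorant[OF _ assms] in auto)

lemma series_derivative_uniform:
  assumes "c < b"
  shows "uniform_limit {a..c} (\<lambda>n x. \<Sum>i<n. (- l) ^ i * first_order_solution (iterate i) x) (series_derivative l) sequentially"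
proof -
  obtain C where "\<And>x. x \<in> {a..c} \<Longrightarrow> unit_solution x \<le> C" using unit_solution_bound[OF assms] by blast
  then show ?thesis
    unfolding series_derivative_def[abs_def]
    by (intro Weierstrass_m_test[OF _ summable_mult[OF majorant_summable[of l c], of C]]) (use derivative_majorant[OF _ assms] in auto)
qed

text \<open>
  Locally uniform convergence suffices: the constants in the bounds may blow up at \<open>b\<close>.
\<close>

lemma uniform_limit_continuous_Ico:
  fixes f :: "nat \<Rightarrow> real \<Rightarrow> real"
  assumes "\<And>c. c < b \<Longrightarrow> uniform_limit {a..c} f g sequentially" "\<And>n. continuous_on {a..<b} (f n)"
  shows "continuous_on {a..<b} g"
proof -
  have "continuous (at x within {a..<b}) g" if x: "x \<in> {a..<b}" for x
  proof -
    obtain c where c: "x < c" "c < b" using x dense by auto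
    have "continuous_on {a..c} g"
      by (rule uniform_limit_theorem[OF _ assms(1)[OF c(2)]])
        (use continuous_on_subset[OF assms(2) Icc_subset_Ico[OF c(2)]] in auto)
    moreover have "at x within {a..c} = at x within {a..<b}"
      by (rule at_within_nhd[of _ "{..<c}"]) (use c in auto)
    ultimately show ?thesis using x c
      by (metis atLeastAtMost_iff atLeastLessThan_iff continuous_on_eq_continuous_within less_imp_le)
  qed
  then show ?thesis by (simp add: continuous_on_eq_continuous_within)
qed

lemma series_solution_continuous: "continuous_on {a..<b} (series_solution l)"
  by (rule uniform_limit_continuous_Ico[OF series_solution_uniform]) (auto intro!: continuous_intros iterate_continuous)

lemma series_derivative_continuous: "continuous_on {a..<b} (series_derivative l)"
  by (rule uniform_limit_continuous_Ico[OF series_derivative_uniform])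
    (auto intro!: continuous_intros first_order_solution_continuous iterate_continuous)

lemma iterate_sums:
  assumes "x \<in> {a..<b}"
  shows "(\<lambda>n. (- l) ^ n * iterate n x) sums series_solution l x"
  unfolding series_solution_def
  by (rule summable_sums, rule summable_comparison_test'[OF majorant_summable[of l x], of 0])
    (use iterate_majorant[of x x] assms in auto)

lemma derivative_sums:
  assumes "x \<in> {a..<b}"
  shows "(\<lambda>n. (- l) ^ n * first_order_solution (iterate n) x) sums series_derivative l x"
  unfolding series_derivative_def
  by (rule summable_sums, rule summable_comparison_test'[OF summable_mult[OF majorant_summable[of l x], of "unit_solution x"], of 0])
    (use derivative_majorant[of x x] assms in auto)

lemma series_solution_deriv:
  assumes x: "x \<in> {a<..<b}"
  shows "(series_solution l has_real_derivative - l * series_derivative l x) (at x)"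
proof -
  obtain c where c: "x < c" "c < b" using x dense by auto
  obtain C where C: "\<And>x. x \<in> {a..c} \<Longrightarrow> unit_solution x \<le> C" using unit_solution_bound[OF c(2)] by blast
  define f' where "f' n y = (case n of 0 \<Rightarrow> 0 | Suc m \<Rightarrow> - l * ((- l) ^ m * first_order_solution (iterate m) y))" for n y
  define M where "M n = (case n of 0 \<Rightarrow> 0 | Suc m \<Rightarrow> \<bar>l\<bar> * (C * majorant l c m))" for n
  have "summable (\<lambda>n. M (Suc n))" unfolding M_def by (simp add: majorant_summable summable_mult)
  then have "summable M" by (simp add: summable_Suc_iff)
  have "\<bar>f' n y\<bar> \<le> M n" if "y \<in> {a..c}" for n y
  proof (cases n)
    case (Suc m)
    then show ?thesis
      unfolding f'_def M_def using derivative_majorant[OF that c(2) C[OF that], of l m]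
      by (simp add: abs_mult mult_left_mono)
  qed (auto simp: f'_def M_def)
  then have "uniform_limit {a..c} (\<lambda>n y. \<Sum>i<n. f' i y) (\<lambda>y. \<Sum>i. f' i y) sequentially"
    by (intro Weierstrass_m_test[OF _ \<open>summable M\<close>]) auto
  then have uc: "uniformly_convergent_on {a..c} (\<lambda>n y. \<Sum>i<n. f' i y)"
    by (rule uniformly_convergentI)
  have der: "((\<lambda>y. (- l) ^ n * iterate n y) has_field_derivative f' n y) (at y within {a..c})" if y: "y \<in> {a..c}" for n y
  proof (cases n)
    case 0
    then show ?thesis by (simp add: iterate_0 f'_def)
  next
    case (Suc m)
    have yb: "y \<in> {a..<b}" using y c by auto
    have "(volterra (iterate m) has_real_derivative first_order_solution (iterate m) y) (at y within {a..c})"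
      by (rule has_field_derivative_subset[OF volterra_deriv[OF iterate_continuous yb] Icc_subset_Ico[OF c(2)]])
    from DERIV_cmult[OF this, of "(- l) ^ n"] show ?thesis
      by (simp add: Suc iterate_Suc f'_def mult.assoc)
  qed
  have "((\<lambda>y. \<Sum>n. (- l) ^ n * iterate n y) has_field_derivative (\<Sum>n. f' n x)) (at x)"
    by (rule has_field_derivative_series'(2)[OF convex_real_interval(5) der uc, of x])
      (use iterate_sums[of x l] x c in \<open>auto simp: sums_iff\<close>)
  moreover have "(\<lambda>m. f' (Suc m) x) sums (- l * series_derivative l x)"
    unfolding f'_def using sums_mult[OF derivative_sums[of x l], of "- l"] x by simp
  then have "(\<Sum>n. f' n x) = - l * series_derivative l x"
    using sums_Suc[of "\<lambda>n. f' n x" "- l * series_derivative l x"] by (simp add: f'_def[of 0] sums_iff)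
  ultimately show ?thesis by (simp add: series_solution_def[abs_def])
qed

lemma series_derivative_deriv:
  assumes x: "x \<in> {a<..<b}"
  shows "(series_derivative l has_real_derivative (series_solution l x - \<beta> x * series_derivative l x) / A x) (at x)"
proof -
  obtain c where c: "x < c" "c < b" using x dense by auto
  obtain d where d: "a < d" "d < x" using x dense by auto
  obtain C where C0: "C \<ge> 0" and C: "\<And>x. x \<in> {a..c} \<Longrightarrow> unit_solution x \<le> C" using unit_solution_bound[OF c(2)] by blast
  have sub: "{d..c} \<subseteq> {a<..<b}" using c d by auto
  have cont: "continuous_on {d..c} (\<lambda>y. 1 / A y)" "continuous_on {d..c} \<beta>"
    using sub A_isCont \<beta>_isCont A_pos
    by (intro continuous_at_imp_continuous_on ballI continuous_intros; force)+
  obtain D where D: "\<And>y. y \<in> {d..c} \<Longrightarrow> \<bar>1 / A y\<bar> \<le> D"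
    using compact_imp_bounded[OF compact_continuous_image[OF cont(1) compact_Icc]] unfolding bounded_iff real_norm_def by blast
  obtain E where E: "\<And>y. y \<in> {d..c} \<Longrightarrow> \<bar>\<beta> y\<bar> \<le> E"
    using compact_imp_bounded[OF compact_continuous_image[OF cont(2) compact_Icc]] unfolding bounded_iff real_norm_def by blast
  have D0: "D \<ge> 0" and E0: "E \<ge> 0"
    using order_trans[OF abs_ge_zero D[of x]] order_trans[OF abs_ge_zero E[of x]] c d by auto
  define f' where "f' n y = ((- l) ^ n * iterate n y - \<beta> y * ((- l) ^ n * first_order_solution (iterate n) y)) / A y" for n y
  have "\<bar>f' n y\<bar> \<le> (D * (1 + E * C)) * majorant l c n" if y: "y \<in> {d..c}" for n y
  proof -
    have y': "y \<in> {a..c}" using y d by auto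
    have 1: "\<bar>(- l) ^ n * iterate n y\<bar> \<le> majorant l c n" by (rule iterate_majorant[OF y' c(2)])
    have "\<bar>\<beta> y * ((- l) ^ n * first_order_solution (iterate n) y)\<bar> \<le> E * (C * majorant l c n)"
      unfolding abs_mult[of "\<beta> y"] by (intro mult_mono E derivative_majorant C y y' c E0 abs_ge_zero)
    with 1 have "\<bar>(- l) ^ n * iterate n y - \<beta> y * ((- l) ^ n * first_order_solution (iterate n) y)\<bar> \<le> majorant l c n + E * (C * majorant l c n)"
      by linarith
    then have "\<bar>1 / A y\<bar> * \<bar>(- l) ^ n * iterate n y - \<beta> y * ((- l) ^ n * first_order_solution (iterate n) y)\<bar>
      \<le> D * (majorant l c n + E * (C * majorant l c n))"
      by (intro mult_mono D y D0) auto
    then show ?thesis by (simp add: f'_def abs_mult algebra_simps)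
  qed
  then have "uniform_limit {d..c} (\<lambda>n y. \<Sum>i<n. f' i y) (\<lambda>y. \<Sum>i. f' i y) sequentially"
    by (intro Weierstrass_m_test[OF _ summable_mult[OF majorant_summable]]) auto
  then have uc: "uniformly_convergent_on {d..c} (\<lambda>n y. \<Sum>i<n. f' i y)"
    by (rule uniformly_convergentI)
  have der: "((\<lambda>y. (- l) ^ n * first_order_solution (iterate n) y) has_field_derivative f' n y) (at y within {d..c})" if y: "y \<in> {d..c}" for n y
  proof -
    have y': "y \<in> {a<..<b}" using y sub by auto
    have "((\<lambda>y. (- l) ^ n * first_order_solution (iterate n) y) has_field_derivative f' n y) (at y)"
      by (rule DERIV_cong[OF DERIV_cmult[OF first_order_solution_deriv[OF iterate_continuous y']]])
        (simp add: f'_def algebra_simps)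
    then show ?thesis by (rule has_field_derivative_at_within)
  qed
  have "((\<lambda>y. \<Sum>n. (- l) ^ n * first_order_solution (iterate n) y) has_field_derivative (\<Sum>n. f' n x)) (at x)"
    by (rule has_field_derivative_series'(2)[OF convex_real_interval(5) der uc, of x])
      (use derivative_sums[of x l] x c d in \<open>auto simp: sums_iff\<close>)
  moreover have "(\<lambda>n. f' n x) sums ((series_solution l x - \<beta> x * series_derivative l x) / A x)"
    unfolding f'_def
    by (intro sums_divide sums_diff sums_mult iterate_sums derivative_sums) (use x in auto)
  then have "(\<Sum>n. f' n x) = (series_solution l x - \<beta> x * series_derivative l x) / A x"
    by (simp add: sums_iff)
  ultimately show ?thesis by (simp add: series_derivative_def[abs_def])
qed

text \<open>
  The derivative of the solution satisfies a first-order equation whose right-hand side is a multiple of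
  the solution itself, so \<open>singular_ode_regular\<close> gains one derivative in each step.
\<close>

lemma series_solution_smooth: "Ck_real n (series_solution l) {a..<b}"
proof (induction n)
  case 0
  then show ?case using series_solution_continuous by simp
next
  case (Suc n)
  define w where "w x = (if x = a then - l * series_solution l a / \<beta> a else - l * series_derivative l x)" for x
  have w: "(w has_real_derivative (- l * series_solution l x - \<beta> x * w x) / A x) (at x)" if x: "x \<in> {a<..<b}" for x
  proof -
    have "((\<lambda>x. - l * series_derivative l x) has_real_derivative (- l * series_solution l x - \<beta> x * w x) / A x) (at x)"
      by (rule DERIV_cong[OF DERIV_cmult[OF series_derivative_deriv[OF x]]]) (use x A_pos[OF x] in \<open>simp add: w_def field_simps\<close>)
    then show ?thesis
      by (rule has_field_derivative_transform_within_open[of _ _ _ "{a<..<b}"]) (use x in \<open>auto simp: w_def\<close>)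
  qed
  have wn: "Ck_real n w {a..<b}"
  proof (rule singular_ode_regular[OF ab A_pos A_smooth A_a A_deriv A'_smooth A'_a p_deriv p_lim p_pos \<beta>_smooth \<beta>_a _ w])
    show "Ck_real n (\<lambda>x. - l * series_solution l x) {a..<b}" by (rule Ck_real_cmult[OF Suc])
    have "((\<lambda>x. p x * (- l * series_derivative l x)) \<longlongrightarrow> 0 * (- l * series_derivative l a)) (at_right a)"
      by (intro tendsto_intros p_lim continuous_on_Ico_tendsto[OF series_derivative_continuous ab])
    then show "((\<lambda>x. p x * w x) \<longlongrightarrow> 0) (at_right a)"
      unfolding mult_zero_left
      by (rule Lim_transform_eventually[OF _ eventually_mono[OF eventually_at_right_interval[OF ab]]])
        (auto simp: w_def)
  qed (auto simp: w_def)
  have der: "(series_solution l has_real_derivative w x) (at x)" if "x \<in> {a<..<b}" for x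
    using series_solution_deriv[OF that, of l] that by (simp add: w_def)
  have "(series_solution l has_real_derivative w a) (at a within {a..<b})"
    by (rule derivative_limit_at_left_endpoint[OF ab continuous_on_Ico_tendsto[OF series_solution_continuous ab]
          continuous_on_Ico_tendsto[OF Ck_real_continuous[OF wn] ab] der])
  then have "(series_solution l has_real_derivative w x) (at x within {a..<b})" if "x \<in> {a..<b}" for x
    using that der[of x] by (cases "x = a") (auto intro: has_field_derivative_at_within)
  then show ?case unfolding Ck_real.simps by (intro exI[of _ w] conjI ballI wn)
qed

lemma series_solution_a: "series_solution l a = 1"
proof -
  have "iterate n a = (if n = 0 then 1 else 0)" for n
    by (cases n) (auto simp: iterate_0 iterate_Suc volterra_a)
  then show ?thesis unfolding series_solution_def
    using suminf_finite[of "{0}" "\<lambda>n. (- l) ^ n * iterate n a"] by auto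
qed

end

lemma (in singular_endpoint) regular_solution:
  obtains u w where "u a = 1" "\<And>k. Ck_real k u {a..<b}"
    "\<And>x. x \<in> {a<..<b} \<Longrightarrow> (u has_real_derivative w x) (at x)"
    "\<And>x. x \<in> {a<..<b} \<Longrightarrow> (w has_real_derivative (- l * u x - \<beta> x * w x) / A x) (at x)"
proof -
  obtain p where "\<And>x. p x > 0" "\<And>x. x \<in> {a<..<b} \<Longrightarrow> (p has_real_derivative p x * \<beta> x / A x) (at x)"
    "(p \<longlongrightarrow> 0) (at_right a)" using integrating_factor by blast
  then interpret singular_endpoint_factor a b A A' \<beta> p
    by unfold_locales auto
  have "((\<lambda>x. - l * series_derivative l x) has_real_derivative (- l * series_solution l x - \<beta> x * (- l * series_derivative l x)) / A x) (at x)"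
    if x: "x \<in> {a<..<b}" for x
    by (rule DERIV_cong[OF DERIV_cmult[OF series_derivative_deriv[OF x]]]) (use A_pos[OF x] in \<open>simp add: field_simps\<close>)
  then show thesis
    using that[of "series_solution l" "\<lambda>x. - l * series_derivative l x"] series_solution_a series_solution_smooth series_solution_deriv
    by blast
qed

section \<open>Uniqueness and gluing of solutions\<close>

text \<open>
  The energy \<open>z\<^sup>2 + y\<^sup>2\<close> satisfies \<open>\<bar>E'\<bar> \<le> K E\<close> on compact intervals, so it vanishes everywhere once it
  vanishes at one point.
\<close>

lemma linear_ode_zero:
  fixes z y P Q :: "real \<Rightarrow> real"
  assumes z: "\<And>x. x \<in> {a<..<b} \<Longrightarrow> (z has_real_derivative y x) (at x)"
    and y: "\<And>x. x \<in> {a<..<b} \<Longrightarrow> (y has_real_derivative P x * z x + Q x * y x) (at x)"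
    and cont: "\<And>x. x \<in> {a<..<b} \<Longrightarrow> isCont P x" "\<And>x. x \<in> {a<..<b} \<Longrightarrow> isCont Q x"
    and s0: "s0 \<in> {a<..<b}" "z s0 = 0" "y s0 = 0" and x: "x \<in> {a<..<b}"
  shows "z x = 0"
proof -
  define c d where "c = min x s0" and "d = max x s0"
  have sub: "{c..d} \<subseteq> {a<..<b}" using x s0 by (auto simp: c_def d_def)
  have cPQ: "continuous_on {c..d} P" "continuous_on {c..d} Q"
    using sub cont by (auto intro!: continuous_at_imp_continuous_on)
  obtain M where M: "\<And>t. t \<in> {c..d} \<Longrightarrow> \<bar>P t\<bar> \<le> M"
    using compact_imp_bounded[OF compact_continuous_image[OF cPQ(1) compact_Icc]] unfolding bounded_iff real_norm_def by blast
  obtain N where N: "\<And>t. t \<in> {c..d} \<Longrightarrow> \<bar>Q t\<bar> \<le> N"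
    using compact_imp_bounded[OF compact_continuous_image[OF cPQ(2) compact_Icc]] unfolding bounded_iff real_norm_def by blast
  define K where "K = 1 + M + 2 * N"
  define E where "E t = z t ^ 2 + y t ^ 2" for t
  define E' where "E' t = 2 * z t * y t + 2 * y t * (P t * z t + Q t * y t)" for t
  have E: "(E has_real_derivative E' t) (at t)" if "t \<in> {c..d}" for t
    unfolding E_def E'_def using z[of t] y[of t] that sub
    by (auto intro!: derivative_eq_intros simp: power2_eq_square)
  have bnd: "\<bar>E' t\<bar> \<le> K * E t" if "t \<in> {c..d}" for t
  proof -
    have 1: "\<bar>2 * z t * y t\<bar> \<le> E t"
      using sum_squares_bound[of "\<bar>z t\<bar>" "\<bar>y t\<bar>"] by (simp add: E_def abs_mult)
    have "\<bar>2 * y t * (P t * z t)\<bar> = \<bar>P t\<bar> * \<bar>2 * z t * y t\<bar>" by (simp add: abs_mult)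
    also have "\<dots> \<le> M * E t" using M[OF that] 1 by (intro mult_mono) auto
    finally have 2: "\<bar>2 * y t * (P t * z t)\<bar> \<le> M * E t" .
    have "\<bar>2 * y t * (Q t * y t)\<bar> = \<bar>Q t\<bar> * (2 * y t ^ 2)" by (simp add: abs_mult power2_eq_square)
    also have "\<dots> \<le> N * (2 * E t)" using N[OF that] by (intro mult_mono) (auto simp: E_def)
    finally have 3: "\<bar>2 * y t * (Q t * y t)\<bar> \<le> 2 * N * E t" by simp
    have "E' t = 2 * z t * y t + 2 * y t * (P t * z t) + 2 * y t * (Q t * y t)" by (simp add: E'_def algebra_simps)
    moreover have "K * E t = E t + M * E t + 2 * N * E t" by (simp add: K_def algebra_simps)
    ultimately show ?thesis using 1 2 3 by linarith
  qed
  have "E x \<le> 0"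
  proof (cases "s0 \<le> x")
    case True
    have "E x * exp (- K * x) \<le> E s0 * exp (- K * s0)"
    proof (rule DERIV_nonpos_imp_nonincreasing[where f="\<lambda>t. E t * exp (- K * t)", OF True])
      fix t assume "s0 \<le> t" "t \<le> x"
      then have t: "t \<in> {c..d}" by (auto simp: c_def d_def)
      have "((\<lambda>t. E t * exp (- K * t)) has_real_derivative (E' t - K * E t) * exp (- K * t)) (at t)"
        by (auto intro!: derivative_eq_intros E t simp: algebra_simps)
      moreover have "(E' t - K * E t) * exp (- K * t) \<le> 0"
        using bnd[OF t] by (intro mult_nonpos_nonneg) auto
      ultimately show "\<exists>y. ((\<lambda>t. E t * exp (- K * t)) has_real_derivative y) (at t) \<and> y \<le> 0" by blast
    qed
    then show ?thesis using s0 by (simp add: E_def mult_le_0_iff)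
  next
    case False
    then have "x \<le> s0" by simp
    have "E x * exp (K * x) \<le> E s0 * exp (K * s0)"
    proof (rule DERIV_nonneg_imp_nondecreasing[where f="\<lambda>t. E t * exp (K * t)", OF \<open>x \<le> s0\<close>])
      fix t assume "x \<le> t" "t \<le> s0"
      then have t: "t \<in> {c..d}" by (auto simp: c_def d_def)
      have "((\<lambda>t. E t * exp (K * t)) has_real_derivative (E' t + K * E t) * exp (K * t)) (at t)"
        by (auto intro!: derivative_eq_intros E t simp: algebra_simps)
      moreover have "0 \<le> (E' t + K * E t) * exp (K * t)"
        using bnd[OF t] by (intro mult_nonneg_nonneg) auto
      ultimately show "\<exists>y. ((\<lambda>t. E t * exp (K * t)) has_real_derivative y) (at t) \<and> 0 \<le> y" by blast
    qed
    then show ?thesis using s0 by (simp add: E_def mult_le_0_iff)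
  qed
  then show ?thesis by (simp add: E_def sum_power2_le_zero_iff)
qed

lemma Ck_real_subset: "Ck_real k f S \<Longrightarrow> T \<subseteq> S \<Longrightarrow> Ck_real k f T"
proof (induction k arbitrary: f)
  case 0
  then show ?case using continuous_on_subset by auto
next
  case (Suc k)
  then obtain f' where "\<forall>x\<in>S. (f has_real_derivative f' x) (at x within S)" "Ck_real k f' S" by auto
  with Suc show ?case unfolding Ck_real.simps
    by (intro exI[of _ f']) (auto intro: has_field_derivative_subset)
qed

lemma has_real_derivative_reflect:
  assumes "(f has_real_derivative D) (at (- x) within S)" "uminus ` T = (S::real set)"
  shows "((\<lambda>x. f (- x)) has_real_derivative - D) (at x within T)"
proof -
  have "(f has_real_derivative D) (at (- x) within uminus ` T)" using assms by simp
  moreover have "(uminus has_real_derivative - 1) (at x within T)" by (auto intro!: derivative_eq_intros)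
  ultimately have "((f \<circ> uminus) has_real_derivative D * - 1) (at x within T)" by (rule DERIV_image_chain)
  then show ?thesis by (simp add: o_def)
qed

lemma Ck_real_reflect:
  assumes "Ck_real k f S" "uminus ` T = (S::real set)"
  shows "Ck_real k (\<lambda>x. f (- x)) T"
  using assms(1)
proof (induction k arbitrary: f)
  case 0
  then show ?case using assms(2) by (auto intro!: continuous_on_compose2[of S f] continuous_intros)
next
  case (Suc k)
  then obtain f' where f': "\<forall>x\<in>S. (f has_real_derivative f' x) (at x within S)" "Ck_real k f' S" by auto
  have "((\<lambda>x. f (- x)) has_real_derivative - f' (- x)) (at x within T)" if "x \<in> T" for x
    using f'(1) that assms(2) by (intro has_real_derivative_reflect[of f _ _ S]) auto
  moreover have "Ck_real k (\<lambda>x. - f' (- x)) T" using Ck_real_cmult[OF Suc.IH[OF f'(2)], of "-1"] by simp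
  ultimately show ?case unfolding Ck_real.simps by (intro exI[of _ "\<lambda>x. - f' (- x)"] conjI ballI)
qed

lemma has_real_derivative_within_unique_interval:
  fixes f :: "real \<Rightarrow> real"
  assumes "(f has_real_derivative D) (at x)" "(f has_real_derivative E) (at x within S)" "{a<..<b} \<subseteq> S" "x \<in> {a<..<b}"
  shows "D = E"
proof -
  have "(f has_real_derivative E) (at x within {a<..<b})" by (rule has_field_derivative_subset[OF assms(2,3)])
  then have "(f has_real_derivative E) (at x)"
    unfolding at_within_open[OF assms(4) open_greaterThanLessThan] .
  then show ?thesis using assms(1) DERIV_unique by blast
qed

text \<open>
  Being of class $C^k$ within an interval is a local condition, and every point of \<open>{a..b}\<close> has a
  neighbourhood in \<open>{a..<b}\<close> or in \<open>{a<..b}\<close>.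
\<close>

lemma Ck_real_glue:
  assumes "Ck_real k f {a..<b}" "Ck_real k f {a<..b}" "a < (b::real)"
  shows "Ck_real k f {a..b}"
  using assms(1,2)
proof (induction k arbitrary: f)
  have w1: "at x within {a..b} = at x within {a..<b}" if "x \<in> {a..<b}" for x
    by (rule at_within_nhd[of _ "{..<b}"]) (use that in auto)
  have w2: "at x within {a..b} = at x within {a<..b}" if "x \<in> {a<..b}" for x
    by (rule at_within_nhd[of _ "{a<..}"]) (use that in auto)
  {
    case 0
    have "continuous (at x within {a..b}) f" if "x \<in> {a..b}" for x
    proof (cases "x = b")
      case True
      then show ?thesis using 0(2) w2[of x] assms(3) that
        by (simp add: continuous_on_eq_continuous_within)
    next
      case False
      then show ?thesis using 0(1) w1[of x] that
        by (simp add: continuous_on_eq_continuous_within)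
    qed
    then show ?case by (simp add: continuous_on_eq_continuous_within)
  next
    case (Suc k)
    obtain f1 where f1: "\<forall>x\<in>{a..<b}. (f has_real_derivative f1 x) (at x within {a..<b})" "Ck_real k f1 {a..<b}"
      using Suc.prems(1) by auto
    obtain f2 where f2: "\<forall>x\<in>{a<..b}. (f has_real_derivative f2 x) (at x within {a<..b})" "Ck_real k f2 {a<..b}"
      using Suc.prems(2) by auto
    have eq: "f1 x = f2 x" if "x \<in> {a<..<b}" for x
    proof (rule has_real_derivative_within_unique_interval)
      show "(f has_real_derivative f1 x) (at x)"
        using f1(1) that at_within_Ico_interior[of a x b] by (metis atLeastLessThan_iff greaterThanLessThan_iff less_imp_le)
      show "(f has_real_derivative f2 x) (at x within {a<..b})" using f2(1) that by auto
    qed (use that in auto)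
    define f' where "f' x = (if x = b then f2 x else f1 x)" for x
    have 1: "Ck_real k f' {a..<b}" by (rule Ck_real_cong[OF f1(2)]) (auto simp: f'_def)
    have 2: "Ck_real k f' {a<..b}" by (rule Ck_real_cong[OF f2(2)]) (use eq in \<open>auto simp: f'_def\<close>)
    have "(f has_real_derivative f' x) (at x within {a..b})" if "x \<in> {a..b}" for x
    proof (cases "x = b")
      case True
      then show ?thesis using bspec[OF f2(1), of x] w2[of x] assms(3) that by (simp add: f'_def)
    next
      case False
      then show ?thesis using bspec[OF f1(1), of x] w1[of x] that by (simp add: f'_def)
    qed
    with Suc.IH[OF 1 2] show ?case unfolding Ck_real.simps by (intro exI[of _ f'] conjI ballI)
  }
qed

lemma has_real_derivative_glue:
  fixes f p q :: "real \<Rightarrow> real"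
  assumes "closed S" "closed T"
    and S: "x \<in> S \<Longrightarrow> (p has_real_derivative D) (at x within S)" "\<And>y. y \<in> S \<Longrightarrow> f y = p y"
    and T: "x \<in> T \<Longrightarrow> (q has_real_derivative D) (at x within T)" "\<And>y. y \<in> T \<Longrightarrow> f y = q y"
  shows "(f has_real_derivative D) (at x within S \<union> T)"
proof -
  have bot: "at x within U = bot" if "closed U" "x \<notin> U" for U
    using that closed_limpt[of U] by (auto simp: trivial_limit_within)
  have "(f has_real_derivative D) (at x within S)"
  proof (cases "x \<in> S")
    case True
    show ?thesis
      by (rule has_field_derivative_transform_within[OF S(1)[OF True], of 1]) (use True S(2) in auto)
  next
    case False
    then show ?thesis using bot[OF assms(1)] by (simp add: has_field_derivative_iff)
  qed
  moreover have "(f has_real_derivative D) (at x within T)"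
  proof (cases "x \<in> T")
    case True
    show ?thesis
      by (rule has_field_derivative_transform_within[OF T(1)[OF True], of 1]) (use True T(2) in auto)
  next
    case False
    then show ?thesis using bot[OF assms(2)] by (simp add: has_field_derivative_iff)
  qed
  ultimately show ?thesis unfolding has_field_derivative_iff unfolding at_within_union by (rule filterlim_sup)
qed

text \<open>
  Truncated powers are the building blocks of the cut-off functions and of the corrections at a
  single point: \<open>(max 0 y) ^ 2\<close> is of class $C^1$.
\<close>

lemma has_real_derivative_truncated_power:
  "((\<lambda>y. (max 0 y) ^ Suc (Suc k)) has_real_derivative real (Suc (Suc k)) * (max 0 y) ^ Suc k) (at (y::real))"
proof -
  have "((\<lambda>y. (max 0 y) ^ Suc (Suc k)) has_real_derivative real (Suc (Suc k)) * (max 0 y) ^ Suc k) (at y within {..0} \<union> {0..})"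
  proof (rule has_real_derivative_glue)
    show "((\<lambda>_. 0) has_real_derivative real (Suc (Suc k)) * (max 0 y) ^ Suc k) (at y within {..0})" if "y \<in> {..0}"
      using that by (auto simp: max_def)
    show "((\<lambda>y. y ^ Suc (Suc k)) has_real_derivative real (Suc (Suc k)) * (max 0 y) ^ Suc k) (at y within {0..})" if "y \<in> {0..}"
      using that DERIV_pow[of "Suc (Suc k)" y] by (simp add: max_def del: power_Suc)
  qed (auto simp: max_def)
  moreover have "{..0} \<union> {0..} = (UNIV::real set)" by auto
  ultimately show ?thesis by simp
qed

section \<open>The radial equation between two focal values\<close>

text \<open>
  The coefficients of the equation \<open>B g' - A g'' = l g\<close> for \<open>g(F)\<close> to be an eigenfunction, with the
  behaviour at the end points that makes both of them regular singular points with a smooth solution.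
\<close>

locale focal_coefficients =
  fixes a b :: real and A A' B :: "real \<Rightarrow> real"
  assumes ab: "a < b"
    and A_pos: "\<And>x. x \<in> {a<..<b} \<Longrightarrow> A x > 0"
    and A_ends: "A a = 0" "A b = 0"
    and A_smooth: "\<And>k. Ck_real k A {a..b}"
    and A'_smooth: "\<And>k. Ck_real k A' {a..b}"
    and A_deriv: "\<And>x. x \<in> {a..b} \<Longrightarrow> (A has_real_derivative A' x) (at x within {a..b})"
    and A'_ends: "A' a > 0" "A' b < 0"
    and B_smooth: "\<And>k. Ck_real k B {a..b}"
    and B_ends: "B a < 0" "B b > 0"
begin

text \<open>
  The derivatives are arguments of the predicate, so that the equation can also be stated at the end
  points.
\<close>

definition radial_solution :: "real \<Rightarrow> real set \<Rightarrow> (real \<Rightarrow> real) \<Rightarrow> (real \<Rightarrow> real) \<Rightarrow> (real \<Rightarrow> real) \<Rightarrow> bool" where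
  "radial_solution l S g g1 g2 \<longleftrightarrow>
     (\<forall>x\<in>S. (g has_real_derivative g1 x) (at x within S) \<and> (g1 has_real_derivative g2 x) (at x within S) \<and>
        B x * g1 x - A x * g2 x = l * g x) \<and> continuous_on S g2"

lemma A_isCont: "x \<in> {a<..<b} \<Longrightarrow> isCont A x" and B_isCont: "x \<in> {a<..<b} \<Longrightarrow> isCont B x"
  using continuous_on_interior[OF Ck_real_continuous[OF A_smooth], of x]
    continuous_on_interior[OF Ck_real_continuous[OF B_smooth], of x] by (auto simp: interior_atLeastAtMost_real)

text \<open>
  A solution on the open interval that is smooth up to an end point solves the equation there too, by
  continuity.
\<close>

lemma radial_solutionI:
  assumes S: "{a<..<b} \<subseteq> S" "S \<subseteq> {a..b}"
    and u: "Ck_real 2 u S"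
    and w: "\<And>x. x \<in> {a<..<b} \<Longrightarrow> (u has_real_derivative w x) (at x)"
    and w': "\<And>x. x \<in> {a<..<b} \<Longrightarrow> (w has_real_derivative (B x * w x - l * u x) / A x) (at x)"
  obtains u1 u2 where "radial_solution l S u u1 u2" "\<And>x. x \<in> {a<..<b} \<Longrightarrow> u1 x = w x"
proof -
  obtain u1 u2 where u1: "\<forall>x\<in>S. (u has_real_derivative u1 x) (at x within S)"
    and u2: "\<forall>x\<in>S. (u1 has_real_derivative u2 x) (at x within S)" "continuous_on S u2"
    using u by (auto simp: numeral_2_eq_2)
  have 1: "u1 x = w x" if "x \<in> {a<..<b}" for x
    using has_real_derivative_within_unique_interval[OF w[OF that] bspec[OF u1] S(1) that] S(1) that by auto
  have 2: "u2 x = (B x * w x - l * u x) / A x" if x: "x \<in> {a<..<b}" for x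
  proof -
    have "(u1 has_real_derivative (B x * w x - l * u x) / A x) (at x)"
      by (rule has_field_derivative_transform_within_open[OF w'[OF x], of "{a<..<b}"]) (use 1 x in auto)
    then show ?thesis
      using has_real_derivative_within_unique_interval[OF _ bspec[OF u2(1)] S(1) x] S(1) x by (metis subsetD)
  qed
  define Z where "Z x = B x * u1 x - A x * u2 x - l * u x" for x
  have Z0: "Z x = 0" if "x \<in> {a<..<b}" for x
    using 1[OF that] 2[OF that] A_pos[OF that] by (simp add: Z_def)
  have contZ: "continuous_on S Z"
    unfolding Z_def using u1 u2 S(2)
    by (intro continuous_intros continuous_on_subset[OF Ck_real_continuous[OF A_smooth]]
        continuous_on_subset[OF Ck_real_continuous[OF B_smooth]]) (auto intro: DERIV_continuous_on)
  have "Z x = 0" if x: "x \<in> S" for x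
  proof (rule tendsto_unique)
    have "x \<in> {a..b}" using x S by auto
    then have "x islimpt {a<..<b}"
      using ab islimpt_greaterThanLessThan1[OF ab] islimpt_greaterThanLessThan2[OF ab]
        interior_limit_point[of x "{a<..<b}"] by (cases "x = a \<or> x = b") (auto simp: interior_open)
    then show "at x within {a<..<b} \<noteq> bot" by (simp add: trivial_limit_within)
    show "(Z \<longlongrightarrow> Z x) (at x within {a<..<b})"
      using contZ x S(1) by (auto simp: continuous_on_def intro: tendsto_within_subset)
    show "(Z \<longlongrightarrow> 0) (at x within {a<..<b})"
      by (rule Lim_transform_eventually[OF tendsto_const]) (auto simp: eventually_at_filter Z0)
  qed
  then show thesis
    using that[of u1 u2] u1 u2 1 by (auto simp: radial_solution_def Z_def)
qed

lemma left_solution: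
  obtains u w where "u a = 1" "\<And>k. Ck_real k u {a..<b}"
    "\<And>x. x \<in> {a<..<b} \<Longrightarrow> (u has_real_derivative w x) (at x)"
    "\<And>x. x \<in> {a<..<b} \<Longrightarrow> (w has_real_derivative (B x * w x - l * u x) / A x) (at x)"
proof -
  have sub: "{a..<b} \<subseteq> {a..b}" by auto
  interpret singular_endpoint a b A A' "\<lambda>x. - B x"
  proof
    show "Ck_real k A {a..<b}" "Ck_real k A' {a..<b}" "Ck_real k (\<lambda>x. - B x) {a..<b}" for k
      using Ck_real_subset[OF A_smooth sub] Ck_real_subset[OF A'_smooth sub]
        Ck_real_cmult[OF Ck_real_subset[OF B_smooth sub], of k "-1"] by auto
    show "(A has_real_derivative A' x) (at x within {a..<b})" if "x \<in> {a..<b}" for x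
      using has_field_derivative_subset[OF A_deriv sub] that by auto
  qed (use ab A_pos A_ends A'_ends B_ends in auto)
  obtain u w where "u a = 1" "\<And>k. Ck_real k u {a..<b}"
    "\<And>x. x \<in> {a<..<b} \<Longrightarrow> (u has_real_derivative w x) (at x)"
    "\<And>x. x \<in> {a<..<b} \<Longrightarrow> (w has_real_derivative (- l * u x - - B x * w x) / A x) (at x)"
    by (rule regular_solution[of l]) blast
  then show thesis by (intro that[of u w]) simp_all
qed

text \<open>
  The reflection \<open>x \<mapsto> - x\<close> exchanges the end points and changes the sign of the first-order term.
\<close>

lemma right_solution:
  obtains v w where "v b = 1" "\<And>k. Ck_real k v {a<..b}"
    "\<And>x. x \<in> {a<..<b} \<Longrightarrow> (v has_real_derivative w x) (at x)"
    "\<And>x. x \<in> {a<..<b} \<Longrightarrow> (w has_real_derivative (B x * w x - l * v x) / A x) (at x)"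
proof -
  have im: "uminus ` {- b..<- a} = {a<..b}" "uminus ` {a<..b} = {- b..<- a}" by auto
  have sub: "{a<..b} \<subseteq> {a..b}" by auto
  interpret singular_endpoint "- b" "- a" "\<lambda>x. A (- x)" "\<lambda>x. - A' (- x)" "\<lambda>x. B (- x)"
  proof
    show "Ck_real k (\<lambda>x. A (- x)) {- b..<- a}" "Ck_real k (\<lambda>x. - A' (- x)) {- b..<- a}"
        "Ck_real k (\<lambda>x. B (- x)) {- b..<- a}" for k
      using Ck_real_reflect[OF Ck_real_subset[OF A_smooth sub] im(1)] Ck_real_reflect[OF Ck_real_subset[OF B_smooth sub] im(1)]
        Ck_real_cmult[OF Ck_real_reflect[OF Ck_real_subset[OF A'_smooth sub] im(1)], of k "-1"] by auto
    show "((\<lambda>x. A (- x)) has_real_derivative - A' (- x)) (at x within {- b..<- a})" if "x \<in> {- b..<- a}" for x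
      by (rule has_real_derivative_reflect[OF has_field_derivative_subset[OF A_deriv sub] im(1)]) (use that in auto)
  qed (use ab A_pos A_ends A'_ends B_ends in auto)
  obtain u w where uw: "u (- b) = 1" "\<And>k. Ck_real k u {- b..<- a}"
    "\<And>x. x \<in> {- b<..<- a} \<Longrightarrow> (u has_real_derivative w x) (at x)"
    "\<And>x. x \<in> {- b<..<- a} \<Longrightarrow> (w has_real_derivative (- l * u x - B (- x) * w x) / A (- x)) (at x)"
    by (rule regular_solution[of l]) blast
  show thesis
  proof (rule that[of "\<lambda>x. u (- x)" "\<lambda>x. - w (- x)"])
    show "Ck_real k (\<lambda>x. u (- x)) {a<..b}" for k by (rule Ck_real_reflect[OF uw(2) im(2)])
    fix x assume x: "x \<in> {a<..<b}"
    then have x': "- x \<in> {- b<..<- a}" by auto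
    show "((\<lambda>x. u (- x)) has_real_derivative - w (- x)) (at x)"
      by (rule has_real_derivative_reflect[OF uw(3)[OF x']]) simp
    show "((\<lambda>x. - w (- x)) has_real_derivative (B x * - w (- x) - l * u (- x)) / A x) (at x)"
    proof (rule DERIV_cong[OF DERIV_minus[OF has_real_derivative_reflect[OF uw(4)[OF x'], of UNIV]]])
      have "- l * u (- x) - B x * w (- x) = B x * - w (- x) - l * u (- x)" by simp
      then show "- (- ((- l * u (- x) - B (- (- x)) * w (- x)) / A (- (- x)))) = (B x * - w (- x) - l * u (- x)) / A x"
        by simp
    qed simp
  qed (use uw in auto)
qed

text \<open>
  The values of \<open>l\<close> for which a nonzero solution is smooth up to both end points. Composed with the
  isoparametric function, such a solution is a radial eigenfunction.
\<close>

definition resonant :: "real \<Rightarrow> bool" where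
  "resonant l \<longleftrightarrow> (\<exists>g g1 g2. (\<forall>k. Ck_real k g {a..b}) \<and> radial_solution l {a..b} g g1 g2 \<and> g a \<noteq> 0)"

text \<open>
  If the Wronskian of the solution that is smooth up to \<open>a\<close> and the one that is smooth up to \<open>b\<close>
  vanishes at some point, a nontrivial combination has vanishing Cauchy data there and is zero. Neither
  solution is zero, so each is a multiple of the other, and together they form one solution that is
  smooth up to both end points.
\<close>

lemma nonresonant_solutions:
  assumes "\<not> resonant l"
  obtains u u1 u2 v v1 v2 where "radial_solution l {a..<b} u u1 u2" "radial_solution l {a<..b} v v1 v2"
    "\<And>s. s \<in> {a<..<b} \<Longrightarrow> u s * v1 s \<noteq> u1 s * v s"
proof -
  obtain u w where u: "u a = 1" "\<And>k. Ck_real k u {a..<b}"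
    "\<And>x. x \<in> {a<..<b} \<Longrightarrow> (u has_real_derivative w x) (at x)"
    "\<And>x. x \<in> {a<..<b} \<Longrightarrow> (w has_real_derivative (B x * w x - l * u x) / A x) (at x)" by (rule left_solution) blast
  obtain v z where v: "v b = 1" "\<And>k. Ck_real k v {a<..b}"
    "\<And>x. x \<in> {a<..<b} \<Longrightarrow> (v has_real_derivative z x) (at x)"
    "\<And>x. x \<in> {a<..<b} \<Longrightarrow> (z has_real_derivative (B x * z x - l * v x) / A x) (at x)" by (rule right_solution) blast
  obtain u1 u2 where U: "radial_solution l {a..<b} u u1 u2" "\<And>x. x \<in> {a<..<b} \<Longrightarrow> u1 x = w x"
    by (rule radial_solutionI[OF _ _ u(2-4)]) auto
  obtain v1 v2 where V: "radial_solution l {a<..b} v v1 v2" "\<And>x. x \<in> {a<..<b} \<Longrightarrow> v1 x = z x"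
    by (rule radial_solutionI[OF _ _ v(2-4)]) auto
  have zero: "\<alpha> * u x + \<gamma> * v x = 0" if s: "s \<in> {a<..<b}" "\<alpha> * u s + \<gamma> * v s = 0" "\<alpha> * w s + \<gamma> * z s = 0" and x: "x \<in> {a<..<b}" for \<alpha> \<gamma> s x
  proof (rule linear_ode_zero[where z="\<lambda>x. \<alpha> * u x + \<gamma> * v x" and y="\<lambda>x. \<alpha> * w x + \<gamma> * z x"
        and P="\<lambda>x. - l / A x" and Q="\<lambda>x. B x / A x", OF _ _ _ _ s x])
    fix x assume x: "x \<in> {a<..<b}"
    show "((\<lambda>x. \<alpha> * u x + \<gamma> * v x) has_real_derivative \<alpha> * w x + \<gamma> * z x) (at x)"
      by (rule DERIV_add[OF DERIV_cmult[OF u(3)[OF x]] DERIV_cmult[OF v(3)[OF x]]])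
    show "((\<lambda>x. \<alpha> * w x + \<gamma> * z x) has_real_derivative - l / A x * (\<alpha> * u x + \<gamma> * v x) + B x / A x * (\<alpha> * w x + \<gamma> * z x)) (at x)"
      by (rule DERIV_cong[OF DERIV_add[OF DERIV_cmult[OF u(4)[OF x]] DERIV_cmult[OF v(4)[OF x]]]])
        (use A_pos[OF x] in \<open>simp add: field_simps\<close>)
    show "isCont (\<lambda>x. - l / A x) x" "isCont (\<lambda>x. B x / A x) x"
      using A_pos[OF x] by (intro continuous_intros A_isCont[OF x] B_isCont[OF x]; simp)+
  qed
  have ev: "\<forall>\<^sub>F x in at_right a. x \<in> {a<..<b}" "\<forall>\<^sub>F x in at_left b. x \<in> {a<..<b}"
    using ab by (auto simp: eventually_at_right_field eventually_at_left_field)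
  have ulim: "(u \<longlongrightarrow> 1) (at_right a)"
    using continuous_on_Ico_tendsto[OF Ck_real_continuous[OF u(2)] ab] u(1) by simp
  have vlim: "(v \<longlongrightarrow> 1) (at_left b)"
  proof -
    have "at b within {a<..b} = at_left b" by (rule at_within_nhd[of _ "{a<..}"]) (use ab in auto)
    moreover have "(v \<longlongrightarrow> v b) (at b within {a<..b})"
      using Ck_real_continuous[OF v(2)] ab by (auto simp: continuous_on_def)
    ultimately show ?thesis using v(1) by simp
  qed
  have unz: "\<not> (\<forall>x\<in>{a<..<b}. u x = 0)"
  proof
    assume "\<forall>x\<in>{a<..<b}. u x = 0"
    then have "(u \<longlongrightarrow> 0) (at_right a)"
      by (intro Lim_transform_eventually[OF tendsto_const] eventually_mono[OF ev(1)]) auto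
    then show False using tendsto_unique[OF _ ulim] by force
  qed
  have vnz: "\<not> (\<forall>x\<in>{a<..<b}. v x = 0)"
  proof
    assume "\<forall>x\<in>{a<..<b}. v x = 0"
    then have "(v \<longlongrightarrow> 0) (at_left b)"
      by (intro Lim_transform_eventually[OF tendsto_const] eventually_mono[OF ev(2)]) auto
    then show False using tendsto_unique[OF _ vlim] by force
  qed
  have "u s * v1 s \<noteq> u1 s * v s" if s: "s \<in> {a<..<b}" for s
  proof
    assume "u s * v1 s = u1 s * v s"
    then have W: "u s * z s = w s * v s" using U(2)[OF s] V(2)[OF s] by simp
    have "\<exists>\<alpha> \<gamma>. \<alpha> * u s + \<gamma> * v s = 0 \<and> \<alpha> * w s + \<gamma> * z s = 0 \<and> (\<alpha> \<noteq> 0 \<or> \<gamma> \<noteq> 0)"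
    proof (cases "u s = 0 \<and> w s = 0")
      case True
      then show ?thesis by (intro exI[of _ 1] exI[of _ 0]) auto
    next
      case False
      then show ?thesis
      proof (cases "u s = 0")
        case True
        with False W show ?thesis by (intro exI[of _ "z s"] exI[of _ "- w s"]) (auto simp: algebra_simps)
      next
        case False
        with W show ?thesis by (intro exI[of _ "v s"] exI[of _ "- u s"]) (auto simp: algebra_simps)
      qed
    qed
    then obtain \<alpha> \<gamma> where ag: "\<alpha> * u s + \<gamma> * v s = 0" "\<alpha> * w s + \<gamma> * z s = 0" "\<alpha> \<noteq> 0 \<or> \<gamma> \<noteq> 0" by blast
    have lin: "\<alpha> * u x + \<gamma> * v x = 0" if "x \<in> {a<..<b}" for x using zero[OF s ag(1,2) that] .
    have "\<gamma> \<noteq> 0"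
    proof
      assume "\<gamma> = 0" then have "\<forall>x\<in>{a<..<b}. u x = 0" using lin ag(3) by auto
      then show False using unz by blast
    qed
    have "\<alpha> \<noteq> 0"
    proof
      assume "\<alpha> = 0" then have "\<forall>x\<in>{a<..<b}. v x = 0" using lin ag(3) by auto
      then show False using vnz by blast
    qed
    \<comment> \<open>\<open>u\<close> extended to \<open>b\<close> by the multiple of \<open>v\<close> with which it agrees\<close>
    define g where "g x = (if x = b then - \<gamma> / \<alpha> * v x else u x)" for x
    have gv: "g x = - \<gamma> / \<alpha> * v x" if "x \<in> {a<..b}" for x
      using lin[of x] that \<open>\<alpha> \<noteq> 0\<close> by (auto simp: g_def field_simps)
    have gk: "Ck_real k g {a..b}" for k
    proof (rule Ck_real_glue[OF _ _ ab])
      show "Ck_real k g {a..<b}" by (rule Ck_real_cong[OF u(2)]) (auto simp: g_def)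
      show "Ck_real k g {a<..b}" by (rule Ck_real_cong[OF Ck_real_cmult[OF v(2), of _ "- \<gamma> / \<alpha>"]]) (use gv in auto)
    qed
    have gd: "(g has_real_derivative w x) (at x)" if "x \<in> {a<..<b}" for x
      by (rule has_field_derivative_transform_within_open[OF u(3)[OF that], of "{a<..<b}"]) (use that in \<open>auto simp: g_def\<close>)
    have gd2: "(w has_real_derivative (B x * w x - l * g x) / A x) (at x)" if "x \<in> {a<..<b}" for x
      using u(4)[OF that] that by (simp add: g_def)
    obtain g1 g2 where "radial_solution l {a..b} g g1 g2"
      by (rule radial_solutionI[OF _ _ gk gd gd2]) auto
    moreover have "g a \<noteq> 0" using u(1) ab by (simp add: g_def)
    ultimately show False using assms gk by (auto simp: resonant_def)
  qed
  then show thesis using that U(1) V(1) by blast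
qed

text \<open>
  Put \<open>g = c u - 1 / l\<close> on the left of \<open>s0\<close> and \<open>g = d v\<close> on the right. Continuity of \<open>g\<close> and \<open>g'\<close> at \<open>s0\<close>
  is a linear system for \<open>c\<close> and \<open>d\<close> whose determinant is the Wronskian. The remaining jump \<open>J\<close> of
  \<open>g''\<close> is compensated on the right by adding \<open>J p0\<close>, where \<open>p0'' = m\<close> falls linearly from \<open>1\<close> to \<open>0\<close> on
  \<open>[s0, s0 + 1 / N]\<close>. The contribution of the correction to \<open>B g' - A g'' - l g\<close> is bounded, and it tends
  to zero pointwise since \<open>m\<close>, \<open>p0'\<close> and \<open>p0\<close> do.
\<close>

lemma indicator_approximation:
  assumes nr: "\<not> resonant l" and l: "l \<noteq> 0" and s0: "s0 \<in> {a<..<b}"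
  obtains g g1 g2 :: "nat \<Rightarrow> real \<Rightarrow> real" and C where
    "\<And>n s. s \<in> {a..b} \<Longrightarrow> (g n has_real_derivative g1 n s) (at s within {a..b})"
    "\<And>n s. s \<in> {a..b} \<Longrightarrow> (g1 n has_real_derivative g2 n s) (at s within {a..b})"
    "\<And>n. continuous_on {a..b} (g2 n)"
    "\<And>n s. s \<in> {a..b} \<Longrightarrow> \<bar>B s * g1 n s - A s * g2 n s - l * g n s\<bar> \<le> C"
    "\<And>s. s \<in> {a..b} \<Longrightarrow> (\<lambda>n. B s * g1 n s - A s * g2 n s - l * g n s) \<longlonglongrightarrow> (if s \<le> s0 then 1 else 0)"
proof -
  obtain u u1 u2 v v1 v2 where U: "radial_solution l {a..<b} u u1 u2" and V: "radial_solution l {a<..b} v v1 v2"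
    and W: "u s0 * v1 s0 \<noteq> u1 s0 * v s0"
    using nonresonant_solutions[OF nr] s0 by metis
  define w where "w = u s0 * v1 s0 - u1 s0 * v s0"
  define c where "c = v1 s0 / (l * w)"
  define d where "d = u1 s0 / (l * w)"
  have w: "w \<noteq> 0" using W by (simp add: w_def)
  have m0: "- 1 / l + c * u s0 = d * v s0"
    using w l by (simp add: c_def d_def field_simps) (simp add: w_def algebra_simps)
  have m1: "c * u1 s0 = d * v1 s0" by (simp add: c_def d_def)
  define J where "J = c * u2 s0 - d * v2 s0"
  define N where "N n = real (Suc n)" for n
  have N: "N n > 0" "N n \<ge> 1" for n by (auto simp: N_def)
  define m where "m n s = max 0 (1 - N n * (s - s0))" for n s
  \<comment> \<open>the second and first antiderivatives of \<open>m n\<close> that vanish at \<open>s0\<close>\<close>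
  define p0 where "p0 n s = (s - s0) / (2 * N n) - (1 - m n s ^ 3) / (6 * N n ^ 2)" for n s
  define p1 where "p1 n s = (1 - m n s ^ 2) / (2 * N n)" for n s
  define g where "g n s = (if s \<le> s0 then - 1 / l + c * u s else d * v s + J * p0 n s)" for n s
  define g1 where "g1 n s = (if s \<le> s0 then c * u1 s else d * v1 s + J * p1 n s)" for n s
  define g2 where "g2 n s = (if s \<le> s0 then c * u2 s else d * v2 s + J * m n s)" for n s
  have ms0: "m n s0 = 1" "p1 n s0 = 0" "p0 n s0 = 0" for n by (auto simp: m_def p0_def p1_def)
  have sub: "{a..s0} \<subseteq> {a..<b}" "{s0..b} \<subseteq> {a<..b}" "{a..b} = {a..s0} \<union> {s0..b}" using s0 by auto
  have lin: "((\<lambda>s. 1 - N n * (s - s0)) has_real_derivative - N n) (at s within S)" for n s S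
    by (auto intro!: derivative_eq_intros)
  have m2: "((\<lambda>s. m n s ^ 2) has_real_derivative - N n * (2 * m n s)) (at s within S)" for n s S
    using DERIV_chain2[OF has_real_derivative_truncated_power[of 0] lin, of n s S]
    by (simp add: m_def numeral_2_eq_2 mult.commute)
  have m3: "((\<lambda>s. m n s ^ 3) has_real_derivative - N n * (3 * m n s ^ 2)) (at s within S)" for n s S
    using DERIV_chain2[OF has_real_derivative_truncated_power[of 1] lin, of n s S]
    by (simp add: m_def numeral_2_eq_2 numeral_3_eq_3 mult.commute)
  have p1': "(p1 n has_real_derivative m n s) (at s within S)" for n s S
  proof -
    have "((\<lambda>s. (1 - m n s ^ 2) / (2 * N n)) has_real_derivative (0 - (- N n * (2 * m n s))) / (2 * N n)) (at s within S)"
      by (intro DERIV_cdivide DERIV_diff DERIV_const m2)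
    then show ?thesis using N(1)[of n] by (simp add: p1_def[abs_def])
  qed
  have p0': "(p0 n has_real_derivative p1 n s) (at s within S)" for n s S
  proof -
    have "((\<lambda>s. (s - s0) / (2 * N n) - (1 - m n s ^ 3) / (6 * N n ^ 2)) has_real_derivative
        (1 - 0) / (2 * N n) - (0 - (- N n * (3 * m n s ^ 2))) / (6 * N n ^ 2)) (at s within S)"
      by (intro DERIV_cdivide DERIV_diff DERIV_const DERIV_ident m3)
    moreover have "(1 - 0) / (2 * N n) - (0 - (- N n * (3 * m n s ^ 2))) / (6 * N n ^ 2) = p1 n s"
      using N(1)[of n] by (simp add: p1_def field_simps power2_eq_square)
    ultimately show ?thesis by (simp add: p0_def[abs_def])
  qed
  have gd: "(g n has_real_derivative g1 n s) (at s within {a..b})" if s: "s \<in> {a..b}" for n s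
    unfolding sub(3)
  proof (rule has_real_derivative_glue[where p="\<lambda>s. - 1 / l + c * u s" and q="\<lambda>s. d * v s + J * p0 n s"])
    assume s: "s \<in> {a..s0}"
    then have "(u has_real_derivative u1 s) (at s within {a..s0})"
      using U sub(1) unfolding radial_solution_def by (blast intro: has_field_derivative_subset)
    then show "((\<lambda>s. - 1 / l + c * u s) has_real_derivative g1 n s) (at s within {a..s0})"
      using s by (auto intro!: derivative_eq_intros simp: g1_def)
  next
    assume s: "s \<in> {s0..b}"
    then have "(v has_real_derivative v1 s) (at s within {s0..b})"
      using V sub(2) unfolding radial_solution_def by (blast intro: has_field_derivative_subset)
    then have "((\<lambda>s. d * v s + J * p0 n s) has_real_derivative d * v1 s + J * p1 n s) (at s within {s0..b})"
      by (intro DERIV_add DERIV_cmult p0')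
    then show "((\<lambda>s. d * v s + J * p0 n s) has_real_derivative g1 n s) (at s within {s0..b})"
      using s m1 ms0 by (cases "s = s0") (auto simp: g1_def)
  qed (use m0 ms0 in \<open>auto simp: g_def le_less\<close>)
  have g1d: "(g1 n has_real_derivative g2 n s) (at s within {a..b})" if s: "s \<in> {a..b}" for n s
    unfolding sub(3)
  proof (rule has_real_derivative_glue[where p="\<lambda>s. c * u1 s" and q="\<lambda>s. d * v1 s + J * p1 n s"])
    assume s: "s \<in> {a..s0}"
    then have "(u1 has_real_derivative u2 s) (at s within {a..s0})"
      using U sub(1) unfolding radial_solution_def by (blast intro: has_field_derivative_subset)
    then show "((\<lambda>s. c * u1 s) has_real_derivative g2 n s) (at s within {a..s0})"
      using s by (auto intro!: derivative_eq_intros simp: g2_def)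
  next
    assume s: "s \<in> {s0..b}"
    then have "(v1 has_real_derivative v2 s) (at s within {s0..b})"
      using V sub(2) unfolding radial_solution_def by (blast intro: has_field_derivative_subset)
    then have "((\<lambda>s. d * v1 s + J * p1 n s) has_real_derivative d * v2 s + J * m n s) (at s within {s0..b})"
      by (intro DERIV_add DERIV_cmult p1')
    then show "((\<lambda>s. d * v1 s + J * p1 n s) has_real_derivative g2 n s) (at s within {s0..b})"
      using s ms0 by (cases "s = s0") (auto simp: g2_def J_def)
  qed (use m1 ms0 in \<open>auto simp: g1_def le_less\<close>)
  have g2c: "continuous_on {a..b} (g2 n)" for n
    unfolding sub(3)
  proof (rule continuous_on_closed_Un)
    have "continuous_on {a..s0} (\<lambda>s. c * u2 s)"
      using U sub(1) unfolding radial_solution_def by (intro continuous_intros) (blast intro: continuous_on_subset)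
    then show "continuous_on {a..s0} (g2 n)" by (rule continuous_on_eq) (auto simp: g2_def)
    have "continuous_on {s0..b} (\<lambda>s. d * v2 s + J * m n s)"
      using V sub(2) unfolding radial_solution_def m_def by (intro continuous_intros) (blast intro: continuous_on_subset)
    then show "continuous_on {s0..b} (g2 n)"
      by (rule continuous_on_eq) (use ms0 in \<open>auto simp: g2_def J_def le_less\<close>)
  qed auto
  have left: "B s * g1 n s - A s * g2 n s - l * g n s = 1" if "s \<in> {a..s0}" for n s
  proof -
    have "B s * u1 s - A s * u2 s = l * u s" using U that sub(1) unfolding radial_solution_def by blast
    then have "c * (B s * u1 s - A s * u2 s) = c * (l * u s)" by simp
    then show ?thesis using that l by (simp add: g_def g1_def g2_def algebra_simps)
  qed
  have right: "B s * g1 n s - A s * g2 n s - l * g n s = J * (B s * p1 n s - A s * m n s - l * p0 n s)" if "s \<in> {s0<..b}" for n s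
  proof -
    have "B s * v1 s - A s * v2 s = l * v s" using V that s0 unfolding radial_solution_def by auto
    then have "d * (B s * v1 s - A s * v2 s) = d * (l * v s)" by simp
    then show ?thesis using that by (simp add: g_def g1_def g2_def algebra_simps)
  qed
  obtain KA where KA: "\<And>s. s \<in> {a..b} \<Longrightarrow> \<bar>A s\<bar> \<le> KA"
    using compact_imp_bounded[OF compact_continuous_image[OF Ck_real_continuous[OF A_smooth] compact_Icc]]
    unfolding bounded_iff real_norm_def by blast
  obtain KB where KB: "\<And>s. s \<in> {a..b} \<Longrightarrow> \<bar>B s\<bar> \<le> KB"
    using compact_imp_bounded[OF compact_continuous_image[OF Ck_real_continuous[OF B_smooth] compact_Icc]]
    unfolding bounded_iff real_norm_def by blast
  have m01: "0 \<le> m n s \<and> m n s \<le> 1" if "s \<in> {s0<..b}" for n s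
    using that N(1)[of n] by (auto simp: m_def)
  have p1b: "\<bar>p1 n s\<bar> \<le> 1 / N n" if "s \<in> {s0<..b}" for n s
  proof -
    have "0 \<le> m n s ^ 2" "m n s ^ 2 \<le> 1" using m01[OF that, of n] by (auto intro: power_le_one)
    then have "\<bar>1 - m n s ^ 2\<bar> \<le> 2" unfolding abs_le_iff by (intro conjI; linarith)
    then show ?thesis using N(1)[of n] by (simp add: p1_def abs_mult field_simps)
  qed
  have p0b: "\<bar>p0 n s\<bar> \<le> (b - s0 + 1) * (1 / N n)" if "s \<in> {s0<..b}" for n s
  proof -
    have "0 \<le> m n s ^ 3" "m n s ^ 3 \<le> 1" using m01[OF that, of n] by (auto intro: power_le_one)
    then have 1: "0 \<le> 1 - m n s ^ 3" "1 - m n s ^ 3 \<le> 1" by auto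
    have "(1 - m n s ^ 3) / (6 * N n ^ 2) \<le> 1 / (6 * N n ^ 2)" using 1 N(1)[of n] by (intro divide_right_mono) auto
    also have "\<dots> \<le> 1 / N n" using N[of n] by (simp add: field_simps power2_eq_square)
    finally have 2: "(1 - m n s ^ 3) / (6 * N n ^ 2) \<le> 1 / N n" .
    have 3: "(1 - m n s ^ 3) / (6 * N n ^ 2) \<ge> 0" using 1 by simp
    have 4: "(s - s0) / (2 * N n) \<ge> 0" using that N(1)[of n] by simp
    have 5: "(s - s0) / (2 * N n) \<le> (b - s0) * (1 / N n)"
      using that N(1)[of n] mult_right_mono[of "s0 + s" "2 * b" "N n"] by (simp add: field_simps)
    have "(b - s0 + 1) * (1 / N n) = (b - s0) * (1 / N n) + 1 / N n"
      by (simp only: distrib_right mult_1_left)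
    then show ?thesis using 2 3 4 5 unfolding p0_def abs_le_iff by linarith
  qed
  have KA0: "KA \<ge> 0" and KB0: "KB \<ge> 0" using KA[of a] KB[of a] ab by auto
  have est: "\<bar>J * (B s * p1 n s - A s * m n s - l * p0 n s)\<bar> \<le> \<bar>J\<bar> * (KB * (1 / N n) + KA * m n s + \<bar>l\<bar> * ((b - s0 + 1) * (1 / N n)))"
    if s: "s \<in> {s0<..b}" for n s
  proof -
    have s': "s \<in> {a..b}" using s s0 by auto
    have "\<bar>B s * p1 n s\<bar> \<le> KB * (1 / N n)" unfolding abs_mult using KB[OF s'] p1b[OF s] KB0 by (intro mult_mono) auto
    moreover have "\<bar>A s * m n s\<bar> \<le> KA * m n s" unfolding abs_mult using KA[OF s'] m01[OF s] KA0 by (intro mult_mono) auto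
    moreover have "\<bar>l * p0 n s\<bar> \<le> \<bar>l\<bar> * ((b - s0 + 1) * (1 / N n))" unfolding abs_mult using p0b[OF s] by (intro mult_mono) auto
    ultimately show ?thesis unfolding abs_mult[of J] by (intro mult_left_mono) auto
  qed
  define C where "C = max 1 (\<bar>J\<bar> * (KB + KA + \<bar>l\<bar> * (b - s0 + 1)))"
  show thesis
  proof (rule that[OF gd g1d g2c])
    fix n s assume s: "s \<in> {a..b}"
    show "\<bar>B s * g1 n s - A s * g2 n s - l * g n s\<bar> \<le> C"
    proof (cases "s \<le> s0")
      case True
      then show ?thesis using left[of s n] s by (simp add: C_def)
    next
      case False
      then have s': "s \<in> {s0<..b}" using s by auto
      have N1: "1 / N n \<le> 1" using N[of n] by simp
      have "\<bar>J\<bar> * (KB * (1 / N n) + KA * m n s + \<bar>l\<bar> * ((b - s0 + 1) * (1 / N n))) \<le> \<bar>J\<bar> * (KB * 1 + KA * 1 + \<bar>l\<bar> * ((b - s0 + 1) * 1))"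
        using N1 m01[OF s', of n] KA0 KB0 s0 by (intro mult_left_mono add_mono) auto
      then have "\<bar>B s * g1 n s - A s * g2 n s - l * g n s\<bar> \<le> \<bar>J\<bar> * (KB + KA + \<bar>l\<bar> * (b - s0 + 1))"
        using order_trans[OF est[OF s', of n]] right[OF s', of n] by simp
      then show ?thesis by (simp add: C_def)
    qed
  next
    fix s assume s: "s \<in> {a..b}"
    show "(\<lambda>n. B s * g1 n s - A s * g2 n s - l * g n s) \<longlonglongrightarrow> (if s \<le> s0 then 1 else 0)"
    proof (cases "s \<le> s0")
      case True
      then show ?thesis using left[of s] s by simp
    next
      case False
      then have s': "s \<in> {s0<..b}" using s by auto
      have N0: "(\<lambda>n. 1 / N n) \<longlonglongrightarrow> 0"
        unfolding N_def using LIMSEQ_inverse_real_of_nat by (simp add: divide_inverse)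
      have "(\<lambda>n. m n s) \<longlonglongrightarrow> 0"
      proof (rule Lim_transform_eventually[OF tendsto_const])
        obtain k :: nat where k: "real k > 1 / (s - s0)" using reals_Archimedean2 by blast
        show "\<forall>\<^sub>F n in sequentially. 0 = m n s"
          unfolding eventually_sequentially
        proof (intro exI[of _ k] allI impI)
          fix n assume "k \<le> n"
          then have "1 / (s - s0) \<le> N n" using k by (simp add: N_def)
          then have "1 \<le> N n * (s - s0)" using s' by (simp add: field_simps)
          then show "0 = m n s" by (simp add: m_def)
        qed
      qed
      then have "(\<lambda>n. \<bar>J\<bar> * (KB * (1 / N n) + KA * m n s + \<bar>l\<bar> * ((b - s0 + 1) * (1 / N n))))
          \<longlonglongrightarrow> \<bar>J\<bar> * (KB * 0 + KA * 0 + \<bar>l\<bar> * ((b - s0 + 1) * 0))"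
        by (intro tendsto_intros N0)
      then have lim: "(\<lambda>n. \<bar>J\<bar> * (KB * (1 / N n) + KA * m n s + \<bar>l\<bar> * ((b - s0 + 1) * (1 / N n)))) \<longlonglongrightarrow> 0"
        by simp
      have "(\<lambda>n. J * (B s * p1 n s - A s * m n s - l * p0 n s)) \<longlonglongrightarrow> 0"
        by (rule Lim_null_comparison[OF _ lim], rule always_eventually, rule allI, unfold real_norm_def, rule est[OF s'])
      then show ?thesis using False right[OF s'] by simp
    qed
  qed
qed

end

section \<open>Change of variables in nonnegative integrals\<close>

text \<open>
  A copy of a finite type with a well-order. The change of variables formula
  \<open>has_absolute_integral_change_of_variables\<close> concerns \<open>real^'n\<close> with a well-ordered index type \<open>'n\<close>.
  Relabelling the coordinates transfers it to every finite index type.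
\<close>

typedef (overloaded) ('n::finite) ordered = "{..<CARD('n)}"
  by (rule exI[of _ 0]) simp

instantiation ordered :: (finite) linorder
begin
definition "x \<le> y \<longleftrightarrow> Rep_ordered x \<le> Rep_ordered y"
definition "x < y \<longleftrightarrow> Rep_ordered x < Rep_ordered y"
instance by standard (auto simp: less_eq_ordered_def less_ordered_def Rep_ordered_inject)
end

instance ordered :: (finite) wellorder
proof
  fix P :: "'a ordered \<Rightarrow> bool" and a
  assume step: "\<And>x. (\<And>y. y < x \<Longrightarrow> P y) \<Longrightarrow> P x"
  show "P a"
    by (induction a rule: measure_induct_rule[of Rep_ordered]) (use step in \<open>auto simp: less_ordered_def\<close>)
qed

instance ordered :: (finite) finite
proof
  have "(UNIV :: 'a ordered set) = Abs_ordered ` {..<CARD('a)}"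
    by (metis type_definition.Abs_image type_definition_ordered)
  then show "finite (UNIV :: 'a ordered set)" by (metis finite_imageI finite_lessThan)
qed

lemma card_ordered: "CARD('n::finite ordered) = CARD('n)"
  using type_definition.card[OF type_definition_ordered[where 'n='n]] by simp

lemma ordered_bij: "\<exists>\<pi> :: 'n::finite ordered \<Rightarrow> 'n. bij \<pi>"
  by (rule finite_same_card_bij) (auto simp: card_ordered)

lemma swapidseq_conj:
  assumes "bij \<rho>" "swapidseq n p"
  shows "swapidseq n (\<rho> \<circ> p \<circ> inv \<rho>)"
  using assms(2)
proof (induction rule: swapidseq.induct)
  case id
  have "\<rho> \<circ> inv \<rho> = Fun.id" using assms(1) surj_iff bij_is_surj by metis
  then show ?case by (simp only: comp_id swapidseq.id)
next
  case (comp_Suc n p a b)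
  have "\<rho> \<circ> (Transposition.transpose a b \<circ> p) \<circ> inv \<rho> = Transposition.transpose (\<rho> a) (\<rho> b) \<circ> (\<rho> \<circ> p \<circ> inv \<rho>)"
    by (auto simp: fun_eq_iff Transposition.transpose_def inj_eq[OF bij_is_inj[OF assms(1)]])
  moreover have "\<rho> a \<noteq> \<rho> b" using assms(1) comp_Suc by (simp add: bij_is_inj inj_eq)
  ultimately show ?case using comp_Suc swapidseq.comp_Suc by metis
qed

lemma sign_conj:
  fixes \<rho> :: "'m::finite \<Rightarrow> 'n::finite"
  assumes "bij \<rho>" "p permutes UNIV"
  shows "sign (\<rho> \<circ> p \<circ> inv \<rho>) = sign p"
proof -
  obtain n where n: "swapidseq n p"
    using assms(2) permutation_permutes[of p] finite_UNIV by (auto simp: permutation_def)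
  show ?thesis
    using evenperm_unique[OF n refl] evenperm_unique[OF swapidseq_conj[OF assms(1) n] refl]
    by (simp add: sign_def)
qed

text \<open>
  Conjugation with \<open>\<rho>\<close> is a bijection between the permutations of the two index types and preserves
  the sign.
\<close>

lemma det_reindex:
  fixes \<rho> :: "'m::finite \<Rightarrow> 'n::finite" and A :: "real^'n^'n"
  assumes \<rho>: "bij \<rho>"
  shows "det (\<chi> i j. A $ \<rho> i $ \<rho> j) = det A"
proof -
  have inv: "inv \<rho> (\<rho> i) = i" "\<rho> (inv \<rho> k) = k" for i k
    using \<rho> by (auto simp: bij_is_inj bij_is_surj surj_f_inv_f)
  have bij_inv: "bij (inv \<rho>)" using \<rho> bij_imp_bij_inv by blast
  have inv_inv: "inv (inv \<rho>) = \<rho>" using \<rho> inv_inv_eq by blast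
  have per: "q permutes (UNIV :: 'b set) \<longleftrightarrow> bij q" for q :: "'b \<Rightarrow> 'b" by (simp add: permutes_univ bij_iff)
  have "det A = (\<Sum>p\<in>{p. p permutes UNIV}. of_int (sign p) * (\<Prod>i\<in>UNIV. A $ i $ p i))"
    by (simp add: det_def)
  also have "\<dots> = (\<Sum>p\<in>{p. p permutes UNIV}. of_int (sign p) * (\<Prod>i\<in>UNIV. A $ \<rho> i $ \<rho> (p i)))"
  proof (rule sum.reindex_bij_witness[where j="\<lambda>p. inv \<rho> \<circ> p \<circ> \<rho>" and i="\<lambda>p. \<rho> \<circ> p \<circ> inv \<rho>"])
    fix p :: "'n \<Rightarrow> 'n" assume "p \<in> {p. p permutes UNIV}"
    then have p: "bij p" "p permutes UNIV" by (auto simp: per)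
    show "\<rho> \<circ> (inv \<rho> \<circ> p \<circ> \<rho>) \<circ> inv \<rho> = p" by (auto simp: fun_eq_iff inv)
    show "inv \<rho> \<circ> p \<circ> \<rho> \<in> {p. p permutes UNIV}" using p \<rho> bij_inv by (auto simp: per intro!: bij_comp)
    have "sign (inv \<rho> \<circ> p \<circ> \<rho>) = sign p" using sign_conj[OF bij_inv p(2)] by (simp add: inv_inv)
    moreover have "(\<Prod>i\<in>UNIV. A $ \<rho> i $ \<rho> ((inv \<rho> \<circ> p \<circ> \<rho>) i)) = (\<Prod>i\<in>UNIV. A $ i $ p i)"
      using prod.reindex_bij_betw[OF \<rho>, of "\<lambda>i. A $ i $ p i"] by (simp add: inv)
    ultimately show "of_int (sign (inv \<rho> \<circ> p \<circ> \<rho>)) * (\<Prod>i\<in>UNIV. A $ \<rho> i $ \<rho> ((inv \<rho> \<circ> p \<circ> \<rho>) i)) = of_int (sign p) * (\<Prod>i\<in>UNIV. A $ i $ p i)"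
      by simp
  next
    fix p :: "'m \<Rightarrow> 'm" assume "p \<in> {p. p permutes UNIV}"
    then have p: "bij p" by (auto simp: per)
    show "inv \<rho> \<circ> (\<rho> \<circ> p \<circ> inv \<rho>) \<circ> \<rho> = p" by (auto simp: fun_eq_iff inv)
    show "\<rho> \<circ> p \<circ> inv \<rho> \<in> {p. p permutes UNIV}" using p \<rho> bij_inv by (auto simp: per intro!: bij_comp)
  qed
  also have "\<dots> = det (\<chi> i j. A $ \<rho> i $ \<rho> j)" by (simp add: det_def)
  finally show ?thesis by simp
qed

definition reindex :: "('m \<Rightarrow> 'n) \<Rightarrow> real^'n::finite \<Rightarrow> real^'m::finite" where
  "reindex \<rho> x = (\<chi> i. x $ \<rho> i)"

lemma linear_reindex: "linear (reindex \<rho>)"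
  by (auto simp: reindex_def linear_iff vec_eq_iff)

lemma bounded_linear_reindex: "bounded_linear (reindex \<rho>)"
  using linear_reindex linear_conv_bounded_linear by blast

lemma reindex_inverse:
  assumes "bij \<rho>"
  shows "reindex (inv \<rho>) (reindex \<rho> x) = x" "reindex \<rho> (reindex (inv \<rho>) y) = y"
  using assms by (auto simp: reindex_def vec_eq_iff bij_is_inj bij_is_surj surj_f_inv_f)

lemma measurable_reindex[measurable]: "reindex \<rho> \<in> borel_measurable borel"
  by (intro borel_measurable_continuous_onI linear_continuous_on bounded_linear_reindex)

lemma prod_Basis_vec: "(\<Prod>b\<in>Basis. (v::real^'n::finite) \<bullet> b) = (\<Prod>i\<in>UNIV. v $ i)"
proof -
  have B: "(Basis :: (real^'n) set) = (\<lambda>i. axis i 1) ` UNIV" by (auto simp: Basis_vec_def)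
  have "inj (\<lambda>i::'n. axis i (1::real))" by (auto simp: inj_on_def axis_eq_axis)
  then show ?thesis unfolding B by (simp add: prod.reindex inner_axis)
qed

text \<open>
  Relabelling coordinates permutes the side lengths of a box and preserves its volume.
\<close>

lemma lborel_reindex:
  fixes \<rho> :: "'m::finite \<Rightarrow> 'n::finite"
  assumes \<rho>: "bij \<rho>"
  shows "distr lborel borel (reindex \<rho>) = (lborel :: (real^'m) measure)"
proof (rule lborel_eqI[symmetric])
  fix l u :: "real^'m" assume lu: "\<And>b. b \<in> Basis \<Longrightarrow> l \<bullet> b \<le> u \<bullet> b"
  then have lu': "l $ i \<le> u $ i" for i using lu[of "axis i 1"] by (simp add: inner_axis axis_in_Basis_iff)
  have lu2: "reindex (inv \<rho>) l \<bullet> b \<le> reindex (inv \<rho>) u \<bullet> b" if "b \<in> Basis" for b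
    using that lu' by (auto simp: Basis_vec_def inner_axis reindex_def)
  have mem: "reindex \<rho> x \<in> box l u \<longleftrightarrow> x \<in> box (reindex (inv \<rho>) l) (reindex (inv \<rho>) u)" for x
  proof -
    have inv: "inv \<rho> (\<rho> i) = i" "\<rho> (inv \<rho> k) = k" for i k
      using \<rho> by (auto simp: bij_is_inj bij_is_surj surj_f_inv_f)
    show ?thesis by (simp add: mem_box_cart reindex_def) (metis inv)
  qed
  have "emeasure (distr lborel borel (reindex \<rho>)) (box l u) = emeasure lborel (box (reindex (inv \<rho>) l) (reindex (inv \<rho>) u))"
    by (subst emeasure_distr) (auto simp: mem vimage_def intro!: arg_cong[where f="emeasure lborel"])
  also have "\<dots> = ennreal (\<Prod>i\<in>UNIV. (reindex (inv \<rho>) (u - l)) $ i)"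
    using lu2 by (subst emeasure_lborel_box) (auto simp: prod_Basis_vec reindex_def)
  also have "(\<Prod>i\<in>UNIV. (reindex (inv \<rho>) (u - l)) $ i) = (\<Prod>i\<in>UNIV. (u - l) $ i)"
    using prod.reindex_bij_betw[OF bij_imp_bij_inv[OF \<rho>], of "\<lambda>i. (u - l) $ i"] by (simp add: reindex_def)
  finally show "emeasure (distr lborel borel (reindex \<rho>)) (box l u) = (\<Prod>b\<in>Basis. (u - l) \<bullet> b)"
    by (simp add: prod_Basis_vec)
qed simp

text \<open>
  For nonnegative functions an infinite integral is the same as nonintegrability, so a statement on
  Bochner integrals carries over to nonnegative integrals in \<open>ennreal\<close>.
\<close>

lemma nn_integral_eq_of_integrable_iff:
  fixes f g :: "'a::euclidean_space \<Rightarrow> real"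
  assumes [measurable]: "f \<in> borel_measurable borel" "g \<in> borel_measurable borel"
    and nn: "\<And>x. f x \<ge> 0" "\<And>x. g x \<ge> 0"
    and eq: "integrable lebesgue f \<longleftrightarrow> integrable lebesgue g" "integral\<^sup>L lebesgue f = integral\<^sup>L lebesgue g"
  shows "(\<integral>\<^sup>+x. ennreal (f x) \<partial>lborel) = (\<integral>\<^sup>+x. ennreal (g x) \<partial>lborel)"
proof -
  have m: "f \<in> borel_measurable lebesgue" "g \<in> borel_measurable lebesgue" by (auto intro: measurable_completion)
  have *: "(\<integral>\<^sup>+x. ennreal (k x) \<partial>lborel) = (if integrable lebesgue k then ennreal (integral\<^sup>L lebesgue k) else \<infinity>)"
    if "k \<in> borel_measurable lebesgue" "\<And>x. k x \<ge> 0" for k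
  proof (cases "integrable lebesgue k")
    case True
    then show ?thesis using nn_integral_eq_integral[OF True] that(2) by (simp add: nn_integral_completion)
  next
    case False
    then show ?thesis using that by (simp add: integrable_iff_bounded nn_integral_completion not_less top_unique)
  qed
  show ?thesis using *[OF m(1) nn(1)] *[OF m(2) nn(2)] eq by simp
qed

text \<open>
  The change of variables formula for absolutely integrable functions concerns vector-valued
  functions, hence the detour through \<open>real^1\<close>. It includes the equivalence of the integrability of both
  sides.
\<close>

lemma nn_integral_change_of_variables_ordered:
  fixes \<tau> :: "real^'m::{finite,wellorder} \<Rightarrow> real^'m::_" and f h :: "real^'m::_ \<Rightarrow> real"
  assumes S[measurable]: "S \<in> sets borel" "\<tau> ` S \<in> sets borel"
    and f[measurable]: "f \<in> borel_measurable borel" "h \<in> borel_measurable borel"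
    and nn: "\<And>x. f x \<ge> 0" "\<And>x. h x \<ge> 0"
    and d: "\<And>x. x \<in> S \<Longrightarrow> (\<tau> has_derivative \<tau>' x) (at x within S)" and inj: "inj_on \<tau> S"
    and h: "\<And>x. x \<in> S \<Longrightarrow> h x = \<bar>det (matrix (\<tau>' x))\<bar> * f (\<tau> x)"
  shows "(\<integral>\<^sup>+y. ennreal (f y * indicator (\<tau> ` S) y) \<partial>lborel) = (\<integral>\<^sup>+x. ennreal (h x * indicator S x) \<partial>lborel)"
proof -
  define fv :: "real^'m::_ \<Rightarrow> real^1" where "fv y = vec (f y)" for y
  define hv :: "real^'m::_ \<Rightarrow> real^1" where "hv x = \<bar>det (matrix (\<tau>' x))\<bar> *\<^sub>R fv (\<tau> x)" for x
  have SL: "S \<in> sets lebesgue" using S(1) by simp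
  have cov: "hv absolutely_integrable_on S \<and> integral S hv = b \<longleftrightarrow> fv absolutely_integrable_on \<tau> ` S \<and> integral (\<tau> ` S) fv = b" for b
    unfolding hv_def by (rule has_absolute_integral_change_of_variables[OF SL d inj])
  have hvh: "hv absolutely_integrable_on S \<longleftrightarrow> (\<lambda>x. h x) absolutely_integrable_on S"
  proof -
    have "hv absolutely_integrable_on S \<longleftrightarrow> (\<lambda>x. hv x $ 1) absolutely_integrable_on S"
      by (rule absolutely_integrable_on_1_iff)
    also have "\<dots> \<longleftrightarrow> (\<lambda>x. h x) absolutely_integrable_on S"
      by (rule absolutely_integrable_spike_eq[OF negligible_empty]) (simp add: hv_def fv_def h)
    finally show ?thesis .
  qed
  have fvf: "fv absolutely_integrable_on \<tau> ` S \<longleftrightarrow> f absolutely_integrable_on \<tau> ` S"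
    using absolutely_integrable_on_1_iff[where f=fv] by (simp add: fv_def)
  have I1: "integral S hv $ 1 = integral S h"
  proof -
    have "integral S (\<lambda>x. hv x $ 1) = integral S h"
      by (rule integral_spike[OF negligible_empty]) (simp add: hv_def fv_def h)
    then show ?thesis by (simp add: integral_on_1_eq[where f=hv])
  qed
  have I2: "integral (\<tau> ` S) fv $ 1 = integral (\<tau> ` S) f"
    by (simp add: integral_on_1_eq[where f=fv]) (simp add: fv_def)
  show ?thesis
  proof (rule nn_integral_eq_of_integrable_iff)
    have a: "integrable lebesgue (\<lambda>x. k x * indicator T x) \<longleftrightarrow> k absolutely_integrable_on T" for k :: "real^'m::_ \<Rightarrow> real" and T
      by (simp add: set_integrable_def mult.commute)
    have b: "integral\<^sup>L lebesgue (\<lambda>x. k x * indicator T x) = integral T k" if "k absolutely_integrable_on T" for k :: "real^'m::_ \<Rightarrow> real" and T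
      using set_lebesgue_integral_eq_integral(2)[OF that] by (simp add: set_lebesgue_integral_def mult.commute)
    show eq: "integrable lebesgue (\<lambda>y. f y * indicator (\<tau> ` S) y) = integrable lebesgue (\<lambda>x. h x * indicator S x)"
      unfolding a using cov hvh fvf by blast
    show "integral\<^sup>L lebesgue (\<lambda>y. f y * indicator (\<tau> ` S) y) = integral\<^sup>L lebesgue (\<lambda>x. h x * indicator S x)"
    proof (cases "h absolutely_integrable_on S")
      case True
      then have "f absolutely_integrable_on \<tau> ` S" using eq unfolding a by blast
      moreover have "integral S hv = integral (\<tau> ` S) fv" using cov True hvh by blast
      ultimately show ?thesis using True b I1 I2 by metis
    next
      case False
      then show ?thesis using eq unfolding a[symmetric] by (simp add: not_integrable_integral_eq)
    qed
  qed (use nn in \<open>auto simp: indicator_def\<close>)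
qed

lemma nn_integral_reindex:
  fixes \<rho> :: "'m::finite \<Rightarrow> 'n::finite"
  assumes \<rho>: "bij \<rho>" and [measurable]: "g \<in> borel_measurable borel"
  shows "(\<integral>\<^sup>+x. g x \<partial>(lborel :: (real^'n) measure)) = (\<integral>\<^sup>+y. g (reindex (inv \<rho>) y) \<partial>(lborel :: (real^'m) measure))"
  by (subst lborel_reindex[OF bij_imp_bij_inv[OF \<rho>], symmetric], subst nn_integral_distr) auto

theorem nn_integral_change_of_variables:
  fixes \<tau> :: "real^'n::finite \<Rightarrow> real^'n" and f h :: "real^'n \<Rightarrow> real"
  assumes S[measurable]: "S \<in> sets borel" "\<tau> ` S \<in> sets borel"
    and f[measurable]: "f \<in> borel_measurable borel" "h \<in> borel_measurable borel"
    and nn: "\<And>x. f x \<ge> 0" "\<And>x. h x \<ge> 0"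
    and d: "\<And>x. x \<in> S \<Longrightarrow> (\<tau> has_derivative \<tau>' x) (at x within S)" and inj: "inj_on \<tau> S"
    and h: "\<And>x. x \<in> S \<Longrightarrow> h x = \<bar>det (matrix (\<tau>' x))\<bar> * f (\<tau> x)"
  shows "(\<integral>\<^sup>+y. ennreal (f y * indicator (\<tau> ` S) y) \<partial>lborel) = (\<integral>\<^sup>+x. ennreal (h x * indicator S x) \<partial>lborel)"
proof -
  obtain \<rho> :: "'n ordered \<Rightarrow> 'n" where \<rho>: "bij \<rho>" using ordered_bij by blast
  define R where "R = reindex \<rho>"
  define Q where "Q = reindex (inv \<rho>)"
  have QR: "Q (R x) = x" "R (Q y) = y" for x y using reindex_inverse[OF \<rho>] by (auto simp: R_def Q_def)
  have [measurable]: "Q \<in> borel_measurable borel" "R \<in> borel_measurable borel" by (simp_all add: Q_def R_def)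
  have img: "R ` T = Q -` T" for T using QR by (auto simp: image_iff) metis
  have imgm: "R ` T \<in> sets borel" if "T \<in> sets borel" for T
    unfolding img using measurable_sets[OF \<open>Q \<in> borel_measurable borel\<close> that] by simp
  have ind: "indicator T (Q y) = (indicator (R ` T) y :: real)" for T y
    unfolding img by (simp add: indicator_def)
  let ?\<tau> = "R \<circ> \<tau> \<circ> Q"
  have \<tau>im: "?\<tau> ` (R ` S) = R ` (\<tau> ` S)" by (auto simp: image_comp QR)
  have "(\<integral>\<^sup>+y. ennreal (f y * indicator (\<tau> ` S) y) \<partial>lborel) = (\<integral>\<^sup>+y. ennreal ((f \<circ> Q) y * indicator (?\<tau> ` (R ` S)) y) \<partial>lborel)"
    unfolding \<tau>im by (subst nn_integral_reindex[OF \<rho>]) (auto simp: ind Q_def[symmetric])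
  also have "\<dots> = (\<integral>\<^sup>+x. ennreal ((h \<circ> Q) x * indicator (R ` S) x) \<partial>lborel)"
  proof (rule nn_integral_change_of_variables_ordered)
    show "R ` S \<in> sets borel" "?\<tau> ` (R ` S) \<in> sets borel" unfolding \<tau>im using imgm S by auto
    show "inj_on ?\<tau> (R ` S)"
      using inj QR by (auto simp: inj_on_def) metis
    fix x assume "x \<in> R ` S"
    then have x: "Q x \<in> S" by (auto simp: QR)
    have "(Q has_derivative Q) (at x within R ` S)"
      unfolding Q_def by (rule bounded_linear_imp_has_derivative[OF bounded_linear_reindex])
    moreover have "(\<tau> has_derivative \<tau>' (Q x)) (at (Q x) within Q ` (R ` S))"
      using d[OF x] by (simp add: image_comp o_def QR)
    ultimately have "(\<tau> \<circ> Q has_derivative \<tau>' (Q x) \<circ> Q) (at x within R ` S)"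
      by (rule diff_chain_within)
    then have "(R \<circ> (\<tau> \<circ> Q) has_derivative R \<circ> (\<tau>' (Q x) \<circ> Q)) (at x within R ` S)"
      by (rule diff_chain_within) (auto simp: R_def intro: bounded_linear_imp_has_derivative[OF bounded_linear_reindex])
    then show "(?\<tau> has_derivative R \<circ> \<tau>' (Q x) \<circ> Q) (at x within R ` S)" by (simp add: o_assoc)
    have Qax: "Q (axis j 1) = axis (\<rho> j) 1" for j
      using \<rho> by (auto simp: Q_def reindex_def vec_eq_iff axis_def bij_is_inj bij_is_surj surj_f_inv_f)
    have "matrix (R \<circ> \<tau>' (Q x) \<circ> Q) = (\<chi> i j. matrix (\<tau>' (Q x)) $ \<rho> i $ \<rho> j)"
      by (simp add: matrix_def Qax) (simp add: R_def reindex_def)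
    then have "det (matrix (R \<circ> \<tau>' (Q x) \<circ> Q)) = det (matrix (\<tau>' (Q x)))" using det_reindex[OF \<rho>] by simp
    then show "(h \<circ> Q) x = \<bar>det (matrix (R \<circ> \<tau>' (Q x) \<circ> Q))\<bar> * (f \<circ> Q) (?\<tau> x)"
      using h[OF x] by (simp add: QR)
  qed (use nn in \<open>auto simp: o_def\<close>)
  also have "\<dots> = (\<integral>\<^sup>+x. ennreal (h x * indicator S x) \<partial>lborel)"
    by (subst nn_integral_reindex[OF \<rho>]) (auto simp: ind Q_def[symmetric])
  finally show ?thesis .
qed

section \<open>Charts\<close>

text \<open>
  On the segment from the identity matrix to \<open>A\<close> all matrices are positive definite, hence invertible,
  so the determinant cannot change its sign.
\<close>

lemma positive_definite_det_pos:
  fixes A :: "real^'n::finite^'n"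
  assumes "\<And>v. v \<noteq> 0 \<Longrightarrow> v \<bullet> (A *v v) > 0"
  shows "det A > 0"
proof -
  define P where "P t = t *\<^sub>R A + (1 - t) *\<^sub>R mat 1" for t :: real
  have nz: "det (P t) \<noteq> 0" if t: "0 \<le> t" "t \<le> 1" for t
  proof
    assume "det (P t) = 0"
    then obtain v where v: "v \<noteq> 0" "P t *v v = 0"
      using invertible_det_nz[of "P t"] invertible_left_inverse[of "P t"] matrix_left_invertible_ker[of "P t"] by metis
    have "P t *v v = t *\<^sub>R (A *v v) + (1 - t) *\<^sub>R v"
      by (simp add: P_def matrix_vector_mult_add_rdistrib scaleR_matrix_vector_assoc[symmetric])
    then have "0 = t * (v \<bullet> (A *v v)) + (1 - t) * (v \<bullet> v)" using v(2)
      by (metis inner_add_right inner_scaleR_right inner_zero_right)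
    moreover have "v \<bullet> (A *v v) > 0" "v \<bullet> v > 0" using assms v(1) by auto
    ultimately show False using t
      by (smt (verit, best) mult_nonneg_nonneg mult_pos_pos)
  qed
  have c: "continuous_on {0..1} (\<lambda>t. det (P t))"
    unfolding P_def det_def by (intro continuous_intros)
  have e: "det (P 0) = 1" "det (P 1) = det A" by (simp_all add: P_def)
  show ?thesis
  proof (rule ccontr)
    assume "\<not> det A > 0"
    then obtain t where "0 \<le> t" "t \<le> 1" "det (P t) = 0"
      using IVT2'[of "\<lambda>t. det (P t)" 1 0 0] c e by auto
    then show False using nz by blast
  qed
qed

lemma chart_inv_facts:
  assumes "is_chart c"
  shows chart_open: "open (fst c)" "open (snd c ` fst c)"
    and chart_cont: "continuous_on (fst c) (snd c)" "continuous_on (snd c ` fst c) (chart_inv c)"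
    and chart_inj: "inj_on (snd c) (fst c)"
    and chart_inv_left: "\<And>p. p \<in> fst c \<Longrightarrow> chart_inv c (snd c p) = p"
    and chart_inv_right: "\<And>x. x \<in> snd c ` fst c \<Longrightarrow> snd c (chart_inv c x) = x"
    and chart_inv_dom: "\<And>x. x \<in> snd c ` fst c \<Longrightarrow> chart_inv c x \<in> fst c"
proof -
  show "open (fst c)" "open (snd c ` fst c)" using assms by (auto simp: is_chart_def)
  obtain \<psi> where h: "homeomorphism (fst c) (snd c ` fst c) (snd c) \<psi>" using assms by (auto simp: is_chart_def)
  show "continuous_on (fst c) (snd c)" using h homeomorphism_cont1 by blast
  show inj: "inj_on (snd c) (fst c)"
    by (rule inj_on_inverseI[of _ \<psi>]) (use h in \<open>simp add: homeomorphism_apply1\<close>)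
  show 1: "chart_inv c (snd c p) = p" if "p \<in> fst c" for p
    using inj that by (simp add: chart_inv_def)
  show "snd c (chart_inv c x) = x" if "x \<in> snd c ` fst c" for x
    using that by (simp add: chart_inv_def f_inv_into_f)
  show "chart_inv c x \<in> fst c" if "x \<in> snd c ` fst c" for x
    using that by (simp add: chart_inv_def inv_into_into)
  have "\<psi> x = chart_inv c x" if "x \<in> snd c ` fst c" for x
    using that 1 h by (auto simp: homeomorphism_apply1)
  then show "continuous_on (snd c ` fst c) (chart_inv c)"
    using homeomorphism_cont2[OF h] by (metis (no_types, lifting) continuous_on_cong)
qed

lemma chart_image_eq_vimage:
  assumes "is_chart c"
  shows "snd c ` (fst c \<inter> W) = snd c ` fst c \<inter> chart_inv c -` W"
  using chart_inv_left[OF assms] by (auto simp: image_iff)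

lemma chart_image_open:
  assumes "is_chart c" "open W"
  shows "open (snd c ` (fst c \<inter> W))"
  unfolding chart_image_eq_vimage[OF assms(1)]
  by (rule continuous_open_preimage[OF chart_cont(2)[OF assms(1)] chart_open(2)[OF assms(1)] assms(2)])

lemma measurable_restrict_lborel:
  "measurable (restrict_space lborel S) N = measurable (restrict_space borel S) N"
  by (rule measurable_cong_sets) (simp_all add: sets_restrict_space)

lemma chart_inv_measurable:
  assumes "is_chart c"
  shows "chart_inv c \<in> measurable (restrict_space lborel (snd c ` fst c)) borel"
  unfolding measurable_restrict_lborel
  by (rule borel_measurable_continuous_on_restrict[OF chart_cont(2)[OF assms]])

lemma chart_image_borel:
  assumes "is_chart c" "E \<in> sets borel"
  shows "snd c ` (fst c \<inter> E) \<in> sets borel"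
proof -
  have "chart_inv c -` E \<inter> space (restrict_space lborel (snd c ` fst c)) \<in> sets (restrict_space lborel (snd c ` fst c))"
    by (rule measurable_sets[OF chart_inv_measurable[OF assms(1)] assms(2)])
  then show ?thesis
    using chart_open(2)[OF assms(1)]
    unfolding chart_image_eq_vimage[OF assms(1)] Int_commute[of "snd c ` fst c"]
    by (simp add: space_restrict_space sets_restrict_space_iff)
qed

lemma local_rep_image:
  assumes "is_chart c" "E \<subseteq> fst c"
  shows "local_rep h c c' ` (snd c ` E) = snd c' ` (h ` E)"
  using chart_inv_left[OF assms(1)] assms(2) by (force simp: local_rep_def image_iff)

section \<open>The measure of a Riemannian metric in a chart\<close>

locale riemannian =
  fixes M :: "('a::{t2_space, second_countable_topology}, 'n::finite) riem"
  assumes riemannian: "riemannian_manifold M"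
begin

abbreviation "image_of c \<equiv> snd c ` fst c"
abbreviation "volume_density c x \<equiv> sqrt (det (metric M c x))"
abbreviation "vol \<equiv> riemannian_measure M"
text \<open>
  The identity is a local isometry, so statements on local isometries include the independence of
  the chart.
\<close>

abbreviation "local_isometry h \<equiv> smooth_map M h \<and> preserves_metric M h"

lemma atlas_chart: "c \<in> atlas M \<Longrightarrow> is_chart c"
  and atlas_cover: "\<exists>c\<in>atlas M. p \<in> fst c"
  and atlas_compatible: "c \<in> atlas M \<Longrightarrow> c' \<in> atlas M \<Longrightarrow> compatible_charts c c'"
  using riemannian by (auto simp: riemannian_manifold_def smooth_atlas_def)

lemma metric_smooth: "c \<in> atlas M \<Longrightarrow> Ck_on k (metric M c) (image_of c)"
  and metric_symmetric: "c \<in> atlas M \<Longrightarrow> x \<in> image_of c \<Longrightarrow> transpose (metric M c x) = metric M c x"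
  and metric_positive: "c \<in> atlas M \<Longrightarrow> x \<in> image_of c \<Longrightarrow> v \<noteq> 0 \<Longrightarrow> v \<bullet> (metric M c x *v v) > 0"
  using riemannian by (auto simp: riemannian_manifold_def smooth_on_def)

lemma metric_det_pos: "c \<in> atlas M \<Longrightarrow> x \<in> image_of c \<Longrightarrow> det (metric M c x) > 0"
  using positive_definite_det_pos metric_positive by blast

lemma volume_density_pos: "c \<in> atlas M \<Longrightarrow> x \<in> image_of c \<Longrightarrow> volume_density c x > 0"
  using metric_det_pos by simp

lemma volume_density_smooth:
  assumes "c \<in> atlas M"
  shows "Ck_on k (volume_density c) (image_of c)"
  by (intro Ck_on_sqrt Ck_on_det Ck_on_mat metric_smooth metric_det_pos chart_open atlas_chart assms)

lemma volume_density_continuous: "c \<in> atlas M \<Longrightarrow> continuous_on (image_of c) (volume_density c)"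
  using volume_density_smooth Ck_on_continuous by blast

lemma local_isometry_id: "local_isometry id"
  using riemannian atlas_compatible
  by (auto simp: riemannian_manifold_def smooth_map_def compatible_charts_def)

lemma riemannian_isometryD:
  assumes "riemannian_isometry M h"
  shows "local_isometry h" "bij h" "smooth_map M (inv h)" "continuous_on UNIV h" "continuous_on UNIV (inv h)"
  using assms by (auto simp: riemannian_isometry_def smooth_map_def)

lemma local_dom_open:
  assumes "c \<in> atlas M" "c' \<in> atlas M" "continuous_on UNIV h"
  shows "open (local_dom h c c')"
  unfolding local_dom_def
  by (intro chart_image_open atlas_chart assms open_vimage chart_open(1))

lemma local_dom_subset: "local_dom h c c' \<subseteq> image_of c"
  by (auto simp: local_dom_def)

lemma local_rep_maps:
  assumes "c \<in> atlas M" "x \<in> local_dom h c c'"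
  shows "local_rep h c c' x \<in> image_of c'" "chart_inv c x \<in> fst c" "h (chart_inv c x) \<in> fst c'"
    "local_rep h c c' x = snd c' (h (chart_inv c x))"
  using assms chart_inv_left[OF atlas_chart[OF assms(1)]] by (auto simp: local_dom_def local_rep_def)

lemma local_rep_smooth:
  assumes "smooth_map M h" "c \<in> atlas M" "c' \<in> atlas M"
  shows "Ck_on k (local_rep h c c') (local_dom h c c')"
  using assms by (auto simp: smooth_map_def smooth_on_def)

lemma local_rep_derivative:
  assumes "smooth_map M h" "c \<in> atlas M" "c' \<in> atlas M" "x \<in> local_dom h c c'"
  shows "(local_rep h c c' has_derivative frechet_derivative (local_rep h c c') (at x)) (at x)"
  using Ck_on_SucE(1)[OF local_rep_smooth[OF assms(1-3)] assms(4)] by blast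

lemma metric_pullback:
  assumes "preserves_metric M h" "c \<in> atlas M" "c' \<in> atlas M" "x \<in> local_dom h c c'"
  shows "metric M c x = transpose (jacobian (local_rep h c c') (at x)) ** metric M c' (local_rep h c c' x) ** jacobian (local_rep h c c') (at x)"
  using assms by (simp add: preserves_metric_def Let_def)

text \<open>
  The determinant of the transformation law of the metric.
\<close>

lemma volume_density_pullback:
  assumes "local_isometry h" "c \<in> atlas M" "c' \<in> atlas M" "x \<in> local_dom h c c'"
  shows "volume_density c x = \<bar>det (jacobian (local_rep h c c') (at x))\<bar> * volume_density c' (local_rep h c c' x)"
proof -
  have "det (metric M c x) = det (jacobian (local_rep h c c') (at x)) ^ 2 * det (metric M c' (local_rep h c c' x))"
    using metric_pullback[of h c c' x] assms by (simp add: det_mul det_transpose power2_eq_square)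
  then show ?thesis by (simp add: real_sqrt_mult)
qed

text \<open>
  The measure with density \<open>sqrt (det g)\<close> in the coordinates of one chart, as a measure on the whole
  manifold that is concentrated on the domain of the chart.
\<close>

definition chart_measure :: "('a, 'n) chart \<Rightarrow> 'a measure" where
  "chart_measure c = distr (density (restrict_space lborel (image_of c)) (\<lambda>x. ennreal (volume_density c x))) borel (chart_inv c)"

lemma volume_density_measurable:
  assumes "c \<in> atlas M"
  shows "volume_density c \<in> borel_measurable (restrict_space lborel (image_of c))"
  unfolding measurable_restrict_lborel
  by (rule borel_measurable_continuous_on_restrict[OF volume_density_continuous[OF assms]])

lemma sets_chart_measure: "sets (chart_measure c) = sets borel"
  by (simp add: chart_measure_def)

lemma emeasure_chart_measure:
  assumes c: "c \<in> atlas M" and E: "E \<in> sets borel"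
  shows "emeasure (chart_measure c) E = (\<integral>\<^sup>+x\<in>snd c ` (fst c \<inter> E). ennreal (volume_density c x) \<partial>lborel)"
proof -
  let ?V = "image_of c" let ?R = "restrict_space lborel ?V"
  have V: "?V \<in> sets lborel" using chart_open(2)[OF atlas_chart[OF c]] by simp
  have md[measurable]: "volume_density c \<in> borel_measurable ?R" by (rule volume_density_measurable[OF c])
  have mi[measurable]: "chart_inv c \<in> measurable ?R borel" by (rule chart_inv_measurable[OF atlas_chart[OF c]])
  have mi': "chart_inv c \<in> measurable (density ?R (\<lambda>x. ennreal (volume_density c x))) borel" by simp
  let ?W = "chart_inv c -` E \<inter> space ?R"
  have "emeasure (chart_measure c) E = emeasure (density ?R (\<lambda>x. ennreal (volume_density c x))) ?W"
    unfolding chart_measure_def using E mi' by (subst emeasure_distr) auto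
  also have "\<dots> = (\<integral>\<^sup>+x. ennreal (volume_density c x) * indicator ?W x \<partial>?R)"
    by (rule emeasure_density) (use measurable_sets[OF mi E] in auto)
  also have "\<dots> = (\<integral>\<^sup>+x. ennreal (volume_density c x) * indicator ?W x * indicator ?V x \<partial>lborel)"
    by (rule nn_integral_restrict_space) (use V in simp)
  also have "\<dots> = (\<integral>\<^sup>+x\<in>snd c ` (fst c \<inter> E). ennreal (volume_density c x) \<partial>lborel)"
    by (rule nn_integral_cong)
      (auto simp: chart_image_eq_vimage[OF atlas_chart[OF c]] space_restrict_space indicator_def)
  finally show ?thesis .
qed

lemma extended_density_measurable:
  assumes "c \<in> atlas M"
  shows "(\<lambda>x. indicator (image_of c) x * volume_density c x) \<in> borel_measurable borel"
  using borel_measurable_continuous_on_indicator[OF _ volume_density_continuous[OF assms]]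
    chart_open(2)[OF atlas_chart[OF assms]] by simp

text \<open>
  The factor that the change of variables formula introduces is the Jacobian determinant by which the
  two volume densities differ. The case of the identity map shows that the measures of two
  charts agree where both are defined.
\<close>

lemma chart_measure_image:
  assumes h: "local_isometry h" "inj_on h E" and c: "c \<in> atlas M" "c' \<in> atlas M"
    and E: "E \<in> sets borel" "h ` E \<in> sets borel" "E \<subseteq> fst c" "h ` E \<subseteq> fst c'"
  shows "emeasure (chart_measure c') (h ` E) = emeasure (chart_measure c) E"
proof -
  note cc = atlas_chart[OF c(1)] and cc' = atlas_chart[OF c(2)]
  let ?\<tau> = "local_rep h c c'" and ?S = "snd c ` E"
  have S: "?S \<subseteq> local_dom h c c'" unfolding local_dom_def using E(3,4) by blast
  have im: "?\<tau> ` ?S = snd c' ` (h ` E)" by (rule local_rep_image[OF cc E(3)])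
  have Eint: "fst c \<inter> E = E" "fst c' \<inter> h ` E = h ` E" using E by auto
  let ?f = "\<lambda>x. indicator (image_of c') x * volume_density c' x"
  let ?h = "\<lambda>x. indicator (image_of c) x * volume_density c x"
  have pos: "0 \<le> ?f x" "0 \<le> ?h x" for x
    using volume_density_pos[OF c(1), of x] volume_density_pos[OF c(2), of x] by (auto simp: indicator_def)
  have "(\<integral>\<^sup>+y. ennreal (?f y * indicator (?\<tau> ` ?S) y) \<partial>lborel) = (\<integral>\<^sup>+x. ennreal (?h x * indicator ?S x) \<partial>lborel)"
  proof (rule nn_integral_change_of_variables[OF _ _ extended_density_measurable extended_density_measurable pos])
    show "?S \<in> sets borel" using chart_image_borel[OF cc E(1)] Eint by simp
    show "?\<tau> ` ?S \<in> sets borel" unfolding im using chart_image_borel[OF cc' E(2)] Eint by simp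
    show "inj_on ?\<tau> ?S"
    proof (rule inj_onI)
      fix x y assume xy: "x \<in> ?S" "y \<in> ?S" "?\<tau> x = ?\<tau> y"
      then obtain p q where pq: "p \<in> E" "q \<in> E" "x = snd c p" "y = snd c q" by auto
      then have "snd c' (h p) = snd c' (h q)"
        using xy(3) E(3) chart_inv_left[OF cc] by (auto simp: local_rep_def subset_iff)
      then have "h p = h q" using chart_inj[OF cc'] pq E(4) by (auto simp: inj_on_def)
      then show "x = y" using h(2) pq by (auto simp: inj_on_def)
    qed
    fix x assume x: "x \<in> ?S"
    then have xd: "x \<in> local_dom h c c'" using S by auto
    show "(?\<tau> has_derivative frechet_derivative ?\<tau> (at x)) (at x within ?S)"
      using local_rep_derivative[OF _ c xd] h(1) has_derivative_at_withinI by blast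
    show "?h x = \<bar>det (matrix (frechet_derivative ?\<tau> (at x)))\<bar> * ?f (?\<tau> x)"
      using volume_density_pullback[OF h(1) c xd] local_rep_maps(1)[OF c(1) xd] xd local_dom_subset[of h c c']
      by (auto simp: jacobian_def)
  qed (use c in auto)
  moreover have "(\<integral>\<^sup>+y. ennreal (?f y * indicator (?\<tau> ` ?S) y) \<partial>lborel) = emeasure (chart_measure c') (h ` E)"
    unfolding emeasure_chart_measure[OF c(2) E(2)] Eint im
    by (rule nn_integral_cong) (use E(4) in \<open>auto simp: indicator_def\<close>)
  moreover have "(\<integral>\<^sup>+x. ennreal (?h x * indicator ?S x) \<partial>lborel) = emeasure (chart_measure c) E"
    unfolding emeasure_chart_measure[OF c(1) E(1)] Eint
    by (rule nn_integral_cong) (use E(3) in \<open>auto simp: indicator_def\<close>)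
  ultimately show ?thesis by simp
qed

lemma chart_measure_consistent:
  assumes "c \<in> atlas M" "c' \<in> atlas M" "E \<in> sets borel" "E \<subseteq> fst c" "E \<subseteq> fst c'"
  shows "emeasure (chart_measure c') E = emeasure (chart_measure c) E"
  using chart_measure_image[OF local_isometry_id, of E c c'] assms by simp

end

section \<open>The Riemannian measure of a compact manifold\<close>

locale compact_riemannian = riemannian M
  for M :: "('a::{t2_space, second_countable_topology}, 'n::finite) riem" +
  assumes compact_UNIV: "compact (UNIV :: 'a set)"
begin

text \<open>
  A finite Borel partition into sets that lie in one chart each. Compactness provides it, and measures
  can be defined and compared on its pieces.
\<close>

definition chart_partition :: "nat \<Rightarrow> (nat \<Rightarrow> ('a, 'n) chart) \<Rightarrow> (nat \<Rightarrow> 'a set) \<Rightarrow> bool" where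
  "chart_partition N cs P \<longleftrightarrow> (\<forall>i<N. cs i \<in> atlas M \<and> P i \<subseteq> fst (cs i)) \<and> (\<forall>i. P i \<in> sets borel) \<and>
    disjoint_family P \<and> (\<Union>i<N. P i) = UNIV"

text \<open>
  From a finite subcover by chart domains, remove from each member the union of the earlier ones.
\<close>

lemma chart_partition_exists: "\<exists>N cs P. chart_partition N cs P"
proof -
  have "UNIV \<subseteq> (\<Union>c\<in>atlas M. fst c)" using atlas_cover by auto
  then obtain D where D: "D \<subseteq> atlas M" "finite D" "UNIV \<subseteq> (\<Union>c\<in>D. fst c)"
    using compactE_image[OF compact_UNIV, of "atlas M" fst] chart_open(1)[OF atlas_chart] by metis
  obtain cs where cs: "bij_betw cs {0..<card D} D" using ex_bij_betw_nat_finite[OF D(2)] by blast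
  define N where "N = card D"
  define P where "P i = (if i < N then fst (cs i) - (\<Union>j<i. fst (cs j)) else {})" for i
  have csD: "cs i \<in> D" if "i < N" for i using cs that by (auto simp: bij_betw_def N_def)
  have op: "open (fst (cs i))" if "i < N" for i
    using csD[OF that] D(1) chart_open(1) atlas_chart by blast
  have "chart_partition N cs P"
    unfolding chart_partition_def
  proof (intro conjI)
    show "\<forall>i<N. cs i \<in> atlas M \<and> P i \<subseteq> fst (cs i)" using csD D(1) by (auto simp: P_def)
    show "\<forall>i. P i \<in> sets borel"
    proof
      fix i show "P i \<in> sets borel"
    proof (cases "i < N")
      case True
      have "open (\<Union>j<i. fst (cs j))" using op True by auto
      then show ?thesis using op[OF True] True unfolding P_def by (simp add: borel_open sets.Diff)
    qed (simp add: P_def)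
    qed
    show "disjoint_family P"
      unfolding disjoint_family_on_def
    proof (intro ballI impI)
      fix m n :: nat assume "m \<noteq> n"
      then have "m < n \<or> n < m" by auto
      then show "P m \<inter> P n = {}" unfolding P_def by auto
    qed
    show "(\<Union>i<N. P i) = UNIV"
    proof -
      have "\<exists>i<N. x \<in> P i" for x
      proof -
        obtain c where "c \<in> D" "x \<in> fst c" using D(3) by blast
        moreover have "D = cs ` {0..<N}" using cs by (simp add: bij_betw_def N_def)
        ultimately have "\<exists>i. i < N \<and> x \<in> fst (cs i)" by auto
        then obtain i where i: "i < N \<and> x \<in> fst (cs i)" and least: "\<And>j. j < i \<Longrightarrow> \<not> (j < N \<and> x \<in> fst (cs j))"
          using exists_least_iff[of "\<lambda>i. i < N \<and> x \<in> fst (cs i)"] by blast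
        have "x \<in> P i" unfolding P_def using i least by (auto dest: order.strict_trans)
        then show ?thesis using i by blast
      qed
      then show ?thesis by auto
    qed
  qed
  then show ?thesis by blast
qed

text \<open>
  \<open>riemannian_measure\<close> is a definite description. A measure with the required property is
  determined by its values on the pieces of a partition. Conversely, the sum of the chart measures of
  the pieces has the property, since chart measures agree on overlaps.
\<close>

lemma riemannian_measure_characterization:
  shows sets_vol: "sets vol = sets borel"
    and emeasure_vol: "\<And>c E. c \<in> atlas M \<Longrightarrow> E \<in> sets borel \<Longrightarrow> E \<subseteq> fst c \<Longrightarrow> emeasure vol E = emeasure (chart_measure c) E"
proof -
  obtain N cs P where part: "chart_partition N cs P" using chart_partition_exists by blast
  have cs: "cs i \<in> atlas M" and PU: "P i \<subseteq> fst (cs i)" if "i < N" for i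
    using part that by (auto simp: chart_partition_def)
  have Pb[measurable]: "P i \<in> sets borel" and disj: "disjoint_family P" and cov: "(\<Union>i<N. P i) = UNIV" for i
    using part by (auto simp: chart_partition_def)
  define Prop where "Prop \<mu> \<longleftrightarrow> sets \<mu> = sets borel \<and> (\<forall>c\<in>atlas M. \<forall>E\<in>sets borel. E \<subseteq> fst c \<longrightarrow>
           emeasure \<mu> E = (\<integral>\<^sup>+x\<in>snd c ` E. ennreal (sqrt (det (metric M c x))) \<partial>lborel))" for \<mu> :: "'a measure"
  have Prop_iff: "Prop \<mu> \<longleftrightarrow> sets \<mu> = sets borel \<and> (\<forall>c\<in>atlas M. \<forall>E\<in>sets borel. E \<subseteq> fst c \<longrightarrow>
           emeasure \<mu> E = emeasure (chart_measure c) E)" for \<mu>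
    unfolding Prop_def by (auto simp: emeasure_chart_measure Int_absorb1)
  define m where "m E = (\<Sum>i<N. emeasure (chart_measure (cs i)) (E \<inter> P i))" for E
  have split: "emeasure \<mu> E = (\<Sum>i<N. emeasure \<mu> (E \<inter> P i))" if "sets \<mu> = sets borel" "E \<in> sets borel" for \<mu> E
  proof -
    have "(\<Sum>i<N. emeasure \<mu> (E \<inter> P i)) = emeasure \<mu> (\<Union>i<N. E \<inter> P i)"
      by (rule sum_emeasure) (use that disj in \<open>auto simp: disjoint_family_on_def\<close>)
    also have "(\<Union>i<N. E \<inter> P i) = E" using cov by blast
    finally show ?thesis by simp
  qed
  have unique: "emeasure \<mu> E = m E" if \<mu>: "Prop \<mu>" and E: "E \<in> sets borel" for \<mu> E
  proof -
    have "emeasure \<mu> (E \<inter> P i) = emeasure (chart_measure (cs i)) (E \<inter> P i)" if "i < N" for i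
    proof -
      have "E \<inter> P i \<in> sets borel" "E \<inter> P i \<subseteq> fst (cs i)" using E Pb PU[OF that] by auto
      then show ?thesis using \<mu> cs[OF that] unfolding Prop_iff by simp
    qed
    then show ?thesis using split[OF _ E, of \<mu>] \<mu> by (simp add: m_def Prop_iff)
  qed
  define \<mu>0 where "\<mu>0 = measure_of UNIV (sets borel) m"
  have sigma: "sigma_algebra (UNIV :: 'a set) (sets borel)" by (metis sets.sigma_algebra_axioms space_borel)
  have ca: "countably_additive (sets borel) m"
    unfolding countably_additive_def
  proof (intro allI impI)
    fix A :: "nat \<Rightarrow> 'a set" assume A: "range A \<subseteq> sets borel" "disjoint_family A"
    have "(\<Sum>n. emeasure (chart_measure (cs i)) (A n \<inter> P i)) = emeasure (chart_measure (cs i)) (\<Union> (range A) \<inter> P i)" for i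
    proof -
      have "(\<Sum>n. emeasure (chart_measure (cs i)) (A n \<inter> P i)) = emeasure (chart_measure (cs i)) (\<Union>n. A n \<inter> P i)"
        by (rule suminf_emeasure) (use A in \<open>auto simp: sets_chart_measure disjoint_family_on_def\<close>)
      then show ?thesis by (simp add: Int_commute)
    qed
    then show "(\<Sum>n. m (A n)) = m (\<Union> (range A))"
      unfolding m_def by (subst suminf_sum) (auto intro: summableI)
  qed
  have em0: "emeasure \<mu>0 E = m E" if "E \<in> sets borel" for E
    unfolding \<mu>0_def by (rule emeasure_measure_of_sigma[OF sigma _ ca that]) (simp add: positive_def m_def)
  have sets0: "sets \<mu>0 = sets borel" unfolding \<mu>0_def using sigma_algebra.sigma_sets_eq[OF sigma] by simp
  have "Prop \<mu>0"
    unfolding Prop_iff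
  proof (intro conjI ballI impI sets0)
    fix c and E :: "'a set" assume c: "c \<in> atlas M" and E: "E \<in> sets borel" "E \<subseteq> fst c"
    have "m E = (\<Sum>i<N. emeasure (chart_measure c) (E \<inter> P i))"
      unfolding m_def
    proof (rule sum.cong[OF refl])
      fix i assume "i \<in> {..<N}"
      then have i: "i < N" by simp
      show "emeasure (chart_measure (cs i)) (E \<inter> P i) = emeasure (chart_measure c) (E \<inter> P i)"
        by (rule chart_measure_consistent[OF c cs[OF i]]) (use E PU[OF i] Pb in auto)
    qed
    also have "\<dots> = emeasure (chart_measure c) E" using split[OF sets_chart_measure E(1)] by simp
    finally show "emeasure \<mu>0 E = emeasure (chart_measure c) E" using em0[OF E(1)] by simp
  qed
  moreover have "\<mu> = \<mu>0" if "Prop \<mu>" for \<mu>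
    by (rule measure_eqI) (use that unique em0 sets0 in \<open>auto simp: Prop_def\<close>)
  ultimately have "vol = \<mu>0" unfolding riemannian_measure_def Prop_def by (intro the_equality) blast+
  then show "sets vol = sets borel"
    "\<And>c E. c \<in> atlas M \<Longrightarrow> E \<in> sets borel \<Longrightarrow> E \<subseteq> fst c \<Longrightarrow> emeasure vol E = emeasure (chart_measure c) E"
    using \<open>Prop \<mu>0\<close> by (auto simp: Prop_iff)
qed

lemma space_vol: "space vol = UNIV"
  using sets_eq_imp_space_eq[OF sets_vol] by simp

lemma measurable_vol: "measurable vol N = measurable borel N"
  by (rule measurable_cong_sets[OF sets_vol refl])

lemma vol_restrict_chart:
  assumes c: "c \<in> atlas M"
  shows "density vol (indicator (fst c)) = chart_measure c"
proof (rule measure_eqI)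
  show "sets (density vol (indicator (fst c))) = sets (chart_measure c)" by (simp add: sets_vol sets_chart_measure)
  fix E assume "E \<in> sets (density vol (indicator (fst c)))"
  then have E: "E \<in> sets borel" by (simp add: sets_vol)
  have U: "fst c \<in> sets borel" using chart_open(1)[OF atlas_chart[OF c]] by simp
  have "emeasure (density vol (indicator (fst c))) E = (\<integral>\<^sup>+x. indicator (fst c) x * indicator E x \<partial>vol)"
    by (rule emeasure_density) (use E U in \<open>auto simp: sets_vol measurable_vol\<close>)
  also have "\<dots> = (\<integral>\<^sup>+x. indicator (fst c \<inter> E) x \<partial>vol)"
    by (rule nn_integral_cong) (auto simp: indicator_def)
  also have "\<dots> = emeasure vol (fst c \<inter> E)" using E U by (simp add: sets_vol)
  also have "\<dots> = emeasure (chart_measure c) (fst c \<inter> E)" by (rule emeasure_vol[OF c]) (use E U in auto)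
  also have "\<dots> = emeasure (chart_measure c) E"
    using E U by (simp add: emeasure_chart_measure[OF c] Int_left_absorb)
  finally show "emeasure (density vol (indicator (fst c))) E = emeasure (chart_measure c) E" .
qed

lemma integral_chart:
  fixes k :: "'a \<Rightarrow> real"
  assumes c: "c \<in> atlas M" and k[measurable]: "k \<in> borel_measurable borel" and supp: "\<And>p. p \<notin> fst c \<Longrightarrow> k p = 0"
  shows "(\<integral>p. k p \<partial>vol) = (\<integral>x. indicator (image_of c) x * (volume_density c x * k (chart_inv c x)) \<partial>lborel)"
proof -
  let ?V = "image_of c" let ?R = "restrict_space lborel ?V"
  have U[measurable]: "fst c \<in> sets borel" using chart_open(1)[OF atlas_chart[OF c]] by simp
  have V: "?V \<inter> space lborel \<in> sets lborel" using chart_open(2)[OF atlas_chart[OF c]] by simp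
  have md[measurable]: "volume_density c \<in> borel_measurable ?R" by (rule volume_density_measurable[OF c])
  have mi[measurable]: "chart_inv c \<in> measurable ?R borel" by (rule chart_inv_measurable[OF atlas_chart[OF c]])
  have kci: "(\<lambda>x. k (chart_inv c x)) \<in> borel_measurable ?R" by measurable
  have "(\<integral>p. k p \<partial>vol) = (\<integral>p. indicator (fst c) p *\<^sub>R k p \<partial>vol)"
    by (rule Bochner_Integration.integral_cong) (use supp in \<open>auto simp: indicator_def\<close>)
  also have "\<dots> = (\<integral>p. k p \<partial>density vol (\<lambda>p. ennreal (indicator (fst c) p)))"
    by (rule integral_density[symmetric]) (auto simp: measurable_vol)
  also have "\<dots> = (\<integral>p. k p \<partial>chart_measure c)"
    using vol_restrict_chart[OF c] by (simp add: ennreal_indicator)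
  also have "\<dots> = (\<integral>x. k (chart_inv c x) \<partial>density ?R (\<lambda>x. ennreal (volume_density c x)))"
    unfolding chart_measure_def by (rule integral_distr) auto
  also have "\<dots> = (\<integral>x. volume_density c x *\<^sub>R k (chart_inv c x) \<partial>?R)"
  proof (rule integral_density[OF kci md])
    show "AE x in ?R. 0 \<le> volume_density c x"
      by (rule AE_I2) (use volume_density_pos[OF c] in \<open>force simp: space_restrict_space less_imp_le\<close>)
  qed
  also have "\<dots> = (\<integral>x. indicator ?V x *\<^sub>R (volume_density c x *\<^sub>R k (chart_inv c x)) \<partial>lborel)"
    by (rule integral_restrict_space[OF V])
  finally show ?thesis by simp
qed

text \<open>
  The density is positive and nonempty open sets of coordinates are not negligible.
\<close>

lemma vol_open_pos:
  assumes "open W" "W \<noteq> {}"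
  shows "emeasure vol W > 0"
proof -
  obtain p where p: "p \<in> W" using assms by auto
  obtain c where c: "c \<in> atlas M" "p \<in> fst c" using atlas_cover by blast
  note cc = atlas_chart[OF c(1)]
  have Wb: "W \<in> sets borel" "fst c \<in> sets borel" using assms chart_open(1)[OF cc] by auto
  let ?T = "snd c ` (fst c \<inter> W)"
  have T: "open ?T" "snd c p \<in> ?T" using chart_image_open[OF cc assms(1)] p c by auto
  have "(\<integral>\<^sup>+x\<in>?T. ennreal (volume_density c x) \<partial>lborel) \<noteq> 0"
  proof
    assume z: "(\<integral>\<^sup>+x\<in>?T. ennreal (volume_density c x) \<partial>lborel) = 0"
    have "?T \<subseteq> image_of c" by auto
    then have eq: "(\<lambda>x. ennreal (volume_density c x) * indicator ?T x) = (\<lambda>x. ennreal (indicator (image_of c) x * volume_density c x) * indicator ?T x)"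
      by (auto simp: indicator_def fun_eq_iff)
    have m: "(\<lambda>x. ennreal (volume_density c x) * indicator ?T x) \<in> borel_measurable lborel"
    proof -
      have [measurable]: "?T \<in> sets borel" "(\<lambda>x. indicator (image_of c) x * volume_density c x) \<in> borel_measurable borel"
        using extended_density_measurable[OF c(1)] T(1) by auto
      show ?thesis unfolding eq by measurable
    qed
    have "AE x in lborel. ennreal (volume_density c x) * indicator ?T x = 0"
      using z m by (simp add: nn_integral_0_iff_AE)
    moreover have "ennreal (volume_density c x) * indicator ?T x \<noteq> 0" if "x \<in> ?T" for x
      using that volume_density_pos[OF c(1), of x] by auto
    ultimately have "AE x in lborel. x \<notin> ?T" by (auto elim!: eventually_mono)
    then have "?T \<in> null_sets lborel" using T(1) AE_iff_null_sets[of ?T lborel] by simp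
    then have "negligible ?T" by (simp add: negligible_iff_null_sets null_sets_completionI)
    then show False using open_not_negligible[OF T(1)] T(2) by blast
  qed
  then have "emeasure vol (fst c \<inter> W) \<noteq> 0"
    using emeasure_vol[OF c(1), of "fst c \<inter> W"] emeasure_chart_measure[OF c(1), of "fst c \<inter> W"] Wb
    by (simp add: Int_left_absorb)
  moreover have "emeasure vol (fst c \<inter> W) \<le> emeasure vol W"
    by (rule emeasure_mono) (use Wb in \<open>auto simp: sets_vol\<close>)
  ultimately show ?thesis by (metis not_gr_zero le_zero_eq)
qed

text \<open>
  The density is bounded on a closed coordinate ball, so every point has a neighbourhood of finite
  measure, and finitely many of these cover the manifold.
\<close>

lemma vol_finite: "finite_measure vol"
proof (rule finite_measureI)
  have "\<exists>W. open W \<and> p \<in> W \<and> emeasure vol W < \<infinity>" for p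
  proof -
    obtain c where c: "c \<in> atlas M" "p \<in> fst c" using atlas_cover by blast
    note cc = atlas_chart[OF c(1)]
    obtain r where r: "r > 0" "cball (snd c p) r \<subseteq> image_of c"
      using open_contains_cball[of "image_of c"] chart_open(2)[OF cc] c(2) by blast
    have "compact (volume_density c ` cball (snd c p) r)"
      by (intro compact_continuous_image continuous_on_subset[OF volume_density_continuous[OF c(1)] r(2)]) auto
    then have "bounded (volume_density c ` cball (snd c p) r)" by (rule compact_imp_bounded)
    then obtain K where "\<forall>y\<in>volume_density c ` cball (snd c p) r. norm y \<le> K" unfolding bounded_iff by blast
    then have K: "volume_density c x \<le> K" if "x \<in> cball (snd c p) r" for x
      using that by (metis abs_le_D1 imageI real_norm_def)
    define W where "W = fst c \<inter> snd c -` ball (snd c p) r"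
    have W: "open W" "p \<in> W"
      using continuous_open_preimage[OF chart_cont(1)[OF cc] chart_open(1)[OF cc] open_ball] c r by (auto simp: W_def)
    have im: "snd c ` (fst c \<inter> W) \<subseteq> cball (snd c p) r" by (auto simp: W_def)
    have "emeasure vol W = (\<integral>\<^sup>+x\<in>snd c ` (fst c \<inter> W). ennreal (volume_density c x) \<partial>lborel)"
      using emeasure_vol[OF c(1), of W] emeasure_chart_measure[OF c(1), of W] W by (auto simp: W_def)
    also have "\<dots> \<le> (\<integral>\<^sup>+x\<in>cball (snd c p) r. ennreal K \<partial>lborel)"
      by (rule nn_integral_mono) (use im K in \<open>auto simp: indicator_def ennreal_leI\<close>)
    also have "\<dots> = ennreal K * emeasure lborel (cball (snd c p) r)" by (simp add: nn_integral_cmult_indicator)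
    also have "\<dots> < \<infinity>" by (simp add: ennreal_mult_less_top emeasure_bounded_finite[OF bounded_cball, simplified])
    finally show ?thesis using W by blast
  qed
  then obtain W where W: "\<And>p. open (W p) \<and> p \<in> W p \<and> emeasure vol (W p) < \<infinity>" by metis
  obtain D where D: "finite D" "UNIV \<subseteq> (\<Union>p\<in>D. W p)"
    using compactE_image[OF compact_UNIV, of UNIV W] W by (metis UNIV_I UN_I subsetI)
  have "emeasure vol (\<Union>p\<in>D. W p) \<le> (\<Sum>p\<in>D. emeasure vol (W p))"
    by (rule emeasure_subadditive_finite) (use D W in \<open>auto simp: sets_vol\<close>)
  also have "\<dots> < \<infinity>" using D(1) W by (induction D rule: finite_induct) auto
  finally show "emeasure vol (space vol) \<noteq> \<infinity>" using top.extremum_uniqueI[OF D(2)] by (simp add: space_vol)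
qed

text \<open>
  Cut a set into pieces \<open>E \<inter> P i \<inter> h -` P j\<close>. Each is mapped by \<open>h\<close> from one chart to another, where
  \<open>chart_measure_image\<close> applies.
\<close>

lemma isometry_measure_preserving:
  assumes h: "riemannian_isometry M h"
  shows "distr vol borel h = vol"
proof -
  note hD = riemannian_isometryD[OF h]
  have hm: "h \<in> measurable borel borel" "inv h \<in> measurable borel borel"
    using hD by (auto intro: borel_measurable_continuous_onI)
  have him: "h ` E = inv h -` E" for E
    by (simp add: bij_vimage_eq_inv_image[OF bij_imp_bij_inv[OF hD(2)]] inv_inv_eq[OF hD(2)])
  have hb: "h ` E \<in> sets borel" if "E \<in> sets borel" for E
    unfolding him using measurable_sets[OF hm(2) that] by simp
  have inj: "inj h" using hD(2) by (rule bij_is_inj)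
  obtain N cs P where part: "chart_partition N cs P" using chart_partition_exists by blast
  have cs: "cs i \<in> atlas M" and PU: "P i \<subseteq> fst (cs i)" if "i < N" for i
    using part that by (auto simp: chart_partition_def)
  have Pb[measurable]: "P i \<in> sets borel" and disj: "disjoint_family P" and cov: "(\<Union>i<N. P i) = UNIV" for i
    using part by (auto simp: chart_partition_def)
  have eq: "emeasure vol (h ` E) = emeasure vol E" if E: "E \<in> sets borel" for E
  proof -
    define Q where "Q ij = E \<inter> P (fst ij) \<inter> h -` P (snd ij)" for ij :: "nat \<times> nat"
    have Qb: "Q ij \<in> sets borel" for ij
      unfolding Q_def using E Pb measurable_sets[OF hm(1) Pb] by auto
    have Qd: "disjoint_family_on Q T" for T
      using disj by (fastforce simp: disjoint_family_on_def Q_def)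
    have Qh: "disjoint_family_on (\<lambda>ij. h ` Q ij) T" for T
      using Qd[of T] inj by (fastforce simp: disjoint_family_on_def inj_def)
    have cov': "x \<in> (\<Union>i<N. P i)" for x using cov by blast
    have QU: "(\<Union>ij\<in>{..<N} \<times> {..<N}. Q ij) = E"
      using cov' unfolding Q_def by fastforce
    have q: "emeasure vol (h ` Q ij) = emeasure vol (Q ij)" if "ij \<in> {..<N} \<times> {..<N}" for ij
    proof -
      obtain i j where ij: "ij = (i, j)" "i < N" "j < N" using \<open>ij \<in> _\<close> by auto
      have sub: "Q ij \<subseteq> fst (cs i)" "h ` Q ij \<subseteq> fst (cs j)" using PU ij by (auto simp: Q_def)
      have "emeasure vol (h ` Q ij) = emeasure (chart_measure (cs j)) (h ` Q ij)"
        by (rule emeasure_vol[OF cs[OF ij(3)] hb[OF Qb] sub(2)])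
      also have "\<dots> = emeasure (chart_measure (cs i)) (Q ij)"
        by (rule chart_measure_image[OF hD(1) _ cs[OF ij(2)] cs[OF ij(3)] Qb hb[OF Qb] sub]) (use inj inj_on_subset in blast)
      also have "\<dots> = emeasure vol (Q ij)" by (rule emeasure_vol[OF cs[OF ij(2)] Qb sub(1), symmetric])
      finally show ?thesis .
    qed
    have "emeasure vol E = (\<Sum>ij\<in>{..<N} \<times> {..<N}. emeasure vol (Q ij))"
    proof -
      have "(\<Sum>ij\<in>{..<N} \<times> {..<N}. emeasure vol (Q ij)) = emeasure vol (\<Union>ij\<in>{..<N} \<times> {..<N}. Q ij)"
        by (rule sum_emeasure) (use Qd Qb in \<open>auto simp: sets_vol\<close>)
      then show ?thesis unfolding QU by simp
    qed
    also have "\<dots> = (\<Sum>ij\<in>{..<N} \<times> {..<N}. emeasure vol (h ` Q ij))" using q by simp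
    also have "\<dots> = emeasure vol (\<Union>ij\<in>{..<N} \<times> {..<N}. h ` Q ij)"
      by (rule sum_emeasure) (use Qh hb[OF Qb] in \<open>auto simp: sets_vol\<close>)
    also have "(\<Union>ij\<in>{..<N} \<times> {..<N}. h ` Q ij) = h ` E" unfolding QU[symmetric] by (simp only: image_UN)
    finally show ?thesis by simp
  qed
  show ?thesis
  proof (rule measure_eqI)
    show "sets (distr vol borel h) = sets vol" by (simp add: sets_vol)
    fix E assume "E \<in> sets (distr vol borel h)"
    then have E: "E \<in> sets borel" by simp
    have "emeasure (distr vol borel h) E = emeasure vol (h -` E)"
      using E hm(1) by (subst emeasure_distr) (auto simp: measurable_vol space_vol)
    also have "\<dots> = emeasure vol (h ` (h -` E))"
      using eq[of "h -` E"] measurable_sets[OF hm(1) E] by simp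
    also have "h ` (h -` E) = E" using hD(2) by (simp add: bij_is_surj surj_image_vimage_eq)
    finally show "emeasure (distr vol borel h) E = emeasure vol E" .
  qed
qed

lemma integral_isometry:
  fixes k :: "'a \<Rightarrow> real"
  assumes h: "riemannian_isometry M h" and k: "k \<in> borel_measurable borel"
  shows "(\<integral>p. k (h p) \<partial>vol) = (\<integral>p. k p \<partial>vol)"
proof -
  have "(\<integral>p. k p \<partial>distr vol borel h) = (\<integral>p. k (h p) \<partial>vol)"
    by (rule integral_distr) (use riemannian_isometryD(4)[OF h] k in \<open>auto simp: measurable_vol intro: borel_measurable_continuous_onI\<close>)
  then show ?thesis using isometry_measure_preserving[OF h] by simp
qed

lemma integrable_bounded:
  fixes k :: "'a \<Rightarrow> real"
  assumes "k \<in> borel_measurable borel" "\<And>p. \<bar>k p\<bar> \<le> C"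
  shows "integrable vol k"
proof -
  interpret finite_measure vol by (rule vol_finite)
  show ?thesis by (rule integrable_const_bound[of _ C]) (use assms in \<open>auto simp: measurable_vol\<close>)
qed

lemma continuous_bounded:
  fixes k :: "'a \<Rightarrow> real"
  assumes "continuous_on UNIV k"
  obtains C where "\<And>p. \<bar>k p\<bar> \<le> C"
proof -
  have "bounded (range k)" by (intro compact_imp_bounded compact_continuous_image assms compact_UNIV)
  then show thesis using that by (auto simp: bounded_iff)
qed

lemma integrable_continuous:
  fixes k :: "'a \<Rightarrow> real"
  assumes "continuous_on UNIV k"
  shows "integrable vol k"
proof -
  obtain C where "\<And>p. \<bar>k p\<bar> \<le> C" using continuous_bounded[OF assms] by blast
  then show ?thesis by (rule integrable_bounded[OF borel_measurable_continuous_onI[OF assms]])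
qed

text \<open>
  A nonnegative function with integral zero vanishes almost everywhere, and nonempty open sets are not
  null sets.
\<close>

lemma integral_continuous_nonneg_zero:
  fixes k :: "'a \<Rightarrow> real"
  assumes k: "continuous_on UNIV k" "\<And>p. k p \<ge> 0" and z: "(\<integral>p. k p \<partial>vol) = 0"
  shows "k p = 0"
proof (rule ccontr)
  assume "k p \<noteq> 0"
  have op: "open (k -` {0<..})" by (intro open_vimage k(1)) auto
  have "AE p in vol. k p = 0"
    using z integral_nonneg_eq_0_iff_AE[OF integrable_continuous[OF k(1)]] k(2) by auto
  then have "AE p in vol. \<not> 0 < k p" by (auto elim!: eventually_mono)
  then have "emeasure vol {p \<in> space vol. 0 < k p} = 0" by (rule emeasure_eq_0_AE)
  moreover have "{p \<in> space vol. 0 < k p} = k -` {0<..}" by (auto simp: space_vol)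
  ultimately have "emeasure vol (k -` {0<..}) = 0" by simp
  moreover have "p \<in> k -` {0<..}" using k(2)[of p] \<open>k p \<noteq> 0\<close> by auto
  ultimately show False using vol_open_pos[OF op] by auto
qed

end

section \<open>Integration by parts in Euclidean space\<close>

lemma Ck_on_partial_deriv:
  fixes f :: "real^'n::finite \<Rightarrow> real"
  assumes "Ck_on (Suc k) f S"
  shows "Ck_on k (partial_deriv i f) S"
  using Ck_on_SucE(2)[OF assms, of "axis i 1"] by (simp add: partial_deriv_def[abs_def] axis_in_Basis_iff)

lemma partial_deriv_eq:
  assumes "(f has_derivative f') (at x)"
  shows "partial_deriv i f x = f' (axis i 1)"
  using frechet_derivative_at[OF assms] by (simp add: partial_deriv_def)

text \<open>ibp\<close>
text \<open>
  The difference quotients \<open>(w (x + t e) - w x) / t\<close> integrate to zero by translation invariance. For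
  \<open>t \<longlonglongrightarrow> 0\<close> they converge to the partial derivative, and they are dominated by a multiple of the
  indicator function of a ball.
\<close>

lemma integral_partial_deriv_zero:
  fixes w :: "real^'n::finite \<Rightarrow> real"
  assumes w: "Ck_on 1 w UNIV" and K: "compact K" "\<And>x. x \<notin> K \<Longrightarrow> w x = 0"
  shows "(\<integral>x. partial_deriv i w x \<partial>lborel) = 0"
proof -
  define e :: "real^'n" where "e = axis i 1"
  have ne: "norm e = 1" by (simp add: e_def norm_axis_1)
  have wc: "continuous_on UNIV w" using w Ck_on_continuous by blast
  have pc: "continuous_on UNIV (partial_deriv i w)" using Ck_on_partial_deriv[of 0 w UNIV i] w by simp
  have der: "((\<lambda>s. w (x + s *\<^sub>R e)) has_real_derivative partial_deriv i w (x + s *\<^sub>R e)) (at s)" for x s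
  proof -
    have "(w has_derivative frechet_derivative w (at (x + s *\<^sub>R e))) (at (x + s *\<^sub>R e))"
      using w Ck_on_SucE(1)[of 0 w UNIV] by simp
    moreover have "((\<lambda>s. x + s *\<^sub>R e) has_derivative (\<lambda>h. h *\<^sub>R e)) (at s)"
      by (auto intro!: derivative_eq_intros)
    ultimately have "((\<lambda>s. w (x + s *\<^sub>R e)) has_derivative (\<lambda>h. frechet_derivative w (at (x + s *\<^sub>R e)) (h *\<^sub>R e))) (at s)"
      by (rule has_derivative_compose[rotated])
    moreover have "frechet_derivative w (at (x + s *\<^sub>R e)) (h *\<^sub>R e) = partial_deriv i w (x + s *\<^sub>R e) * h" for h
    proof -
      have "linear (frechet_derivative w (at (x + s *\<^sub>R e)))"
        using w linear_frechet_derivative[of w "at (x + s *\<^sub>R e)"] by simp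
      then show ?thesis by (simp add: linear_scale partial_deriv_def e_def)
    qed
    ultimately show ?thesis unfolding has_field_derivative_def by (simp add: fun_eq_iff)
  qed
  have supp: "partial_deriv i w x = 0" if "x \<notin> K" for x
  proof -
    have "((\<lambda>x. 0) has_derivative (\<lambda>h. 0)) (at x)" by simp
    then have "(w has_derivative (\<lambda>h. 0)) (at x)"
      by (rule has_derivative_transform_within_open[of _ _ _ _ "- K"]) (use K that compact_imp_closed in auto)
    then show ?thesis using partial_deriv_eq by blast
  qed
  obtain R where R: "\<And>x. x \<in> K \<Longrightarrow> norm x \<le> R"
    using compact_imp_bounded[OF K(1)] by (auto simp: bounded_iff)
  \<comment> \<open>the steps are at most \<open>1\<close>, so a unit margin contains the supports of all difference quotients\<close>
  define B where "B = cball (0 :: real^'n) (R + 1)"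
  obtain C where C: "\<And>x. \<bar>partial_deriv i w x\<bar> \<le> C"
  proof -
    have "bounded (partial_deriv i w ` K)"
      by (intro compact_imp_bounded compact_continuous_image continuous_on_subset[OF pc] K) auto
    then obtain C where "\<forall>y\<in>partial_deriv i w ` K. norm y \<le> C" unfolding bounded_iff by blast
    then have "\<bar>partial_deriv i w x\<bar> \<le> max C 0" for x
      using supp[of x] by (cases "x \<in> K") auto
    then show thesis using that by blast
  qed
  have C0: "C \<ge> 0" using C[of 0] by linarith
  define t where "t n = 1 / real (Suc n)" for n
  have t: "0 < t n" "t n \<le> 1" for n by (auto simp: t_def)
  define D where "D n x = (w (x + t n *\<^sub>R e) - w x) / t n" for n x
  have wint: "integrable lborel w"
  proof -
    have "integrable lborel (\<lambda>x. indicator K x *\<^sub>R w x)"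
      by (rule borel_integrable_compact[OF K(1) continuous_on_subset[OF wc]]) auto
    moreover have "(\<lambda>x. indicator K x *\<^sub>R w x) = w" using K(2) by (auto simp: fun_eq_iff indicator_def)
    ultimately show ?thesis by simp
  qed
  have wshift: "integrable lborel (\<lambda>x. w (x + t n *\<^sub>R e))" "(\<integral>x. w (x + t n *\<^sub>R e) \<partial>lborel) = (\<integral>x. w x \<partial>lborel)" for n
  proof -
    have d: "distr lborel borel ((+) (t n *\<^sub>R e)) = (lborel :: (real^'n) measure)" by (rule lborel_distr_plus)
    have [measurable]: "w \<in> borel_measurable borel" using wc borel_measurable_continuous_onI by blast
    have "integrable (distr lborel borel ((+) (t n *\<^sub>R e))) w" using wint by (simp add: d)
    then show "integrable lborel (\<lambda>x. w (x + t n *\<^sub>R e))"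
      by (subst (asm) integrable_distr_eq) (auto simp: add.commute)
    have "(\<integral>x. w x \<partial>distr lborel borel ((+) (t n *\<^sub>R e))) = (\<integral>x. w (t n *\<^sub>R e + x) \<partial>lborel)"
      by (rule integral_distr) auto
    then show "(\<integral>x. w (x + t n *\<^sub>R e) \<partial>lborel) = (\<integral>x. w x \<partial>lborel)" by (simp add: d add.commute)
  qed
  have D0: "(\<integral>x. D n x \<partial>lborel) = 0" for n
    unfolding D_def using wshift[of n] wint by simp
  have Dbound: "norm (D n x) \<le> indicator B x * C" for n x
  proof (cases "x \<in> B")
    case True
    obtain z where z: "0 < z" "z < t n" "w (x + t n *\<^sub>R e) - w (x + 0 *\<^sub>R e) = (t n - 0) * partial_deriv i w (x + z *\<^sub>R e)"
      using MVT2[OF t(1)[of n], of "\<lambda>s. w (x + s *\<^sub>R e)" "\<lambda>s. partial_deriv i w (x + s *\<^sub>R e)"] der by blast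
    then have "D n x = partial_deriv i w (x + z *\<^sub>R e)" using t(1)[of n] by (simp add: D_def)
    then show ?thesis using C True by simp
  next
    case False
    then have "norm x > R + 1" by (simp add: B_def)
    moreover have "norm x \<le> norm (x + t n *\<^sub>R e) + norm (t n *\<^sub>R e)" by (metis add_diff_cancel norm_triangle_ineq4)
    ultimately have "norm (x + t n *\<^sub>R e) > R" "norm x > R" using t[of n] ne by auto
    then have "x \<notin> K" "x + t n *\<^sub>R e \<notin> K" using R by force+
    then show ?thesis using K(2) False by (simp add: D_def)
  qed
  have tlim: "t \<longlonglongrightarrow> 0" unfolding t_def using LIMSEQ_inverse_real_of_nat by (simp add: divide_inverse)
  have Dlim: "(\<lambda>n. D n x) \<longlonglongrightarrow> partial_deriv i w x" for x
  proof -
    have "((\<lambda>h. (w (x + h *\<^sub>R e) - w x) / h) \<longlongrightarrow> partial_deriv i w x) (at 0)"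
      using der[of x 0] by (simp add: DERIV_def)
    moreover have "filterlim t (at 0) sequentially"
      using tlim t(1) by (auto simp: filterlim_at less_imp_neq[symmetric] intro!: always_eventually)
    ultimately show ?thesis unfolding D_def by (rule filterlim_compose)
  qed
  have "(\<lambda>n. \<integral>x. D n x \<partial>lborel) \<longlonglongrightarrow> (\<integral>x. partial_deriv i w x \<partial>lborel)"
  proof (rule integral_dominated_convergence)
    show "integrable lborel (\<lambda>x. indicator B x * C)"
      unfolding B_def using emeasure_bounded_finite[OF bounded_cball]
      by (intro integrable_mult_left integrable_real_indicator) auto
    show "partial_deriv i w \<in> borel_measurable lborel" using pc by (simp add: borel_measurable_continuous_onI)
    show "D n \<in> borel_measurable lborel" for n
      unfolding D_def using wshift(1)[of n] wint by (intro borel_measurable_divide borel_measurable_diff) auto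
  qed (use Dbound Dlim in auto)
  then show ?thesis using LIMSEQ_unique D0 by (simp add: LIMSEQ_const_iff)
qed

section \<open>The pairing of differentials\<close>

lemma matrix_inv_mult:
  fixes A :: "real^'n::finite^'n"
  assumes "det A \<noteq> 0"
  shows "A *v (matrix_inv A *v b) = b" "matrix_inv A *v (A *v b) = b"
proof -
  have "invertible A" using assms invertible_det_nz by blast
  then have "\<exists>A'. A ** A' = mat 1 \<and> A' ** A = mat 1" by (simp add: invertible_def)
  from someI_ex[OF this] have "A ** matrix_inv A = mat 1" "matrix_inv A ** A = mat 1"
    by (auto simp: matrix_inv_def)
  then show "A *v (matrix_inv A *v b) = b" "matrix_inv A *v (A *v b) = b"
    by (metis matrix_vector_mul_assoc matrix_vector_mul_lid)+
qed

lemma inner_transpose_matrix: "v \<bullet> (transpose A *v w) = (A *v v) \<bullet> (w :: real^'m::finite)" for A :: "real^'n::finite^'m"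
  using dot_lmul_matrix[of w A v] by (simp add: transpose_matrix_vector inner_commute)

lemma inner_matrix_transpose: "v \<bullet> (A *v w) = (transpose A *v v) \<bullet> w" for A :: "real^'n::finite^'m::finite"
  using inner_transpose_matrix[of v "transpose A" w] by (simp add: transpose_transpose)

text \<open>
  Cramer's rule makes the smooth dependence of \<open>matrix_inv A *v b\<close> on \<open>A\<close> and \<open>b\<close> evident.
\<close>

lemma matrix_inv_cramer:
  fixes A :: "real^'n::finite^'n"
  assumes "det A \<noteq> 0"
  shows "matrix_inv A *v b = (\<chi> k. det (\<chi> i j. if j = k then b $ i else A $ i $ j) / det A)"
  using cramer[OF assms] matrix_inv_mult(1)[OF assms] by blast

context riemannian begin

definition Ck_function :: "nat \<Rightarrow> ('a \<Rightarrow> real) \<Rightarrow> bool" where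
  "Ck_function k f \<longleftrightarrow> (\<forall>c\<in>atlas M. Ck_on k (f \<circ> chart_inv c) (image_of c))"

abbreviation "C1_function \<equiv> Ck_function 1"

definition differential :: "('a, 'n) chart \<Rightarrow> ('a \<Rightarrow> real) \<Rightarrow> real^'n \<Rightarrow> real^'n" where
  "differential c f x = (\<chi> i. partial_deriv i (f \<circ> chart_inv c) x)"

definition chart_pairing :: "('a, 'n) chart \<Rightarrow> ('a \<Rightarrow> real) \<Rightarrow> ('a \<Rightarrow> real) \<Rightarrow> real^'n \<Rightarrow> real" where
  "chart_pairing c u v x = (matrix_inv (metric M c x) *v differential c u x) \<bullet> differential c v x"

text \<open>
  The inner product \<open>\<langle>du, dv\<rangle>\<close> of the gradients of two functions. All integral identities are formulated
  with it, since it involves first derivatives only and is preserved by isometries.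
\<close>

definition pairing :: "('a \<Rightarrow> real) \<Rightarrow> ('a \<Rightarrow> real) \<Rightarrow> 'a \<Rightarrow> real" where
  "pairing u v p = chart_pairing (chart_at M p) u v (snd (chart_at M p) p)"

lemma image_open: "c \<in> atlas M \<Longrightarrow> open (image_of c)"
  using chart_open(2) atlas_chart by blast

lemma chart_at_atlas: "chart_at M p \<in> atlas M" "p \<in> fst (chart_at M p)"
proof -
  have "\<exists>c. c \<in> atlas M \<and> p \<in> fst c" using atlas_cover[of p] by blast
  from someI_ex[OF this] show "chart_at M p \<in> atlas M" "p \<in> fst (chart_at M p)"
    unfolding chart_at_def by blast+
qed

lemma smooth_function_iff: "smooth_function M f \<longleftrightarrow> (\<forall>k. Ck_function k f)"
  by (auto simp: smooth_function_def Ck_function_def smooth_on_def)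

lemma Ck_functionD: "Ck_function k f \<Longrightarrow> c \<in> atlas M \<Longrightarrow> Ck_on k (f \<circ> chart_inv c) (image_of c)"
  by (auto simp: Ck_function_def)

lemma Ck_function_le: "Ck_function k f \<Longrightarrow> j \<le> k \<Longrightarrow> Ck_function j f"
  unfolding Ck_function_def using Ck_on_le by blast

lemma C1_derivative:
  assumes "C1_function f" "c \<in> atlas M" "x \<in> image_of c"
  shows "(f \<circ> chart_inv c has_derivative frechet_derivative (f \<circ> chart_inv c) (at x)) (at x)"
  by (rule Ck_on_SucE(1)[OF Ck_functionD[OF assms(1,2), unfolded One_nat_def] assms(3)])

lemma continuous_on_from_chart:
  fixes k :: "'a \<Rightarrow> real"
  assumes c: "c \<in> atlas M" and "continuous_on (image_of c) (k \<circ> chart_inv c)"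
  shows "continuous_on (fst c) k"
proof -
  have "continuous_on (fst c) (\<lambda>p. (k \<circ> chart_inv c) (snd c p))"
    by (rule continuous_on_compose2[OF assms(2) chart_cont(1)[OF atlas_chart[OF c]]]) auto
  then show ?thesis
    by (rule continuous_on_eq) (simp add: chart_inv_left[OF atlas_chart[OF c]])
qed

text \<open>
  Quantities that are given by a formula in each chart are continuous if the formula is.
\<close>

lemma continuous_on_from_atlas:
  fixes k :: "'a \<Rightarrow> real"
  assumes "\<And>c. c \<in> atlas M \<Longrightarrow> continuous_on (image_of c) (k \<circ> chart_inv c)"
  shows "continuous_on UNIV k"
proof -
  have "isCont k p" for p
  proof -
    obtain c where c: "c \<in> atlas M" "p \<in> fst c" using atlas_cover by blast
    then show ?thesis
      using continuous_on_from_chart[OF c(1) assms[OF c(1)]] chart_open(1)[OF atlas_chart[OF c(1)]]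
      by (simp add: continuous_on_eq_continuous_at)
  qed
  then show ?thesis by (simp add: continuous_at_imp_continuous_on)
qed

lemma Ck_function_continuous: "Ck_function k f \<Longrightarrow> continuous_on UNIV f"
  using continuous_on_from_atlas Ck_functionD Ck_on_continuous by blast

lemma Ck_function_const: "Ck_function k (\<lambda>p. r)"
  by (auto simp: Ck_function_def o_def intro: Ck_on_const image_open)

lemma Ck_function_add: "Ck_function k f \<Longrightarrow> Ck_function k g \<Longrightarrow> Ck_function k (\<lambda>p. f p + g p)"
  by (auto simp: Ck_function_def o_def intro: Ck_on_add image_open)

lemma Ck_function_mult: "Ck_function k f \<Longrightarrow> Ck_function k g \<Longrightarrow> Ck_function k (\<lambda>p. f p * g p)"
  by (auto simp: Ck_function_def o_def intro: Ck_on_mult image_open)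

lemma Ck_function_sum: "(\<And>i. i \<in> I \<Longrightarrow> Ck_function k (f i)) \<Longrightarrow> Ck_function k (\<lambda>p. \<Sum>i\<in>I. f i p)"
  by (induction I rule: infinite_finite_induct) (auto intro: Ck_function_const Ck_function_add)

lemma Ck_function_inverse: "Ck_function k f \<Longrightarrow> (\<And>p. f p > 0) \<Longrightarrow> Ck_function k (\<lambda>p. inverse (f p))"
  by (auto simp: Ck_function_def o_def intro: Ck_on_inverse image_open)

lemma Ck_function_compose_real:
  assumes "Ck_function k f" "Ck_real k g T" "range f \<subseteq> T"
  shows "Ck_function k (\<lambda>p. g (f p))"
  unfolding Ck_function_def
proof
  fix c assume c: "c \<in> atlas M"
  have "Ck_on k (\<lambda>x. g ((f \<circ> chart_inv c) x)) (image_of c)"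
    by (rule Ck_on_compose_real[OF image_open[OF c] Ck_functionD[OF assms(1) c] assms(2)]) (use assms(3) in auto)
  then show "Ck_on k ((\<lambda>p. g (f p)) \<circ> chart_inv c) (image_of c)" by (simp add: o_def)
qed

lemma compose_in_charts:
  assumes h: "smooth_map M h" and c: "c \<in> atlas M" "c' \<in> atlas M" and x: "x \<in> local_dom h c c'"
  shows "(f \<circ> h \<circ> chart_inv c) x = (f \<circ> chart_inv c') (local_rep h c c' x)"
  using local_rep_maps[OF c(1) x] chart_inv_left[OF atlas_chart[OF c(2)]] by simp

lemma C1_function_compose_map:
  assumes f: "C1_function f" and h: "smooth_map M h"
  shows "C1_function (f \<circ> h)"
  unfolding Ck_function_def
proof
  fix c assume c: "c \<in> atlas M"
  show "Ck_on 1 (f \<circ> h \<circ> chart_inv c) (image_of c)"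
  proof (rule Ck_on_local)
    fix x assume x: "x \<in> image_of c"
    obtain c' where c': "c' \<in> atlas M" "h (chart_inv c x) \<in> fst c'" using atlas_cover by blast
    let ?D = "local_dom h c c'"
    have op: "open ?D" using local_dom_open[OF c c'(1)] h by (simp add: smooth_map_def)
    have xD: "x \<in> ?D"
      using x c'(2) chart_inv_left[OF atlas_chart[OF c]] by (auto simp: local_dom_def)
    have "Ck_on 1 (\<lambda>x. (f \<circ> chart_inv c') (local_rep h c c' x)) ?D"
      by (rule C1_compose[OF op local_rep_smooth[OF h c c'(1)] image_open[OF c'(1)] Ck_functionD[OF f c'(1)]])
        (use local_rep_maps(1)[OF c] in blast)
    then have "Ck_on 1 (f \<circ> h \<circ> chart_inv c) ?D"
      by (rule Ck_on_cong[OF op, rotated]) (rule compose_in_charts[OF h c c'(1), symmetric])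
    then show "\<exists>T. open T \<and> x \<in> T \<and> Ck_on 1 (f \<circ> h \<circ> chart_inv c) T" using op xD by blast
  qed
qed

lemma differential_eqI:
  assumes "(f \<circ> chart_inv c has_derivative f') (at x)"
  shows "differential c f x = (\<chi> i. f' (axis i 1))"
  using partial_deriv_eq[OF assms] by (simp add: differential_def)

lemma differential_add:
  assumes "C1_function f" "C1_function g" "c \<in> atlas M" "x \<in> image_of c"
  shows "differential c (\<lambda>p. f p + g p) x = differential c f x + differential c g x"
proof -
  note df = C1_derivative[OF assms(1,3,4)] and dg = C1_derivative[OF assms(2,3,4)]
  have "((\<lambda>p. f p + g p) \<circ> chart_inv c has_derivative
      (\<lambda>h. frechet_derivative (f \<circ> chart_inv c) (at x) h + frechet_derivative (g \<circ> chart_inv c) (at x) h)) (at x)"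
    using has_derivative_add[OF df dg] by (simp add: o_def)
  from differential_eqI[OF this] show ?thesis
    by (simp add: differential_eqI[OF df] differential_eqI[OF dg] vec_eq_iff)
qed

lemma differential_mult:
  assumes "C1_function f" "C1_function g" "c \<in> atlas M" "x \<in> image_of c"
  shows "differential c (\<lambda>p. f p * g p) x = f (chart_inv c x) *\<^sub>R differential c g x + g (chart_inv c x) *\<^sub>R differential c f x"
proof -
  note df = C1_derivative[OF assms(1,3,4)] and dg = C1_derivative[OF assms(2,3,4)]
  have "((\<lambda>p. f p * g p) \<circ> chart_inv c has_derivative
      (\<lambda>h. (f \<circ> chart_inv c) x * frechet_derivative (g \<circ> chart_inv c) (at x) h + frechet_derivative (f \<circ> chart_inv c) (at x) h * (g \<circ> chart_inv c) x)) (at x)"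
    using has_derivative_mult[OF df dg] by (simp add: o_def)
  from differential_eqI[OF this] show ?thesis
    by (simp add: differential_eqI[OF df] differential_eqI[OF dg] vec_eq_iff algebra_simps)
qed

lemma differential_compose_real:
  assumes f: "C1_function f" and "c \<in> atlas M" "x \<in> image_of c"
    and g: "(g has_real_derivative g') (at (f (chart_inv c x)) within T)" "range f \<subseteq> T"
  shows "differential c (\<lambda>p. g (f p)) x = g' *\<^sub>R differential c f x"
proof -
  note df = C1_derivative[OF assms(1-3)]
  have "((\<lambda>x. g ((f \<circ> chart_inv c) x)) has_derivative (\<lambda>h. g' * frechet_derivative (f \<circ> chart_inv c) (at x) h)) (at x)"
    by (rule has_derivative_compose_real[OF df open_UNIV]) (use g in auto)
  then have "((\<lambda>p. g (f p)) \<circ> chart_inv c has_derivative (\<lambda>h. g' * frechet_derivative (f \<circ> chart_inv c) (at x) h)) (at x)"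
    by (simp add: o_def)
  from differential_eqI[OF this] show ?thesis
    by (simp add: differential_eqI[OF df] vec_eq_iff)
qed

text \<open>
  The chain rule: differentials transform with the transposed Jacobian matrix.
\<close>

lemma differential_pullback:
  assumes f: "C1_function f" and h: "smooth_map M h" and c: "c \<in> atlas M" "c' \<in> atlas M" and x: "x \<in> local_dom h c c'"
  shows "differential c (f \<circ> h) x = transpose (jacobian (local_rep h c c') (at x)) *v differential c' f (local_rep h c c' x)"
proof -
  let ?\<tau> = "local_rep h c c'" let ?d\<tau> = "frechet_derivative ?\<tau> (at x)" let ?df = "frechet_derivative (f \<circ> chart_inv c') (at (?\<tau> x))"
  have op: "open (local_dom h c c')" using local_dom_open[OF c] h by (simp add: smooth_map_def)
  have tx: "?\<tau> x \<in> image_of c'" using local_rep_maps(1)[OF c(1) x] .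
  have df: "(f \<circ> chart_inv c' has_derivative ?df) (at (?\<tau> x))" by (rule C1_derivative[OF f c(2) tx])
  have d: "((\<lambda>x. (f \<circ> chart_inv c') (?\<tau> x)) has_derivative (\<lambda>v. ?df (?d\<tau> v))) (at x)"
    by (rule has_derivative_compose[OF local_rep_derivative[OF h c x] df])
  have "(f \<circ> h \<circ> chart_inv c has_derivative (\<lambda>v. ?df (?d\<tau> v))) (at x)"
    by (rule has_derivative_transform_within_open[OF d op x]) (rule compose_in_charts[OF h c, symmetric])
  from differential_eqI[OF this] have 1: "differential c (f \<circ> h) x = (\<chi> i. ?df (?d\<tau> (axis i 1)))" .
  have "?df v = (\<Sum>j\<in>UNIV. v $ j * differential c' f (?\<tau> x) $ j)" for v
    using frechet_derivative_basis_expansion[of "f \<circ> chart_inv c'" "?\<tau> x" v] df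
    by (auto simp: differential_def partial_deriv_def differentiable_def)
  then show ?thesis
    unfolding 1 by (simp add: vec_eq_iff matrix_vector_mult_def transpose_def jacobian_def matrix_def)
qed

text \<open>
  The Jacobian matrices of the differentials cancel against those of the inverse metric. For \<open>h = id\<close>
  this is the independence of the pairing from the chart.
\<close>

lemma chart_pairing_pullback:
  assumes u: "C1_function u" and v: "C1_function v" and h: "local_isometry h"
    and c: "c \<in> atlas M" "c' \<in> atlas M" and x: "x \<in> local_dom h c c'"
  shows "chart_pairing c (u \<circ> h) (v \<circ> h) x = chart_pairing c' u v (local_rep h c c' x)"
proof -
  let ?\<tau> = "local_rep h c c'" let ?J = "jacobian ?\<tau> (at x)" let ?g = "metric M c x" let ?g' = "metric M c' (?\<tau> x)"
  let ?a = "differential c' u (?\<tau> x)" let ?b = "differential c' v (?\<tau> x)"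
  have g: "?g = transpose ?J ** ?g' ** ?J" using metric_pullback[OF _ c x] h by blast
  have dg: "det ?g \<noteq> 0" "det ?g' \<noteq> 0"
    using metric_det_pos[OF c(1), of x] metric_det_pos[OF c(2) local_rep_maps(1)[OF c(1) x]] x local_dom_subset[of h c c'] by auto
  have "det (transpose ?J) \<noteq> 0" using dg g by (auto simp: det_mul det_transpose)
  then have inj: "transpose ?J *v y = transpose ?J *v z \<Longrightarrow> y = z" for y z
    using matrix_inv_mult(2) by metis
  define w where "w = matrix_inv ?g *v (transpose ?J *v ?a)"
  have "?g *v w = transpose ?J *v ?a" unfolding w_def by (rule matrix_inv_mult(1)[OF dg(1)])
  then have "transpose ?J *v (?g' *v (?J *v w)) = transpose ?J *v ?a"
    by (simp add: g matrix_vector_mul_assoc matrix_mul_assoc)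
  then have "?g' *v (?J *v w) = ?a" by (rule inj)
  then have Jw: "?J *v w = matrix_inv ?g' *v ?a" using matrix_inv_mult(2)[OF dg(2)] by metis
  have "chart_pairing c (u \<circ> h) (v \<circ> h) x = w \<bullet> (transpose ?J *v ?b)"
    using differential_pullback[OF u _ c x] differential_pullback[OF v _ c x] h by (simp add: chart_pairing_def w_def)
  also have "\<dots> = (?J *v w) \<bullet> ?b" by (rule inner_transpose_matrix)
  finally show ?thesis by (simp add: Jw chart_pairing_def)
qed

lemma pairing_chart:
  assumes u: "C1_function u" and v: "C1_function v" and c: "c \<in> atlas M" "p \<in> fst c"
  shows "pairing u v p = chart_pairing c u v (snd c p)"
proof -
  let ?c' = "chart_at M p"
  have x: "snd c p \<in> local_dom id c ?c'" using c chart_at_atlas(2)[of p] by (auto simp: local_dom_def)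
  have "local_rep id c ?c' (snd c p) = snd ?c' p"
    using chart_inv_left[OF atlas_chart[OF c(1)] c(2)] by (simp add: local_rep_def)
  then show ?thesis
    using chart_pairing_pullback[OF u v local_isometry_id c(1) chart_at_atlas(1) x] by (simp add: pairing_def)
qed

lemma pairing_isometry:
  assumes u: "C1_function u" and v: "C1_function v" and h: "local_isometry h"
  shows "pairing (u \<circ> h) (v \<circ> h) p = pairing u v (h p)"
proof -
  let ?c = "chart_at M p" let ?c' = "chart_at M (h p)"
  have x: "snd ?c p \<in> local_dom h ?c ?c'" using chart_at_atlas(2) by (auto simp: local_dom_def)
  have "local_rep h ?c ?c' (snd ?c p) = snd ?c' (h p)"
    using chart_inv_left[OF atlas_chart[OF chart_at_atlas(1)] chart_at_atlas(2)] by (simp add: local_rep_def)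
  then show ?thesis
    using chart_pairing_pullback[OF u v h chart_at_atlas(1) chart_at_atlas(1) x] by (simp add: pairing_def)
qed

lemma pairing_sym: "pairing u v p = pairing v u p"
proof -
  let ?c = "chart_at M p"
  let ?g = "metric M ?c (snd ?c p)" let ?a = "differential ?c u (snd ?c p)" let ?b = "differential ?c v (snd ?c p)"
  have x: "snd ?c p \<in> image_of ?c" using chart_at_atlas(2) by auto
  have dg: "det ?g \<noteq> 0" using metric_det_pos[OF chart_at_atlas(1) x] by simp
  have "(matrix_inv ?g *v ?a) \<bullet> ?b = (matrix_inv ?g *v ?a) \<bullet> (?g *v (matrix_inv ?g *v ?b))"
    by (simp add: matrix_inv_mult(1)[OF dg])
  also have "\<dots> = (transpose ?g *v (matrix_inv ?g *v ?a)) \<bullet> (matrix_inv ?g *v ?b)"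
    by (simp add: inner_matrix_transpose)
  also have "\<dots> = ?a \<bullet> (matrix_inv ?g *v ?b)"
    by (simp add: metric_symmetric[OF chart_at_atlas(1) x] matrix_inv_mult(1)[OF dg])
  finally show ?thesis by (simp add: pairing_def chart_pairing_def inner_commute)
qed

lemma pairing_add_right:
  assumes "C1_function f" "C1_function g"
  shows "pairing u (\<lambda>p. f p + g p) p = pairing u f p + pairing u g p"
  using differential_add[OF assms chart_at_atlas(1)] chart_at_atlas(2)[of p]
  by (simp add: pairing_def chart_pairing_def inner_add_right)

lemma pairing_mult_right:
  assumes "C1_function f" "C1_function g"
  shows "pairing u (\<lambda>p. f p * g p) p = f p * pairing u g p + g p * pairing u f p"
  using differential_mult[OF assms chart_at_atlas(1)] chart_at_atlas(2)[of p] chart_inv_left[OF atlas_chart[OF chart_at_atlas(1)] chart_at_atlas(2), of p]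
  by (simp add: pairing_def chart_pairing_def inner_add_right)

lemma pairing_compose_right:
  assumes "C1_function f" "(g has_real_derivative g') (at (f p) within T)" "range f \<subseteq> T"
  shows "pairing u (\<lambda>p. g (f p)) p = g' * pairing u f p"
proof -
  have "differential (chart_at M p) (\<lambda>p. g (f p)) (snd (chart_at M p) p) = g' *\<^sub>R differential (chart_at M p) f (snd (chart_at M p) p)"
    by (rule differential_compose_real[OF assms(1) chart_at_atlas(1) _ _ assms(3)])
      (use assms(2) chart_at_atlas(2)[of p] chart_inv_left[OF atlas_chart[OF chart_at_atlas(1)] chart_at_atlas(2), of p] in auto)
  then show ?thesis by (simp add: pairing_def chart_pairing_def)
qed

lemma pairing_const_right: "pairing u (\<lambda>p. r) p = 0"
proof -
  have "differential c (\<lambda>p. r) x = 0" for c x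
    by (rule differential_eqI[of "\<lambda>p. r" c "\<lambda>h. 0" x, THEN trans]) (auto simp: o_def vec_eq_iff)
  then show ?thesis by (simp add: pairing_def chart_pairing_def)
qed

lemma pairing_sum_right:
  assumes "\<And>i. i \<in> I \<Longrightarrow> C1_function (f i)"
  shows "pairing u (\<lambda>p. \<Sum>i\<in>I. f i p) p = (\<Sum>i\<in>I. pairing u (f i) p)"
  using assms
  by (induction I rule: infinite_finite_induct) (simp_all add: pairing_const_right pairing_add_right Ck_function_sum)

end

section \<open>Green's identity\<close>

lemma integrable_compact_support:
  fixes f :: "real^'n::finite \<Rightarrow> real"
  assumes "continuous_on V f" "compact K" "K \<subseteq> V" "\<And>x. x \<in> V \<Longrightarrow> x \<notin> K \<Longrightarrow> f x = 0"
  shows "integrable lborel (\<lambda>x. indicator V x * f x)"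
proof -
  have "integrable lborel (\<lambda>x. indicator K x *\<^sub>R f x)"
    by (rule borel_integrable_compact[OF assms(2) continuous_on_subset[OF assms(1,3)]])
  moreover have "(\<lambda>x. indicator K x *\<^sub>R f x) = (\<lambda>x. indicator V x * f x)"
    using assms(3,4) by (auto simp: fun_eq_iff indicator_def)
  ultimately show ?thesis by simp
qed

context riemannian begin

text \<open>
  The components of the gradient as a density. In these terms the Laplacian is minus a sum of
  partial derivatives, divided by the volume density.
\<close>

definition flux :: "('a, 'n) chart \<Rightarrow> ('a \<Rightarrow> real) \<Rightarrow> 'n \<Rightarrow> real^'n \<Rightarrow> real" where
  "flux c u i y = volume_density c y * (matrix_inv (metric M c y) *v differential c u y) $ i"

definition chart_laplacian :: "('a, 'n) chart \<Rightarrow> ('a \<Rightarrow> real) \<Rightarrow> real^'n \<Rightarrow> real" where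
  "chart_laplacian c u x = - ((\<Sum>i\<in>UNIV. partial_deriv i (flux c u i) x) / volume_density c x)"

lemma laplacian_eq: "laplacian M u p = chart_laplacian (chart_at M p) u (snd (chart_at M p) p)"
  by (simp add: laplacian_def divergence_def gradient_def chart_laplacian_def flux_def differential_def Let_def flux_def[abs_def] differential_def[abs_def])

lemma differential_smooth:
  assumes "Ck_function (Suc k) u" "c \<in> atlas M"
  shows "Ck_on k (\<lambda>y. differential c u y $ i) (image_of c)"
  using Ck_on_partial_deriv[OF Ck_functionD[OF assms], of i] by (simp add: differential_def)

text \<open>
  By Cramer's rule the components of the gradient are quotients of determinants.
\<close>

lemma gradient_smooth:
  assumes u: "Ck_function (Suc k) u" and c: "c \<in> atlas M"
  shows "Ck_on k (\<lambda>y. (matrix_inv (metric M c y) *v differential c u y) $ i) (image_of c)"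
proof -
  note V = image_open[OF c]
  have "Ck_on k (\<lambda>y. det (\<chi> ia j. if j = i then differential c u y $ ia else metric M c y $ ia $ j) / det (metric M c y)) (image_of c)"
  proof (intro Ck_on_divide[OF V] Ck_on_det[OF V])
    fix ia j
    have "Ck_on k (\<lambda>y. if j = i then differential c u y $ ia else metric M c y $ ia $ j) (image_of c)"
      using differential_smooth[OF u c] Ck_on_mat[OF V metric_smooth[OF c]] by (cases "j = i") auto
    then show "Ck_on k (\<lambda>y. (\<chi> ia j. if j = i then differential c u y $ ia else metric M c y $ ia $ j) $ ia $ j) (image_of c)"
      by simp
  next
    show "Ck_on k (\<lambda>x. metric M c x $ ia $ j) (image_of c)" for ia j by (rule Ck_on_mat[OF V metric_smooth[OF c]])
    show "0 < det (metric M c x)" if "x \<in> image_of c" for x using metric_det_pos[OF c that] .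
  qed
  then show ?thesis
  proof (rule Ck_on_cong[OF V, rotated])
    fix x assume "x \<in> image_of c"
    then have "det (metric M c x) \<noteq> 0" using metric_det_pos[OF c] by force
    then show "det (\<chi> ia j. if j = i then differential c u x $ ia else metric M c x $ ia $ j) / det (metric M c x) = (matrix_inv (metric M c x) *v differential c u x) $ i"
      by (simp add: matrix_inv_cramer)
  qed
qed

lemma flux_smooth:
  assumes "Ck_function (Suc k) u" "c \<in> atlas M"
  shows "Ck_on k (flux c u i) (image_of c)"
  unfolding flux_def[abs_def]
  by (intro Ck_on_mult image_open volume_density_smooth gradient_smooth assms)

lemma chart_laplacian_continuous:
  assumes u: "Ck_function 2 u" and c: "c \<in> atlas M"
  shows "continuous_on (image_of c) (chart_laplacian c u)"
proof -
  have "continuous_on (image_of c) (partial_deriv i (flux c u i))" for i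
    using Ck_on_partial_deriv[OF flux_smooth[of "Suc 0" u c i]] u c by (simp add: numeral_2_eq_2)
  then show ?thesis
    unfolding chart_laplacian_def[abs_def] using volume_density_pos[OF c]
    by (intro continuous_intros volume_density_continuous[OF c]) force+
qed

lemma chart_pairing_continuous:
  assumes u: "C1_function u" and v: "C1_function v" and c: "c \<in> atlas M"
  shows "continuous_on (image_of c) (chart_pairing c u v)"
proof -
  have 1: "continuous_on (image_of c) (\<lambda>y. (matrix_inv (metric M c y) *v differential c u y) $ i)" for i
    using gradient_smooth[of 0 u c i] u c by simp
  have 2: "continuous_on (image_of c) (\<lambda>y. differential c v y $ i)" for i
    using differential_smooth[of 0 v c i] v c by simp
  show ?thesis unfolding chart_pairing_def[abs_def] inner_vec_def inner_real_def
    by (intro continuous_intros 1 2)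
qed

lemma pairing_continuous:
  assumes u: "C1_function u" and v: "C1_function v"
  shows "continuous_on UNIV (pairing u v)"
proof (rule continuous_on_from_atlas)
  fix c assume c: "c \<in> atlas M"
  show "continuous_on (image_of c) (pairing u v \<circ> chart_inv c)"
    by (rule continuous_on_eq[OF chart_pairing_continuous[OF u v c]])
      (simp add: pairing_chart[OF u v c chart_inv_dom[OF atlas_chart[OF c]]] chart_inv_right[OF atlas_chart[OF c]])
qed

lemma pairing_zero_outside:
  assumes "open W" "\<And>q. q \<in> W \<Longrightarrow> v q = 0" "p \<in> W"
  shows "pairing u v p = 0"
proof -
  let ?c = "chart_at M p"
  note c = chart_at_atlas[of p]
  have op: "open (snd ?c ` (fst ?c \<inter> W))" by (rule chart_image_open[OF atlas_chart[OF c(1)] assms(1)])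
  have "((\<lambda>x. 0) has_derivative (\<lambda>h. 0)) (at (snd ?c p))" by simp
  then have "(v \<circ> chart_inv ?c has_derivative (\<lambda>h. 0)) (at (snd ?c p))"
    by (rule has_derivative_transform_within_open[OF _ op])
      (use assms c chart_inv_left[OF atlas_chart[OF c(1)]] in auto)
  from differential_eqI[OF this] have "differential ?c v (snd ?c p) = 0" by (simp add: vec_eq_iff)
  then show ?thesis by (simp add: pairing_def chart_pairing_def)
qed

text \<open>
  The function \<open>w i\<close> is \<open>\<phi>\<close> times the \<open>i\<close>-th component of the flux, extended by zero. Its partial
  derivative in direction \<open>i\<close> has integral zero. By the product rule the sum over \<open>i\<close> of these
  derivatives is the difference of the two integrands.
\<close>

lemma chart_green:
  assumes c: "c \<in> atlas M" and u: "Ck_function 2 u" and \<phi>: "C1_function \<phi>"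
    and S: "compact S" "S \<subseteq> fst c" "\<And>q. q \<notin> S \<Longrightarrow> \<phi> q = 0"
  shows "(\<integral>x. indicator (image_of c) x * (volume_density c x * chart_pairing c u \<phi> x) \<partial>lborel) =
    (\<integral>x. indicator (image_of c) x * (volume_density c x * (chart_laplacian c u x * \<phi> (chart_inv c x))) \<partial>lborel)"
    (is "?I1 = ?I2")
proof -
  note cc = atlas_chart[OF c] and V = image_open[OF c]
  let ?V = "image_of c" let ?\<phi> = "\<phi> \<circ> chart_inv c"
  define K where "K = snd c ` S"
  have K: "compact K" "K \<subseteq> ?V"
    unfolding K_def using S compact_continuous_image[OF continuous_on_subset[OF chart_cont(1)[OF cc] S(2)]] by auto
  have \<phi>0: "?\<phi> x = 0" if "x \<in> ?V" "x \<notin> K" for x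
  proof -
    have "chart_inv c x \<notin> S" using that chart_inv_right[OF cc, of x] by (auto simp: K_def image_iff)
    then show ?thesis using S(3) by simp
  qed
  have u1: "C1_function u" using u Ck_function_le[of 2 u 1] by simp
  have fl: "Ck_on 1 (flux c u i) ?V" for i using flux_smooth[of 1 u c i] u c by (simp add: numeral_2_eq_2)
  have \<phi>C: "Ck_on 1 ?\<phi> ?V" by (rule Ck_functionD[OF \<phi> c])
  define w where "w i x = (if x \<in> ?V then ?\<phi> x * flux c u i x else 0)" for i x
  have w0: "w i x = 0" if "x \<notin> K" for i x using \<phi>0 that by (auto simp: w_def)
  have wV: "Ck_on 1 (w i) ?V" for i
    by (rule Ck_on_cong[OF V _ Ck_on_mult[OF V \<phi>C fl[of i]]]) (simp add: w_def)
  have wK: "Ck_on 1 (w i) (- K)" for i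
    by (rule Ck_on_cong[OF _ _ Ck_on_const[of _ _ 0]]) (use w0 K(1) compact_imp_closed in auto)
  have Kopen: "open (- K)" using compact_imp_closed[OF K(1)] by (simp add: open_Compl)
  have w1: "Ck_on 1 (w i) UNIV" for i
  proof (rule Ck_on_local)
    fix x :: "real^'n"
    show "\<exists>T. open T \<and> x \<in> T \<and> Ck_on 1 (w i) T"
      using V wV[of i] wK[of i] K compact_imp_closed[OF K(1)] by (cases "x \<in> ?V") (auto intro: exI[of _ ?V] exI[of _ "- K"])
  qed
  have zero: "(\<integral>x. partial_deriv i (w i) x \<partial>lborel) = 0" for i
    by (rule integral_partial_deriv_zero[OF w1 K(1) w0])
  let ?p = "\<lambda>i x. partial_deriv i ?\<phi> x * flux c u i x + ?\<phi> x * partial_deriv i (flux c u i) x"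
  have pw: "partial_deriv i (w i) x = indicator ?V x * ?p i x" for i x
  proof (cases "x \<in> ?V")
    case True
    have "(?\<phi> has_derivative frechet_derivative ?\<phi> (at x)) (at x)" by (rule C1_derivative[OF \<phi> c True])
    moreover have "(flux c u i has_derivative frechet_derivative (flux c u i) (at x)) (at x)"
      by (rule Ck_on_SucE(1)[OF fl[unfolded One_nat_def] True])
    ultimately have "((\<lambda>x. ?\<phi> x * flux c u i x) has_derivative
        (\<lambda>h. ?\<phi> x * frechet_derivative (flux c u i) (at x) h + frechet_derivative ?\<phi> (at x) h * flux c u i x)) (at x)"
      by (rule has_derivative_mult)
    then have "(w i has_derivative
        (\<lambda>h. ?\<phi> x * frechet_derivative (flux c u i) (at x) h + frechet_derivative ?\<phi> (at x) h * flux c u i x)) (at x)"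
      by (rule has_derivative_transform_within_open[OF _ V True]) (simp add: w_def)
    from partial_deriv_eq[OF this, of i] show ?thesis using True by (simp add: partial_deriv_def)
  next
    case False
    have "((\<lambda>x. 0) has_derivative (\<lambda>h. 0)) (at x)" by simp
    then have "(w i has_derivative (\<lambda>h. 0)) (at x)"
      by (rule has_derivative_transform_within_open[of _ _ _ _ "- K"]) (use K False w0 Kopen in auto)
    from partial_deriv_eq[OF this, of i] show ?thesis using False by simp
  qed
  have contp: "continuous_on ?V (?p i)" for i
  proof (intro continuous_on_add continuous_on_mult)
    show "continuous_on ?V (partial_deriv i ?\<phi>)" using Ck_on_partial_deriv[of 0 ?\<phi> ?V i] \<phi>C by simp
    show "continuous_on ?V (partial_deriv i (flux c u i))" using Ck_on_partial_deriv[of 0 "flux c u i" ?V i] fl by simp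
    show "continuous_on ?V (flux c u i)" using Ck_on_continuous[OF fl] .
    show "continuous_on ?V ?\<phi>" using Ck_on_continuous[OF \<phi>C] .
  qed
  have p\<phi>0: "partial_deriv i ?\<phi> x = 0" if "x \<in> ?V" "x \<notin> K" for i x
  proof -
    have "((\<lambda>x. 0) has_derivative (\<lambda>h. 0)) (at x)" by simp
    then have "(?\<phi> has_derivative (\<lambda>h. 0)) (at x)"
      by (rule has_derivative_transform_within_open[of _ _ _ _ "?V \<inter> - K"])
        (use V that \<phi>0 Kopen in auto)
    then show ?thesis using partial_deriv_eq by blast
  qed
  have intp: "integrable lborel (\<lambda>x. indicator ?V x * ?p i x)" for i
    by (rule integrable_compact_support[OF contp K]) (use \<phi>0 p\<phi>0 in auto)
  have sum: "(\<Sum>i\<in>UNIV. indicator ?V x * ?p i x) =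
      indicator ?V x * (volume_density c x * chart_pairing c u \<phi> x) - indicator ?V x * (volume_density c x * (chart_laplacian c u x * ?\<phi> x))" for x
  proof (cases "x \<in> ?V")
    case True
    have "(\<Sum>i\<in>UNIV. partial_deriv i ?\<phi> x * flux c u i x) = volume_density c x * chart_pairing c u \<phi> x"
      by (simp add: chart_pairing_def flux_def inner_vec_def sum_distrib_left differential_def[of c \<phi>] mult_ac)
    moreover have "(\<Sum>i\<in>UNIV. ?\<phi> x * partial_deriv i (flux c u i) x) = - (volume_density c x * (chart_laplacian c u x * ?\<phi> x))"
      using volume_density_pos[OF c True] by (simp add: chart_laplacian_def sum_distrib_left[symmetric])
    ultimately show ?thesis using True by (simp add: sum.distrib)
  qed simp
  have "0 = (\<Sum>i\<in>UNIV. \<integral>x. partial_deriv i (w i) x \<partial>lborel)" using zero by simp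
  also have "\<dots> = (\<integral>x. (\<Sum>i\<in>UNIV. indicator ?V x * ?p i x) \<partial>lborel)"
    unfolding pw by (rule Bochner_Integration.integral_sum[symmetric]) (rule intp)
  also have "\<dots> = ?I1 - ?I2"
    unfolding sum unfolding o_apply
  proof (rule Bochner_Integration.integral_diff)
    show "integrable lborel (\<lambda>x. indicator ?V x * (volume_density c x * chart_pairing c u \<phi> x))"
    proof (rule integrable_compact_support[OF _ K])
      show "continuous_on ?V (\<lambda>x. volume_density c x * chart_pairing c u \<phi> x)"
        by (intro continuous_intros volume_density_continuous chart_pairing_continuous u1 \<phi> c)
      show "volume_density c x * chart_pairing c u \<phi> x = 0" if "x \<in> ?V" "x \<notin> K" for x
      proof -
        have "differential c \<phi> x = 0" using p\<phi>0[OF that] by (simp add: differential_def vec_eq_iff)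
        then show ?thesis by (simp add: chart_pairing_def)
      qed
    qed
    show "integrable lborel (\<lambda>x. indicator ?V x * (volume_density c x * (chart_laplacian c u x * \<phi> (chart_inv c x))))"
    proof (rule integrable_compact_support[OF _ K])
      have "continuous_on ?V (\<lambda>x. \<phi> (chart_inv c x))" using Ck_on_continuous[OF \<phi>C] by (simp add: o_def)
      then show "continuous_on ?V (\<lambda>x. volume_density c x * (chart_laplacian c u x * \<phi> (chart_inv c x)))"
        by (intro continuous_intros volume_density_continuous chart_laplacian_continuous u c)
    qed (use \<phi>0 in auto)
  qed
  finally show ?thesis by simp
qed

text \<open>
  The Laplacian as computed in the chart \<open>c\<close>, extended by zero, so that its product with a test function
  supported in the chart is defined on the whole manifold.
\<close>

definition extended_laplacian :: "('a, 'n) chart \<Rightarrow> ('a \<Rightarrow> real) \<Rightarrow> 'a \<Rightarrow> real" where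
  "extended_laplacian c u p = (if p \<in> fst c then chart_laplacian c u (snd c p) else 0)"

lemma extended_laplacian_continuous:
  assumes "c \<in> atlas M" "Ck_function 2 u"
  shows "continuous_on (fst c) (extended_laplacian c u)"
proof (rule continuous_on_from_chart[OF assms(1)])
  show "continuous_on (image_of c) (extended_laplacian c u \<circ> chart_inv c)"
    by (rule continuous_on_eq[OF chart_laplacian_continuous[OF assms(2,1)]])
      (simp add: extended_laplacian_def chart_inv_dom[OF atlas_chart[OF assms(1)]] chart_inv_right[OF atlas_chart[OF assms(1)]])
qed

lemma continuous_on_extend_zero:
  fixes k :: "'a \<Rightarrow> real"
  assumes "continuous_on U k" "open U" "compact S" "S \<subseteq> U" "\<And>q. q \<notin> S \<Longrightarrow> k q = 0"
  shows "continuous_on UNIV k"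
proof -
  have "open (- S)" using compact_imp_closed[OF assms(3)] by blast
  moreover have "continuous_on (- S) k" by (rule continuous_on_eq[OF continuous_on_const[of _ 0]]) (use assms(5) in auto)
  ultimately have "continuous_on (U \<union> - S) k" using assms(1,2) by (intro continuous_on_open_Un)
  moreover have "U \<union> - S = UNIV" using assms(4) by auto
  ultimately show ?thesis by simp
qed

text \<open>
  In coordinates the function is \<open>(max 0 (r\<^sup>2 - \<bar>x - x0\<bar>\<^sup>2))\<^sup>2\<close>. Squaring makes
  the truncation of class $C^1$, which is the regularity of a test function.
\<close>

lemma bump_function:
  assumes c: "c \<in> atlas M" "p \<in> fst c" and W: "open W" "p \<in> W"
  shows "\<exists>\<beta> S. C1_function \<beta> \<and> (\<forall>q. \<beta> q \<ge> 0) \<and> \<beta> p > 0 \<and> compact S \<and> S \<subseteq> W \<inter> fst c \<and> (\<forall>q. q \<notin> S \<longrightarrow> \<beta> q = 0)"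
proof -
  note cc = atlas_chart[OF c(1)]
  define x0 where "x0 = snd c p"
  have "open (snd c ` (fst c \<inter> W))" "x0 \<in> snd c ` (fst c \<inter> W)"
    using chart_image_open[OF cc W(1)] c W by (auto simp: x0_def)
  then obtain r where r: "r > 0" "cball x0 r \<subseteq> snd c ` (fst c \<inter> W)" using open_contains_cball by blast
  define b where "b x = (max 0 (r^2 - (x - x0) \<bullet> (x - x0)))^2" for x
  have b1: "Ck_on 1 b UNIV"
  proof -
    have "Ck_on 1 (\<lambda>x. r^2 - (x - x0) \<bullet> (x - x0)) UNIV"
      unfolding inner_vec_def inner_real_def vector_minus_component
      by (intro Ck_on_diff Ck_on_sum Ck_on_mult Ck_on_const Ck_on_vec Ck_on_id open_UNIV)
    moreover have "Ck_real 1 (\<lambda>y. (max 0 y)^2) UNIV"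
    proof -
      have "((\<lambda>y. (max 0 y)^2) has_real_derivative 2 * max 0 y) (at y)" for y :: real
        using has_real_derivative_truncated_power[of 0 y] by (simp add: numeral_2_eq_2)
      moreover have "continuous_on UNIV (\<lambda>y::real. 2 * max 0 y)" by (intro continuous_intros)
      ultimately show ?thesis by (auto intro!: exI[of _ "\<lambda>y. 2 * max 0 y"])
    qed
    ultimately show ?thesis unfolding b_def[abs_def] by (rule Ck_on_compose_real[OF open_UNIV]) auto
  qed
  define S where "S = chart_inv c ` cball x0 r"
  define \<beta> where "\<beta> q = (if q \<in> fst c then b (snd c q) else 0)" for q
  have sub: "cball x0 r \<subseteq> image_of c" using r(2) by blast
  have S: "compact S" unfolding S_def
    by (intro compact_continuous_image continuous_on_subset[OF chart_cont(2)[OF cc] sub]) auto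
  have SW: "S \<subseteq> W \<inter> fst c" unfolding S_def using r(2) chart_inv_left[OF cc] by force
  have \<beta>0: "\<beta> q = 0" if "q \<notin> S" for q
  proof (cases "q \<in> fst c")
    case True
    have "snd c q \<notin> cball x0 r" using that chart_inv_left[OF cc True] unfolding S_def by (metis imageI)
    then have "r < norm (snd c q - x0)" by (simp add: dist_norm norm_minus_commute)
    then have "r^2 < (snd c q - x0) \<bullet> (snd c q - x0)"
      using r(1) by (simp add: dot_square_norm power_strict_mono)
    then show ?thesis by (simp add: \<beta>_def b_def)
  qed (simp add: \<beta>_def)
  have "C1_function \<beta>"
    unfolding Ck_function_def
  proof
    fix c' assume c': "c' \<in> atlas M"
    note cc' = atlas_chart[OF c']
    show "Ck_on 1 (\<beta> \<circ> chart_inv c') (image_of c')"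
    proof (rule Ck_on_local)
      fix x assume x: "x \<in> image_of c'"
      show "\<exists>T. open T \<and> x \<in> T \<and> Ck_on 1 (\<beta> \<circ> chart_inv c') T"
      proof (cases "chart_inv c' x \<in> fst c")
        case True
        let ?D = "local_dom id c' c"
        have op: "open ?D" by (rule local_dom_open[OF c' c(1)]) (simp add: id_def)
        have xD: "x \<in> ?D" using x True chart_inv_left[OF cc'] by (auto simp: local_dom_def)
        have "Ck_on 1 (\<lambda>x. b (local_rep id c' c x)) ?D"
          by (rule C1_compose[OF op local_rep_smooth[OF _ c' c(1)] open_UNIV b1]) (use local_isometry_id in auto)
        then have "Ck_on 1 (\<beta> \<circ> chart_inv c') ?D"
          by (rule Ck_on_cong[OF op, rotated]) (use local_rep_maps[OF c', of _ id c] in \<open>simp add: \<beta>_def\<close>)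
        then show ?thesis using op xD by blast
      next
        case False
        let ?T = "snd c' ` (fst c' \<inter> - S)"
        have op: "open ?T" by (rule chart_image_open[OF cc']) (use compact_imp_closed[OF S] in auto)
        have xT: "x \<in> ?T" using x False SW chart_inv_left[OF cc'] by auto
        have "Ck_on 1 (\<beta> \<circ> chart_inv c') ?T"
          by (rule Ck_on_cong[OF op _ Ck_on_const[OF op, of _ 0]]) (use chart_inv_left[OF cc'] \<beta>0 in auto)
        then show ?thesis using op xT by blast
      qed
    qed
  qed
  moreover have "\<beta> p > 0" using r(1) c(2) by (simp add: \<beta>_def b_def x0_def)
  moreover have "\<forall>q. \<beta> q \<ge> 0" by (simp add: \<beta>_def b_def)
  ultimately show ?thesis using S SW \<beta>0 by blast
qed

end

context compact_riemannian begin

lemma local_green: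
  assumes c: "c \<in> atlas M" and u: "Ck_function 2 u" and \<phi>: "C1_function \<phi>"
    and S: "compact S" "S \<subseteq> fst c" "\<And>q. q \<notin> S \<Longrightarrow> \<phi> q = 0"
  shows "(\<integral>p. pairing u \<phi> p \<partial>vol) = (\<integral>p. extended_laplacian c u p * \<phi> p \<partial>vol)"
    and "continuous_on UNIV (\<lambda>p. extended_laplacian c u p * \<phi> p)"
proof -
  note cc = atlas_chart[OF c]
  have u1: "C1_function u" using u Ck_function_le[of 2 u 1] by simp
  show cont: "continuous_on UNIV (\<lambda>p. extended_laplacian c u p * \<phi> p)"
    by (rule continuous_on_extend_zero[OF _ chart_open(1)[OF cc] S(1,2)])
      (use S(3) in \<open>auto intro!: continuous_intros extended_laplacian_continuous c u continuous_on_subset[OF Ck_function_continuous[OF \<phi>]]\<close>)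
  have "(\<integral>p. pairing u \<phi> p \<partial>vol) = (\<integral>x. indicator (image_of c) x * (volume_density c x * pairing u \<phi> (chart_inv c x)) \<partial>lborel)"
  proof (rule integral_chart[OF c borel_measurable_continuous_onI[OF pairing_continuous[OF u1 \<phi>]]])
    fix p assume "p \<notin> fst c"
    then show "pairing u \<phi> p = 0"
      by (intro pairing_zero_outside[of "- S"]) (use S compact_imp_closed in auto)
  qed
  also have "\<dots> = (\<integral>x. indicator (image_of c) x * (volume_density c x * chart_pairing c u \<phi> x) \<partial>lborel)"
    by (rule Bochner_Integration.integral_cong)
      (auto simp: indicator_def pairing_chart[OF u1 \<phi> c chart_inv_dom[OF cc]] chart_inv_left[OF cc] pairing_chart[OF u1 \<phi> c])
  also have "\<dots> = (\<integral>x. indicator (image_of c) x * (volume_density c x * (chart_laplacian c u x * \<phi> (chart_inv c x))) \<partial>lborel)"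
    by (rule chart_green[OF c u \<phi> S])
  also have "\<dots> = (\<integral>x. indicator (image_of c) x * (volume_density c x * (extended_laplacian c u (chart_inv c x) * \<phi> (chart_inv c x))) \<partial>lborel)"
    by (rule Bochner_Integration.integral_cong)
      (auto simp: indicator_def extended_laplacian_def chart_inv_left[OF cc])
  also have "\<dots> = (\<integral>p. extended_laplacian c u p * \<phi> p \<partial>vol)"
    by (rule integral_chart[OF c borel_measurable_continuous_onI[OF cont], symmetric]) (simp add: extended_laplacian_def)
  finally show "(\<integral>p. pairing u \<phi> p \<partial>vol) = (\<integral>p. extended_laplacian c u p * \<phi> p \<partial>vol)" .
qed

text \<open>
  The left-hand side of \<open>local_green\<close> does not mention the chart. If the Laplacians computed in two charts
  differed, say \<open>L > L'\<close> near \<open>p\<close>, a bump function supported there would distinguish the right-hand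
  sides.
\<close>

lemma chart_laplacian_le:
  assumes u: "Ck_function 2 u" and c: "c \<in> atlas M" "c' \<in> atlas M" and p: "p \<in> fst c" "p \<in> fst c'"
  shows "extended_laplacian c u p \<le> extended_laplacian c' u p"
proof (rule ccontr)
  assume neg: "\<not> ?thesis"
  let ?U = "fst c \<inter> fst c'" let ?L = "\<lambda>p. extended_laplacian c u p - extended_laplacian c' u p"
  have U: "open ?U" using c chart_open(1) atlas_chart by blast
  have "continuous_on ?U ?L"
    by (intro continuous_intros continuous_on_subset[OF extended_laplacian_continuous[OF c(1) u]]
        continuous_on_subset[OF extended_laplacian_continuous[OF c(2) u]]) auto
  then have W: "open (?U \<inter> ?L -` {0<..})" by (rule continuous_open_preimage[OF _ U]) simp
  have pW: "p \<in> ?U \<inter> ?L -` {0<..}" using neg p by auto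
  obtain \<beta> S where \<beta>': "C1_function \<beta> \<and> (\<forall>q. \<beta> q \<ge> 0) \<and> \<beta> p > 0 \<and> compact S \<and> S \<subseteq> (?U \<inter> ?L -` {0<..}) \<inter> fst c \<and> (\<forall>q. q \<notin> S \<longrightarrow> \<beta> q = 0)"
    using bump_function[OF c(1) p(1) W pW] by (elim exE) (rule that)
  then have \<beta>: "C1_function \<beta>" "\<And>q. \<beta> q \<ge> 0" "\<beta> p > 0" "compact S" "S \<subseteq> (?U \<inter> ?L -` {0<..}) \<inter> fst c" "\<And>q. q \<notin> S \<Longrightarrow> \<beta> q = 0"
    by auto
  have Sc: "S \<subseteq> fst c" "S \<subseteq> fst c'" using \<beta>(5) by auto
  note g = local_green[OF c(1) u \<beta>(1,4) Sc(1) \<beta>(6)] and g' = local_green[OF c(2) u \<beta>(1,4) Sc(2) \<beta>(6)]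
  let ?k = "\<lambda>q. extended_laplacian c u q * \<beta> q - extended_laplacian c' u q * \<beta> q"
  have "?k p = 0"
  proof (rule integral_continuous_nonneg_zero)
    show "continuous_on UNIV ?k" by (intro continuous_intros g(2) g'(2))
    show "0 \<le> ?k q" for q
    proof (cases "q \<in> S")
      case True
      then have "?L q > 0" using \<beta>(5) by auto
      then have "0 \<le> ?L q * \<beta> q" using \<beta>(2)[of q] by simp
      then show ?thesis by (simp add: algebra_simps)
    qed (simp add: \<beta>(6))
    show "(\<integral>q. ?k q \<partial>vol) = 0"
      using g(1) g'(1) integrable_continuous[OF g(2)] integrable_continuous[OF g'(2)] by simp
  qed
  then have "?L p * \<beta> p = 0" by (simp add: algebra_simps)
  then show False using pW \<beta>(3) by auto
qed

lemma laplacian_chart: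
  assumes u: "Ck_function 2 u" and c: "c \<in> atlas M" "p \<in> fst c"
  shows "laplacian M u p = extended_laplacian c u p"
proof -
  have "laplacian M u p = extended_laplacian (chart_at M p) u p"
    by (simp add: laplacian_eq extended_laplacian_def chart_at_atlas)
  then show ?thesis
    using chart_laplacian_le[OF u c(1) chart_at_atlas(1) c(2) chart_at_atlas(2)]
      chart_laplacian_le[OF u chart_at_atlas(1) c(1) chart_at_atlas(2) c(2)] by (simp add: order_antisym)
qed

lemma laplacian_continuous:
  assumes u: "Ck_function 2 u"
  shows "continuous_on UNIV (laplacian M u)"
proof -
  have "isCont (laplacian M u) p" for p
  proof -
    obtain c where c: "c \<in> atlas M" "p \<in> fst c" using atlas_cover by blast
    have "continuous_on (fst c) (laplacian M u)"
      by (rule continuous_on_eq[OF extended_laplacian_continuous[OF c(1) u]]) (simp add: laplacian_chart[OF u c(1)])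
    then show ?thesis using chart_open(1)[OF atlas_chart[OF c(1)]] c(2) by (simp add: continuous_on_eq_continuous_at)
  qed
  then show ?thesis by (simp add: continuous_at_imp_continuous_on)
qed

text \<open>
  Write \<open>\<phi>\<close> as a finite sum of functions \<open>\<beta> p \<psi>\<close>, each supported in one chart, where \<open>\<psi>\<close> is \<open>\<phi>\<close> divided
  by the positive sum of finitely many bump functions.
\<close>

theorem green:
  assumes u: "Ck_function 2 u" and \<phi>: "C1_function \<phi>"
  shows "(\<integral>p. pairing u \<phi> p \<partial>vol) = (\<integral>p. laplacian M u p * \<phi> p \<partial>vol)"
proof -
  have u1: "C1_function u" using u Ck_function_le[of 2 u 1] by simp
  have "\<exists>\<beta> S c. C1_function \<beta> \<and> (\<forall>q. \<beta> q \<ge> 0) \<and> \<beta> p > 0 \<and> compact S \<and> S \<subseteq> fst c \<and> c \<in> atlas M \<and> (\<forall>q. q \<notin> S \<longrightarrow> \<beta> q = 0)" for p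
    using bump_function[OF chart_at_atlas(1) chart_at_atlas(2) open_UNIV UNIV_I, of p] chart_at_atlas(1)[of p]
    unfolding Int_UNIV_left by blast
  then obtain \<beta> S c where \<beta>: "\<And>p. C1_function (\<beta> p)" "\<And>p q. \<beta> p q \<ge> 0" "\<And>p. \<beta> p p > 0"
    and S: "\<And>p. compact (S p)" "\<And>p. S p \<subseteq> fst (c p)" "\<And>p q. q \<notin> S p \<Longrightarrow> \<beta> p q = 0" and c: "\<And>p. c p \<in> atlas M"
    by metis
  have "open (\<beta> p -` {0<..})" for p by (intro open_vimage Ck_function_continuous[OF \<beta>(1)]) simp
  moreover have "UNIV \<subseteq> (\<Union>p\<in>UNIV. \<beta> p -` {0<..})" using \<beta>(3) by blast
  ultimately obtain D where D: "finite D" "UNIV \<subseteq> (\<Union>p\<in>D. \<beta> p -` {0<..})"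
    by (rule compactE_image[OF compact_UNIV])
  define \<sigma> where "\<sigma> q = (\<Sum>p\<in>D. \<beta> p q)" for q
  have \<sigma>pos: "\<sigma> q > 0" for q
  proof -
    obtain p where "p \<in> D" "\<beta> p q > 0" using D(2) by auto
    then show ?thesis unfolding \<sigma>_def using D(1) \<beta>(2) by (intro sum_pos2[of D p]) auto
  qed
  define \<psi> where "\<psi> q = \<phi> q * inverse (\<sigma> q)" for q
  have \<psi>: "C1_function \<psi>" unfolding \<psi>_def \<sigma>_def
    by (intro Ck_function_mult \<phi> Ck_function_inverse Ck_function_sum \<beta>(1)) (use \<sigma>pos in \<open>simp add: \<sigma>_def\<close>)
  have \<beta>\<psi>: "C1_function (\<lambda>q. \<beta> p q * \<psi> q)" for p by (intro Ck_function_mult \<beta>(1) \<psi>)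
  have split: "\<phi> = (\<lambda>q. \<Sum>p\<in>D. \<beta> p q * \<psi> q)"
  proof
    fix q
    have "(\<Sum>p\<in>D. \<beta> p q * \<psi> q) = \<sigma> q * \<psi> q" by (simp add: \<sigma>_def sum_distrib_right)
    then show "\<phi> q = (\<Sum>p\<in>D. \<beta> p q * \<psi> q)" using \<sigma>pos[of q] by (simp add: \<psi>_def)
  qed
  have piece: "(\<integral>q. pairing u (\<lambda>q. \<beta> p q * \<psi> q) q \<partial>vol) = (\<integral>q. laplacian M u q * (\<beta> p q * \<psi> q) \<partial>vol)" for p
  proof -
    have "(\<integral>q. pairing u (\<lambda>q. \<beta> p q * \<psi> q) q \<partial>vol) = (\<integral>q. extended_laplacian (c p) u q * (\<beta> p q * \<psi> q) \<partial>vol)"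
      by (rule local_green(1)[OF c u \<beta>\<psi> S(1,2)]) (simp add: S(3))
    also have "\<dots> = (\<integral>q. laplacian M u q * (\<beta> p q * \<psi> q) \<partial>vol)"
    proof (rule Bochner_Integration.integral_cong[OF refl])
      fix q show "extended_laplacian (c p) u q * (\<beta> p q * \<psi> q) = laplacian M u q * (\<beta> p q * \<psi> q)"
        using S(3)[of q p] S(2)[of p] laplacian_chart[OF u c, of q p] by (cases "q \<in> S p") auto
    qed
    finally show ?thesis .
  qed
  have "(\<integral>q. pairing u \<phi> q \<partial>vol) = (\<integral>q. (\<Sum>p\<in>D. pairing u (\<lambda>q. \<beta> p q * \<psi> q) q) \<partial>vol)"
  proof (rule Bochner_Integration.integral_cong[OF refl])
    fix q show "pairing u \<phi> q = (\<Sum>p\<in>D. pairing u (\<lambda>q. \<beta> p q * \<psi> q) q)"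
      by (subst split) (rule pairing_sum_right[OF \<beta>\<psi>])
  qed
  also have "\<dots> = (\<Sum>p\<in>D. \<integral>q. pairing u (\<lambda>q. \<beta> p q * \<psi> q) q \<partial>vol)"
    by (rule Bochner_Integration.integral_sum) (intro integrable_continuous pairing_continuous u1 \<beta>\<psi>)
  also have "\<dots> = (\<Sum>p\<in>D. \<integral>q. laplacian M u q * (\<beta> p q * \<psi> q) \<partial>vol)" by (simp add: piece)
  also have "\<dots> = (\<integral>q. (\<Sum>p\<in>D. laplacian M u q * (\<beta> p q * \<psi> q)) \<partial>vol)"
    by (rule Bochner_Integration.integral_sum[symmetric])
      (intro integrable_continuous continuous_intros laplacian_continuous u Ck_function_continuous[OF \<beta>(1)] Ck_function_continuous[OF \<psi>])
  also have "\<dots> = (\<integral>q. laplacian M u q * \<phi> q \<partial>vol)"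
  proof (rule Bochner_Integration.integral_cong[OF refl])
    fix q show "(\<Sum>p\<in>D. laplacian M u q * (\<beta> p q * \<psi> q)) = laplacian M u q * \<phi> q"
      using fun_cong[OF split, of q] by (simp add: sum_distrib_left)
  qed
  finally show ?thesis .
qed

end

section \<open>Behaviour of the coefficients at the focal values\<close>

text \<open>
  \<open>f\<^sup>2 exp (- 2 L t)\<close> is nonincreasing.
\<close>

lemma gronwall_zero:
  fixes f :: "real \<Rightarrow> real"
  assumes d: "\<And>t. t \<in> {0..1} \<Longrightarrow> (f has_real_derivative f' t) (at t)"
    and b: "\<And>t. t \<in> {0..1} \<Longrightarrow> \<bar>f' t\<bar> \<le> L * \<bar>f t\<bar>" and 0: "f 0 = 0"
  shows "f 1 = 0"
proof -
  have "f 1 ^ 2 * exp (- 2 * L * 1) \<le> f 0 ^ 2 * exp (- 2 * L * 0)"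
  proof (rule DERIV_nonpos_imp_nonincreasing[where f="\<lambda>t. f t ^ 2 * exp (- 2 * L * t)"])
    fix t :: real assume "0 \<le> t" "t \<le> 1"
    then have t: "t \<in> {0..1}" by simp
    have "((\<lambda>t. f t ^ 2 * exp (- 2 * L * t)) has_real_derivative 2 * (f t * f' t - L * f t ^ 2) * exp (- 2 * L * t)) (at t)"
      by (auto intro!: derivative_eq_intros d[OF t] simp: algebra_simps power2_eq_square)
    moreover have "f t * f' t \<le> L * f t ^ 2"
    proof -
      have "f t * f' t \<le> \<bar>f t\<bar> * \<bar>f' t\<bar>" by (metis abs_ge_self abs_mult)
      also have "\<dots> \<le> \<bar>f t\<bar> * (L * \<bar>f t\<bar>)" using b[OF t] by (intro mult_left_mono) auto
      finally show ?thesis by (simp add: power2_eq_square mult_ac abs_mult_self_eq)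
    qed
    then have "2 * (f t * f' t - L * f t ^ 2) \<le> 0" by simp
    then have "2 * (f t * f' t - L * f t ^ 2) * exp (- 2 * L * t) \<le> 0" by (rule mult_nonpos_nonneg) simp
    ultimately show "\<exists>y. ((\<lambda>t. f t ^ 2 * exp (- 2 * L * t)) has_real_derivative y) (at t) \<and> y \<le> 0" by blast
  qed simp
  then show ?thesis using 0 by (simp add: mult_le_0_iff)
qed

lemma mvt_interval:
  fixes f :: "real \<Rightarrow> real"
  assumes d: "\<And>x. x \<in> {a..b} \<Longrightarrow> (f has_real_derivative f' x) (at x within {a..b})" and "c \<in> {a..b}" "s \<in> {a..b}"
  obtains \<xi> where "\<xi> \<in> {a..b}" "\<bar>\<xi> - c\<bar> \<le> \<bar>s - c\<bar>" "f s - f c = f' \<xi> * (s - c)"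
proof -
  define x y where "x = min c s" and "y = max c s"
  have sub: "{x..y} \<subseteq> {a..b}" using assms by (auto simp: x_def y_def)
  have "\<exists>\<xi>\<in>{x..y}. f y - f x = f' \<xi> * (y - x)"
  proof (rule mvt_very_simple)
    show "x \<le> y" by (simp add: x_def y_def)
    fix t assume "x \<le> t" "t \<le> y"
    then have "(f has_real_derivative f' t) (at t within {x..y})"
      using has_field_derivative_subset[OF d sub] sub by auto
    then show "(f has_derivative (*) (f' t)) (at t within {x..y})" by (simp add: has_field_derivative_def)
  qed
  then obtain \<xi> where \<xi>: "\<xi> \<in> {x..y}" "f y - f x = f' \<xi> * (y - x)" by blast
  then have "f s - f c = f' \<xi> * (s - c)" by (auto simp: x_def y_def min_def max_def algebra_simps split: if_splits)
  moreover have "\<bar>\<xi> - c\<bar> \<le> \<bar>s - c\<bar>" using \<xi>(1) by (auto simp: x_def y_def)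
  ultimately show thesis using that \<xi>(1) sub by blast
qed

lemma Ck_real_derivative_bounded:
  assumes "Ck_real 1 f {a..b}"
  obtains f' K where "\<And>x. x \<in> {a..b} \<Longrightarrow> (f has_real_derivative f' x) (at x within {a..b})" "\<And>x. x \<in> {a..b} \<Longrightarrow> \<bar>f' x\<bar> \<le> K" "K \<ge> 0"
proof -
  obtain f' where f': "\<forall>x\<in>{a..b}. (f has_real_derivative f' x) (at x within {a..b})" "continuous_on {a..b} f'"
    using assms by auto
  obtain K where "\<forall>y\<in>f' ` {a..b}. norm y \<le> K"
    using compact_imp_bounded[OF compact_continuous_image[OF f'(2) compact_Icc]] unfolding bounded_iff by blast
  then have "\<bar>f' x\<bar> \<le> max K 0" if "x \<in> {a..b}" for x using that by (simp add: le_max_iff_disj)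
  then show thesis using that[of f' "max K 0"] f'(1) by auto
qed

text \<open>
  Taylor's formula with a quadratic error term, for a function with one-sided derivatives at the end
  points.
\<close>

lemma taylor_upper_bound:
  fixes f f' :: "real \<Rightarrow> real"
  assumes d: "\<And>x. x \<in> {a..b} \<Longrightarrow> (f has_real_derivative f' x) (at x within {a..b})" and f': "Ck_real 1 f' {a..b}"
    and c: "c \<in> {a..b}"
  obtains K where "\<And>s. s \<in> {a..b} \<Longrightarrow> f s \<le> f c + f' c * (s - c) + K * (s - c)^2"
proof -
  obtain f'' K where f'': "\<And>x. x \<in> {a..b} \<Longrightarrow> (f' has_real_derivative f'' x) (at x within {a..b})" "\<And>x. x \<in> {a..b} \<Longrightarrow> \<bar>f'' x\<bar> \<le> K" "K \<ge> 0"
    using Ck_real_derivative_bounded[OF f'] by metis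
  have "f s \<le> f c + f' c * (s - c) + K * (s - c)^2" if s: "s \<in> {a..b}" for s
  proof -
    obtain \<xi> where \<xi>: "\<xi> \<in> {a..b}" "\<bar>\<xi> - c\<bar> \<le> \<bar>s - c\<bar>" "f s - f c = f' \<xi> * (s - c)"
      using mvt_interval[OF d c s] by metis
    obtain \<eta> where \<eta>: "\<eta> \<in> {a..b}" "f' \<xi> - f' c = f'' \<eta> * (\<xi> - c)"
      using mvt_interval[OF f''(1) c \<xi>(1)] by metis
    have "f s = f c + f' c * (s - c) + (f' \<xi> - f' c) * (s - c)" using \<xi>(3) by (simp add: algebra_simps)
    moreover have "(f' \<xi> - f' c) * (s - c) \<le> \<bar>f'' \<eta>\<bar> * \<bar>\<xi> - c\<bar> * \<bar>s - c\<bar>"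
      unfolding \<eta>(2) by (metis abs_ge_self abs_mult)
    moreover have "\<bar>f'' \<eta>\<bar> * \<bar>\<xi> - c\<bar> * \<bar>s - c\<bar> \<le> K * \<bar>s - c\<bar> * \<bar>s - c\<bar>"
      by (intro mult_right_mono mult_mono f''(2)[OF \<eta>(1)] \<xi>(2) f''(3)) auto
    ultimately show ?thesis by (simp add: power2_eq_square abs_mult_self_eq mult.assoc)
  qed
  then show thesis using that by blast
qed

lemma continuous_on_quadratic_form:
  fixes g :: "'b::topological_space \<Rightarrow> real^'n::finite^'n"
  assumes g: "continuous_on S g" and v: "continuous_on S v"
  shows "continuous_on S (\<lambda>t. v t \<bullet> (g t *v v t))"
  unfolding inner_vec_def matrix_vector_mult_def inner_real_def vec_lambda_beta
  by (intro continuous_intros g v)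

text \<open>
  The Cauchy-Schwarz inequality between a covector \<open>a\<close> and a vector \<open>v\<close>, each measured in the norm that the
  metric induces. It is the ordinary inequality for \<open>v\<close> and the vector dual to \<open>a\<close>.
\<close>

lemma positive_definite_cauchy_schwarz:
  fixes A :: "real^'n::finite^'n"
  assumes sym: "transpose A = A" and pos: "\<And>v. v \<noteq> 0 \<Longrightarrow> v \<bullet> (A *v v) > 0"
  shows "(a \<bullet> v)^2 \<le> (v \<bullet> (A *v v)) * ((matrix_inv A *v a) \<bullet> a)"
proof -
  have det: "det A \<noteq> 0" using positive_definite_det_pos[of A] pos by force
  define w where "w = matrix_inv A *v a"
  have a: "a = A *v w" by (simp add: w_def matrix_inv_mult(1)[OF det])
  have nn: "x \<bullet> (A *v x) \<ge> 0" for x using pos[of x] by (cases "x = 0") auto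
  have wv: "w \<bullet> (A *v v) = v \<bullet> (A *v w)"
    using inner_matrix_transpose[of w A v] sym by (simp add: inner_commute)
  show ?thesis
  proof (cases "v = 0")
    case False
    define q where "q = v \<bullet> (A *v v)"
    define s where "s = v \<bullet> (A *v w)"
    have q: "q > 0" using pos[OF False] by (simp add: q_def)
    have "0 \<le> (q *\<^sub>R w - s *\<^sub>R v) \<bullet> (A *v (q *\<^sub>R w - s *\<^sub>R v))" by (rule nn)
    also have "\<dots> = q * (q * (w \<bullet> (A *v w)) - s^2)"
      by (simp add: matrix_vector_mult_diff_distrib matrix_vector_mult_scaleR inner_diff_left inner_diff_right wv
          q_def[symmetric] s_def[symmetric] power2_eq_square algebra_simps)
    finally have "s^2 \<le> q * (w \<bullet> (A *v w))" using q by (simp add: zero_le_mult_iff)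
    moreover have "a \<bullet> v = s" by (simp add: a s_def inner_commute)
    ultimately show ?thesis by (simp add: q_def w_def[symmetric] a[symmetric])
  qed simp
qed

context riemannian begin

lemma pairing_nonneg: "pairing u u p \<ge> 0"
proof -
  let ?c = "chart_at M p" let ?x = "snd (chart_at M p) p"
  have x: "?x \<in> image_of ?c" using chart_at_atlas(2) by auto
  note pd = positive_definite_cauchy_schwarz[OF metric_symmetric[OF chart_at_atlas(1) x] metric_positive[OF chart_at_atlas(1) x]]
  define a where "a = differential ?c u ?x"
  define v where "v = matrix_inv (metric M ?c ?x) *v a"
  have "det (metric M ?c ?x) \<noteq> 0" using metric_det_pos[OF chart_at_atlas(1) x] by simp
  then have "metric M ?c ?x *v v = a" unfolding v_def by (rule matrix_inv_mult(1))
  then have "v \<bullet> a \<ge> 0" using metric_positive[OF chart_at_atlas(1) x, of v] by (cases "v = 0") auto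
  then show ?thesis by (simp add: pairing_def chart_pairing_def a_def v_def)
qed

lemma sq_norm_gradient: "sq_norm_at M (gradient M F) p = pairing F F p"
proof -
  let ?c = "chart_at M p" let ?x = "snd (chart_at M p) p"
  have x: "?x \<in> image_of ?c" using chart_at_atlas(2) by auto
  have "det (metric M ?c ?x) \<noteq> 0" using metric_det_pos[OF chart_at_atlas(1) x] by simp
  then show ?thesis
    by (simp add: sq_norm_at_def gradient_def pairing_def chart_pairing_def differential_def Let_def matrix_inv_mult(1))
qed

lemma directional_derivative:
  assumes "C1_function f" "c \<in> atlas M" "x \<in> image_of c"
  shows "(f \<circ> chart_inv c has_derivative (\<lambda>v. differential c f x \<bullet> v)) (at x)"
proof -
  have "frechet_derivative (f \<circ> chart_inv c) (at x) v = differential c f x \<bullet> v" for v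
    using frechet_derivative_basis_expansion[of "f \<circ> chart_inv c" x v] C1_derivative[OF assms]
    by (auto simp: differential_def partial_deriv_def inner_vec_def differentiable_def mult.commute)
  then have "frechet_derivative (f \<circ> chart_inv c) (at x) = (\<lambda>v. differential c f x \<bullet> v)" by (rule ext)
  then show ?thesis using C1_derivative[OF assms] by (simp only:)
qed

end

text \<open>
  The equation for the Laplacian of \<open>F\<close> enters in its weak form. This form is what the arguments use,
  and it is stable under replacing \<open>F\<close> by \<open>- F\<close>, so that statements about the minimum carry over to
  the maximum.
\<close>

locale isoparametric = compact_riemannian M
  for M :: "('a::{t2_space, second_countable_topology}, 'n::finite) riem" +
  fixes F :: "'a \<Rightarrow> real" and a b :: real and A B :: "real \<Rightarrow> real"
  assumes connected_UNIV: "connected (UNIV :: 'a set)"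
    and ab: "a < b"
    and F_smooth: "\<And>k. Ck_function k F"
    and F_range: "range F = {a..b}"
    and A_smooth: "\<And>k. Ck_real k A {a..b}"
    and B_smooth: "\<And>k. Ck_real k B {a..b}"
    and pairing_F: "\<And>p. pairing F F p = A (F p)"
    and weak_F: "\<And>\<phi>. C1_function \<phi> \<Longrightarrow> (\<integral>p. pairing F \<phi> p \<partial>vol) = (\<integral>p. B (F p) * \<phi> p \<partial>vol)"
begin

lemma F_in: "F p \<in> {a..b}" using F_range by blast

lemma F_attains: "s \<in> {a..b} \<Longrightarrow> \<exists>p. F p = s" using F_range by (metis image_iff)

lemma F_continuous: "continuous_on UNIV F" using Ck_function_continuous F_smooth by blast

lemma A_nonneg: "s \<in> {a..b} \<Longrightarrow> A s \<ge> 0"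
  using pairing_nonneg[of F] pairing_F F_attains by metis

lemma derivative_along_line:
  assumes c: "c \<in> atlas M" and x: "x + t *\<^sub>R v \<in> image_of c"
  shows "((\<lambda>t. F (chart_inv c (x + t *\<^sub>R v))) has_real_derivative differential c F (x + t *\<^sub>R v) \<bullet> v) (at t)"
proof -
  have "((\<lambda>t. x + t *\<^sub>R v) has_derivative (\<lambda>h. h *\<^sub>R v)) (at t)" by (auto intro!: derivative_eq_intros)
  from has_derivative_compose[OF this directional_derivative[OF F_smooth c x]]
  have "((\<lambda>t. F (chart_inv c (x + t *\<^sub>R v))) has_derivative (\<lambda>h. differential c F (x + t *\<^sub>R v) \<bullet> (h *\<^sub>R v))) (at t)"
    by (simp add: o_def)
  then show ?thesis unfolding has_field_derivative_def
    by (rule has_derivative_eq_rhs) (simp add: fun_eq_iff mult.commute)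
qed

text \<open>
  The derivative of \<open>F\<close> along a vector is at most the length of the vector times the length
  \<open>sqrt (A F)\<close> of the gradient.
\<close>

lemma differential_bound:
  assumes c: "c \<in> atlas M" and x: "x \<in> image_of c"
  shows "(differential c F x \<bullet> v)^2 \<le> (v \<bullet> (metric M c x *v v)) * A (F (chart_inv c x))"
proof -
  have "A (F (chart_inv c x)) = (matrix_inv (metric M c x) *v differential c F x) \<bullet> differential c F x"
    using pairing_chart[OF F_smooth F_smooth c chart_inv_dom[OF atlas_chart[OF c] x]] pairing_F[of "chart_inv c x"]
    by (simp add: chart_pairing_def chart_inv_right[OF atlas_chart[OF c] x])
  then show ?thesis
    using positive_definite_cauchy_schwarz[OF metric_symmetric[OF c x] metric_positive[OF c x], of "differential c F x" v] by simp
qed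

text \<open>
  Suppose \<open>A s \<le> K (s - c0)\<^sup>2\<close>. Then \<open>\<bar>dF v\<bar> \<le> L \<bar>F - c0\<bar>\<close> along coordinate segments, and by Gronwall's
  inequality \<open>F\<close> is constant near every point of the level set of \<open>c0\<close>. This set is then open and closed,
  so \<open>F\<close> is constant on the connected manifold.
\<close>

lemma level_not_degenerate:
  assumes c0: "c0 \<in> {a..b}"
  shows "\<not> (\<forall>s\<in>{a..b}. A s \<le> K * (s - c0)^2)"
proof
  assume K: "\<forall>s\<in>{a..b}. A s \<le> K * (s - c0)^2"
  let ?Z = "F -` {c0}"
  have closed: "closed ?Z" using F_continuous by (intro closed_vimage) auto
  have "open ?Z"
    unfolding open_subopen[of ?Z]
  proof
    fix p assume p: "p \<in> ?Z"
    obtain c where c: "c \<in> atlas M" "p \<in> fst c" using atlas_cover by blast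
    note cc = atlas_chart[OF c(1)]
    define x where "x = snd c p"
    obtain r where r: "r > 0" "ball x r \<subseteq> image_of c"
      using image_open[OF c(1)] c(2) open_contains_ball unfolding x_def by blast
    have zero: "F (chart_inv c y) = c0" if y: "y \<in> ball x r" for y
    proof -
      define v where "v = y - x"
      have line: "x + t *\<^sub>R v \<in> image_of c" if "t \<in> {0..1}" for t
      proof -
        have "norm (t *\<^sub>R v) \<le> norm v" using that by (simp add: mult_left_le_one_le)
        then have "x + t *\<^sub>R v \<in> ball x r" using y by (simp add: v_def dist_norm norm_minus_commute)
        then show ?thesis using r by blast
      qed
      define q where "q t = v \<bullet> (metric M c (x + t *\<^sub>R v) *v v)" for t
      have qc: "continuous_on {0..1} q"
        unfolding q_def
        by (intro continuous_on_quadratic_form continuous_intros continuous_on_compose2[OF Ck_on_continuous[OF metric_smooth[OF c(1), of 0]]])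
          (use line in blast)
      obtain Q where Q: "\<And>t. t \<in> {0..1} \<Longrightarrow> \<bar>q t\<bar> \<le> Q"
        using compact_imp_bounded[OF compact_continuous_image[OF qc compact_Icc]] unfolding bounded_iff real_norm_def by blast
      define L where "L = sqrt (Q * \<bar>K\<bar>)"
      have "F (chart_inv c (x + 1 *\<^sub>R v)) - c0 = 0"
      proof (rule gronwall_zero[where f="\<lambda>t. F (chart_inv c (x + t *\<^sub>R v)) - c0" and L=L])
        fix t :: real assume t: "t \<in> {0..1}"
        show "((\<lambda>t. F (chart_inv c (x + t *\<^sub>R v)) - c0) has_real_derivative differential c F (x + t *\<^sub>R v) \<bullet> v) (at t)"
          using derivative_along_line[OF c(1) line[OF t]] by (auto intro!: derivative_eq_intros)
        let ?s = "F (chart_inv c (x + t *\<^sub>R v))"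
        have "(differential c F (x + t *\<^sub>R v) \<bullet> v)^2 \<le> q t * A ?s"
          using differential_bound[OF c(1) line[OF t]] by (simp add: q_def)
        also have "\<dots> \<le> Q * (\<bar>K\<bar> * (?s - c0)^2)"
        proof (rule mult_mono)
          show "q t \<le> Q" using Q[OF t] by simp
          have "A ?s \<le> K * (?s - c0)^2" using K F_in by blast
          also have "\<dots> \<le> \<bar>K\<bar> * (?s - c0)^2" by (intro mult_right_mono) auto
          finally show "A ?s \<le> \<bar>K\<bar> * (?s - c0)^2" .
          show "0 \<le> Q" using Q[OF t] by linarith
          show "0 \<le> A ?s" using A_nonneg F_in by blast
        qed
        finally have "sqrt ((differential c F (x + t *\<^sub>R v) \<bullet> v)^2) \<le> sqrt (Q * (\<bar>K\<bar> * (?s - c0)^2))" by (rule real_sqrt_le_mono)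
        then show "\<bar>differential c F (x + t *\<^sub>R v) \<bullet> v\<bar> \<le> L * \<bar>?s - c0\<bar>"
          by (simp add: L_def real_sqrt_mult mult.assoc)
      qed (use p c(2) chart_inv_left[OF cc] in \<open>simp add: x_def\<close>)
      then show ?thesis by (simp add: v_def)
    qed
    define W where "W = fst c \<inter> snd c -` ball x r"
    have "open W" "p \<in> W"
      using continuous_open_preimage[OF chart_cont(1)[OF cc] chart_open(1)[OF cc] open_ball] c(2) r(1) by (auto simp: W_def x_def)
    moreover have "W \<subseteq> ?Z"
    proof
      fix q assume "q \<in> W"
      then show "q \<in> ?Z" using zero[of "snd c q"] chart_inv_left[OF cc, of q] by (simp add: W_def)
    qed
    ultimately show "\<exists>T. open T \<and> p \<in> T \<and> T \<subseteq> ?Z" by blast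
  qed
  then have "?Z = {} \<or> ?Z = UNIV" using closed connected_UNIV by (auto simp: connected_clopen)
  moreover have "?Z \<noteq> {}" using F_attains[OF c0] by auto
  ultimately have "F p = c0" for p by auto
  then have "range F = {c0}" by auto
  then show False using F_range ab by (metis atLeastAtMost_singleton_iff less_irrefl)
qed

text \<open>
  At a zero \<open>c\<close> of \<open>A\<close> the linear term of the Taylor expansion has to be positive somewhere: otherwise \<open>A\<close>
  would be bounded by its quadratic error term, contrary to \<open>level_not_degenerate\<close>. So \<open>A\<close> has simple
  zeros at \<open>a\<close> and \<open>b\<close> and no zero in between, where its derivative would vanish.
\<close>

lemma critical_value:
  assumes c: "c \<in> {a..b}" "A c = 0" and d: "\<And>x. x \<in> {a..b} \<Longrightarrow> (A has_real_derivative A' x) (at x within {a..b})" "Ck_real 1 A' {a..b}"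
  shows "\<exists>s\<in>{a..b}. A' c * (s - c) > 0"
proof (rule ccontr)
  assume "\<not> ?thesis"
  then have le: "A' c * (s - c) \<le> 0" if "s \<in> {a..b}" for s using that by (force simp: not_less)
  obtain K where "\<And>s. s \<in> {a..b} \<Longrightarrow> A s \<le> A c + A' c * (s - c) + K * (s - c)^2"
    using taylor_upper_bound[OF d c(1)] by blast
  then have "A s \<le> K * (s - c)^2" if "s \<in> {a..b}" for s using le[OF that] c(2) that by fastforce
  then show False using level_not_degenerate[OF c(1), of K] by blast
qed

lemma A_zero_at_extremum:
  assumes "F p = a \<or> F p = b"
  shows "A (F p) = 0"
proof -
  let ?c = "chart_at M p" let ?x = "snd (chart_at M p) p"
  note c = chart_at_atlas[of p]
  have x: "?x \<in> image_of ?c" using c(2) by auto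
  have Fx: "F (chart_inv ?c ?x) = F p" using chart_inv_left[OF atlas_chart[OF c(1)] c(2)] by simp
  have "(\<lambda>v. differential ?c F ?x \<bullet> v) = (\<lambda>v. 0)"
  proof (rule differential_zero_maxmin[OF x image_open[OF c(1)] directional_derivative[OF F_smooth c(1) x]])
    show "(\<forall>y\<in>image_of ?c. (F \<circ> chart_inv ?c) y \<le> (F \<circ> chart_inv ?c) ?x) \<or> (\<forall>y\<in>image_of ?c. (F \<circ> chart_inv ?c) ?x \<le> (F \<circ> chart_inv ?c) y)"
      using assms Fx F_in by auto
  qed
  then have "differential ?c F ?x \<bullet> differential ?c F ?x = 0" by metis
  then have "differential ?c F ?x = 0" by simp
  then have "pairing F F p = 0" by (simp add: pairing_def chart_pairing_def)
  then show ?thesis using pairing_F by simp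
qed

lemma A_ends: "A a = 0" "A b = 0"
  using A_zero_at_extremum F_attains[of a] F_attains[of b] ab by auto

lemma A_interior_pos:
  assumes s: "s \<in> {a<..<b}"
  shows "A s > 0"
proof (rule ccontr)
  assume "\<not> A s > 0"
  then have As: "A s = 0" using A_nonneg[of s] s by auto
  obtain A' where A': "\<forall>x\<in>{a..b}. (A has_real_derivative A' x) (at x within {a..b})" "Ck_real 1 A' {a..b}"
    using A_smooth[of "Suc 1"] by (metis Ck_real.simps(2))
  have ds: "(A has_real_derivative A' s) (at s)"
    using bspec[OF A'(1), of s] s at_within_Icc_at[of a s b] by auto
  have "A' s = 0"
  proof (rule DERIV_local_min[OF ds])
    show "0 < min (s - a) (b - s)" using s by auto
    show "\<forall>y. \<bar>s - y\<bar> < min (s - a) (b - s) \<longrightarrow> A s \<le> A y" using A_nonneg As by (auto simp: abs_if split: if_splits)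
  qed
  then show False using critical_value[OF _ As _ A'(2)] A'(1) s by force
qed

lemma A_derivative_ends:
  assumes "\<And>x. x \<in> {a..b} \<Longrightarrow> (A has_real_derivative A' x) (at x within {a..b})" "Ck_real 1 A' {a..b}"
  shows "A' a > 0" "A' b < 0"
  using critical_value[OF _ A_ends(1) assms] critical_value[OF _ A_ends(2) assms] ab
  by (auto simp: zero_less_mult_iff)

text \<open>
  The weak equation with the test function \<open>\<eta>(F)\<close>.
\<close>

lemma weak_radial:
  assumes "Ck_real 1 \<eta> {a..b}" "\<And>x. x \<in> {a..b} \<Longrightarrow> (\<eta> has_real_derivative \<eta>' x) (at x within {a..b})"
  shows "(\<integral>p. \<eta>' (F p) * A (F p) \<partial>vol) = (\<integral>p. B (F p) * \<eta> (F p) \<partial>vol)"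
proof -
  have sub: "range F \<subseteq> {a..b}" using F_range by simp
  have "pairing F (\<lambda>p. \<eta> (F p)) p = \<eta>' (F p) * A (F p)" for p
    using pairing_compose_right[OF F_smooth assms(2)[OF F_in] sub] pairing_F by simp
  then show ?thesis using weak_F[OF Ck_function_compose_real[OF F_smooth assms(1) sub]] by simp
qed

lemma AF_continuous: "continuous_on {a..b} g \<Longrightarrow> continuous_on UNIV (\<lambda>p. g (F p))"
  by (rule continuous_on_compose2[OF _ F_continuous]) (use F_range in auto)

text \<open>
  Test the weak equation with \<open>\<eta>(F)\<close>, where \<open>\<eta> s = (max 0 (a + \<epsilon> - s))\<^sup>2\<close> is concentrated near the minimum.
  The result is \<open>\<integral> (2 A + B y)(F) y(F) = 0\<close> with \<open>y = max 0 (a + \<epsilon> - s)\<close>. Now \<open>A s\<close> is about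
  \<open>A' a (s - a)\<close>. If \<open>B a \<ge> 0\<close> and \<open>L\<close> bounds \<open>\<bar>B'\<bar>\<close>, then \<open>B s y s \<ge> - L (s - a) \<epsilon>\<close>, which is negligible
  against \<open>A s\<close> for small \<open>\<epsilon>\<close>, and the integrand would be nonnegative without being zero.
\<close>

lemma B_at_minimum: "B a < 0"
proof (rule ccontr)
  assume "\<not> B a < 0"
  then have Ba: "B a \<ge> 0" by simp
  obtain A' where A': "\<And>x. x \<in> {a..b} \<Longrightarrow> (A has_real_derivative A' x) (at x within {a..b})" "Ck_real 1 A' {a..b}"
    using A_smooth[of "Suc 1"] by (metis Ck_real.simps(2))
  have pos: "A' a > 0" by (rule A_derivative_ends[OF A'])
  obtain A'' K where A'': "\<And>x. x \<in> {a..b} \<Longrightarrow> (A' has_real_derivative A'' x) (at x within {a..b})" "\<And>x. x \<in> {a..b} \<Longrightarrow> \<bar>A'' x\<bar> \<le> K" "K \<ge> 0"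
    using Ck_real_derivative_bounded[OF A'(2)] by metis
  obtain B' L where B': "\<And>x. x \<in> {a..b} \<Longrightarrow> (B has_real_derivative B' x) (at x within {a..b})" "\<And>x. x \<in> {a..b} \<Longrightarrow> \<bar>B' x\<bar> \<le> L" "L \<ge> 0"
    using Ck_real_derivative_bounded[OF B_smooth[of 1]] by metis
  \<comment> \<open>small enough for the errors \<open>K \<epsilon>\<close> and \<open>L \<epsilon>\<close> to stay below half of \<open>A' a\<close>\<close>
  define \<epsilon> where "\<epsilon> = min (b - a) (A' a / (2 * (K + L + 1)))"
  have KL: "K + L + 1 > 0" using A''(3) B'(3) by simp
  have \<epsilon>: "\<epsilon> > 0" "\<epsilon> \<le> b - a" "\<epsilon> * (K + L + 1) \<le> A' a / 2"
  proof -
    show "\<epsilon> > 0" using ab pos KL by (simp add: \<epsilon>_def)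
    show "\<epsilon> \<le> b - a" by (simp add: \<epsilon>_def)
    have "\<epsilon> * (K + L + 1) \<le> A' a / (2 * (K + L + 1)) * (K + L + 1)" using KL by (intro mult_right_mono) (auto simp: \<epsilon>_def)
    also have "\<dots> = A' a / 2"
    proof -
      have "z / (2 * x) * x = z / 2" if "x > 0" for x z :: real using that by simp
      then show ?thesis using KL by blast
    qed
    finally show "\<epsilon> * (K + L + 1) \<le> A' a / 2" .
  qed
  define y where "y s = max 0 (a + \<epsilon> - s)" for s
  define \<eta> where "\<eta> s = y s ^ 2" for s
  have \<eta>: "(\<eta> has_real_derivative - 2 * y s) (at s within T)" for s T
  proof -
    have "((\<lambda>s. a + \<epsilon> - s) has_real_derivative - 1) (at s within T)" by (auto intro!: derivative_eq_intros)
    from DERIV_chain2[OF has_real_derivative_truncated_power[of 0] this] show ?thesis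
      by (simp add: \<eta>_def[abs_def] y_def numeral_2_eq_2)
  qed
  have yc: "continuous_on T y" for T unfolding y_def by (intro continuous_intros)
  have "Ck_real 1 \<eta> {a..b}"
    using \<eta> by (auto intro!: exI[of _ "\<lambda>s. - 2 * y s"] continuous_intros yc)
  then have "(\<integral>p. - 2 * y (F p) * A (F p) \<partial>vol) = (\<integral>p. B (F p) * \<eta> (F p) \<partial>vol)"
    by (rule weak_radial[where \<eta>'="\<lambda>s. - 2 * y s"]) (rule \<eta>)
  define k where "k s = (2 * A s + B s * y s) * y s" for s
  have Ac: "continuous_on {a..b} A" and Bc: "continuous_on {a..b} B"
    using A_smooth[of 0] B_smooth[of 0] by auto
  have est: "(2 * A s + B s * y s) \<ge> (A' a / 2) * (s - a)" if s: "s \<in> {a..b}" "s \<le> a + \<epsilon>" for s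
  proof -
    have aI: "a \<in> {a..b}" using ab by simp
    obtain \<xi> where \<xi>: "\<xi> \<in> {a..b}" "\<bar>\<xi> - a\<bar> \<le> \<bar>s - a\<bar>" "A s - A a = A' \<xi> * (s - a)"
      using mvt_interval[OF A'(1) aI s(1)] by metis
    obtain \<zeta> where \<zeta>: "\<zeta> \<in> {a..b}" "A' \<xi> - A' a = A'' \<zeta> * (\<xi> - a)"
      using mvt_interval[OF A''(1) aI \<xi>(1)] by metis
    have sa: "0 \<le> s - a" "s - a \<le> \<epsilon>" using s by auto
    have "\<bar>A' \<xi> - A' a\<bar> \<le> K * \<epsilon>" unfolding \<zeta>(2) abs_mult using A''(2)[OF \<zeta>(1)] \<xi>(2) sa by (intro mult_mono) auto
    moreover have "K * \<epsilon> \<le> A' a / 2" using \<epsilon>(1,3) B'(3) by (simp add: algebra_simps) (smt (verit) mult_nonneg_nonneg)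
    ultimately have "A' \<xi> \<ge> A' a / 2" by linarith
    then have "A s \<ge> A' a / 2 * (s - a)" using mult_right_mono[OF _ sa(1), of "A' a / 2" "A' \<xi>"] \<xi>(3) A_ends(1) by simp
    moreover have "B s * y s \<ge> - (A' a / 2) * (s - a)"
    proof -
      obtain \<omega> where \<omega>: "\<omega> \<in> {a..b}" "B s - B a = B' \<omega> * (s - a)"
        using mvt_interval[OF B'(1) aI s(1)] by metis
      have "- B' \<omega> * (s - a) \<le> L * (s - a)" using B'(2)[OF \<omega>(1)] sa by (intro mult_right_mono) auto
      then have "B s \<ge> - (L * (s - a))" using \<omega>(2) Ba by simp
      moreover have y: "0 \<le> y s" "y s \<le> \<epsilon>" using s \<epsilon>(1) by (auto simp: y_def)
      ultimately have "B s * y s \<ge> - (L * (s - a)) * y s" by (intro mult_right_mono)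
      moreover have "L * (s - a) * y s \<le> L * (s - a) * \<epsilon>" using y B'(3) sa by (intro mult_left_mono) auto
      moreover have "L * (s - a) * \<epsilon> \<le> (A' a / 2) * (s - a)"
      proof -
        have "L * \<epsilon> \<le> A' a / 2" using \<epsilon>(1,3) A''(3) by (simp add: algebra_simps) (smt (verit) mult_nonneg_nonneg)
        then have "(L * \<epsilon>) * (s - a) \<le> (A' a / 2) * (s - a)" by (rule mult_right_mono[OF _ sa(1)])
        moreover have "L * (s - a) * \<epsilon> = (L * \<epsilon>) * (s - a)" by (simp only: mult_ac)
        ultimately show ?thesis by (simp only:)
      qed
      moreover have "- (L * (s - a)) * y s = - (L * (s - a) * y s)" "- (A' a / 2) * (s - a) = - ((A' a / 2) * (s - a))"
        by (rule minus_mult_left[symmetric])+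
      ultimately show ?thesis by linarith
    qed
    ultimately show ?thesis by linarith
  qed
  have knn: "k s \<ge> 0" if "s \<in> {a..b}" for s
  proof (cases "s \<le> a + \<epsilon>")
    case True
    have "(A' a / 2) * (s - a) \<ge> 0" using pos that by simp
    then show ?thesis using est[OF that True] unfolding k_def y_def by (intro mult_nonneg_nonneg) auto
  qed (simp add: k_def y_def)
  obtain p where p: "F p = a + \<epsilon> / 2" using F_attains[of "a + \<epsilon> / 2"] \<epsilon> ab by auto
  have "k (F p) = 0"
  proof (rule integral_continuous_nonneg_zero)
    show "continuous_on UNIV (\<lambda>p. k (F p))"
      by (rule AF_continuous) (auto simp: k_def intro!: continuous_intros Ac Bc yc)
    show "0 \<le> k (F p)" for p using knn F_in by blast
    have i1: "integrable vol (\<lambda>p. - 2 * y (F p) * A (F p))" "integrable vol (\<lambda>p. B (F p) * \<eta> (F p))"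
      by (intro integrable_continuous AF_continuous[of "\<lambda>s. - 2 * y s * A s"] AF_continuous[of "\<lambda>s. B s * \<eta> s"];
          auto simp: \<eta>_def intro!: continuous_intros Ac Bc yc)+
    have "(\<integral>p. k (F p) \<partial>vol) = (\<integral>p. B (F p) * \<eta> (F p) - (- 2 * y (F p) * A (F p)) \<partial>vol)"
      by (rule Bochner_Integration.integral_cong) (auto simp: k_def \<eta>_def power2_eq_square algebra_simps)
    also have "\<dots> = 0" using i1 \<open>(\<integral>p. - 2 * y (F p) * A (F p) \<partial>vol) = _\<close> by simp
    finally show "(\<integral>p. k (F p) \<partial>vol) = 0" .
  qed
  moreover have "k (F p) > 0"
  proof -
    have yp: "y (F p) = \<epsilon> / 2" using p \<epsilon>(1) by (simp add: y_def)
    have "F p \<le> a + \<epsilon>" using p \<epsilon>(1) by simp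
    from est[OF F_in this] have "2 * A (F p) + B (F p) * y (F p) \<ge> (A' a / 2) * (\<epsilon> / 2)" using p by simp
    moreover have "(A' a / 2) * (\<epsilon> / 2) > 0" using pos \<epsilon>(1) by simp
    ultimately have "2 * A (F p) + B (F p) * y (F p) > 0" by linarith
    moreover have "y (F p) > 0" using yp \<epsilon>(1) by simp
    ultimately show ?thesis unfolding k_def by (rule mult_pos_pos)
  qed
  ultimately show False by simp
qed

lemma reflected: "isoparametric M (\<lambda>p. - F p) (- b) (- a) (\<lambda>s. A (- s)) (\<lambda>s. - B (- s))"
proof
  have im: "uminus ` {- b..- a} = {a..b}" by auto
  have neg: "Ck_real k (\<lambda>x::real. - x) UNIV" for k
  proof (cases k)
    case (Suc j)
    have "\<exists>f'. (\<forall>x\<in>UNIV. ((\<lambda>x. - x) has_real_derivative f' x) (at x within UNIV)) \<and> Ck_real j f' UNIV"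
      by (rule exI[of _ "\<lambda>_. - 1"]) (auto intro!: derivative_eq_intros Ck_real_const)
    then show ?thesis using Suc by simp
  qed (auto intro: continuous_intros)
  show "Ck_function k (\<lambda>p. - F p)" for k by (rule Ck_function_compose_real[OF F_smooth neg]) simp
  have pr: "pairing u (\<lambda>p. - F p) p = - pairing u F p" for u p
  proof -
    have "pairing u (\<lambda>p. - F p) p = - 1 * pairing u F p"
      by (rule pairing_compose_right[OF F_smooth, where T=UNIV and g="\<lambda>x. - x"]) (auto intro!: derivative_eq_intros)
    then show ?thesis by simp
  qed
  show "pairing (\<lambda>p. - F p) (\<lambda>p. - F p) p = A (- (- F p))" for p
    using pr[of "\<lambda>p. - F p" p] pr[of F p] pairing_sym[of "\<lambda>p. - F p" F p] pairing_F[of p] by simp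
  show "(\<integral>p. pairing (\<lambda>p. - F p) \<phi> p \<partial>vol) = (\<integral>p. - B (- (- F p)) * \<phi> p \<partial>vol)" if "C1_function \<phi>" for \<phi>
  proof -
    have "pairing (\<lambda>p. - F p) \<phi> p = - pairing F \<phi> p" for p
      using pr[of \<phi> p] by (simp add: pairing_sym[of _ \<phi>])
    then show ?thesis using weak_F[OF that] by simp
  qed
  show "range (\<lambda>p. - F p) = {- b..- a}" using F_range by (metis image_image image_uminus_atLeastAtMost)
  show "Ck_real k (\<lambda>s. A (- s)) {- b..- a}" "Ck_real k (\<lambda>s. - B (- s)) {- b..- a}" for k
    using Ck_real_reflect[OF A_smooth im] Ck_real_cmult[OF Ck_real_reflect[OF B_smooth im], of k "-1"] by auto
qed (use ab connected_UNIV in auto)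

lemma B_at_maximum: "B b > 0"
  using isoparametric.B_at_minimum[OF reflected] by simp

text \<open>
  On an open set where \<open>F = b\<close>, the pairing with a bump function \<open>\<beta>\<close> vanishes, so the weak equation
  gives \<open>B b \<integral> \<beta> = 0\<close>, although \<open>B b > 0\<close>.
\<close>

lemma maximum_set_no_interior:
  assumes "open W" "p \<in> W"
  shows "\<exists>q\<in>W. F q < b"
proof (rule ccontr)
  assume "\<not> ?thesis"
  then have FW: "F q = b" if "q \<in> W" for q using F_in[of q] that by force
  obtain \<beta> S where \<beta>': "C1_function \<beta> \<and> (\<forall>q. \<beta> q \<ge> 0) \<and> \<beta> p > 0 \<and> compact S \<and> S \<subseteq> W \<inter> fst (chart_at M p) \<and> (\<forall>q. q \<notin> S \<longrightarrow> \<beta> q = 0)"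
    using bump_function[OF chart_at_atlas(1) chart_at_atlas(2) assms] by (elim exE) (rule that)
  then have \<beta>: "C1_function \<beta>" "\<And>q. \<beta> q \<ge> 0" "\<beta> p > 0" "compact S" "S \<subseteq> W" "\<And>q. q \<notin> S \<Longrightarrow> \<beta> q = 0"
    by auto
  have "pairing F \<beta> q = 0" for q
  proof (cases "q \<in> S")
    case True
    have "pairing \<beta> (\<lambda>p. F p + (- b)) q = 0"
      by (rule pairing_zero_outside[OF assms(1)]) (use FW True \<beta>(5) in auto)
    moreover have "pairing \<beta> (\<lambda>p. F p + (- b)) q = pairing \<beta> F q"
      using pairing_add_right[OF F_smooth Ck_function_const, of \<beta> "- b" q] by (simp add: pairing_const_right)
    ultimately show ?thesis by (simp add: pairing_sym[of F])
  next
    case False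
    then show ?thesis
      by (intro pairing_zero_outside[of "- S"]) (use \<beta>(4,6) compact_imp_closed in auto)
  qed
  then have "(\<integral>q. B (F q) * \<beta> q \<partial>vol) = 0" using weak_F[OF \<beta>(1)] by simp
  moreover have eq: "B (F q) * \<beta> q = B b * \<beta> q" for q using FW \<beta>(5,6) by (cases "q \<in> S") auto
  ultimately have z: "(\<integral>q. B b * \<beta> q \<partial>vol) = 0" by simp
  have "B b * \<beta> p = 0"
    by (rule integral_continuous_nonneg_zero[OF _ _ z])
      (use B_at_maximum \<beta>(2) in \<open>auto intro!: continuous_intros Ck_function_continuous[OF \<beta>(1)]\<close>)
  then show False using B_at_maximum \<beta>(3) by simp
qed

lemma focal: "\<exists>A'. focal_coefficients a b A A' B"
proof -
  obtain A' where A': "\<And>x. x \<in> {a..b} \<Longrightarrow> (A has_real_derivative A' x) (at x within {a..b})"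
    using A_smooth[of "Suc 0"] unfolding Ck_real.simps by blast
  have A'k: "Ck_real k A' {a..b}" for k
  proof -
    obtain D where D: "\<forall>x\<in>{a..b}. (A has_real_derivative D x) (at x within {a..b})" "Ck_real k D {a..b}"
      using A_smooth[of "Suc k"] by auto
    have "D x = A' x" if "x \<in> {a..b}" for x
    proof (rule has_field_derivative_unique)
      show "at x within {a..b} \<noteq> bot" using that ab by (auto simp: trivial_limit_within islimpt_Icc)
    qed (use D A' that in auto)
    then show ?thesis using Ck_real_cong[OF D(2)] by blast
  qed
  have "focal_coefficients a b A A' B"
    by unfold_locales (use ab A_interior_pos A_ends A_smooth A'k A' A_derivative_ends[OF A' A'k] B_smooth B_at_minimum B_at_maximum in auto)
  then show ?thesis by blast
qed

end

section \<open>Curves and the Riemannian distance\<close>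

context riemannian begin

text \<open>
  \<open>piecewise_C1_curve\<close> with the exceptional set of times as a parameter.
\<close>

definition good_times :: "(real \<Rightarrow> 'a) \<Rightarrow> real set \<Rightarrow> bool" where
  "good_times \<gamma> K \<longleftrightarrow> path \<gamma> \<and> finite K \<and>
     (\<forall>c\<in>atlas M. (snd c \<circ> \<gamma>) C1_differentiable_on (({0..1} - K) \<inter> \<gamma> -` fst c))"

lemma piecewise_C1_iff: "piecewise_C1_curve M \<gamma> \<longleftrightarrow> (\<exists>K. good_times \<gamma> K)"
  by (auto simp: piecewise_C1_curve_def good_times_def)

lemma path_isCont: "path \<gamma> \<Longrightarrow> t \<in> {0<..<1} \<Longrightarrow> isCont \<gamma> t"
  unfolding path_def by (rule continuous_on_interior) auto

lemma eventually_in_chart: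
  assumes c: "c \<in> atlas M" and "isCont \<gamma> t" "\<gamma> t \<in> fst c"
  shows "\<forall>\<^sub>F s in nhds t. \<gamma> s \<in> fst c"
proof -
  have "filterlim \<gamma> (nhds (\<gamma> t)) (nhds t)" using assms(2) by (simp add: isCont_def tendsto_at_iff_tendsto_nhds)
  then show ?thesis using topological_tendstoD chart_open(1)[OF atlas_chart[OF c]] assms(3) by blast
qed

text \<open>
  The speed is defined in a selected chart that changes from point to point. It may be computed in any
  chart around the point, since velocities transform with the Jacobian matrix of the transition map.
\<close>

lemma speed_chart:
  assumes c: "c \<in> atlas M" "\<gamma> t \<in> fst c" and \<gamma>: "isCont \<gamma> t"
    and v: "((snd c \<circ> \<gamma>) has_vector_derivative v) (at t)"
  shows "speed M \<gamma> t = sqrt (v \<bullet> (metric M c (snd c (\<gamma> t)) *v v))"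
proof -
  let ?c' = "chart_at M (\<gamma> t)" let ?\<tau> = "local_rep id c ?c'" let ?x = "snd c (\<gamma> t)"
  note c' = chart_at_atlas[of "\<gamma> t"]
  have x: "?x \<in> local_dom id c ?c'" using c c'(2) by (auto simp: local_dom_def)
  have \<tau>: "(?\<tau> has_derivative frechet_derivative ?\<tau> (at ?x)) (at ?x)"
    using local_rep_derivative[OF _ c(1) c'(1) x] local_isometry_id by blast
  have \<tau>v: "frechet_derivative ?\<tau> (at ?x) w = jacobian ?\<tau> (at ?x) *v w" for w
    using has_derivative_linear[OF \<tau>] by (simp add: jacobian_def matrix_works)
  have "((\<lambda>s. ?\<tau> ((snd c \<circ> \<gamma>) s)) has_derivative (\<lambda>h. frechet_derivative ?\<tau> (at ?x) (h *\<^sub>R v))) (at t)"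
    by (rule has_derivative_compose[where f="snd c \<circ> \<gamma>", OF v[unfolded has_vector_derivative_def]]) (unfold o_apply, rule \<tau>)
  then have d: "((\<lambda>s. ?\<tau> ((snd c \<circ> \<gamma>) s)) has_vector_derivative jacobian ?\<tau> (at ?x) *v v) (at t)"
    unfolding has_vector_derivative_def \<tau>v by (simp add: matrix_vector_mult_scaleR)
  have ev: "\<forall>\<^sub>F s in nhds t. ?\<tau> ((snd c \<circ> \<gamma>) s) = (snd ?c' \<circ> \<gamma>) s"
    using eventually_in_chart[OF c(1) \<gamma> c(2)]
    by eventually_elim (simp add: local_rep_def chart_inv_left[OF atlas_chart[OF c(1)]])
  have "((snd ?c' \<circ> \<gamma>) has_vector_derivative jacobian ?\<tau> (at ?x) *v v) (at t)"
  proof -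
    obtain T where T: "open T" "t \<in> T" "\<forall>s\<in>T. ?\<tau> ((snd c \<circ> \<gamma>) s) = (snd ?c' \<circ> \<gamma>) s"
      using ev unfolding eventually_nhds by blast
    show ?thesis by (rule has_vector_derivative_transform_within_open[OF d T(1,2)]) (use T(3) in blast)
  qed
  then have vd: "vector_derivative (snd ?c' \<circ> \<gamma>) (at t) = jacobian ?\<tau> (at ?x) *v v"
    by (rule vector_derivative_at)
  have \<tau>x: "?\<tau> ?x = snd ?c' (\<gamma> t)" using chart_inv_left[OF atlas_chart[OF c(1)] c(2)] by (simp add: local_rep_def)
  let ?J = "jacobian ?\<tau> (at ?x)"
  have "v \<bullet> (metric M c ?x *v v) = v \<bullet> (transpose ?J *v (metric M ?c' (?\<tau> ?x) *v (?J *v v)))"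
    using metric_pullback[OF _ c(1) c'(1) x] local_isometry_id by (simp add: matrix_vector_mul_assoc matrix_mul_assoc)
  also have "\<dots> = (?J *v v) \<bullet> (metric M ?c' (?\<tau> ?x) *v (?J *v v))" by (rule inner_transpose_matrix)
  finally show ?thesis by (simp add: speed_def Let_def vd \<tau>x)
qed

lemma good_timesD:
  assumes "good_times \<gamma> K"
  shows "path \<gamma>" "finite K"
    and "c \<in> atlas M \<Longrightarrow> \<exists>D. (\<forall>t\<in>({0<..<1} - K) \<inter> \<gamma> -` fst c. ((snd c \<circ> \<gamma>) has_vector_derivative D t) (at t)) \<and> continuous_on (({0<..<1} - K) \<inter> \<gamma> -` fst c) D"
proof -
  show "path \<gamma>" "finite K" using assms by (auto simp: good_times_def)
  assume "c \<in> atlas M"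
  then have "(snd c \<circ> \<gamma>) C1_differentiable_on (({0..1} - K) \<inter> \<gamma> -` fst c)" using assms by (simp add: good_times_def)
  then obtain D where D: "\<forall>t\<in>({0..1} - K) \<inter> \<gamma> -` fst c. ((snd c \<circ> \<gamma>) has_vector_derivative D t) (at t)"
     "continuous_on (({0..1} - K) \<inter> \<gamma> -` fst c) D"
    unfolding C1_differentiable_on_def by blast
  have "({0<..<1} - K) \<inter> \<gamma> -` fst c \<subseteq> ({0..1} - K) \<inter> \<gamma> -` fst c" by auto
  with D show "\<exists>D. (\<forall>t\<in>({0<..<1} - K) \<inter> \<gamma> -` fst c. ((snd c \<circ> \<gamma>) has_vector_derivative D t) (at t)) \<and> continuous_on (({0<..<1} - K) \<inter> \<gamma> -` fst c) D"
    by (meson continuous_on_subset subsetD)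
qed

text \<open>
  Near a given time a single chart can be used, in which the speed is given by a continuous formula.
\<close>

lemma speed_continuous:
  assumes g: "good_times \<gamma> K"
  shows "continuous_on ({0<..<1} - K) (speed M \<gamma>)"
proof (intro continuous_at_imp_continuous_on ballI)
  fix t assume t: "t \<in> {0<..<1} - K"
  note path = good_timesD(1)[OF g]
  let ?c = "chart_at M (\<gamma> t)"
  note c = chart_at_atlas[of "\<gamma> t"]
  define N where "N = ({0<..<1} - K) \<inter> \<gamma> -` fst ?c"
  obtain D where D: "\<forall>t\<in>N. ((snd ?c \<circ> \<gamma>) has_vector_derivative D t) (at t)" "continuous_on N D"
    using good_timesD(3)[OF g c(1)] unfolding N_def by blast
  have op: "open ({0<..<1} - K)" using good_timesD(2)[OF g] by (intro open_Diff) (auto simp: finite_imp_closed)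
  have cont\<gamma>: "continuous_on ({0<..<1} - K) \<gamma>"
    using path unfolding path_def by (rule continuous_on_subset) auto
  have N: "open N" "t \<in> N"
    unfolding N_def using continuous_open_preimage[OF cont\<gamma> op chart_open(1)[OF atlas_chart[OF c(1)]]] t c(2) by auto
  have \<gamma>N: "continuous_on N \<gamma>" "\<gamma> ` N \<subseteq> fst ?c" using continuous_on_subset[OF cont\<gamma>] by (auto simp: N_def)
  have \<kappa>: "continuous_on N (\<lambda>s. snd ?c (\<gamma> s))"
    by (rule continuous_on_compose2[OF chart_cont(1)[OF atlas_chart[OF c(1)]] \<gamma>N])
  have "continuous_on N (\<lambda>s. sqrt (D s \<bullet> (metric M ?c (snd ?c (\<gamma> s)) *v D s)))"
    by (intro continuous_intros continuous_on_quadratic_form D(2)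
        continuous_on_compose2[OF Ck_on_continuous[OF metric_smooth[OF c(1), of 0]] \<kappa>]) (use \<gamma>N in auto)
  moreover have "sqrt (D s \<bullet> (metric M ?c (snd ?c (\<gamma> s)) *v D s)) = speed M \<gamma> s" if "s \<in> N" for s
  proof (rule speed_chart[OF c(1) _ path_isCont[OF path], symmetric])
    show "\<gamma> s \<in> fst ?c" "s \<in> {0<..<1}" using that by (auto simp: N_def)
    show "((snd ?c \<circ> \<gamma>) has_vector_derivative D s) (at s)" using D(1) that by blast
  qed
  ultimately have "continuous_on N (speed M \<gamma>)" by (rule continuous_on_eq)
  then show "isCont (speed M \<gamma>) t" using N by (simp add: continuous_on_eq_continuous_at)
qed

lemma speed_nonneg: "speed M \<gamma> t \<ge> 0"
proof -
  let ?c = "chart_at M (\<gamma> t)"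
  have x: "snd ?c (\<gamma> t) \<in> image_of ?c" using chart_at_atlas(2) by auto
  have "v \<bullet> (metric M ?c (snd ?c (\<gamma> t)) *v v) \<ge> 0" for v
    using metric_positive[OF chart_at_atlas(1) x, of v] by (cases "v = 0") auto
  then show ?thesis by (simp add: speed_def Let_def)
qed

lemma curve_length_open:
  assumes "finite K"
  shows "curve_length M \<gamma> = (\<integral>\<^sup>+t. ennreal (speed M \<gamma> t) * indicator ({0<..<1} - K) t \<partial>lborel)"
  unfolding curve_length_def
proof (rule nn_integral_cong_AE)
  have "AE t in lborel. t \<notin> K \<union> {0, 1 :: real}"
    using assms by (intro AE_not_in finite_imp_null_set_lborel) auto
  then show "AE t in lborel. ennreal (speed M \<gamma> t) * indicator {0..1} t = ennreal (speed M \<gamma> t) * indicator ({0<..<1} - K) t"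
    by eventually_elim (auto simp: indicator_def)
qed

lemma speed_measurable:
  assumes g: "good_times \<gamma> K"
  shows "(\<lambda>t. ennreal (speed M \<gamma> t) * indicator ({0<..<1} - K) t) \<in> borel_measurable borel"
proof -
  have "open ({0<..<1} - K)" using good_timesD(2)[OF g] by (intro open_Diff) (auto simp: finite_imp_closed)
  then have "({0<..<1} - K) \<in> sets borel" by simp
  then have "(\<lambda>t. indicator ({0<..<1} - K) t *\<^sub>R speed M \<gamma> t) \<in> borel_measurable borel"
    by (rule borel_measurable_continuous_on_indicator[OF _ speed_continuous[OF g]])
  then have "(\<lambda>t. ennreal (indicator ({0<..<1} - K) t *\<^sub>R speed M \<gamma> t)) \<in> borel_measurable borel" by measurable
  moreover have "ennreal (indicator ({0<..<1} - K) t *\<^sub>R speed M \<gamma> t) = ennreal (speed M \<gamma> t) * indicator ({0<..<1} - K) t" for t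
    by (auto simp: indicator_def)
  ultimately show ?thesis by simp
qed

lemma has_vector_derivative_affine:
  assumes "(f has_vector_derivative v) (at (k * t + m))"
  shows "((\<lambda>t. f (k * t + m)) has_vector_derivative k *\<^sub>R v) (at (t::real))"
proof -
  have "((\<lambda>t. k * t + m) has_vector_derivative k) (at t)"
    unfolding has_real_derivative_iff_has_vector_derivative[symmetric] by (auto intro!: derivative_eq_intros)
  from vector_diff_chain_at[OF this assms] show ?thesis by (simp add: o_def)
qed

text \<open>
  Each half of the joined curve runs through one of the curves with double speed. The new exceptional set
  contains the time \<open>1 / 2\<close>, where the velocity may jump.
\<close>

lemma join_curves:
  assumes g1: "good_times \<gamma>1 K1" and g2: "good_times \<gamma>2 K2" and e: "pathfinish \<gamma>1 = pathstart \<gamma>2"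
  shows "piecewise_C1_curve M (\<gamma>1 +++ \<gamma>2)" "curve_length M (\<gamma>1 +++ \<gamma>2) = curve_length M \<gamma>1 + curve_length M \<gamma>2"
proof -
  let ?\<gamma> = "\<gamma>1 +++ \<gamma>2"
  define K where "K = {0, 1/2, 1} \<union> (\<lambda>t. t / 2) ` K1 \<union> (\<lambda>t. (t + 1) / 2) ` K2"
  have p: "path ?\<gamma>" using good_timesD(1)[OF g1] good_timesD(1)[OF g2] e by (rule path_join_imp)
  have K: "finite K" using good_timesD(2)[OF g1] good_timesD(2)[OF g2] by (simp add: K_def)
  have left: "2 * t \<in> {0<..<1} - K1" "?\<gamma> t = \<gamma>1 (2 * t)" if "t \<in> ({0<..<1} - K) \<inter> {..<1/2}" for t
  proof -
    have "2 * t \<notin> K1"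
    proof
      assume "2 * t \<in> K1"
      then have "(2 * t) / 2 \<in> K" unfolding K_def by blast
      then show False using that by simp
    qed
    then show "2 * t \<in> {0<..<1} - K1" "?\<gamma> t = \<gamma>1 (2 * t)" using that by (auto simp: joinpaths_def)
  qed
  have right: "2 * t - 1 \<in> {0<..<1} - K2" "?\<gamma> t = \<gamma>2 (2 * t - 1)" if "t \<in> ({0<..<1} - K) \<inter> {1/2<..}" for t
  proof -
    have "2 * t - 1 \<notin> K2"
    proof
      assume "2 * t - 1 \<in> K2"
      then have "((2 * t - 1) + 1) / 2 \<in> K" unfolding K_def by blast
      then show False using that by simp
    qed
    then show "2 * t - 1 \<in> {0<..<1} - K2" "?\<gamma> t = \<gamma>2 (2 * t - 1)" using that by (auto simp: joinpaths_def)
  qed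
  have derL: "((snd c \<circ> ?\<gamma>) has_vector_derivative 2 *\<^sub>R v) (at t)"
    if "((snd c \<circ> \<gamma>1) has_vector_derivative v) (at (2 * t))" "t < 1/2" for c :: "('a, 'n) chart" and v t
  proof -
    have "((\<lambda>t. (snd c \<circ> \<gamma>1) (2 * t + 0)) has_vector_derivative 2 *\<^sub>R v) (at t)"
      by (rule has_vector_derivative_affine) (use that in \<open>simp only: add_0_right\<close>)
    then show ?thesis
      by (rule has_vector_derivative_transform_within_open[of _ _ _ "{..<1/2}"]) (use that in \<open>auto simp: joinpaths_def\<close>)
  qed
  have derR: "((snd c \<circ> ?\<gamma>) has_vector_derivative 2 *\<^sub>R v) (at t)"
    if "((snd c \<circ> \<gamma>2) has_vector_derivative v) (at (2 * t - 1))" "t > 1/2" for c :: "('a, 'n) chart" and v t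
  proof -
    have "((\<lambda>t. (snd c \<circ> \<gamma>2) (2 * t + - 1)) has_vector_derivative 2 *\<^sub>R v) (at t)"
      by (rule has_vector_derivative_affine) (use that in \<open>simp only: add_uminus_conv_diff\<close>)
    then show ?thesis
      by (rule has_vector_derivative_transform_within_open[of _ _ _ "{1/2<..}"]) (use that in \<open>auto simp: joinpaths_def\<close>)
  qed
  have good: "good_times ?\<gamma> K"
    unfolding good_times_def
  proof (intro conjI ballI p K)
    fix c assume c: "c \<in> atlas M"
    let ?S = "({0..1} - K) \<inter> ?\<gamma> -` fst c"
    have S: "?S = ({0<..<1} - K) \<inter> ?\<gamma> -` fst c" by (auto simp: K_def less_le)
    obtain D1 where D1: "\<forall>t\<in>({0<..<1} - K1) \<inter> \<gamma>1 -` fst c. ((snd c \<circ> \<gamma>1) has_vector_derivative D1 t) (at t)" "continuous_on (({0<..<1} - K1) \<inter> \<gamma>1 -` fst c) D1"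
      using good_timesD(3)[OF g1 c] by blast
    obtain D2 where D2: "\<forall>t\<in>({0<..<1} - K2) \<inter> \<gamma>2 -` fst c. ((snd c \<circ> \<gamma>2) has_vector_derivative D2 t) (at t)" "continuous_on (({0<..<1} - K2) \<inter> \<gamma>2 -` fst c) D2"
      using good_timesD(3)[OF g2 c] by blast
    define D where "D t = (if t < 1/2 then 2 *\<^sub>R D1 (2 * t) else 2 *\<^sub>R D2 (2 * t - 1))" for t
    have split: "?S = (?S \<inter> {..<1/2}) \<union> (?S \<inter> {1/2<..})" by (auto simp: K_def)
    have L: "2 * t \<in> ({0<..<1} - K1) \<inter> \<gamma>1 -` fst c" if "t \<in> ?S \<inter> {..<1/2}" for t
      using left[of t] that unfolding S by auto
    have R: "2 * t - 1 \<in> ({0<..<1} - K2) \<inter> \<gamma>2 -` fst c" if "t \<in> ?S \<inter> {1/2<..}" for t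
      using right[of t] that unfolding S by auto
    have "((snd c \<circ> ?\<gamma>) has_vector_derivative D t) (at t)" if "t \<in> ?S" for t
    proof (cases "t < 1/2")
      case True
      then have "2 * t \<in> ({0<..<1} - K1) \<inter> \<gamma>1 -` fst c" using L that by simp
      then show ?thesis using derL[of c "D1 (2 * t)" t] D1(1) True by (simp add: D_def)
    next
      case False
      then have "t > 1/2" using that by (auto simp: K_def less_le)
      then have "2 * t - 1 \<in> ({0<..<1} - K2) \<inter> \<gamma>2 -` fst c" using R that by simp
      then show ?thesis using derR[of c "D2 (2 * t - 1)" t] D2(1) \<open>t > 1/2\<close> by (simp add: D_def)
    qed
    moreover have "continuous_on ((?S \<inter> {..<1/2}) \<union> (?S \<inter> {1/2<..})) D"
    proof (rule continuous_on_Un_local_open)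
      show "openin (top_of_set (?S \<inter> {..<1/2} \<union> ?S \<inter> {1/2<..})) (?S \<inter> {..<1/2})"
        "openin (top_of_set (?S \<inter> {..<1/2} \<union> ?S \<inter> {1/2<..})) (?S \<inter> {1/2<..})"
        unfolding split[symmetric] by (auto intro: openin_open_Int)
      have "continuous_on (?S \<inter> {..<1/2}) (\<lambda>t. 2 *\<^sub>R D1 (2 * t))"
        by (intro continuous_intros continuous_on_compose2[OF D1(2)]) (use L in blast)
      then show "continuous_on (?S \<inter> {..<1/2}) D" by (rule continuous_on_eq) (auto simp: D_def)
      have "continuous_on (?S \<inter> {1/2<..}) (\<lambda>t. 2 *\<^sub>R D2 (2 * t - 1))"
        by (intro continuous_intros continuous_on_compose2[OF D2(2)]) (use R in blast)
      then show "continuous_on (?S \<inter> {1/2<..}) D" by (rule continuous_on_eq) (auto simp: D_def)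
    qed
    ultimately show "(snd c \<circ> ?\<gamma>) C1_differentiable_on ?S"
      unfolding C1_differentiable_on_def split[symmetric] by blast
  qed
  then show "piecewise_C1_curve M ?\<gamma>" using piecewise_C1_iff by blast
  have spL: "speed M ?\<gamma> t = 2 * speed M \<gamma>1 (2 * t)" if t: "t \<in> ({0<..<1} - K) \<inter> {..<1/2}" for t
  proof -
    note tl = left[OF t]
    let ?c = "chart_at M (\<gamma>1 (2 * t))"
    note c = chart_at_atlas[of "\<gamma>1 (2 * t)"]
    obtain v where v: "((snd ?c \<circ> \<gamma>1) has_vector_derivative v) (at (2 * t))"
      using good_timesD(3)[OF g1 c(1)] tl(1) c(2) by blast
    have "speed M \<gamma>1 (2 * t) = sqrt (v \<bullet> (metric M ?c (snd ?c (\<gamma>1 (2 * t))) *v v))"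
      by (rule speed_chart[OF c path_isCont[OF good_timesD(1)[OF g1]] v]) (use tl in auto)
    moreover have "speed M ?\<gamma> t = sqrt ((2 *\<^sub>R v) \<bullet> (metric M ?c (snd ?c (?\<gamma> t)) *v (2 *\<^sub>R v)))"
      by (rule speed_chart[OF c(1) _ path_isCont[OF p] derL[OF v]]) (use c(2) tl t in auto)
    ultimately show ?thesis by (simp add: tl(2) matrix_vector_mult_scaleR real_sqrt_mult)
  qed
  have spR: "speed M ?\<gamma> t = 2 * speed M \<gamma>2 (2 * t - 1)" if t: "t \<in> ({0<..<1} - K) \<inter> {1/2<..}" for t
  proof -
    note tr = right[OF t]
    let ?c = "chart_at M (\<gamma>2 (2 * t - 1))"
    note c = chart_at_atlas[of "\<gamma>2 (2 * t - 1)"]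
    obtain v where v: "((snd ?c \<circ> \<gamma>2) has_vector_derivative v) (at (2 * t - 1))"
      using good_timesD(3)[OF g2 c(1)] tr(1) c(2) by blast
    have "speed M \<gamma>2 (2 * t - 1) = sqrt (v \<bullet> (metric M ?c (snd ?c (\<gamma>2 (2 * t - 1))) *v v))"
      by (rule speed_chart[OF c path_isCont[OF good_timesD(1)[OF g2]] v]) (use tr in auto)
    moreover have "speed M ?\<gamma> t = sqrt ((2 *\<^sub>R v) \<bullet> (metric M ?c (snd ?c (?\<gamma> t)) *v (2 *\<^sub>R v)))"
      by (rule speed_chart[OF c(1) _ path_isCont[OF p] derR[OF v]]) (use c(2) tr t in auto)
    ultimately show ?thesis by (simp add: tr(2) matrix_vector_mult_scaleR real_sqrt_mult)
  qed
  define f1 where "f1 t = ennreal (speed M \<gamma>1 t) * indicator ({0<..<1} - K1) t" for t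
  define f2 where "f2 t = ennreal (speed M \<gamma>2 t) * indicator ({0<..<1} - K2) t" for t
  have m[measurable]: "f1 \<in> borel_measurable borel" "f2 \<in> borel_measurable borel"
    unfolding f1_def[abs_def] f2_def[abs_def] by (rule speed_measurable[OF g1] speed_measurable[OF g2])+
  have "AE t in lborel. t \<notin> K" using K by (intro AE_not_in finite_imp_null_set_lborel)
  then have "AE t in lborel. ennreal (speed M ?\<gamma> t) * indicator ({0<..<1} - K) t = 2 * f1 (0 + 2 * t) + 2 * f2 (- 1 + 2 * t)"
  proof eventually_elim
    case (elim t)
    show ?case
    proof (cases "t \<in> {0<..<1}")
      case False
      then show ?thesis by (auto simp: f1_def f2_def indicator_def)
    next
      case True
      then have "t \<noteq> 1/2" using elim by (auto simp: K_def)
      then consider "t \<in> ({0<..<1} - K) \<inter> {..<1/2}" | "t \<in> ({0<..<1} - K) \<inter> {1/2<..}" using True elim by force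
      then show ?thesis
      proof cases
        case 1
        then have "f2 (- 1 + 2 * t) = 0" by (auto simp: f2_def indicator_def)
        moreover have "f1 (0 + 2 * t) = ennreal (speed M \<gamma>1 (2 * t))" using left(1)[OF 1] by (simp add: f1_def)
        ultimately show ?thesis using spL[OF 1] 1 by (simp add: ennreal_mult speed_nonneg)
      next
        case 2
        then have "f1 (0 + 2 * t) = 0" by (auto simp: f1_def indicator_def)
        moreover have "f2 (- 1 + 2 * t) = ennreal (speed M \<gamma>2 (2 * t - 1))" using right(1)[OF 2] by (simp add: f2_def add.commute)
        ultimately show ?thesis using spR[OF 2] 2 by (simp add: ennreal_mult speed_nonneg)
      qed
    qed
  qed
  then have "curve_length M ?\<gamma> = (\<integral>\<^sup>+t. 2 * f1 (0 + 2 * t) + 2 * f2 (- 1 + 2 * t) \<partial>lborel)"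
    unfolding curve_length_open[OF K] by (rule nn_integral_cong_AE)
  also have "\<dots> = 2 * (\<integral>\<^sup>+t. f1 (0 + 2 * t) \<partial>lborel) + 2 * (\<integral>\<^sup>+t. f2 (- 1 + 2 * t) \<partial>lborel)"
    by (simp add: nn_integral_add nn_integral_cmult)
  also have "\<dots> = (\<integral>\<^sup>+t. f1 t \<partial>lborel) + (\<integral>\<^sup>+t. f2 t \<partial>lborel)"
    using nn_integral_real_affine[OF m(1), of 2 0] nn_integral_real_affine[OF m(2), of 2 "- 1"] by simp
  also have "\<dots> = curve_length M \<gamma>1 + curve_length M \<gamma>2"
    by (simp add: f1_def f2_def curve_length_open[OF good_timesD(2)[OF g1], of \<gamma>1] curve_length_open[OF good_timesD(2)[OF g2], of \<gamma>2])
  finally show "curve_length M ?\<gamma> = curve_length M \<gamma>1 + curve_length M \<gamma>2" .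
qed

lemma line_curve:
  assumes c: "c \<in> atlas M" and line: "\<And>t. t \<in> {0..1} \<Longrightarrow> x + t *\<^sub>R w \<in> image_of c"
  shows "good_times (\<lambda>t. chart_inv c (x + t *\<^sub>R w)) {0, 1}"
    and "\<And>t. t \<in> {0<..<1} \<Longrightarrow> speed M (\<lambda>t. chart_inv c (x + t *\<^sub>R w)) t = sqrt (w \<bullet> (metric M c (x + t *\<^sub>R w) *v w))"
proof -
  note cc = atlas_chart[OF c]
  let ?\<gamma> = "\<lambda>t. chart_inv c (x + t *\<^sub>R w)"
  have p: "path ?\<gamma>"
    unfolding path_def by (rule continuous_on_compose2[OF chart_cont(2)[OF cc]]) (use line in \<open>auto intro!: continuous_intros\<close>)
  have lined: "((\<lambda>t. x + t *\<^sub>R w) has_vector_derivative w) (at t)" for t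
    by (auto simp: has_vector_derivative_def intro!: derivative_eq_intros)
  show "good_times ?\<gamma> {0, 1}"
    unfolding good_times_def
  proof (intro conjI ballI p)
    fix c' assume c': "c' \<in> atlas M"
    let ?S = "({0..1} - {0, 1}) \<inter> ?\<gamma> -` fst c'" let ?\<tau> = "local_rep id c c'"
    define D where "D t = frechet_derivative ?\<tau> (at (x + t *\<^sub>R w)) w" for t
    have dom: "x + t *\<^sub>R w \<in> local_dom id c c'" if "t \<in> ?S" for t
      using that line[of t] chart_inv_left[OF cc] by (auto simp: local_dom_def)
    have "((snd c' \<circ> ?\<gamma>) has_vector_derivative D t) (at t)" if t: "t \<in> ?S" for t
    proof -
      have "(?\<tau> has_derivative frechet_derivative ?\<tau> (at (x + t *\<^sub>R w))) (at (x + t *\<^sub>R w))"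
        using local_rep_derivative[OF _ c c' dom[OF t]] local_isometry_id by blast
      then have "((\<lambda>t. ?\<tau> (x + t *\<^sub>R w)) has_derivative (\<lambda>h. frechet_derivative ?\<tau> (at (x + t *\<^sub>R w)) (h *\<^sub>R w))) (at t)"
        by (rule has_derivative_compose[OF lined[unfolded has_vector_derivative_def]])
      moreover have "linear (frechet_derivative ?\<tau> (at (x + t *\<^sub>R w)))"
        using \<open>(?\<tau> has_derivative _) _\<close> has_derivative_linear by blast
      ultimately have "((\<lambda>t. ?\<tau> (x + t *\<^sub>R w)) has_vector_derivative D t) (at t)"
        by (simp add: has_vector_derivative_def D_def linear_scale)
      moreover have "(\<lambda>t. ?\<tau> (x + t *\<^sub>R w)) = snd c' \<circ> ?\<gamma>" by (auto simp: local_rep_def)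
      ultimately show ?thesis by simp
    qed
    moreover have "continuous_on ?S D"
    proof -
      have C1: "Ck_on (Suc 0) ?\<tau> (local_dom id c c')"
        using local_rep_smooth[OF _ c c'] local_isometry_id by blast
      have "continuous_on (local_dom id c c') (\<lambda>y. frechet_derivative ?\<tau> (at y) (axis j 1))" for j
        using Ck_on_SucE(2)[OF C1, of "axis j 1"] by (simp add: axis_in_Basis_iff)
      then have "continuous_on (local_dom id c c') (\<lambda>y. \<Sum>j\<in>UNIV. w $ j *\<^sub>R frechet_derivative ?\<tau> (at y) (axis j 1))"
        by (intro continuous_intros)
      then have "continuous_on (local_dom id c c') (\<lambda>y. frechet_derivative ?\<tau> (at y) w)"
        by (rule continuous_on_eq)
          (use C1 frechet_derivative_basis_expansion[of ?\<tau> _ w] in auto)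
      then show ?thesis unfolding D_def
        by (rule continuous_on_compose2) (intro continuous_intros, use dom in blast)
    qed
    ultimately show "(snd c' \<circ> ?\<gamma>) C1_differentiable_on ?S"
      unfolding C1_differentiable_on_def by blast
  qed simp
  fix t :: real assume t: "t \<in> {0<..<1}"
  have "((\<lambda>t. x + t *\<^sub>R w) has_vector_derivative w) (at t)" by (rule lined)
  then have "((snd c \<circ> ?\<gamma>) has_vector_derivative w) (at t)"
    by (rule has_vector_derivative_transform_within_open[of _ _ _ "{0<..<1}"])
      (use t line chart_inv_right[OF cc] in auto)
  from speed_chart[OF c _ path_isCont[OF p t] this]
  show "speed M ?\<gamma> t = sqrt (w \<bullet> (metric M c (x + t *\<^sub>R w) *v w))"
    using line[of t] t chart_inv_dom[OF cc] chart_inv_right[OF cc] by simp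
qed

lemma line_length:
  assumes c: "c \<in> atlas M" and line: "\<And>t. t \<in> {0..1} \<Longrightarrow> x + t *\<^sub>R w \<in> image_of c"
    and s: "\<And>t. t \<in> {0..1} \<Longrightarrow> sqrt (w \<bullet> (metric M c (x + t *\<^sub>R w) *v w)) \<le> s"
  shows "curve_length M (\<lambda>t. chart_inv c (x + t *\<^sub>R w)) \<le> ennreal s"
proof -
  have "curve_length M (\<lambda>t. chart_inv c (x + t *\<^sub>R w)) \<le> (\<integral>\<^sup>+t. ennreal s * indicator {0..1::real} t \<partial>lborel)"
    unfolding curve_length_open[of "{0, 1}", simplified]
    by (rule nn_integral_mono) (use s line_curve(2)[OF c line] in \<open>auto simp: indicator_def intro!: ennreal_leI\<close>)
  also have "\<dots> = ennreal s" by (simp add: nn_integral_cmult_indicator)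
  finally show ?thesis .
qed

text \<open>
  The infimum of the lengths before its conversion to a real number. The triangle inequality
  holds here without knowing that the infimum is finite, and it is used to prove the finiteness.
\<close>

definition ext_dist :: "'a \<Rightarrow> 'a \<Rightarrow> ennreal" where
  "ext_dist p q = (INF \<gamma>\<in>{\<gamma>. piecewise_C1_curve M \<gamma> \<and> pathstart \<gamma> = p \<and> pathfinish \<gamma> = q}. curve_length M \<gamma>)"

lemma riem_dist_eq: "riem_dist M p q = enn2real (ext_dist p q)"
  by (simp add: riem_dist_def ext_dist_def)

lemma ext_dist_le: "piecewise_C1_curve M \<gamma> \<Longrightarrow> ext_dist (pathstart \<gamma>) (pathfinish \<gamma>) \<le> curve_length M \<gamma>"
  unfolding ext_dist_def by (rule INF_lower) simp

lemma ext_dist_triangle: "ext_dist p r \<le> ext_dist p q + ext_dist q r"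
proof (rule ennreal_le_epsilon)
  fix e :: real assume top: "ext_dist p q + ext_dist q r < top" and e: "0 < e"
  have less: "x < x + ennreal (e / 2)" if "x < top" for x
    using that e by (cases x) (auto simp: ennreal_less_iff ennreal_plus[symmetric] simp del: ennreal_plus)
  have "ext_dist p q < ext_dist p q + ennreal (e / 2)" "ext_dist q r < ext_dist q r + ennreal (e / 2)"
    using top less by auto
  then obtain \<gamma>1 \<gamma>2 where
    1: "piecewise_C1_curve M \<gamma>1" "pathstart \<gamma>1 = p" "pathfinish \<gamma>1 = q" "curve_length M \<gamma>1 < ext_dist p q + ennreal (e / 2)" and
    2: "piecewise_C1_curve M \<gamma>2" "pathstart \<gamma>2 = q" "pathfinish \<gamma>2 = r" "curve_length M \<gamma>2 < ext_dist q r + ennreal (e / 2)"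
    unfolding ext_dist_def[of p q] ext_dist_def[of q r] INF_less_iff by blast
  obtain K1 K2 where g: "good_times \<gamma>1 K1" "good_times \<gamma>2 K2" using 1(1) 2(1) piecewise_C1_iff by blast
  have j: "pathfinish \<gamma>1 = pathstart \<gamma>2" using 1 2 by simp
  have "ext_dist p r \<le> curve_length M \<gamma>1 + curve_length M \<gamma>2"
    using ext_dist_le[OF join_curves(1)[OF g j]] join_curves(2)[OF g j] 1 2 by simp
  also have "\<dots> \<le> (ext_dist p q + ennreal (e / 2)) + (ext_dist q r + ennreal (e / 2))"
    using 1(4) 2(4) by (intro add_mono) auto
  also have "\<dots> = (ext_dist p q + ext_dist q r) + (ennreal (e / 2) + ennreal (e / 2))" by (simp only: add_ac)
  also have "ennreal (e / 2) + ennreal (e / 2) = ennreal e" using e by (simp flip: ennreal_plus)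
  finally show "ext_dist p r \<le> ext_dist p q + ext_dist q r + ennreal e" .
qed

lemma ext_dist_line:
  assumes c: "c \<in> atlas M" and line: "\<And>t. t \<in> {0..1} \<Longrightarrow> x + t *\<^sub>R w \<in> image_of c"
    and s: "\<And>t. t \<in> {0..1} \<Longrightarrow> sqrt (w \<bullet> (metric M c (x + t *\<^sub>R w) *v w)) \<le> s"
  shows "ext_dist (chart_inv c x) (chart_inv c (x + w)) \<le> ennreal s"
proof -
  have "piecewise_C1_curve M (\<lambda>t. chart_inv c (x + t *\<^sub>R w))" using line_curve(1)[OF c line] piecewise_C1_iff by blast
  from ext_dist_le[OF this] line_length[OF c line s] show ?thesis by (simp add: pathstart_def pathfinish_def)
qed

text \<open>
  On a small coordinate ball the metric is bounded by a multiple \<open>\<Lambda>\<^sup>2\<close> of the Euclidean one, so that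
  straight segments have length at most \<open>\<Lambda>\<close> times their Euclidean length.
\<close>

lemma ext_dist_small:
  assumes e: "e > 0"
  shows "\<exists>W. open W \<and> p \<in> W \<and> (\<forall>q\<in>W. ext_dist p q \<le> ennreal e \<and> ext_dist q p \<le> ennreal e)"
proof -
  obtain c where c: "c \<in> atlas M" "p \<in> fst c" using atlas_cover by blast
  note cc = atlas_chart[OF c(1)]
  define x where "x = snd c p"
  obtain r where r: "r > 0" "cball x r \<subseteq> image_of c"
    using image_open[OF c(1)] c(2) open_contains_cball unfolding x_def by blast
  have "continuous_on (cball x r \<times> sphere 0 1) (\<lambda>(y, v). v \<bullet> (metric M c y *v v))"
    unfolding case_prod_beta
    by (intro continuous_on_quadratic_form continuous_intros continuous_on_compose2[OF Ck_on_continuous[OF metric_smooth[OF c(1), of 0]]])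
      (use r in auto)
  then have "bounded ((\<lambda>(y, v). v \<bullet> (metric M c y *v v)) ` (cball x r \<times> sphere 0 1))"
    by (intro compact_imp_bounded compact_continuous_image compact_Times) auto
  then obtain L where "\<forall>z\<in>(\<lambda>(y, v). v \<bullet> (metric M c y *v v)) ` (cball x r \<times> sphere 0 1). norm z \<le> L"
    unfolding bounded_iff by blast
  then have L: "v \<bullet> (metric M c y *v v) \<le> L" if "y \<in> cball x r" "norm v = 1" for y v
    using that by (force simp: abs_le_iff)
  define \<Lambda> where "\<Lambda> = sqrt (max L 0)"
  have bound: "sqrt (w \<bullet> (metric M c y *v w)) \<le> \<Lambda> * norm w" if "y \<in> cball x r" for y w
  proof (cases "w = 0")
    case False
    define v where "v = (1 / norm w) *\<^sub>R w"
    have w: "w = norm w *\<^sub>R v" "norm v = 1" using False by (auto simp: v_def)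
    have "w \<bullet> (metric M c y *v w) = (norm w)^2 * (v \<bullet> (metric M c y *v v))"
      by (subst (1 2) w(1)) (simp add: matrix_vector_mult_scaleR power2_eq_square)
    also have "\<dots> \<le> (norm w)^2 * max L 0" using L[OF that w(2)] by (intro mult_left_mono) auto
    finally have "sqrt (w \<bullet> (metric M c y *v w)) \<le> sqrt ((norm w)^2 * max L 0)" by (rule real_sqrt_le_mono)
    then show ?thesis by (simp add: real_sqrt_mult \<Lambda>_def mult.commute)
  qed simp
  \<comment> \<open>\<open>\<Lambda>\<close> may be zero, hence the \<open>+ 1\<close>\<close>
  define d where "d = min r (e / (\<Lambda> + 1))"
  have \<Lambda>0: "\<Lambda> \<ge> 0" by (simp add: \<Lambda>_def)
  have d: "d > 0" "d \<le> r" "\<Lambda> * d \<le> e"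
  proof -
    show "d > 0" "d \<le> r" using r e \<Lambda>0 by (auto simp: d_def)
    have "\<Lambda> * d \<le> (\<Lambda> + 1) * (e / (\<Lambda> + 1))" using \<Lambda>0 e r by (intro mult_mono) (auto simp: d_def)
    then show "\<Lambda> * d \<le> e" using \<Lambda>0 by simp
  qed
  define W where "W = fst c \<inter> snd c -` ball x d"
  have "open W" "p \<in> W"
    using continuous_open_preimage[OF chart_cont(1)[OF cc] chart_open(1)[OF cc] open_ball] c(2) d(1) by (auto simp: W_def x_def)
  moreover have "ext_dist p q \<le> ennreal e \<and> ext_dist q p \<le> ennreal e" if q: "q \<in> W" for q
  proof -
    define y where "y = snd c q"
    have y: "norm (y - x) < d" using q by (simp add: W_def y_def dist_norm norm_minus_commute)
    have pq: "chart_inv c x = p" "chart_inv c y = q"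
      using chart_inv_left[OF cc] c(2) q by (auto simp: x_def y_def W_def)
    have convex: "x + t *\<^sub>R (y - x) \<in> cball x r" "y + t *\<^sub>R (x - y) \<in> cball x r" if "t \<in> {0..1}" for t
    proof -
      have "norm (t *\<^sub>R (y - x)) \<le> 1 * norm (y - x)" using that unfolding norm_scaleR by (intro mult_right_mono) auto
      then show "x + t *\<^sub>R (y - x) \<in> cball x r" using y d(2) by (simp add: dist_norm)
      have "norm ((1 - t) *\<^sub>R (y - x)) \<le> 1 * norm (y - x)" using that unfolding norm_scaleR by (intro mult_right_mono) auto
      moreover have "x - (y + t *\<^sub>R (x - y)) = - ((1 - t) *\<^sub>R (y - x))" by (simp add: algebra_simps)
      ultimately show "y + t *\<^sub>R (x - y) \<in> cball x r" using y d(2) by (simp add: dist_norm)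
    qed
    have b: "\<Lambda> * norm (y - x) \<le> e" "\<Lambda> * norm (x - y) \<le> e"
      using mult_left_mono[OF less_imp_le[OF y] \<Lambda>0] d(3) by (auto simp: norm_minus_commute)
    have "ext_dist (chart_inv c x) (chart_inv c (x + (y - x))) \<le> ennreal e"
      by (rule ext_dist_line[OF c(1)]) (use convex r(2) order_trans[OF bound b(1)] in blast)+
    moreover have "ext_dist (chart_inv c y) (chart_inv c (y + (x - y))) \<le> ennreal e"
      by (rule ext_dist_line[OF c(1)]) (use convex r(2) order_trans[OF bound b(2)] in blast)+
    ultimately show ?thesis by (simp add: pq)
  qed
  ultimately show ?thesis by blast
qed

text \<open>
  The points at finite distance from \<open>p\<close> form an open set with open complement.
\<close>

lemma ext_dist_finite:
  assumes conn: "connected (UNIV :: 'a set)"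
  shows "ext_dist p q < top"
proof -
  define Z where "Z = {q. ext_dist p q < top}"
  have sm: "\<exists>W. open W \<and> q \<in> W \<and> (\<forall>r\<in>W. ext_dist q r \<le> ennreal 1 \<and> ext_dist r q \<le> ennreal 1)" for q
    by (rule ext_dist_small) simp
  have "open Z"
    unfolding open_subopen[of Z]
  proof
    fix q assume q: "q \<in> Z"
    obtain W where W: "open W" "q \<in> W" "\<forall>r\<in>W. ext_dist q r \<le> ennreal 1 \<and> ext_dist r q \<le> ennreal 1" using sm by blast
    have "r \<in> Z" if "r \<in> W" for r
      using ext_dist_triangle[of p r q] W(3) that q unfolding Z_def
      by (metis (mono_tags, lifting) ennreal_add_less_top ennreal_less_top mem_Collect_eq order_le_less_trans)
    then show "\<exists>T. open T \<and> q \<in> T \<and> T \<subseteq> Z" using W by blast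
  qed
  moreover have "open (- Z)"
    unfolding open_subopen[of "- Z"]
  proof
    fix q assume q: "q \<in> - Z"
    obtain W where W: "open W" "q \<in> W" "\<forall>r\<in>W. ext_dist q r \<le> ennreal 1 \<and> ext_dist r q \<le> ennreal 1" using sm by blast
    have "r \<notin> Z" if "r \<in> W" for r
      using ext_dist_triangle[of p q r] W(3) that q unfolding Z_def
      by (metis (mono_tags, lifting) Compl_iff ennreal_add_less_top ennreal_less_top mem_Collect_eq order_le_less_trans)
    then show "\<exists>T. open T \<and> q \<in> T \<and> T \<subseteq> - Z" using W by blast
  qed
  ultimately have "Z = {} \<or> Z = UNIV" using conn by (auto simp: connected_clopen closed_def)
  moreover have "p \<in> Z"
    using sm[of p] unfolding Z_def by (metis ennreal_less_top mem_Collect_eq order_le_less_trans)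
  ultimately show ?thesis unfolding Z_def by blast
qed

end

section \<open>The distance from the focal set\<close>

context isoparametric begin

abbreviation "dist_M \<equiv> riem_dist M"
abbreviation "\<rho> \<equiv> focal_dist M F a"

lemma dist_finite: "ext_dist p q = ennreal (dist_M p q)"
  using ext_dist_finite[OF connected_UNIV, of p q] by (simp add: riem_dist_eq)

lemma dist_nonneg: "dist_M p q \<ge> 0"
  by (simp add: riem_dist_eq)

lemma dist_triangle: "dist_M p r \<le> dist_M p q + dist_M q r"
  using ext_dist_triangle[of p r q] unfolding dist_finite
  by (simp add: ennreal_plus[symmetric] dist_nonneg del: ennreal_plus)

lemma dist_le_iff: "e \<ge> 0 \<Longrightarrow> ext_dist p q \<le> ennreal e \<longleftrightarrow> dist_M p q \<le> e"
  unfolding dist_finite by simp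

lemma dist_small:
  assumes "e > 0"
  shows "\<exists>W. open W \<and> p \<in> W \<and> (\<forall>q\<in>W. dist_M p q \<le> e \<and> dist_M q p \<le> e)"
  using ext_dist_small[OF assms, of p] assms by (simp add: dist_le_iff)

lemma dist_self: "dist_M p p = 0"
proof (rule ccontr)
  assume "dist_M p p \<noteq> 0"
  then have "dist_M p p / 2 > 0" using dist_nonneg[of p p] by simp
  from dist_small[OF this, of p] show False using \<open>dist_M p p / 2 > 0\<close> by force
qed

lemma rho_eq: "\<rho> p = (INF q\<in>F -` {a}. dist_M p q)"
proof -
  have "(\<lambda>(p, q). dist_M p q) ` ({p} \<times> F -` {a}) = dist_M p ` (F -` {a})" by auto
  then show ?thesis by (simp only: focal_dist_def riem_setdist_def)
qed

lemma focal_nonempty: "F -` {a} \<noteq> {}"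
  using F_attains[of a] ab by auto

lemma rho_le: "F q = a \<Longrightarrow> \<rho> p \<le> dist_M p q"
  unfolding rho_eq by (rule cINF_lower) (auto intro!: bdd_belowI[of _ 0] simp: dist_nonneg)

lemma rho_greatest: "(\<And>q. F q = a \<Longrightarrow> r \<le> dist_M p q) \<Longrightarrow> r \<le> \<rho> p"
  unfolding rho_eq by (rule cINF_greatest[OF focal_nonempty]) auto

lemma rho_nonneg: "\<rho> p \<ge> 0"
  by (rule rho_greatest) (rule dist_nonneg)

lemma rho_zero: "F p = a \<Longrightarrow> \<rho> p = 0"
  using rho_le[of p p] rho_nonneg[of p] dist_self[of p] by simp

lemma rho_triangle: "\<rho> p \<le> dist_M p q + \<rho> q"
proof -
  have "\<rho> p - dist_M p q \<le> \<rho> q"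
  proof (rule rho_greatest)
    fix r assume "F r = a"
    then show "\<rho> p - dist_M p q \<le> dist_M q r" using rho_le[of r p] dist_triangle[of p r q] by simp
  qed
  then show ?thesis by simp
qed

lemma rho_continuous: "continuous_on UNIV \<rho>"
proof -
  have "isCont \<rho> p" for p
    unfolding isCont_def tendsto_iff
  proof (intro allI impI)
    fix e :: real assume e: "e > 0"
    then have "e / 2 > 0" by simp
    from dist_small[OF this] obtain W where W: "open W" "p \<in> W" "\<forall>q\<in>W. dist_M p q \<le> e / 2 \<and> dist_M q p \<le> e / 2" by blast
    have "dist (\<rho> q) (\<rho> p) < e" if "q \<in> W" for q
      using rho_triangle[of p q] rho_triangle[of q p] bspec[OF W(3) that] e unfolding dist_real_def by linarith
    then show "\<forall>\<^sub>F q in at p. dist (\<rho> q) (\<rho> p) < e"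
      using W(1,2) unfolding eventually_at_topological by blast
  qed
  then show ?thesis by (simp add: continuous_at_imp_continuous_on)
qed

text \<open>
  If \<open>\<bar>\<theta>'\<bar> sqrt A \<le> 1\<close>, the derivative of \<open>\<theta>(F)\<close> along a curve is bounded by the speed, so the length is at
  least the increase of \<open>\<theta>(F)\<close>.
\<close>

lemma curve_length_lower_bound:
  assumes \<gamma>: "piecewise_C1_curve M \<gamma>"
    and \<theta>: "\<And>s. s \<in> {a..b} \<Longrightarrow> (\<theta> has_real_derivative \<theta>' s) (at s within {a..b})"
    and bound: "\<And>s. s \<in> {a..b} \<Longrightarrow> \<bar>\<theta>' s\<bar> * sqrt (A s) \<le> 1"
  shows "ennreal \<bar>\<theta> (F (pathfinish \<gamma>)) - \<theta> (F (pathstart \<gamma>))\<bar> \<le> curve_length M \<gamma>"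
proof (cases "curve_length M \<gamma> = \<infinity>")
  case False
  obtain K where g: "good_times \<gamma> K" using \<gamma> piecewise_C1_iff by blast
  note path = good_timesD(1)[OF g]
  define f where "f t = \<theta> (F (\<gamma> t))" for t
  have \<theta>c: "continuous_on {a..b} \<theta>" using \<theta> DERIV_continuous_on by blast
  have fc: "continuous_on {0..1} f"
    unfolding f_def
    by (rule continuous_on_compose2[OF AF_continuous[OF \<theta>c]]) (use path in \<open>auto simp: path_def\<close>)
  have der: "\<exists>d. (f has_vector_derivative d) (at t) \<and> \<bar>d\<bar> \<le> speed M \<gamma> t" if t: "t \<in> {0<..<1} - K" for t
  proof -
    let ?c = "chart_at M (\<gamma> t)"
    note c = chart_at_atlas[of "\<gamma> t"]
    note cc = atlas_chart[OF c(1)]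
    let ?x = "snd ?c (\<gamma> t)"
    have x: "?x \<in> image_of ?c" using c(2) by auto
    have cont: "isCont \<gamma> t" using path_isCont[OF path] t by simp
    obtain v where v: "((snd ?c \<circ> \<gamma>) has_vector_derivative v) (at t)"
      using good_timesD(3)[OF g c(1)] t c(2) by blast
    note sp = speed_chart[OF c cont v]
    let ?d = "differential ?c F ?x \<bullet> v"
    have 1: "((\<lambda>s. (F \<circ> chart_inv ?c) ((snd ?c \<circ> \<gamma>) s)) has_derivative (\<lambda>h. differential ?c F ?x \<bullet> (h *\<^sub>R v))) (at t)"
      by (rule has_derivative_compose[where f="snd ?c \<circ> \<gamma>", OF v[unfolded has_vector_derivative_def]])
        (unfold o_apply, rule directional_derivative[OF F_smooth c(1) x, unfolded o_def])
    obtain T where T: "open T" "t \<in> T" "\<forall>s\<in>T. \<gamma> s \<in> fst ?c"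
      using eventually_in_chart[OF c(1) cont c(2)] unfolding eventually_nhds by blast
    have "((\<lambda>s. F (\<gamma> s)) has_derivative (\<lambda>h. differential ?c F ?x \<bullet> (h *\<^sub>R v))) (at t)"
      by (rule has_derivative_transform_within_open[OF 1 T(1,2)]) (use T(3) chart_inv_left[OF cc] in simp)
    then have "((\<lambda>s. \<theta> (F (\<gamma> s))) has_derivative (\<lambda>h. \<theta>' (F (\<gamma> t)) * (differential ?c F ?x \<bullet> (h *\<^sub>R v)))) (at t)"
      using F_range by (intro has_derivative_compose_real[where f="\<lambda>s. F (\<gamma> s)" and S=UNIV and T="{a..b}", OF _ open_UNIV UNIV_I _ \<theta>[OF F_in[of "\<gamma> t"]]]) auto
    then have "(f has_vector_derivative (\<theta>' (F (\<gamma> t)) * ?d)) (at t)"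
      unfolding has_vector_derivative_def f_def by (rule has_derivative_eq_rhs) (auto simp: fun_eq_iff)
    moreover have "\<bar>\<theta>' (F (\<gamma> t)) * ?d\<bar> \<le> speed M \<gamma> t"
    proof -
      have "?d^2 \<le> (v \<bullet> (metric M ?c ?x *v v)) * A (F (\<gamma> t))"
        using differential_bound[OF c(1) x, of v] chart_inv_left[OF cc c(2)] by simp
      then have "sqrt (?d^2) \<le> sqrt ((v \<bullet> (metric M ?c ?x *v v)) * A (F (\<gamma> t)))" by (rule real_sqrt_le_mono)
      then have "\<bar>?d\<bar> \<le> speed M \<gamma> t * sqrt (A (F (\<gamma> t)))" by (simp add: sp real_sqrt_mult)
      then have "\<bar>\<theta>' (F (\<gamma> t)) * ?d\<bar> \<le> \<bar>\<theta>' (F (\<gamma> t))\<bar> * (speed M \<gamma> t * sqrt (A (F (\<gamma> t))))"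
        unfolding abs_mult by (intro mult_left_mono) auto
      also have "\<dots> = speed M \<gamma> t * (\<bar>\<theta>' (F (\<gamma> t))\<bar> * sqrt (A (F (\<gamma> t))))" by (simp only: mult_ac)
      also have "\<dots> \<le> speed M \<gamma> t * 1" using bound[OF F_in] speed_nonneg by (intro mult_left_mono)
      finally show ?thesis by simp
    qed
    ultimately show ?thesis by blast
  qed
  then obtain D where D: "\<And>t. t \<in> {0<..<1} - K \<Longrightarrow> (f has_vector_derivative D t) (at t) \<and> \<bar>D t\<bar> \<le> speed M \<gamma> t" by metis
  define f' where "f' t = (if t \<in> {0<..<1} - K then D t else 0)" for t
  have hi: "(f' has_integral (f 1 - f 0)) {0..1}"
    by (rule fundamental_theorem_of_calculus_interior_strong[OF good_timesD(2)[OF g] _ _ fc]) (use D in \<open>auto simp: f'_def\<close>)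
  have "f' \<in> borel_measurable (lebesgue_on {0..1})" using hi integrable_imp_measurable by blast
  then have m: "(\<lambda>t. indicator {0..1} t *\<^sub>R f' t) \<in> borel_measurable lebesgue"
    using borel_measurable_restrict_space_iff[of "{0..1}" lebesgue f'] by simp
  have le: "(\<integral>\<^sup>+t. ennreal (norm (indicator {0..1} t *\<^sub>R f' t)) \<partial>lebesgue) \<le> curve_length M \<gamma>"
    unfolding nn_integral_completion curve_length_def
    by (rule nn_integral_mono) (use D speed_nonneg in \<open>auto simp: f'_def indicator_def intro!: ennreal_leI\<close>)
  then have fin: "(\<integral>\<^sup>+t. ennreal (norm (indicator {0..1} t *\<^sub>R f' t)) \<partial>lebesgue) < \<infinity>"
    by (rule order_le_less_trans) (use False in \<open>simp only: infinity_ennreal_def less_top[symmetric] not_False_eq_True\<close>)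
  have int: "integrable lebesgue (\<lambda>t. indicator {0..1} t *\<^sub>R f' t)" by (rule integrableI_bounded[OF m fin])
  have "ennreal (norm (\<integral>t. indicator {0..1} t *\<^sub>R f' t \<partial>lebesgue)) \<le> (\<integral>\<^sup>+t. ennreal (norm (indicator {0..1} t *\<^sub>R f' t)) \<partial>lebesgue)"
    by (rule integral_norm_bound_ennreal[OF int])
  moreover have "(\<integral>t. indicator {0..1} t *\<^sub>R f' t \<partial>lebesgue) = f 1 - f 0"
  proof -
    have "f' absolutely_integrable_on {0..1}" using int by (simp add: set_integrable_def)
    then have "(LINT t:{0..1}|lebesgue. f' t) = integral {0..1} f'" by (rule set_lebesgue_integral_eq_integral)
    then show ?thesis using hi by (simp add: set_lebesgue_integral_def integral_unique)
  qed
  ultimately show ?thesis using le by (simp add: f_def pathstart_def pathfinish_def)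
qed simp

lemma dist_lower_bound:
  assumes "\<And>s. s \<in> {a..b} \<Longrightarrow> (\<theta> has_real_derivative \<theta>' s) (at s within {a..b})"
    and "\<And>s. s \<in> {a..b} \<Longrightarrow> \<bar>\<theta>' s\<bar> * sqrt (A s) \<le> 1"
  shows "\<bar>\<theta> (F p) - \<theta> (F q)\<bar> \<le> dist_M p q"
proof -
  have "ennreal \<bar>\<theta> (F p) - \<theta> (F q)\<bar> \<le> ext_dist p q"
    unfolding ext_dist_def
  proof (rule INF_greatest)
    fix \<gamma> assume "\<gamma> \<in> {\<gamma>. piecewise_C1_curve M \<gamma> \<and> pathstart \<gamma> = p \<and> pathfinish \<gamma> = q}"
    then show "ennreal \<bar>\<theta> (F p) - \<theta> (F q)\<bar> \<le> curve_length M \<gamma>"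
      using curve_length_lower_bound[of \<gamma>, OF _ assms] by (auto simp: abs_minus_commute)
  qed
  then show ?thesis unfolding dist_finite by (simp add: dist_nonneg)
qed

lemma rho_lower_bound:
  assumes "\<And>s. s \<in> {a..b} \<Longrightarrow> (\<theta> has_real_derivative \<theta>' s) (at s within {a..b})"
    and "\<And>s. s \<in> {a..b} \<Longrightarrow> \<bar>\<theta>' s\<bar> * sqrt (A s) \<le> 1"
  shows "\<theta> (F p) - \<theta> a \<le> \<rho> p"
proof (rule rho_greatest)
  fix q assume "F q = a"
  then show "\<theta> (F p) - \<theta> a \<le> dist_M p q" using dist_lower_bound[of \<theta> \<theta>', OF assms, of p q] by simp
qed

text \<open>
  The coordinate line from \<open>y\<close> in the direction of the negative gradient has the initial speed
  \<open>sqrt (A (F y))\<close>, while \<open>\<theta>(F)\<close> initially decreases at the rate \<open>\<theta>' A (F y)\<close>. This rate is larger if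
  \<open>\<theta>' sqrt A > 1\<close>. So a short step covers less distance than the amount by which \<open>\<theta>(F)\<close> decreases.
\<close>

lemma descent_step:
  assumes y: "A (F y) > 0"
    and \<theta>: "(\<theta> has_real_derivative \<theta>') (at (F y) within {a..b})" and steep: "\<theta>' * sqrt (A (F y)) > 1"
  obtains z where "F z \<le> F y" "dist_M y z < \<theta> (F y) - \<theta> (F z)"
proof -
  let ?c = "chart_at M y"
  note c = chart_at_atlas[of y]
  note cc = atlas_chart[OF c(1)]
  define x where "x = snd ?c y"
  have x: "x \<in> image_of ?c" and yx: "chart_inv ?c x = y" using c(2) chart_inv_left[OF cc] by (auto simp: x_def)
  let ?g = "metric M ?c x"
  define w where "w = matrix_inv ?g *v differential ?c F x"
  define v where "v = - w"
  have gw: "?g *v w = differential ?c F x"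
    unfolding w_def using metric_det_pos[OF c(1) x] by (intro matrix_inv_mult(1)) simp
  have wd: "w \<bullet> differential ?c F x = A (F y)"
    using pairing_F[of y] by (simp add: pairing_def chart_pairing_def w_def x_def)
  have dv: "differential ?c F x \<bullet> v = - A (F y)" using wd by (simp add: v_def inner_commute)
  have gv: "v \<bullet> (?g *v v) = A (F y)"
  proof -
    have "?g *v (- w) = - (?g *v w)" using matrix_vector_mult_scaleR[of ?g "-1" w] by simp
    then show ?thesis using wd by (simp add: v_def gw)
  qed
  have "sqrt (A (F y)) < \<theta>' * A (F y)"
  proof -
    have "sqrt (A (F y)) * 1 < sqrt (A (F y)) * (\<theta>' * sqrt (A (F y)))"
      using y steep by (intro mult_strict_left_mono) auto
    also have "\<dots> = \<theta>' * (sqrt (A (F y)) * sqrt (A (F y)))" by (simp only: mult_ac)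
    also have "sqrt (A (F y)) * sqrt (A (F y)) = A (F y)" using y by simp
    finally show ?thesis by simp
  qed
  \<comment> \<open>a rate strictly between the initial speed and the initial decrease of \<open>\<theta>(F)\<close>\<close>
  then obtain s where s: "sqrt (A (F y)) < s" "s < \<theta>' * A (F y)" using dense by blast
  have op: "open (image_of ?c)" by (rule image_open[OF c(1)])
  define l where "l t = x + t *\<^sub>R v" for t
  have ev1: "\<forall>\<^sub>F t in at_right 0. \<forall>r\<in>{0..t}. l r \<in> image_of ?c \<and> sqrt (v \<bullet> (metric M ?c (l r) *v v)) \<le> s"
  proof -
    have "continuous_on (image_of ?c) (\<lambda>y. sqrt (v \<bullet> (metric M ?c y *v v)))"
      by (intro continuous_intros continuous_on_quadratic_form Ck_on_continuous[OF metric_smooth[OF c(1), of 0]])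
    then have "open (image_of ?c \<inter> (\<lambda>y. sqrt (v \<bullet> (metric M ?c y *v v))) -` {..<s})"
      by (rule continuous_open_preimage[OF _ op]) simp
    moreover have "x \<in> image_of ?c \<inter> (\<lambda>y. sqrt (v \<bullet> (metric M ?c y *v v))) -` {..<s}" using x s gv by simp
    ultimately obtain e where e: "e > 0" "ball x e \<subseteq> image_of ?c \<inter> (\<lambda>y. sqrt (v \<bullet> (metric M ?c y *v v))) -` {..<s}"
      using open_contains_ball by blast
    define \<delta> where "\<delta> = e / (norm v + 1)"
    have \<delta>: "\<delta> > 0" using e by (simp add: \<delta>_def add_nonneg_pos)
    have in_ball: "l r \<in> ball x e" if "0 \<le> r" "r < \<delta>" for r
    proof -
      have "r * norm v \<le> r * (norm v + 1)" using that by (intro mult_left_mono) auto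
      also have "\<dots> < \<delta> * (norm v + 1)" using that by (intro mult_strict_right_mono) (auto simp: add_nonneg_pos)
      also have "\<dots> = e"
      proof -
        have "norm v + 1 \<noteq> 0" using norm_ge_zero[of v] by linarith
        then show ?thesis by (simp add: \<delta>_def)
      qed
      finally show ?thesis using that by (simp add: l_def dist_norm)
    qed
    have "l r \<in> image_of ?c \<and> sqrt (v \<bullet> (metric M ?c (l r) *v v)) \<le> s" if "0 \<le> r" "r < \<delta>" for r
    proof -
      have "l r \<in> image_of ?c \<inter> (\<lambda>y. sqrt (v \<bullet> (metric M ?c y *v v))) -` {..<s}" using in_ball[OF that] e(2) by (rule subsetD[rotated])
      then show ?thesis by auto
    qed
    then show ?thesis using \<delta> unfolding eventually_at_right_field by (intro exI[of _ \<delta>]) auto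
  qed
  let ?h = "\<lambda>t. F (chart_inv ?c (x + t *\<^sub>R v))"
  have dh: "(?h has_real_derivative - A (F y)) (at 0)"
    using derivative_along_line[OF c(1), of x 0 v] x dv by simp
  have "((\<lambda>t. \<theta> (?h t)) has_derivative (\<lambda>h. \<theta>' * (- A (F y) * h))) (at 0)"
    by (rule has_derivative_compose_real[OF dh[unfolded has_field_derivative_def] open_UNIV UNIV_I, of "{a..b}"])
      (use F_range \<theta> yx in auto)
  then have "((\<lambda>t. \<theta> (?h t)) has_real_derivative - (\<theta>' * A (F y))) (at 0)"
    unfolding has_field_derivative_def by (rule has_derivative_eq_rhs) (auto simp: fun_eq_iff)
  then have "((\<lambda>t. (\<theta> (?h t) - \<theta> (?h 0)) / t) \<longlongrightarrow> - (\<theta>' * A (F y))) (at_right 0)"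
    unfolding DERIV_def by (simp add: filterlim_at_split)
  then have ev2: "\<forall>\<^sub>F t in at_right 0. (\<theta> (?h t) - \<theta> (?h 0)) / t < - s"
    by (rule order_tendstoD) (use s in simp)
  have "((\<lambda>t. (?h t - ?h 0) / t) \<longlongrightarrow> - A (F y)) (at_right 0)"
    using dh unfolding DERIV_def by (simp add: filterlim_at_split)
  then have ev3: "\<forall>\<^sub>F t in at_right 0. (?h t - ?h 0) / t < 0"
    by (rule order_tendstoD) (use y in simp)
  have ev4: "\<forall>\<^sub>F t in at_right (0::real). t > 0" by (simp add: eventually_at_right_less)
  have "\<forall>\<^sub>F t in at_right 0. (\<forall>r\<in>{0..t}. l r \<in> image_of ?c \<and> sqrt (v \<bullet> (metric M ?c (l r) *v v)) \<le> s) \<and>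
      (\<theta> (?h t) - \<theta> (?h 0)) / t < - s \<and> (?h t - ?h 0) / t < 0 \<and> t > 0"
    using ev1 ev2 ev3 ev4 by eventually_elim blast
  then obtain t where t: "\<forall>r\<in>{0..t}. l r \<in> image_of ?c \<and> sqrt (v \<bullet> (metric M ?c (l r) *v v)) \<le> s"
      "(\<theta> (?h t) - \<theta> (?h 0)) / t < - s" "(?h t - ?h 0) / t < 0" "t > 0"
    using eventually_happens[of _ "at_right (0::real)"] by force
  define z where "z = chart_inv ?c (x + t *\<^sub>R v)"
  have lr: "x + r *\<^sub>R (t *\<^sub>R v) = l (r * t)" for r by (simp add: l_def)
  have mem: "r * t \<in> {0..t}" if "r \<in> {0..1}" for r using that t(4) by (simp add: mult_left_le_one_le)
  have "ext_dist (chart_inv ?c x) (chart_inv ?c (x + t *\<^sub>R v)) \<le> ennreal (t * s)"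
  proof (rule ext_dist_line[OF c(1)])
    fix r :: real assume r: "r \<in> {0..1}"
    show "x + r *\<^sub>R (t *\<^sub>R v) \<in> image_of ?c" unfolding lr using t(1) mem[OF r] by blast
    have "(t *\<^sub>R v) \<bullet> (metric M ?c (x + r *\<^sub>R (t *\<^sub>R v)) *v (t *\<^sub>R v)) = t^2 * (v \<bullet> (metric M ?c (l (r * t)) *v v))"
      by (simp add: lr matrix_vector_mult_scaleR power2_eq_square l_def)
    then have "sqrt ((t *\<^sub>R v) \<bullet> (metric M ?c (x + r *\<^sub>R (t *\<^sub>R v)) *v (t *\<^sub>R v))) = t * sqrt (v \<bullet> (metric M ?c (l (r * t)) *v v))"
      using t(4) by (simp add: real_sqrt_mult)
    also have "\<dots> \<le> t * s" using t(1,4) mem[OF r] by (intro mult_left_mono) auto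
    finally show "sqrt ((t *\<^sub>R v) \<bullet> (metric M ?c (x + r *\<^sub>R (t *\<^sub>R v)) *v (t *\<^sub>R v))) \<le> t * s" .
  qed
  moreover have s0: "s > 0" using s(1) y by (meson order.strict_trans real_sqrt_gt_0_iff)
  ultimately have "dist_M y z \<le> t * s" using dist_le_iff[of "t * s" y z] t(4) by (simp add: z_def yx)
  moreover have "\<theta> (F z) - \<theta> (F y) < - s * t" using t(2,4) by (simp add: pos_divide_less_eq z_def yx)
  moreover have "F z < F y" using t(3,4) by (simp add: divide_less_0_iff z_def yx)
  ultimately show thesis using that[of z] by (simp add: mult.commute)
qed

text \<open>
  The function \<open>1 / sqrt A\<close> is unbounded at the focal values. Adding \<open>1 / (n + 1)\<close> to \<open>A\<close> makes the integral
  differentiable up to the end points, so that \<open>rho_lower_bound\<close> applies.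
\<close>

definition \<theta>_approx :: "nat \<Rightarrow> real \<Rightarrow> real" where
  "\<theta>_approx n s = integral {a..s} (\<lambda>s. 1 / sqrt (A s + 1 / real (Suc n)))"

abbreviation "\<theta>_slope n s \<equiv> 1 / sqrt (A s + 1 / real (Suc n))"

lemma \<theta>_slope_pos: "s \<in> {a..b} \<Longrightarrow> \<theta>_slope n s > 0"
  using A_nonneg[of s] by (simp add: add_nonneg_pos)

lemma \<theta>_slope_continuous: "continuous_on {a..b} (\<theta>_slope n)"
proof -
  have "continuous_on {a..b} A" using A_smooth[of 0] by simp
  moreover have "sqrt (A s + 1 / real (Suc n)) \<noteq> 0" if "s \<in> {a..b}" for s using \<theta>_slope_pos[OF that, of n] by auto
  ultimately show ?thesis by (intro continuous_intros) auto
qed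

lemma \<theta>_approx_deriv: "s \<in> {a..b} \<Longrightarrow> (\<theta>_approx n has_real_derivative \<theta>_slope n s) (at s within {a..b})"
  unfolding \<theta>_approx_def[abs_def] by (rule integral_has_real_derivative[OF \<theta>_slope_continuous])

lemma \<theta>_slope_bound: "s \<in> {a..b} \<Longrightarrow> \<bar>\<theta>_slope n s\<bar> * sqrt (A s) \<le> 1"
proof -
  assume s: "s \<in> {a..b}"
  have "sqrt (A s) \<le> sqrt (A s + 1 / real (Suc n))" by simp
  then show ?thesis using \<theta>_slope_pos[OF s, of n] A_nonneg[OF s] by (simp add: divide_le_eq_1 zero_less_divide_iff)
qed

lemma \<theta>_approx_le_rho: "\<theta>_approx n (F p) \<le> \<rho> p"
  using rho_lower_bound[OF \<theta>_approx_deriv \<theta>_slope_bound, of n p] by (simp add: \<theta>_approx_def)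

text \<open>
  The slopes are bounded below uniformly in \<open>n\<close>, as \<open>A\<close> is bounded. Hence the limit \<open>\<phi>\<close> is strictly
  increasing.
\<close>

lemma \<theta>_approx_increase:
  "\<exists>\<kappa>>0. \<forall>n s t. a \<le> s \<longrightarrow> s \<le> t \<longrightarrow> t \<le> b \<longrightarrow> \<theta>_approx n s + \<kappa> * (t - s) \<le> \<theta>_approx n t"
proof -
  have Ac: "continuous_on {a..b} A" using A_smooth[of 0] by simp
  obtain C where C: "\<forall>y\<in>A ` {a..b}. norm y \<le> C"
    using compact_imp_bounded[OF compact_continuous_image[OF Ac compact_Icc]] unfolding bounded_iff by blast
  then have C: "A s \<le> C" if "s \<in> {a..b}" for s using that by (force simp: abs_le_iff)
  have C0: "C \<ge> 0" using C[of a] A_nonneg[of a] ab by force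
  define \<kappa> where "\<kappa> = 1 / sqrt (C + 1)"
  have "\<theta>_approx n s + \<kappa> * (t - s) \<le> \<theta>_approx n t" if st: "a \<le> s" "s \<le> t" "t \<le> b" for n s t
  proof -
    have "s \<in> {a..b}" "t \<in> {a..b}" using st by auto
    then obtain \<xi> where \<xi>: "\<xi> \<in> {a..b}" "\<theta>_approx n t - \<theta>_approx n s = \<theta>_slope n \<xi> * (t - s)"
      using mvt_interval[OF \<theta>_approx_deriv, of s t n] by metis
    have "A \<xi> + 1 / real (Suc n) \<le> C + 1" using C[OF \<xi>(1)] by (intro add_mono) auto
    then have "sqrt (A \<xi> + 1 / real (Suc n)) \<le> sqrt (C + 1)" by simp
    then have "\<kappa> \<le> \<theta>_slope n \<xi>" unfolding \<kappa>_def using \<theta>_slope_pos[OF \<xi>(1), of n]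
      by (intro divide_left_mono) (auto simp: zero_less_divide_iff C0 add_nonneg_pos intro!: mult_pos_pos)
    then have "\<kappa> * (t - s) \<le> \<theta>_slope n \<xi> * (t - s)" using st by (intro mult_right_mono) auto
    then show ?thesis using \<xi>(2) by simp
  qed
  moreover have "\<kappa> > 0" using C0 by (simp add: \<kappa>_def)
  ultimately show ?thesis by blast
qed

text \<open>
  The value of the improper integral of \<open>1 / sqrt A\<close> from \<open>a\<close> to \<open>s\<close>.
\<close>

definition \<phi> :: "real \<Rightarrow> real" where
  "\<phi> s = (SUP n. \<theta>_approx n s)"

lemma \<theta>_approx_bdd: "s \<in> {a..b} \<Longrightarrow> bdd_above (range (\<lambda>n. \<theta>_approx n s))"
  using F_attains[of s] \<theta>_approx_le_rho by (metis bdd_aboveI2)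

lemma \<theta>_approx_le_\<phi>: "s \<in> {a..b} \<Longrightarrow> \<theta>_approx n s \<le> \<phi> s"
  unfolding \<phi>_def by (rule cSUP_upper) (auto intro: \<theta>_approx_bdd)

lemma \<phi>_le_rho: "\<phi> (F p) \<le> \<rho> p"
  unfolding \<phi>_def by (rule cSUP_least) (auto intro: \<theta>_approx_le_rho)

lemma \<phi>_strict_mono:
  assumes "a \<le> s" "s < t" "t \<le> b"
  shows "\<phi> s < \<phi> t"
proof -
  obtain \<kappa> where \<kappa>: "\<kappa> > 0" "\<forall>n s t. a \<le> s \<longrightarrow> s \<le> t \<longrightarrow> t \<le> b \<longrightarrow> \<theta>_approx n s + \<kappa> * (t - s) \<le> \<theta>_approx n t"
    using \<theta>_approx_increase by blast
  have "\<phi> s \<le> \<phi> t - \<kappa> * (t - s)"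
    unfolding \<phi>_def[of s]
  proof (rule cSUP_least)
    fix n
    show "\<theta>_approx n s \<le> \<phi> t - \<kappa> * (t - s)"
      using \<kappa>(2)[rule_format, of s t n] \<theta>_approx_le_\<phi>[of t n] assms by auto
  qed simp
  then show ?thesis using \<kappa>(1) assms by (smt (verit) mult_pos_pos)
qed

lemma \<theta>_approx_nonneg: "s \<in> {a..b} \<Longrightarrow> \<theta>_approx n s \<ge> 0"
proof -
  assume s: "s \<in> {a..b}"
  obtain \<kappa> where \<kappa>: "\<kappa> > 0" "\<forall>n s t. a \<le> s \<longrightarrow> s \<le> t \<longrightarrow> t \<le> b \<longrightarrow> \<theta>_approx n s + \<kappa> * (t - s) \<le> \<theta>_approx n t"
    using \<theta>_approx_increase by blast
  have "\<theta>_approx n a + \<kappa> * (s - a) \<le> \<theta>_approx n s" using \<kappa>(2) s by auto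
  moreover have "\<theta>_approx n a = 0" by (simp add: \<theta>_approx_def)
  moreover have "\<kappa> * (s - a) \<ge> 0" using \<kappa>(1) s by simp
  ultimately show ?thesis by linarith
qed

text \<open>
  The set where \<open>\<rho> \<ge> e\<close> is compact and disjoint from the focal set, so \<open>F\<close> has a minimum larger than \<open>a\<close>
  on it.
\<close>

lemma rho_near_focal:
  assumes "e > 0"
  obtains c where "c > a" "\<And>p. F p < c \<Longrightarrow> \<rho> p < e"
proof -
  let ?S = "{p. e \<le> \<rho> p}"
  have "closed ?S" using rho_continuous by (intro closed_Collect_le) auto
  then have S: "compact ?S" using compact_UNIV by (metis compact_Int_closed inf_top_left)
  show thesis
  proof (cases "?S = {}")
    case True
    then show thesis using that[of "a + 1"] by (force simp: not_le)
  next
    case False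
    obtain p where p: "p \<in> ?S" "\<forall>q\<in>?S. F p \<le> F q"
      using continuous_attains_inf[OF S False continuous_on_subset[OF F_continuous]] by blast
    have "F p \<noteq> a" using p(1) rho_zero[of p] assms by auto
    then have "F p > a" using F_in[of p] by auto
    then show thesis using that[of "F p"] p(2) by (force simp: not_le)
  qed
qed

text \<open>
  Compare \<open>\<rho>\<close> with \<open>\<Theta> = (1 + \<delta>) \<theta>_approx n\<close>, whose slope exceeds \<open>1 / sqrt A\<close> on \<open>{c1..F x}\<close> if \<open>n\<close> is large.
  Let \<open>\<rho> - \<Theta>(F)\<close> attain its maximum over \<open>{F \<le> F x}\<close> at \<open>y\<close>. By \<open>descent_step\<close> and the triangle inequality
  \<open>y\<close> does not lie in \<open>{F \<ge> c1}\<close>, since a step against the gradient would increase this difference. So \<open>F y < c1\<close> and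
  \<open>\<rho> y < e\<close>, and \<open>\<rho> x \<le> \<Theta>(F x) + e\<close> follows.
\<close>

lemma rho_le_\<phi>_interior:
  assumes Fx: "F x < b"
  shows "\<rho> x \<le> \<phi> (F x)"
proof -
  have main: "\<rho> x \<le> (1 + \<delta>) * \<phi> (F x) + e" if \<delta>: "\<delta> > 0" and e: "e > 0" for \<delta> e
  proof -
    obtain c1 where c1: "c1 > a" "\<And>p. F p < c1 \<Longrightarrow> \<rho> p < e" using rho_near_focal[OF e] by blast
    have \<phi>0: "\<phi> (F x) \<ge> 0" using \<theta>_approx_nonneg[OF F_in[of x], of 0] \<theta>_approx_le_\<phi>[OF F_in[of x], of 0] by linarith
    show ?thesis
    proof (cases "F x < c1")
      case True
      then show ?thesis using c1(2)[OF True] \<phi>0 \<delta> by (smt (verit) mult_nonneg_nonneg)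
    next
      case False
      have sub: "{c1..F x} \<subseteq> {a<..<b}" using c1(1) Fx by auto
      have Ac: "continuous_on {c1..F x} A"
      proof (rule continuous_on_subset)
        show "continuous_on {a..b} A" using A_smooth[of 0] by simp
        show "{c1..F x} \<subseteq> {a..b}" using sub by (meson greaterThanLessThan_subseteq_atLeastAtMost_iff subset_trans order_refl)
      qed
      obtain s0 where s0: "s0 \<in> {c1..F x}" "\<forall>s\<in>{c1..F x}. A s0 \<le> A s"
        using continuous_attains_inf[OF compact_Icc _ Ac] False by auto
      have m: "A s0 > 0" using A_interior_pos s0 sub by blast
      obtain n where n: "1 / (((1 + \<delta>)^2 - 1) * A s0) < real n" using reals_Archimedean2 by blast
      have pos: "((1 + \<delta>)^2 - 1) * A s0 > 0" using m \<delta> by (simp add: power2_eq_square algebra_simps add_pos_pos)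
      have small: "1 / real (Suc n) < ((1 + \<delta>)^2 - 1) * A s0"
      proof -
        have "1 < real n * (((1 + \<delta>)^2 - 1) * A s0)" using n pos by (simp add: pos_divide_less_eq)
        also have "\<dots> \<le> real (Suc n) * (((1 + \<delta>)^2 - 1) * A s0)" using pos by (intro mult_right_mono) auto
        finally show ?thesis by (simp add: pos_divide_less_eq mult.commute)
      qed
      define K where "K = {p. F p \<le> F x}"
      have "closed K" unfolding K_def using F_continuous by (intro closed_Collect_le) auto
      then have K: "compact K" "K \<noteq> {}" using compact_UNIV by (metis compact_Int_closed inf_top_left) (auto simp: K_def)
      define \<Theta> where "\<Theta> s = (1 + \<delta>) * \<theta>_approx n s" for s
      have \<Theta>d: "(\<Theta> has_real_derivative (1 + \<delta>) * \<theta>_slope n s) (at s within {a..b})" if "s \<in> {a..b}" for s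
        unfolding \<Theta>_def[abs_def] by (rule DERIV_cmult[OF \<theta>_approx_deriv[OF that]])
      have \<Theta>c: "continuous_on UNIV (\<lambda>p. \<Theta> (F p))" by (rule AF_continuous[OF DERIV_continuous_on[OF \<Theta>d]])
      have "continuous_on K (\<lambda>p. \<rho> p - \<Theta> (F p))"
        by (intro continuous_intros continuous_on_subset[OF rho_continuous] continuous_on_subset[OF \<Theta>c]) auto
      then obtain y where y: "y \<in> K" "\<forall>p\<in>K. \<rho> p - \<Theta> (F p) \<le> \<rho> y - \<Theta> (F y)"
        using continuous_attains_sup[OF K] by blast
      have "F y < c1"
      proof (rule ccontr)
        assume "\<not> F y < c1"
        then have Fy: "F y \<in> {c1..F x}" using y(1) by (auto simp: K_def)
        have Ay: "A s0 \<le> A (F y)" using s0(2) Fy by blast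
        have "A (F y) + 1 / real (Suc n) < (1 + \<delta>)^2 * A (F y)"
        proof -
          have "((1 + \<delta>)^2 - 1) * A s0 \<le> ((1 + \<delta>)^2 - 1) * A (F y)"
            using Ay \<delta> by (intro mult_left_mono) (auto simp: power2_eq_square algebra_simps)
          then show ?thesis using small by (simp add: algebra_simps)
        qed
        then have "sqrt (A (F y) + 1 / real (Suc n)) < sqrt ((1 + \<delta>)^2 * A (F y))" by simp
        then have "sqrt (A (F y) + 1 / real (Suc n)) < (1 + \<delta>) * sqrt (A (F y))" using \<delta> by (simp add: real_sqrt_mult)
        then have steep: "(1 + \<delta>) * \<theta>_slope n (F y) * sqrt (A (F y)) > 1"
          using \<theta>_slope_pos[OF F_in[of y], of n] by (simp add: pos_less_divide_eq del: of_nat_Suc)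
        obtain z where z: "F z \<le> F y" "dist_M y z < \<Theta> (F y) - \<Theta> (F z)"
          using descent_step[OF _ \<Theta>d[OF F_in] steep] m Ay by auto
        have "z \<in> K" using z(1) y(1) by (auto simp: K_def)
        then have "\<rho> z - \<Theta> (F z) \<le> \<rho> y - \<Theta> (F y)" using y(2) by blast
        then show False using z(2) rho_triangle[of y z] by linarith
      qed
      then have "\<rho> y < e" by (rule c1(2))
      moreover have "\<Theta> (F y) \<ge> 0" using \<theta>_approx_nonneg[OF F_in] \<delta> by (simp add: \<Theta>_def)
      moreover have "\<rho> x - \<Theta> (F x) \<le> \<rho> y - \<Theta> (F y)" using y(2) by (simp add: K_def)
      moreover have "\<Theta> (F x) \<le> (1 + \<delta>) * \<phi> (F x)"
        unfolding \<Theta>_def using \<theta>_approx_le_\<phi>[OF F_in] \<delta> by (intro mult_left_mono) auto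
      ultimately show ?thesis by linarith
    qed
  qed
  show ?thesis
  proof (rule field_le_epsilon)
    fix e :: real assume e: "e > 0"
    have \<phi>0: "\<phi> (F x) \<ge> 0" using \<theta>_approx_nonneg[OF F_in[of x], of 0] \<theta>_approx_le_\<phi>[OF F_in[of x], of 0] by linarith
    define \<delta> where "\<delta> = e / (2 * (\<phi> (F x) + 1))"
    have \<delta>: "\<delta> > 0" using e \<phi>0 by (simp add: \<delta>_def)
    have "\<delta> * \<phi> (F x) \<le> \<delta> * (\<phi> (F x) + 1)" using \<delta> by (intro mult_left_mono) auto
    also have "\<dots> = e / 2"
    proof -
      have "\<phi> (F x) + 1 \<noteq> 0" using \<phi>0 by linarith
      then show ?thesis unfolding \<delta>_def by (simp add: divide_simps del: distrib_left_numeral)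
    qed
    finally have "(1 + \<delta>) * \<phi> (F x) + e / 2 \<le> \<phi> (F x) + e" by (simp add: algebra_simps)
    then show "\<rho> x \<le> \<phi> (F x) + e" using main[OF \<delta>, of "e / 2"] e by simp
  qed
qed

lemma \<phi>_mono: "a \<le> s \<Longrightarrow> s \<le> t \<Longrightarrow> t \<le> b \<Longrightarrow> \<phi> s \<le> \<phi> t"
  using \<phi>_strict_mono[of s t] by (cases "s = t") auto

text \<open>
  Points with \<open>F = b\<close> are limits of points with \<open>F < b\<close>, so the interior estimate extends to them by
  the continuity of \<open>\<rho>\<close>.
\<close>

theorem rho_eq_\<phi>: "\<rho> x = \<phi> (F x)"
proof (rule antisym)
  show "\<phi> (F x) \<le> \<rho> x" by (rule \<phi>_le_rho)
  show "\<rho> x \<le> \<phi> (F x)"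
  proof (cases "F x < b")
    case True
    then show ?thesis by (rule rho_le_\<phi>_interior)
  next
    case False
    then have Fb: "F x = b" using F_in[of x] by auto
    show ?thesis
    proof (rule ccontr)
      assume "\<not> \<rho> x \<le> \<phi> (F x)"
      then have "x \<in> \<rho> -` {\<phi> b<..}" using Fb by simp
      moreover have "open (\<rho> -` {\<phi> b<..})" by (intro open_vimage rho_continuous) auto
      ultimately obtain q where q: "\<rho> q > \<phi> b" "F q < b" using maximum_set_no_interior by blast
      have "\<phi> (F q) \<le> \<phi> b" by (rule \<phi>_mono) (use F_in[of q] in auto)
      then show False using rho_le_\<phi>_interior[OF q(2)] q(1) by linarith
    qed
  qed
qed

end

section \<open>Integrals of eigenfunctions over sublevel sets\<close>

context compact_riemannian begin

text \<open>
  Near a point where \<open>k\<close> is not zero it has constant sign, and a bump function supported there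
  detects it.
\<close>

lemma continuous_orthogonal_zero:
  assumes k: "continuous_on UNIV k" and orth: "\<And>\<phi>. C1_function \<phi> \<Longrightarrow> (\<integral>p. k p * \<phi> p \<partial>vol) = 0"
  shows "k p = 0"
proof (rule ccontr)
  assume nz: "k p \<noteq> 0"
  define j where "j q = sgn (k p) * k q" for q
  have jc: "continuous_on UNIV j" unfolding j_def by (intro continuous_intros k)
  have jp: "j p > 0" using nz by (simp add: j_def sgn_if)
  have W: "open (j -` {0<..})" by (rule open_vimage[OF _ jc]) simp
  obtain \<beta> S where \<beta>: "C1_function \<beta>" "\<forall>q. 0 \<le> \<beta> q" "0 < \<beta> p" "S \<subseteq> j -` {0<..} \<inter> fst (chart_at M p)" "\<forall>q. q \<notin> S \<longrightarrow> \<beta> q = 0"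
    using bump_function[OF chart_at_atlas W, of p] jp by blast
  have "j p * \<beta> p = 0"
  proof (rule integral_continuous_nonneg_zero)
    show "continuous_on UNIV (\<lambda>q. j q * \<beta> q)" by (intro continuous_intros jc Ck_function_continuous[OF \<beta>(1)])
    show "0 \<le> j q * \<beta> q" for q
    proof (cases "q \<in> S")
      case True
      then have "j q > 0" using \<beta>(4) by auto
      then show ?thesis using \<beta>(2) by simp
    qed (use \<beta>(5) in simp)
    have "(\<integral>q. j q * \<beta> q \<partial>vol) = sgn (k p) * (\<integral>q. k q * \<beta> q \<partial>vol)"
      unfolding j_def mult.assoc by (rule integral_mult_right_zero)
    then show "(\<integral>q. j q * \<beta> q \<partial>vol) = 0" using orth[OF \<beta>(1)] by simp
  qed
  then show False using jp \<beta>(3) by auto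
qed

text \<open>
  For the test function \<open>\<phi>\<close> use the weak equation of \<open>f\<close> with \<open>\<phi> \<circ> inv h\<close>.
  Both sides are integrals of quantities that \<open>h\<close> preserves.
\<close>

lemma eigenfunction_weak_pullback:
  assumes f: "eigenfunction M l f" and h: "riemannian_isometry M h" and \<phi>: "C1_function \<phi>"
  shows "(\<integral>p. pairing (f \<circ> h) \<phi> p \<partial>vol) = l * (\<integral>p. f (h p) * \<phi> p \<partial>vol)"
proof -
  note hh = riemannian_isometryD[OF h]
  have fs: "Ck_function k f" for k using f unfolding eigenfunction_def smooth_function_iff by blast
  define \<psi> where "\<psi> = \<phi> \<circ> inv h"
  have \<psi>: "C1_function \<psi>" unfolding \<psi>_def by (rule C1_function_compose_map[OF \<phi> hh(3)])
  have \<phi>_eq: "\<psi> \<circ> h = \<phi>" using hh(2) by (simp add: \<psi>_def fun_eq_iff bij_is_inj)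
  have "(\<integral>p. pairing (f \<circ> h) \<phi> p \<partial>vol) = (\<integral>p. pairing f \<psi> (h p) \<partial>vol)"
    using pairing_isometry[OF fs \<psi> hh(1)] by (simp add: \<phi>_eq)
  also have "\<dots> = (\<integral>p. pairing f \<psi> p \<partial>vol)"
    by (rule integral_isometry[OF h borel_measurable_continuous_onI[OF pairing_continuous[OF fs \<psi>]]])
  also have "\<dots> = (\<integral>p. laplacian M f p * \<psi> p \<partial>vol)" by (rule green[OF fs \<psi>])
  also have "\<dots> = (\<integral>p. l * (f p * \<psi> p) \<partial>vol)" using f by (simp add: eigenfunction_def mult.assoc)
  also have "\<dots> = l * (\<integral>p. f p * \<psi> p \<partial>vol)" by (rule integral_mult_right_zero)
  also have "(\<integral>p. f p * \<psi> p \<partial>vol) = (\<integral>p. f (h p) * \<psi> (h p) \<partial>vol)"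
    by (rule integral_isometry[OF h, symmetric])
      (intro borel_measurable_continuous_onI continuous_intros Ck_function_continuous[OF fs] Ck_function_continuous[OF \<psi>])
  finally show ?thesis using fun_cong[OF \<phi>_eq] unfolding o_apply by simp
qed

lemma constant_eigenfunction: "eigenfunction M 0 (\<lambda>_. 1)"
proof -
  have s: "Ck_function k (\<lambda>_. 1)" for k by (rule Ck_function_const)
  have "laplacian M (\<lambda>_. 1) p = 0" for p
  proof (rule continuous_orthogonal_zero[OF laplacian_continuous[OF s]])
    fix \<phi> assume \<phi>: "C1_function \<phi>"
    have "pairing (\<lambda>_. 1) \<phi> q = 0" for q using pairing_sym pairing_const_right by metis
    then show "(\<integral>p. laplacian M (\<lambda>_. 1) p * \<phi> p \<partial>vol) = 0" using green[OF s \<phi>] by simp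
  qed
  then show ?thesis using s by (simp add: eigenfunction_def smooth_function_iff fun_eq_iff)
qed

end

context isoparametric begin

lemma C1_radial:
  assumes "\<And>s. s \<in> {a..b} \<Longrightarrow> (g has_real_derivative g1 s) (at s within {a..b})" "continuous_on {a..b} g1"
  shows "C1_function (\<lambda>p. g (F p))"
proof (rule Ck_function_compose_real[OF F_smooth, of _ _ "{a..b}"])
  show "Ck_real 1 g {a..b}" using assms unfolding One_nat_def Ck_real.simps by blast
qed (use F_range in simp)

text \<open>
  By the chain rule \<open>\<langle>dw, d(g(F))\<rangle> = g'(F) \<langle>dF, dw\<rangle>\<close>, and by the product rule this is
  \<open>\<langle>dF, d(g'(F) w)\<rangle> - A(F) g''(F) w\<close>. The weak equation of \<open>F\<close> evaluates the integral of the first term.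
\<close>

lemma radial_weak_identity:
  assumes w: "C1_function w" and g: "\<And>s. s \<in> {a..b} \<Longrightarrow> (g has_real_derivative g1 s) (at s within {a..b})"
    and g1: "\<And>s. s \<in> {a..b} \<Longrightarrow> (g1 has_real_derivative g2 s) (at s within {a..b})"
    and g2: "continuous_on {a..b} g2"
  shows "(\<integral>p. pairing w (\<lambda>p. g (F p)) p \<partial>vol) = (\<integral>p. (B (F p) * g1 (F p) - A (F p) * g2 (F p)) * w p \<partial>vol)"
proof -
  have c1: "continuous_on {a..b} g1" using DERIV_continuous_on[OF g1] by blast
  have Ac: "continuous_on {a..b} A" using A_smooth[of 0] by simp
  have Bc: "continuous_on {a..b} B" using B_smooth[of 0] by simp
  note wc = Ck_function_continuous[OF w]
  have G1: "C1_function (\<lambda>p. g1 (F p))" by (rule C1_radial[OF g1 g2])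
  have R: "range F \<subseteq> {a..b}" using F_range by simp
  have \<phi>: "C1_function (\<lambda>p. g1 (F p) * w p)" by (rule Ck_function_mult[OF G1 w])
  have 1: "pairing w (\<lambda>p. g (F p)) p = g1 (F p) * pairing F w p" for p
    using pairing_compose_right[OF F_smooth g[OF F_in] R] pairing_sym[of w F p] by simp
  have 2: "pairing F (\<lambda>p. g1 (F p) * w p) p = g1 (F p) * pairing F w p + A (F p) * g2 (F p) * w p" for p
    using pairing_mult_right[OF G1 w, of F p] pairing_compose_right[OF F_smooth g1[OF F_in] R, of F] pairing_F by simp
  have i1: "integrable vol (\<lambda>p. g1 (F p) * pairing F w p)"
    by (intro integrable_continuous continuous_intros AF_continuous c1 pairing_continuous F_smooth w)
  have i2: "integrable vol (\<lambda>p. A (F p) * g2 (F p) * w p)"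
    by (intro integrable_continuous continuous_intros AF_continuous Ac g2 wc)
  have i3: "integrable vol (\<lambda>p. B (F p) * (g1 (F p) * w p))"
    by (intro integrable_continuous continuous_intros AF_continuous Bc c1 wc)
  have "(\<integral>p. g1 (F p) * pairing F w p \<partial>vol) + (\<integral>p. A (F p) * g2 (F p) * w p \<partial>vol) = (\<integral>p. B (F p) * (g1 (F p) * w p) \<partial>vol)"
    using weak_F[OF \<phi>] Bochner_Integration.integral_add[OF i1 i2] by (simp add: 2)
  moreover have "(\<integral>p. (B (F p) * g1 (F p) - A (F p) * g2 (F p)) * w p \<partial>vol)
      = (\<integral>p. B (F p) * (g1 (F p) * w p) \<partial>vol) - (\<integral>p. A (F p) * g2 (F p) * w p \<partial>vol)"
    using Bochner_Integration.integral_diff[OF i3 i2] by (simp add: algebra_simps)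
  ultimately show ?thesis by (simp add: 1)
qed

text \<open>
  By \<open>radial_weak_identity\<close> with arbitrary \<open>w\<close>, the function \<open>\<Delta>(g(F)) - l g(F)\<close> is orthogonal to all test
  functions. As \<open>F\<close> is a function of \<open>\<rho>\<close>, every function of \<open>F\<close> is radial.
\<close>

lemma radial_eigenfunction:
  assumes gs: "\<And>k. Ck_real k g {a..b}" and g: "\<And>s. s \<in> {a..b} \<Longrightarrow> (g has_real_derivative g1 s) (at s within {a..b})"
    and g1: "\<And>s. s \<in> {a..b} \<Longrightarrow> (g1 has_real_derivative g2 s) (at s within {a..b})"
    and g2: "continuous_on {a..b} g2" and ode: "\<And>s. s \<in> {a..b} \<Longrightarrow> B s * g1 s - A s * g2 s = l * g s"
    and nz: "g a \<noteq> 0"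
  shows "eigenfunction M l (\<lambda>p. g (F p))" "radial M F a (\<lambda>p. g (F p))"
proof -
  let ?u = "\<lambda>p. g (F p)"
  have R: "range F \<subseteq> {a..b}" using F_range by simp
  have us: "Ck_function k ?u" for k by (rule Ck_function_compose_real[OF F_smooth gs R])
  have "laplacian M ?u p - l * ?u p = 0" for p
  proof (rule continuous_orthogonal_zero)
    show "continuous_on UNIV (\<lambda>p. laplacian M ?u p - l * ?u p)"
      by (intro continuous_intros laplacian_continuous us Ck_function_continuous[OF us])
    fix \<phi> assume \<phi>: "C1_function \<phi>"
    note \<phi>c = Ck_function_continuous[OF \<phi>]
    have "(\<integral>p. laplacian M ?u p * \<phi> p \<partial>vol) = (\<integral>p. pairing \<phi> ?u p \<partial>vol)"
      using green[OF us \<phi>] by (simp add: pairing_sym[of \<phi>])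
    also have "\<dots> = (\<integral>p. l * ?u p * \<phi> p \<partial>vol)"
      using radial_weak_identity[OF \<phi> g g1 g2] by (simp add: ode[OF F_in])
    finally have *: "(\<integral>p. laplacian M ?u p * \<phi> p \<partial>vol) = (\<integral>p. l * ?u p * \<phi> p \<partial>vol)" .
    have "integrable vol (\<lambda>p. laplacian M ?u p * \<phi> p)"
      by (intro integrable_continuous continuous_intros laplacian_continuous us \<phi>c)
    moreover have "integrable vol (\<lambda>p. l * ?u p * \<phi> p)"
      by (intro integrable_continuous continuous_intros Ck_function_continuous[OF us] \<phi>c)
    ultimately show "(\<integral>p. (laplacian M ?u p - l * ?u p) * \<phi> p \<partial>vol) = 0"
      using * by (simp add: left_diff_distrib)
  qed
  moreover have "?u \<noteq> (\<lambda>_. 0)"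
  proof -
    obtain p where "F p = a" using F_attains[of a] ab by auto
    then have "?u p \<noteq> 0" using nz by simp
    then show ?thesis by metis
  qed
  ultimately show "eigenfunction M l ?u" using us by (simp add: eigenfunction_def smooth_function_iff)
  have inj: "inj_on \<phi> {a..b}"
  proof (rule inj_onI)
    fix s t assume "s \<in> {a..b}" "t \<in> {a..b}" "\<phi> s = \<phi> t"
    then show "s = t" using \<phi>_strict_mono[of s t] \<phi>_strict_mono[of t s] by (cases s t rule: linorder_cases) auto
  qed
  show "radial M F a ?u"
    unfolding radial_def
  proof
    show "?u = (\<lambda>r. g (the_inv_into {a..b} \<phi> r)) \<circ> \<rho>"
      by (rule ext) (simp add: rho_eq_\<phi> the_inv_into_f_f[OF inj F_in])
  qed
qed

text \<open>
  By \<open>radial_weak_identity\<close> the integral of \<open>(B g' - A g'' - l g)(F) w\<close> vanishes for each member of the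
  approximating sequence, and dominated convergence passes to the limit.
\<close>

lemma sublevel_integral_zero:
  assumes w: "C1_function w" and weak: "\<And>\<phi>. C1_function \<phi> \<Longrightarrow> (\<integral>p. pairing w \<phi> p \<partial>vol) = l * (\<integral>p. w p * \<phi> p \<partial>vol)"
    and l: "l \<noteq> 0" and fc: "focal_coefficients a b A A' B" and nr: "\<not> focal_coefficients.resonant a b A B l"
    and s0: "s0 \<in> {a<..<b}"
  shows "(\<integral>p. indicator {..s0} (F p) * w p \<partial>vol) = 0"
proof -
  show ?thesis
  proof (rule focal_coefficients.indicator_approximation[OF fc nr l s0])
    fix g g1 g2 :: "nat \<Rightarrow> real \<Rightarrow> real" and C
    assume g: "\<And>n s. s \<in> {a..b} \<Longrightarrow> (g n has_real_derivative g1 n s) (at s within {a..b})"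
      and g1: "\<And>n s. s \<in> {a..b} \<Longrightarrow> (g1 n has_real_derivative g2 n s) (at s within {a..b})"
      and g2: "\<And>n. continuous_on {a..b} (g2 n)"
      and bd: "\<And>n s. s \<in> {a..b} \<Longrightarrow> \<bar>B s * g1 n s - A s * g2 n s - l * g n s\<bar> \<le> C"
      and lim: "\<And>s. s \<in> {a..b} \<Longrightarrow> (\<lambda>n. B s * g1 n s - A s * g2 n s - l * g n s) \<longlonglongrightarrow> (if s \<le> s0 then 1 else 0)"
    define T where "T n s = B s * g1 n s - A s * g2 n s - l * g n s" for n s
    note wc = Ck_function_continuous[OF w]
    have Ac: "continuous_on {a..b} A" using A_smooth[of 0] by simp
    have Bc: "continuous_on {a..b} B" using B_smooth[of 0] by simp
    have gc: "continuous_on {a..b} (g n)" for n using DERIV_continuous_on[OF g] by blast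
    have g1c: "continuous_on {a..b} (g1 n)" for n using DERIV_continuous_on[OF g1] by blast
    have Tc: "continuous_on UNIV (\<lambda>p. T n (F p) * w p)" for n
      unfolding T_def by (intro continuous_intros AF_continuous Ac Bc gc g1c g2 wc)
    have zero: "(\<integral>p. T n (F p) * w p \<partial>vol) = 0" for n
    proof -
      have i1: "integrable vol (\<lambda>p. (B (F p) * g1 n (F p) - A (F p) * g2 n (F p)) * w p)"
        by (intro integrable_continuous continuous_intros AF_continuous Ac Bc gc g1c g2 wc)
      have i2: "integrable vol (\<lambda>p. l * (w p * g n (F p)))"
        by (intro integrable_continuous continuous_intros AF_continuous gc wc)
      have "(\<integral>p. (B (F p) * g1 n (F p) - A (F p) * g2 n (F p)) * w p \<partial>vol) = l * (\<integral>p. w p * g n (F p) \<partial>vol)"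
        using radial_weak_identity[OF w g g1 g2, of n] weak[OF C1_radial[OF g g1c], of n] by simp
      also have "\<dots> = (\<integral>p. l * (w p * g n (F p)) \<partial>vol)" by (rule integral_mult_right_zero[symmetric])
      finally show ?thesis using Bochner_Integration.integral_diff[OF i1 i2] by (simp add: T_def algebra_simps)
    qed
    have "(\<lambda>n. \<integral>p. T n (F p) * w p \<partial>vol) \<longlonglongrightarrow> (\<integral>p. indicator {..s0} (F p) * w p \<partial>vol)"
    proof (rule integral_dominated_convergence)
      have "F \<in> borel_measurable borel" by (rule borel_measurable_continuous_onI[OF F_continuous])
      moreover have "w \<in> borel_measurable borel" by (rule borel_measurable_continuous_onI[OF wc])
      ultimately show "(\<lambda>p. indicator {..s0} (F p) * w p) \<in> borel_measurable vol"
        unfolding measurable_vol by measurable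
      show "(\<lambda>p. T n (F p) * w p) \<in> borel_measurable vol" for n
        using integrable_continuous[OF Tc] by (rule borel_measurable_integrable)
      show "integrable vol (\<lambda>p. C * \<bar>w p\<bar>)" by (intro integrable_continuous continuous_intros wc)
      show "AE p in vol. (\<lambda>n. T n (F p) * w p) \<longlonglongrightarrow> indicator {..s0} (F p) * w p"
      proof (intro AE_I2 tendsto_mult_right)
        fix p
        have "indicator {..s0} (F p) = (if F p \<le> s0 then 1 else 0 :: real)" by (simp add: indicator_def)
        then show "(\<lambda>n. T n (F p)) \<longlonglongrightarrow> indicator {..s0} (F p)" using lim[OF F_in] unfolding T_def by simp
      qed
      show "AE p in vol. norm (T n (F p) * w p) \<le> C * \<bar>w p\<bar>" for n
        using bd[OF F_in] unfolding T_def by (intro AE_I2) (simp add: abs_mult mult_right_mono)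
    qed
    then show ?thesis using zero LIMSEQ_unique[OF _ tendsto_const] by simp
  qed
qed

text \<open>
  A proper nonempty initial segment of \<open>[a, b]\<close> has the form \<open>[a, c]\<close> or \<open>[a, c)\<close>. It is approached by intervals
  \<open>[a, \<sigma> n]\<close> with \<open>\<sigma> n\<close> decreasing, respectively increasing, to \<open>c\<close>.
\<close>

lemma downset_indicator_limit:
  assumes down: "\<And>s t. s \<in> J \<Longrightarrow> t \<le> s \<Longrightarrow> t \<in> {a..b} \<Longrightarrow> t \<in> J"
    and ne: "J \<inter> {a..b} \<noteq> {}" and b: "b \<notin> J"
  shows "\<exists>\<sigma> :: nat \<Rightarrow> real. (\<forall>n. \<sigma> n \<in> {a<..<b}) \<and>
    (\<forall>s\<in>{a..b}. (\<lambda>n. indicator {..\<sigma> n} s :: real) \<longlonglongrightarrow> indicator J s)"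
proof -
  define c where "c = Sup (J \<inter> {a..b})"
  have bdd: "bdd_above (J \<inter> {a..b})" by (rule bdd_aboveI[of _ b]) auto
  have up: "s \<le> c" if "s \<in> J" "s \<in> {a..b}" for s
    unfolding c_def by (rule cSup_upper[OF _ bdd]) (use that in simp)
  have c: "c \<in> {a..b}"
  proof -
    obtain s where s: "s \<in> J" "s \<in> {a..b}" using ne by blast
    have "c \<le> b" unfolding c_def by (rule cSup_least[OF ne]) simp
    then show ?thesis using up[OF s] s(2) by simp
  qed
  have below: "s \<in> J" if s: "s < c" "s \<in> {a..b}" for s
  proof -
    obtain t where "t \<in> J \<inter> {a..b}" "s < t" using less_cSupD[OF ne] s(1) unfolding c_def by blast
    then show ?thesis using down[of t s] s by simp
  qed
  show ?thesis
  proof (cases "c \<in> J")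
    case True
    have cb: "c < b" using c b True by (cases "c = b") auto
    define \<sigma> where "\<sigma> n = c + (b - c) / real (n + 2)" for n :: nat
    have gt: "c < \<sigma> n" "\<sigma> n < b" for n
    proof -
      show "c < \<sigma> n" using cb by (simp add: \<sigma>_def)
      have "(b - c) / real (n + 2) < (b - c) / 1" using cb by (intro divide_strict_left_mono) auto
      then show "\<sigma> n < b" by (simp add: \<sigma>_def)
    qed
    have lim: "\<sigma> \<longlonglongrightarrow> c"
      unfolding \<sigma>_def using tendsto_add[OF tendsto_const[of c] LIMSEQ_ignore_initial_segment[OF lim_const_over_n[of "b - c"], of 2]] by simp
    have "(\<lambda>n. indicator {..\<sigma> n} s :: real) \<longlonglongrightarrow> indicator J s" if s: "s \<in> {a..b}" for s
    proof (cases "s \<in> J")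
      case in_J: True
      have "s \<le> \<sigma> n" for n using up[OF in_J s] gt(1)[of n] by simp
      then show ?thesis using in_J by simp
    next
      case False
      then have "c < s" using below[of s] s \<open>c \<in> J\<close> by (cases s c rule: linorder_cases) auto
      with lim have "\<forall>\<^sub>F n in sequentially. \<sigma> n < s" by (rule order_tendstoD)
      then have "\<forall>\<^sub>F n in sequentially. indicator {..\<sigma> n} s = (0::real)" by eventually_elim simp
      then show ?thesis using False by (simp add: tendsto_eventually)
    qed
    then show ?thesis using gt c by (intro exI[of _ \<sigma>]) (auto intro: le_less_trans)
  next
    case False
    have ac: "a < c"
    proof -
      obtain s where "s \<in> J" "s \<in> {a..b}" using ne by blast
      then show ?thesis using up[of s] False by (cases "s = c") auto
    qed
    define \<sigma> where "\<sigma> n = c - (c - a) / real (n + 2)" for n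
    have gt: "a < \<sigma> n" "\<sigma> n < c" for n
    proof -
      show "\<sigma> n < c" using ac by (simp add: \<sigma>_def)
      have "(c - a) / real (n + 2) < (c - a) / 1" using ac by (intro divide_strict_left_mono) auto
      then show "a < \<sigma> n" by (simp add: \<sigma>_def)
    qed
    have lim: "\<sigma> \<longlonglongrightarrow> c"
      unfolding \<sigma>_def using tendsto_diff[OF tendsto_const[of c] LIMSEQ_ignore_initial_segment[OF lim_const_over_n[of "c - a"], of 2]] by simp
    have "(\<lambda>n. indicator {..\<sigma> n} s :: real) \<longlonglongrightarrow> indicator J s" if s: "s \<in> {a..b}" for s
    proof (cases "s \<in> J")
      case in_J: True
      then have "s < c" using up[OF in_J s] False by (cases "s = c") auto
      with lim have "\<forall>\<^sub>F n in sequentially. s < \<sigma> n" by (rule order_tendstoD)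
      then have "\<forall>\<^sub>F n in sequentially. indicator {..\<sigma> n} s = (1::real)" by eventually_elim simp
      then show ?thesis using in_J by (simp add: tendsto_eventually)
    next
      case not_J: False
      then have "c \<le> s" using below[of s] s by force
      then have "\<not> s \<le> \<sigma> n" for n using gt(2)[of n] by simp
      then show ?thesis using not_J by simp
    qed
    then show ?thesis using gt c by (intro exI[of _ \<sigma>]) (auto intro: less_le_trans)
  qed
qed

text \<open>
  For \<open>J \<supseteq> [a, b]\<close> the integral of \<open>w\<close> itself vanishes, as the weak equation with the test function \<open>1\<close> shows.
  The other cases are limits of \<open>sublevel_integral_zero\<close>.
\<close>

lemma downset_integral_zero:
  assumes w: "C1_function w" and weak: "\<And>\<phi>. C1_function \<phi> \<Longrightarrow> (\<integral>p. pairing w \<phi> p \<partial>vol) = l * (\<integral>p. w p * \<phi> p \<partial>vol)"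
    and l: "l \<noteq> 0" and fc: "focal_coefficients a b A A' B" and nr: "\<not> focal_coefficients.resonant a b A B l"
    and down: "\<And>s t. s \<in> J \<Longrightarrow> t \<le> s \<Longrightarrow> t \<in> {a..b} \<Longrightarrow> t \<in> J"
  shows "(\<integral>p. indicator J (F p) * w p \<partial>vol) = 0"
proof -
  note wc = Ck_function_continuous[OF w]
  consider "J \<inter> {a..b} = {}" | "b \<in> J" | "J \<inter> {a..b} \<noteq> {}" "b \<notin> J" by blast
  then show ?thesis
  proof cases
    case 1
    have "F p \<notin> J" for p using F_in[of p] 1 by blast
    then show ?thesis by simp
  next
    case 2
    have "F p \<in> J" for p using down[OF 2, of "F p"] F_in[of p] by simp
    moreover have "l * (\<integral>p. w p * 1 \<partial>vol) = 0"
      using weak[OF Ck_function_const[of 1 1]] by (simp add: pairing_const_right)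
    ultimately show ?thesis using l by simp
  next
    case 3
    from downset_indicator_limit[of J, OF _ this] down obtain \<sigma> :: "nat \<Rightarrow> real"
      where \<sigma>: "\<forall>n. \<sigma> n \<in> {a<..<b}" and lim: "\<forall>s\<in>{a..b}. (\<lambda>n. indicator {..\<sigma> n} s :: real) \<longlonglongrightarrow> indicator J s" by blast
    have m: "F \<in> borel_measurable borel" "w \<in> borel_measurable borel"
      by (intro borel_measurable_continuous_onI F_continuous wc)+
    have sm: "(\<lambda>p. indicator {..\<sigma> n} (F p) * w p) \<in> borel_measurable vol" for n
      unfolding measurable_vol using m by measurable
    have conv: "(\<lambda>n. indicator {..\<sigma> n} (F p) * w p) \<longlonglongrightarrow> indicator J (F p) * w p" for p
      by (rule tendsto_mult_right[OF bspec[OF lim F_in]])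
    have "(\<lambda>n. \<integral>p. indicator {..\<sigma> n} (F p) * w p \<partial>vol) \<longlonglongrightarrow> (\<integral>p. indicator J (F p) * w p \<partial>vol)"
    proof (rule integral_dominated_convergence[OF borel_measurable_LIMSEQ_real[OF conv sm] sm])
      show "integrable vol (\<lambda>p. \<bar>w p\<bar>)" by (intro integrable_continuous continuous_intros wc)
      show "AE p in vol. (\<lambda>n. indicator {..\<sigma> n} (F p) * w p) \<longlonglongrightarrow> indicator J (F p) * w p" by (intro AE_I2 conv)
      show "AE p in vol. norm (indicator {..\<sigma> n} (F p) * w p) \<le> \<bar>w p\<bar>" for n
        by (intro AE_I2) (simp add: abs_mult indicator_def)
    qed
    moreover have "(\<integral>p. indicator {..\<sigma> n} (F p) * w p \<partial>vol) = 0" for n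
      by (rule sublevel_integral_zero[OF w weak l fc nr \<sigma>[rule_format]])
    ultimately show ?thesis using LIMSEQ_unique[OF _ tendsto_const] by simp
  qed
qed

section \<open>Isoparametric tubes\<close>

lemma tube_eq: "isoparametric_tube M F a t = {p. \<phi> (F p) < t}"
  unfolding isoparametric_tube_def rho_eq_\<phi> ..

lemma tube_open: "open (isoparametric_tube M F a t)"
  unfolding isoparametric_tube_def by (intro open_Collect_less rho_continuous continuous_on_const)

lemma nonradial_not_resonant:
  assumes l: "l \<in> Spec1 M - radial_Spec M F a" and fc: "focal_coefficients a b A A' B"
  shows "\<not> focal_coefficients.resonant a b A B l"
proof
  assume "focal_coefficients.resonant a b A B l"
  then obtain g g1 g2 where g: "\<forall>k. Ck_real k g {a..b}"
      "focal_coefficients.radial_solution A B l {a..b} g g1 g2" "g a \<noteq> 0"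
    unfolding focal_coefficients.resonant_def[OF fc] by blast
  have e: "eigenfunction M l (\<lambda>p. g (F p))" "radial M F a (\<lambda>p. g (F p))"
    by (rule radial_eigenfunction[where g=g and ?g1.0=g1 and ?g2.0=g2];
        use g focal_coefficients.radial_solution_def[OF fc] in auto)+
  then have "l \<in> radial_Spec M F a" unfolding radial_Spec_def Spec1_def by blast
  then show False using l by blast
qed

text \<open>
  Constants are radial eigenfunctions for the eigenvalue \<open>0\<close>.
\<close>

lemma nonradial_nonzero: "l \<in> Spec1 M - radial_Spec M F a \<Longrightarrow> l \<noteq> 0"
proof
  assume l: "l \<in> Spec1 M - radial_Spec M F a" "l = 0"
  have "radial M F a (\<lambda>_. 1)" unfolding radial_def by (rule exI[of _ "\<lambda>_. 1"]) auto
  then have "0 \<in> radial_Spec M F a"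
    using constant_eigenfunction unfolding radial_Spec_def Spec1_def by blast
  then show False using l by blast
qed

text \<open>
  Substituting \<open>h\<close> turns the integral over \<open>h(\<Omega>)\<close> into the integral of \<open>f \<circ> h\<close> over \<open>\<Omega>\<close>, and \<open>\<Omega>\<close> is the
  preimage under \<open>F\<close> of an initial segment of \<open>[a, b]\<close>.
\<close>

lemma tube_integral_zero:
  assumes l: "l \<in> Spec1 M - radial_Spec M F a" and f: "eigenfunction M l f" and h: "riemannian_isometry M h"
  shows "(LINT x:h ` isoparametric_tube M F a t|vol. f x) = 0"
proof -
  let ?\<Omega> = "isoparametric_tube M F a t"
  obtain A' where fc: "focal_coefficients a b A A' B" using focal by blast
  note hh = riemannian_isometryD[OF h]
  have fs: "Ck_function k f" for k using f unfolding eigenfunction_def smooth_function_iff by blast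
  have w: "C1_function (f \<circ> h)" by (rule C1_function_compose_map[OF fs conjunct1[OF hh(1)]])
  have im: "h ` ?\<Omega> = inv h -` ?\<Omega>" by (rule bij_vimage_eq_inv_image[OF bij_imp_bij_inv[OF hh(2)], unfolded inv_inv_eq[OF hh(2)], symmetric])
  have "open (h ` ?\<Omega>)" unfolding im by (rule open_vimage[OF tube_open hh(5)])
  then have "(\<lambda>p. indicator (h ` ?\<Omega>) p *\<^sub>R f p) \<in> borel_measurable borel"
    using borel_measurable_continuous_onI[OF Ck_function_continuous[OF fs]] by (intro borel_measurable_scaleR) auto
  then have "(LINT x:h ` ?\<Omega>|vol. f x) = (\<integral>p. indicator (h ` ?\<Omega>) (h p) *\<^sub>R f (h p) \<partial>vol)"
    unfolding set_lebesgue_integral_def by (rule integral_isometry[OF h, symmetric])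
  also have "\<dots> = (\<integral>p. indicator {s \<in> {a..b}. \<phi> s < t} (F p) * (f \<circ> h) p \<partial>vol)"
  proof (rule Bochner_Integration.integral_cong[OF refl])
    fix p
    have "h p \<in> h ` ?\<Omega> \<longleftrightarrow> \<phi> (F p) < t"
      using inj_image_mem_iff[OF bij_is_inj[OF hh(2)]] by (simp add: tube_eq)
    then show "indicator (h ` ?\<Omega>) (h p) *\<^sub>R f (h p) = indicator {s \<in> {a..b}. \<phi> s < t} (F p) * (f \<circ> h) p"
      using F_in[of p] by (simp add: indicator_def)
  qed
  also have "\<dots> = 0"
  proof (rule downset_integral_zero[OF w _ nonradial_nonzero[OF l] fc nonradial_not_resonant[OF l fc]])
    show "(\<integral>p. pairing (f \<circ> h) \<phi> p \<partial>vol) = l * (\<integral>p. (f \<circ> h) p * \<phi> p \<partial>vol)" if "C1_function \<phi>" for \<phi>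
      using eigenfunction_weak_pullback[OF f h that] by simp
    show "s' \<in> {s \<in> {a..b}. \<phi> s < t}" if "s \<in> {s \<in> {a..b}. \<phi> s < t}" "s' \<le> s" "s' \<in> {a..b}" for s s'
      using \<phi>_mono[of s' s] that by auto
  qed
  finally show ?thesis .
qed

end

lemma smooth_on_interval_Ck_real:
  assumes "smooth_on_interval f a b"
  shows "Ck_real k f {a..b}"
proof -
  obtain d :: "nat \<Rightarrow> real \<Rightarrow> real" where d: "d 0 = f"
    "\<forall>k. \<forall>x\<in>{a..b}. (d k has_real_derivative d (Suc k) x) (at x within {a..b})"
    using assms unfolding smooth_on_interval_def by blast
  have "Ck_real k (d n) {a..b}" for n
  proof (induction k arbitrary: n)
    case 0
    have "continuous_on {a..b} (d n)" by (rule DERIV_continuous_on[of _ _ "d (Suc n)"]) (use d(2) in blast)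
    then show ?case by simp
  next
    case (Suc k)
    show ?case unfolding Ck_real.simps using Suc.IH[of "Suc n"] d(2) by blast
  qed
  from this[of 0] show ?thesis using d(1) by simp
qed

lemma isoparametric_function_locale:
  assumes M: "compact_connected_riemannian_manifold M" and F: "isoparametric_function M F a b"
  shows "\<exists>A B. isoparametric M F a b A B"
proof -
  obtain A B where AB: "smooth_on_interval A a b" "smooth_on_interval B a b"
    "\<forall>p. sq_norm_at M (gradient M F) p = A (F p)" "\<forall>p. laplacian M F p = B (F p)"
    using F unfolding isoparametric_function_def by blast
  interpret compact_riemannian M
    by unfold_locales (use M in \<open>auto simp: compact_connected_riemannian_manifold_def\<close>)
  have Fs: "Ck_function k F" for k using F unfolding isoparametric_function_def smooth_function_iff by blast
  have "isoparametric M F a b A B"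
  proof
    show "connected (UNIV :: 'a set)" using M by (simp add: compact_connected_riemannian_manifold_def)
    show "a < b" "range F = {a..b}" using F by (auto simp: isoparametric_function_def)
    show "Ck_function k F" "Ck_real k A {a..b}" "Ck_real k B {a..b}" for k
      by (rule Fs smooth_on_interval_Ck_real AB)+
    show "pairing F F p = A (F p)" for p using AB(3) sq_norm_gradient by metis
    show "(\<integral>p. pairing F \<phi> p \<partial>vol) = (\<integral>p. B (F p) * \<phi> p \<partial>vol)" if "C1_function \<phi>" for \<phi>
      using green[OF Fs that] AB(4) by simp
  qed
  then show ?thesis by blast
qed

theorem theorem19:
  fixes M :: "('a::{t2_space, second_countable_topology}, 'n::finite) riem"
    and F :: "'a \<Rightarrow> real" and a b :: real
  assumes "compact_connected_riemannian_manifold M"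
    and "proper_isoparametric_function M F a b"
    and "radial_Spec M F a \<subset> Spec1 M"
  shows "(\<forall>t\<in>{0<..<foliation_width M F a b}. \<not> pompeiu_property M (isoparametric_tube M F a t)) \<and>
    (\<forall>l\<in>Spec1 M - radial_Spec M F a. \<forall>f. eigenfunction M l f \<longrightarrow>
       (\<forall>t\<in>{0<..<foliation_width M F a b}. \<forall>h. riemannian_isometry M h \<longrightarrow>
          (LINT x:h ` isoparametric_tube M F a t|riemannian_measure M. f x) = 0))"
proof
  obtain A B where "isoparametric M F a b A B"
    using isoparametric_function_locale assms(1,2) unfolding proper_isoparametric_function_def by blast
  then interpret isoparametric M F a b A B .
  show "\<forall>l\<in>Spec1 M - radial_Spec M F a. \<forall>f. eigenfunction M l f \<longrightarrow>
       (\<forall>t\<in>{0<..<foliation_width M F a b}. \<forall>h. riemannian_isometry M h \<longrightarrow>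
          (LINT x:h ` isoparametric_tube M F a t|riemannian_measure M. f x) = 0)"
    by (intro ballI allI impI tube_integral_zero)
  show "\<forall>t\<in>{0<..<foliation_width M F a b}. \<not> pompeiu_property M (isoparametric_tube M F a t)"
  proof
    fix t
    obtain l f where l: "l \<in> Spec1 M - radial_Spec M F a" and f: "eigenfunction M l f"
      using assms(3) unfolding Spec1_def by blast
    have "continuous_on UNIV f"
      using f Ck_function_continuous unfolding eigenfunction_def smooth_function_iff by blast
    then show "\<not> pompeiu_property M (isoparametric_tube M F a t)"
      using f tube_integral_zero[OF l f] unfolding pompeiu_property_def eigenfunction_def by blast
  qed
qed

end
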